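(* (i) There is no non-trivial 3-braid link with the skein polynomial of an unlink: if $L$ is a 3-braid link and $P(L)=P(U_n)$ for some $n\in\{1,2,3\}$, where $U_n$ is the $n$-component unlink, then $L$ is an unlink. (ii) There are only finitely many 3-braid links with the same skein polynomial: for every polynomial $Q\in\mathbb Z[v^{\pm1},z^{\pm1}]$ the set of (isotopy classes of) 3-braid links $L$ with $P(L)=Q$ is finite.
   Context: Links are oriented links in $S^3$. A 3-braid link is a link that is the closure of some braid in the 3-strand braid group $B_3$. The skein (HOMFLY) polynomial $P(L)\in\mathbb Z[v^{\pm1},z^{\pm1}]$ is determined by $P(\text{unknot})=1$ and $v^{-1}P(L_+)-vP(L_-)=zP(L_0)$, where $L_+,L_-,L_0$ have diagrams equal except near one crossing, which is respectively positive, negative and smoothed out. *)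

theory Defs
  imports "HOL-Analysis.Analysis" "HOL-Library.Poly_Mapping"
begin

section \<open>Space\<close>

text \<open>Euclidean 3-space is \<open>complex \<times> real\<close>: the point \<open>(x + iy, z)\<close> has coordinates
  \<open>(x, y, z)\<close>, right-handed.\<close>

type_synonym R3 = "complex \<times> real"
type_synonym R4 = "R3 \<times> real"

definition S3 :: "R4 set"
  where "S3 = sphere 0 1"

text \<open>Inverse stereographic projection from the north pole \<open>(0, 1)\<close>. It carries 3-space onto
  the sphere minus a point and fixes the orientation of the sphere; links, their diagrams
  (projections to the \<open>xy\<close>-plane, viewed from large \<open>z\<close>) and closed braids are drawn in 3-space
  and moved to the sphere by it.\<close>

definition to_S3 :: "R3 \<Rightarrow> R4"
  where "to_S3 x = ((2 / ((norm x)\<^sup>2 + 1)) *\<^sub>R x, ((norm x)\<^sup>2 - 1) / ((norm x)\<^sup>2 + 1))"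


section \<open>Oriented links and isotopy\<close>

definition simple_closed_curve :: "(real \<Rightarrow> R4) \<Rightarrow> bool"
  where "simple_closed_curve \<gamma> \<longleftrightarrow>
    continuous_on UNIV \<gamma> \<and> range \<gamma> \<subseteq> S3 \<and> (\<forall>t. \<gamma> (t + 1) = \<gamma> t) \<and> inj_on \<gamma> {0..<1}"

text \<open>Lifts to the real line of the orientation-preserving homeomorphisms of \<open>\<real>/\<int>\<close>.\<close>

definition reparametrization :: "(real \<Rightarrow> real) \<Rightarrow> bool"
  where "reparametrization \<tau> \<longleftrightarrow>
    continuous_on UNIV \<tau> \<and> strict_mono \<tau> \<and> (\<forall>t. \<tau> (t + 1) = \<tau> t + 1)"

text \<open>An oriented link is represented by the set of all positively oriented parametrizations of
  all of its components, so that two links are equal as oriented subsets of the sphere iff they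
  are equal as sets of curves.\<close>

type_synonym olink = "(real \<Rightarrow> R4) set"

definition olink_of :: "(real \<Rightarrow> R4) set \<Rightarrow> olink"
  where "olink_of C = {\<gamma> \<circ> \<tau> | \<gamma> \<tau>. \<gamma> \<in> C \<and> reparametrization \<tau>}"

definition points :: "olink \<Rightarrow> R4 set"
  where "points L = (\<Union>\<gamma>\<in>L. range \<gamma>)"

text \<open>Tameness in the form of local flatness: locally, the pair (sphere, link) is homeomorphic to
  the pair (3-space, straight line).\<close>

definition locally_flat :: "R4 set \<Rightarrow> bool"
  where "locally_flat K \<longleftrightarrow>
    (\<forall>x\<in>K. \<exists>U h g. openin (top_of_set S3) U \<and> x \<in> U \<and>
       homeomorphism U (UNIV :: R3 set) h g \<and> h ` (U \<inter> K) = {0} \<times> UNIV)"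

definition link :: "olink \<Rightarrow> bool"
  where "link L \<longleftrightarrow>
    (\<exists>C. finite C \<and> C \<noteq> {} \<and> (\<forall>\<gamma>\<in>C. simple_closed_curve \<gamma>) \<and>
       (\<forall>\<gamma>\<in>C. \<forall>\<gamma>'\<in>C. \<gamma> \<noteq> \<gamma>' \<longrightarrow> range \<gamma> \<inter> range \<gamma>' = {}) \<and>
       L = olink_of C) \<and>
    locally_flat (points L)"

definition isotopic :: "olink \<Rightarrow> olink \<Rightarrow> bool"
  where "isotopic L L' \<longleftrightarrow>
    (\<exists>H :: real \<times> R4 \<Rightarrow> R4.
       continuous_on ({0..1} \<times> S3) H \<and>
       (\<forall>t\<in>{0..1}. \<exists>g. homeomorphism S3 S3 (\<lambda>x. H (t, x)) g) \<and>
       (\<forall>x\<in>S3. H (0, x) = x) \<and>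
       L' = (\<lambda>\<gamma>. (\<lambda>x. H (1, x)) \<circ> \<gamma>) ` L)"

definition link_isotopy :: "(olink \<times> olink) set"
  where "link_isotopy = {(L, L'). link L \<and> link L' \<and> isotopic L L'}"

text \<open>The unlink with \<open>n\<close> components: unit circles in \<open>n\<close> parallel planes, which bound disjoint
  flat discs.\<close>

definition unlink :: "nat \<Rightarrow> olink"
  where "unlink n = olink_of {\<lambda>t. to_S3 (cis (2 * pi * t), real k) | k. k < n}"

definition is_unlink :: "olink \<Rightarrow> bool"
  where "is_unlink L \<longleftrightarrow> (\<exists>n\<ge>1. isotopic (unlink n) L)"


section \<open>Closed braids\<close>

text \<open>Elements of the \<open>N\<close>-strand braid group are given by words in Artin's generators:
  the integer \<open>i > 0\<close> stands for the \<open>i\<close>-th generator and \<open>- i\<close> for its inverse.\<close>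

definition braid_word :: "nat \<Rightarrow> int list \<Rightarrow> bool"
  where "braid_word N w \<longleftrightarrow> (\<forall>k\<in>set w. k \<noteq> 0 \<and> \<bar>k\<bar> < int N)"

text \<open>The strands start and end at the points \<open>1, \<dots>, N\<close> of the complex plane. During the letter
  \<open>\<plusminus> i\<close> the points \<open>i\<close> and \<open>i + 1\<close> are exchanged by a half turn about their midpoint; \<open>slice N k s\<close>
  is the set of positions of the \<open>N\<close> strands at time \<open>s \<in> [0, 1]\<close> of the letter \<open>k\<close>.
  The letter \<open>0\<close> denotes the trivial braid.\<close>

definition slice :: "nat \<Rightarrow> int \<Rightarrow> real \<Rightarrow> complex set"
  where "slice N k s =
    (if k = 0 then of_nat ` {1..N}
     else (let i = nat \<bar>k\<bar>; c = of_nat i + 1/2; d = cis (- of_int (sgn k) * pi * s) / 2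
           in of_nat ` ({1..N} - {i, i + 1}) \<union> {c - d, c + d}))"

text \<open>The half-plane with polar angle \<open>\<theta>\<close> bounded by the braid axis, i.e. the \<open>z\<close>-axis: a point
  \<open>w\<close> with positive real part is placed at distance \<open>Re w\<close> from the axis and height \<open>Im w\<close>.\<close>

definition page :: "complex \<Rightarrow> real \<Rightarrow> R3"
  where "page w \<theta> = (of_real (Re w) * cis \<theta>, Im w)"

text \<open>The letters of the braid occupy consecutive sectors around the axis; the last sector,
  with the letter \<open>0\<close>, contains the closing strands.\<close>

definition closed_braid_points :: "nat \<Rightarrow> int list \<Rightarrow> R3 set"
  where "closed_braid_points N w =
    (let u = w @ [0]
     in {page p (2 * pi * (real j + s) / real (length u)) | j s p.
           j < length u \<and> s \<in> {0..1} \<and> p \<in> slice N (u ! j) s})"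

text \<open>A closed braid is oriented so that the polar angle increases along its strands.\<close>

definition braid_closure :: "nat \<Rightarrow> int list \<Rightarrow> olink"
  where "braid_closure N w =
    {\<gamma>. simple_closed_curve \<gamma> \<and> range \<gamma> \<subseteq> to_S3 ` closed_braid_points N w \<and>
        (\<exists>p \<theta>. continuous_on UNIV \<theta> \<and> strict_mono \<theta> \<and>
           (\<forall>t. Re (p t) > 0 \<and> \<gamma> t = to_S3 (page (p t) (\<theta> t))))}"

definition three_braid_link :: "olink \<Rightarrow> bool"
  where "three_braid_link L \<longleftrightarrow>
    link L \<and> (\<exists>w. braid_word 3 w \<and> isotopic (braid_closure 3 w) L)"


section \<open>The skein polynomial\<close>

text \<open>Laurent polynomials in \<open>v\<close> and \<open>z\<close> with integer coefficients, as the group ring of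
  \<open>\<int> \<times> \<int>\<close>: the exponent pair \<open>(i, j)\<close> belongs to the monomial \<open>v^i z^j\<close>.\<close>

type_synonym laurent = "(int \<times> int) \<Rightarrow>\<^sub>0 int"

definition mono_vz :: "int \<Rightarrow> int \<Rightarrow> laurent"
  where "mono_vz i j = Poly_Mapping.single (i, j) 1"

definition skein_box :: "R3 set"
  where "skein_box = {(w, h). \<bar>Re w\<bar> \<le> 1 \<and> \<bar>Im w\<bar> \<le> 1 \<and> \<bar>h\<bar> \<le> 1}"

text \<open>Two strands in the box, labelled by \<open>\<delta> = - 1\<close> (starting on the left) and \<open>\<delta> = 1\<close> (starting
  on the right), both running in the direction of increasing \<open>y\<close>. For \<open>\<epsilon> = 1\<close> the strand going
  from bottom left to top right is the upper one, so the crossing is positive; for \<open>\<epsilon> = - 1\<close> it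
  is negative.\<close>

definition crossing :: "real \<Rightarrow> real \<Rightarrow> real \<Rightarrow> R3"
  where "crossing \<epsilon> \<delta> s =
    (Complex (\<delta> * cos (pi * s) / 2) (2 * s - 1), - \<epsilon> * \<delta> * sin (pi * s) / 2)"

definition smoothing :: "real \<Rightarrow> real \<Rightarrow> R3"
  where "smoothing \<delta> s = (Complex (\<delta> / 2) (2 * s - 1), 0)"

text \<open>\<open>p\<close>, restricted to the unit interval, is an injective positively oriented parametrization
  of a proper subarc of a component of \<open>L\<close>. Since \<open>L\<close> is closed under reparametrization, any such
  arc is the restriction of some \<open>\<gamma> \<in> L\<close> to half a period.\<close>

definition runs_along :: "olink \<Rightarrow> (real \<Rightarrow> R4) \<Rightarrow> bool"
  where "runs_along L p \<longleftrightarrow> (\<exists>\<gamma>\<in>L. \<forall>s\<in>{0..1}. p s = \<gamma> (s / 2))"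

definition inside_box :: "olink \<Rightarrow> (real \<Rightarrow> real \<Rightarrow> R3) \<Rightarrow> bool"
  where "inside_box L T \<longleftrightarrow>
    points L \<inter> to_S3 ` skein_box = to_S3 ` {T \<delta> s | \<delta> s. \<delta> \<in> {- 1, 1} \<and> s \<in> {0..1}} \<and>
    (\<forall>\<delta>\<in>{- 1, 1}. runs_along L (to_S3 \<circ> T \<delta>))"

definition same_outside_box :: "olink \<Rightarrow> olink \<Rightarrow> bool"
  where "same_outside_box L L' \<longleftrightarrow>
    (\<forall>p. (\<forall>s\<in>{0..1}. p s \<notin> to_S3 ` interior skein_box) \<longrightarrow>
       (runs_along L p \<longleftrightarrow> runs_along L' p))"

text \<open>A skein triple in standard position. Every triple of links whose diagrams differ only at one
  crossing can be moved to this position by one ambient isotopy applied to all three links, so for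
  an isotopy invariant it is enough to require the skein relation here.\<close>

definition skein_triple :: "olink \<Rightarrow> olink \<Rightarrow> olink \<Rightarrow> bool"
  where "skein_triple Lp Lm L0 \<longleftrightarrow>
    link Lp \<and> link Lm \<and> link L0 \<and>
    inside_box Lp (crossing 1) \<and> inside_box Lm (crossing (- 1)) \<and> inside_box L0 smoothing \<and>
    same_outside_box Lp Lm \<and> same_outside_box Lp L0"

text \<open>The defining properties of the skein polynomial. They determine its values on all links;
  values on sets of curves that are not links are irrelevant.\<close>

definition is_skein_polynomial :: "(olink \<Rightarrow> laurent) \<Rightarrow> bool"
  where "is_skein_polynomial P \<longleftrightarrow>
    (\<forall>L L'. link L \<and> link L' \<and> isotopic L L' \<longrightarrow> P L = P L') \<and>
    P (unlink 1) = 1 \<and>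
    (\<forall>Lp Lm L0. skein_triple Lp Lm L0 \<longrightarrow>
       mono_vz (- 1) 0 * P Lp - mono_vz 1 0 * P Lm = mono_vz 0 1 * P L0)"

end

theory Submission
  imports Defs
begin

text \<open>A closed 3-braid is determined, up to finitely many possibilities, by the exponent sum of its
  word and by the trace of the word in a two-dimensional representation, and the skein
  polynomial \<open>P\<close> determines both up to finitely many possibilities.

  Let \<open>w\<close> be a 3-braid word with exponent sum \<open>e\<close>. The skein relation at the last letter,
  conjugation and the braid relations reduce \<open>w\<close> to the words \<open>[]\<close>, \<open>[1]\<close> and \<open>[1, 2]\<close>, whose
  closures are unlinks; so a property of \<open>w\<close> and of the polynomial of its closure that is
  compatible with these moves only has to be checked for three words (\<open>skein_word_induct\<close>).
  Three such properties are used.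
  \<^item> Every exponent of \<open>v\<close> in the polynomial is \<open>e - 2\<close>, \<open>e\<close> or \<open>e + 2\<close> (\<open>f_v_support\<close>).
  \<^item> Its value at \<open>v = 2\<close>, \<open>z = -3/2\<close> is \<open>1\<close>, so it is not zero (\<open>f_ev_1\<close>). Hence the
    polynomial leaves at most three possibilities for \<open>e\<close>.
  \<^item> Its value at \<open>v = 1\<close>, \<open>z = 5/2 * \<i>\<close> is \<open>\<i>^e * 4/13 * (tr w - 2^e - 2^(-e))\<close>,
    where \<open>tr\<close> is the trace in a representation in which both generators have eigenvalues \<open>2\<close>
    and \<open>1/2\<close> (\<open>f_trace\<close>). Hence the polynomial and \<open>e\<close> determine \<open>tr w\<close>.

  The full twist generates the centre of the braid group, and modulo the centre the braid group
  is the modular group, a free product of cyclic groups of orders two and three. Cyclic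
  reduction there shows that, up to conjugation and powers of the full twist, \<open>w\<close> is one of
  three short words or a word in the letters \<open>1\<close> and \<open>-2\<close> (\<open>exists_normal_form\<close>). The matrices
  of these two letters are nonnegative, and the trace of such a word is at least \<open>2^length\<close>
  (\<open>tr_ge_power\<close>), while the full twist acts as \<open>-1\<close>; so only finitely many normal forms have a
  given absolute trace. The power of the full twist that has been dropped is recovered from \<open>e\<close>,
  because the exponent sum of the full twist is six (\<open>normal_form_determines\<close>). This proves that
  only finitely many closed 3-braids share a polynomial. For the polynomial of an unlink the
  trace is so small that only ten normal forms remain, and the trace and the exponent sum modulo
  six single out one conjugacy class, which is that of a word whose closure is this unlink.

  The geometry enters through three facts. Closures of conjugate words are isotopic: a closed
  braid is a loop of configurations of three points in a half-plane, a homotopy of such loops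
  gives an isotopy that preserves the pages of the open book around the axis
  (\<open>homotopic_loops_isotopic\<close>), and so relations between words become homotopies. The closures
  of \<open>[]\<close>, of \<open>[1]\<close> and \<open>[-1]\<close>, and of \<open>[1, 2]\<close>, \<open>[1, -2]\<close> and \<open>[-1, -2]\<close> are unlinks: they are
  deformed until every component is a round circle or a curve whose height rises and falls only
  once, and such a curve is straightened by affine maps of the horizontal planes
  (\<open>unimodal_curve_unlink\<close>). Finally, the skein relation holds for the closures of
  \<open>\<beta> @ [1]\<close>, \<open>\<beta> @ [-1]\<close> and \<open>\<beta>\<close>: a homotopy followed by one explicit
  homeomorphism, the same for all three, brings the last letter into the standard box
  (\<open>skein_triple_boxed\<close>).\<close>

section \<open>Isotopies of the sphere that come from isotopies of 3-space\<close>

definition from_S3 :: "R4 \<Rightarrow> R3"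
  where "from_S3 y = (1 / (1 - snd y)) *\<^sub>R fst y"

lemma in_S3_iff: "y \<in> S3 \<longleftrightarrow> (norm (fst y))\<^sup>2 + (snd y)\<^sup>2 = 1"
  by (cases y) (simp add: S3_def norm_Pair sphere_def)

lemma norm_sq_add_one_pos: "0 < (norm (x::'a::real_normed_vector))\<^sup>2 + 1"
  by (rule add_nonneg_pos) auto

lemma norm_sq_add_one_ne [simp]: "(norm (x::'a::real_normed_vector))\<^sup>2 + 1 \<noteq> 0"
  using norm_sq_add_one_pos[of x] by linarith

lemma to_S3_in [simp]: "to_S3 x \<in> S3"
proof -
  have "(2 / ((norm x)\<^sup>2 + 1) * norm x)\<^sup>2 + (((norm x)\<^sup>2 - 1) / ((norm x)\<^sup>2 + 1))\<^sup>2
      = (4 * (norm x)\<^sup>2 + ((norm x)\<^sup>2 - 1)\<^sup>2) / ((norm x)\<^sup>2 + 1)\<^sup>2"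
    by (simp add: power_divide power_mult_distrib add_divide_distrib)
  also have "4 * (norm x)\<^sup>2 + ((norm x)\<^sup>2 - 1)\<^sup>2 = ((norm x)\<^sup>2 + 1)\<^sup>2"
    by (simp add: power2_eq_square algebra_simps)
  finally show ?thesis
    by (simp add: in_S3_iff to_S3_def del: norm_scaleR) (simp add: norm_sq_add_one_pos less_imp_le)
qed

lemma one_minus_snd_to_S3: "1 - snd (to_S3 x) = 2 / ((norm x)\<^sup>2 + 1)"
proof -
  have "1 - (a - 1) / (a + 1) = 2 / (a + 1)" if "a + 1 > 0" for a :: real
    using that by (simp add: field_simps)
  from this[OF norm_sq_add_one_pos[of x]] show ?thesis by (simp add: to_S3_def)
qed

lemma snd_to_S3_less: "snd (to_S3 x) < 1"
  using one_minus_snd_to_S3[of x] norm_sq_add_one_pos[of x]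
  by (smt (verit) divide_pos_pos)

lemma from_to_S3 [simp]: "from_S3 (to_S3 x) = x"
proof -
  have "1 / (2 / a) * (2 / a) = 1" if "a \<noteq> 0" for a :: real
    using that by simp
  from this[OF norm_sq_add_one_ne[of x]]
  show ?thesis unfolding from_S3_def one_minus_snd_to_S3 by (simp only: to_S3_def fst_conv scaleR_scaleR) simp
qed

lemma to_S3_inj [simp]: "to_S3 x = to_S3 y \<longleftrightarrow> x = y"
  by (metis from_to_S3)

lemma inj_to_S3: "inj to_S3"
  by (simp add: inj_on_def)

lemma to_S3_ne_pole [simp]: "to_S3 x \<noteq> (0, 1)" "(0, 1) \<noteq> to_S3 x"
  using snd_to_S3_less[of x] by (metis less_irrefl snd_conv)+

lemma S3_snd_le:
  assumes "y \<in> S3" "y \<noteq> (0, 1)"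
  shows "snd y < 1"
proof (rule ccontr)
  assume "\<not> snd y < 1"
  then have "1 \<le> (snd y)\<^sup>2" by simp
  moreover have e: "(norm (fst y))\<^sup>2 + (snd y)\<^sup>2 = 1" using assms(1) by (simp add: in_S3_iff)
  ultimately have "(norm (fst y))\<^sup>2 \<le> 0" by linarith
  then have "fst y = 0" by simp
  then have "(snd y)\<^sup>2 = 1" using e by simp
  then have "snd y = 1" using \<open>\<not> snd y < 1\<close> by (auto simp: power2_eq_1_iff)
  then show False using \<open>fst y = 0\<close> assms(2) by (cases y) simp
qed

lemma norm_from_S3:
  assumes "y \<in> S3" "y \<noteq> (0, 1)"
  shows "(norm (from_S3 y))\<^sup>2 = (1 + snd y) / (1 - snd y)"
proof -
  have lt: "snd y < 1" using S3_snd_le assms by blast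
  have "(norm (from_S3 y))\<^sup>2 = (norm (fst y))\<^sup>2 / (1 - snd y)\<^sup>2"
    by (simp add: from_S3_def power_divide)
  also have "(norm (fst y))\<^sup>2 = (1 + snd y) * (1 - snd y)"
    using assms(1) unfolding in_S3_iff by (simp add: power2_eq_square algebra_simps)
  finally show ?thesis using lt by (simp add: power2_eq_square)
qed

lemma to_from_S3:
  assumes "y \<in> S3" "y \<noteq> (0, 1)"
  shows "to_S3 (from_S3 y) = y"
proof -
  have lt: "snd y < 1" using S3_snd_le assms by blast
  have n: "(norm (from_S3 y))\<^sup>2 + 1 = 2 / (1 - snd y)"
    using lt by (simp add: norm_from_S3[OF assms] field_simps)
  have m: "(norm (from_S3 y))\<^sup>2 - 1 = 2 * snd y / (1 - snd y)"
    using lt by (simp add: norm_from_S3[OF assms] field_simps)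
  show ?thesis unfolding to_S3_def n m using lt
    by (cases y) (simp add: from_S3_def)
qed

lemma range_to_S3: "range to_S3 = S3 - {(0, 1)}"
proof (intro equalityI subsetI)
  fix y :: R4 assume "y \<in> S3 - {(0, 1)}"
  then have "y = to_S3 (from_S3 y)" by (simp add: to_from_S3)
  then show "y \<in> range to_S3" by (rule range_eqI)
qed auto

lemma continuous_on_to_S3 [continuous_intros]:
  "continuous_on A f \<Longrightarrow> continuous_on A (\<lambda>x. to_S3 (f x))"
  unfolding to_S3_def by (intro continuous_intros) auto

lemma continuous_on_from_S3 [continuous_intros]:
  assumes "continuous_on A f" "\<And>x. x \<in> A \<Longrightarrow> f x \<in> S3" "\<And>x. x \<in> A \<Longrightarrow> f x \<noteq> (0, 1)"
  shows "continuous_on A (\<lambda>x. from_S3 (f x))"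
proof -
  have "1 - snd (f x) \<noteq> 0" if "x \<in> A" for x
    using S3_snd_le[OF assms(2,3)[OF that]] by simp
  then show ?thesis
    unfolding from_S3_def by (intro continuous_intros assms) auto
qed

lemma continuous_on_compose_to_S3_iff:
  "continuous_on A (\<lambda>x. to_S3 (f x)) \<longleftrightarrow> continuous_on A f"
proof
  assume "continuous_on A (\<lambda>x. to_S3 (f x))"
  then have "continuous_on A (\<lambda>x. from_S3 (to_S3 (f x)))"
    by (rule continuous_on_from_S3) auto
  then show "continuous_on A f" by simp
qed (rule continuous_on_to_S3)

text \<open>Neighbourhoods of the pole correspond to complements of balls. Therefore a map of 3-space
  extends to the sphere as soon as it sends points of large norm to points of large norm.\<close>

lemma dist_to_S3_pole: "(dist (to_S3 x) (0, 1))\<^sup>2 = 4 / ((norm x)\<^sup>2 + 1)"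
proof -
  have a: "dist (to_S3 x) (0,1) = norm (fst (to_S3 x), snd (to_S3 x) - 1)"
    by (simp add: dist_norm to_S3_def)
  have "(dist (to_S3 x) (0, 1))\<^sup>2 = (norm (fst (to_S3 x)))\<^sup>2 + (snd (to_S3 x) - 1)\<^sup>2"
    unfolding a by (simp add: norm_Pair)
  also have "\<dots> = 2 * (1 - snd (to_S3 x))"
    using to_S3_in[of x] unfolding in_S3_iff by (simp add: power2_eq_square algebra_simps)
  finally show ?thesis by (simp add: one_minus_snd_to_S3)
qed

lemma homeomorphism_bij_betw: "homeomorphism S T f g \<Longrightarrow> bij_betw f S T"
  by (rule bij_betw_byWitness[where f' = g]) (auto simp: homeomorphism_def)

text \<open>The sphere is compact, so that continuous bijections of it are homeomorphisms.\<close>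

lemma isotopicI:
  fixes H :: "real \<times> R4 \<Rightarrow> R4"
  assumes c: "continuous_on ({0..1} \<times> S3) H"
    and b: "\<And>t. t \<in> {0..1} \<Longrightarrow> bij_betw (\<lambda>x. H (t, x)) S3 S3"
    and i: "\<And>x. x \<in> S3 \<Longrightarrow> H (0, x) = x"
    and l: "L' = (\<lambda>\<gamma>. (\<lambda>x. H (1, x)) \<circ> \<gamma>) ` L"
  shows "isotopic L L'"
  unfolding isotopic_def
proof (intro exI[of _ H] conjI ballI)
  fix t :: real assume t: "t \<in> {0..1}"
  have "continuous_on S3 (\<lambda>x. H (t, x))"
    by (rule continuous_on_compose2[OF c]) (use t in \<open>auto intro!: continuous_intros\<close>)
  moreover have "compact S3" by (simp add: S3_def)
  ultimately show "\<exists>g. homeomorphism S3 S3 (\<lambda>x. H (t, x)) g"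
    using b[OF t] homeomorphism_compact[of S3 "\<lambda>x. H (t,x)" S3] by (auto simp: bij_betw_def)
qed (use assms in auto)

text \<open>Properness, uniformly in time: it lets a family of maps extend over the point at
  infinity.\<close>

definition proper_family :: "(real \<times> R3 \<Rightarrow> R3) \<Rightarrow> bool"
  where "proper_family F \<longleftrightarrow>
    (\<forall>B. \<exists>B'. \<forall>t\<in>{0..1}. \<forall>x. norm (F (t, x)) \<le> B \<longrightarrow> norm x \<le> B')"

text \<open>The final maps of isotopies of 3-space that extend to the sphere.\<close>

definition ambient :: "(R3 \<Rightarrow> R3) \<Rightarrow> bool"
  where "ambient f \<longleftrightarrow> (\<exists>F. continuous_on ({0..1} \<times> UNIV) F \<and> (\<forall>t\<in>{0..1}. bij (\<lambda>x. F (t, x))) \<and>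
     proper_family F \<and> (\<forall>x. F (0, x) = x) \<and> (\<forall>x. F (1, x) = f x))"

lemma continuous_on_openin_at:
  assumes "openin (top_of_set S) T" "continuous_on T f" "x \<in> T"
  shows "continuous (at x within S) f"
proof -
  obtain U where U: "open U" "T = S \<inter> U" using assms(1) by (auto simp: openin_open)
  have "at x within S = at x within T"
    by (rule at_within_nhd[of x U]) (use U assms(3) in auto)
  then show ?thesis using assms(2,3) by (simp add: continuous_on_eq_continuous_within)
qed

lemma continuous_on_sphere_extension:
  assumes c: "continuous_on ({0..1} \<times> UNIV) F" and p: "proper_family F"
  shows "continuous_on ({0..1} \<times> S3) (\<lambda>(t, y). if y = (0, 1) then (0, 1) else to_S3 (F (t, from_S3 y)))"
    (is "continuous_on _ ?H")
proof -
  let ?N = "(0, 1) :: R4"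
  let ?S = "{0..1} \<times> S3 :: (real \<times> R4) set"
  have cN: "continuous_on ({0..1} \<times> (S3 - {?N})) ?H"
  proof -
    have "continuous_on ({0..1} \<times> (S3 - {?N})) (\<lambda>z. to_S3 (F (fst z, from_S3 (snd z))))"
      by (intro continuous_intros continuous_on_compose2[OF c]) auto
    then show ?thesis
      by (rule continuous_on_eq) (auto simp: case_prod_beta)
  qed
  show ?thesis
    unfolding continuous_on_eq_continuous_within
  proof
    fix z assume z: "z \<in> ?S"
    show "continuous (at z within ?S) ?H"
    proof (cases "snd z = ?N")
      case False
      have o: "openin (top_of_set ?S) ({0..1} \<times> (S3 - {?N}))"
      proof -
        have "{0..1} \<times> (S3 - {?N}) = ?S \<inter> (UNIV \<times> (- {?N}))" by auto
        moreover have "open (UNIV \<times> (- {?N}) :: (real \<times> R4) set)"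
          by (intro open_Times) auto
        ultimately show ?thesis by (metis openin_open_Int)
      qed
      have zi: "z \<in> {0..1} \<times> (S3 - {?N})" using z False by auto
      show ?thesis by (rule continuous_on_openin_at[OF o cN zi])
    next
      case True
      show ?thesis
        unfolding continuous_within_eps_delta
      proof (intro allI impI)
        fix e :: real assume e: "e > 0"
        \<comment> \<open>points of norm above \<open>B\<close> lie within \<open>e\<close> of the pole, and points within \<open>d\<close>
          of the pole have norm above \<open>B'\<close>\<close>
        define B where "B = 2 / e"
        obtain B' where B': "\<And>t x. t \<in> {0..1} \<Longrightarrow> norm (F (t, x)) \<le> B \<Longrightarrow> norm x \<le> B'"
          using p unfolding proper_family_def by meson
        define d where "d = 2 / sqrt (\<bar>B'\<bar>\<^sup>2 + 1)"
        have dpos: "d > 0" unfolding d_def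
          by (smt (verit) divide_pos_pos real_sqrt_gt_zero zero_le_power2)
        have "dist (?H z') (?H z) < e" if z': "z' \<in> ?S" and dz: "dist z' z < d" for z'
        proof (cases "snd z' = ?N")
          case True
          then show ?thesis using \<open>snd z = ?N\<close> e by (auto simp: case_prod_beta)
        next
          case F: False
          define y where "y = from_S3 (snd z')"
          have sy: "to_S3 y = snd z'" unfolding y_def using to_from_S3 F z' by auto
          have t': "fst z' \<in> {0..1}" using z' by auto
          have "dist (to_S3 y) ?N < d"
            using dist_snd_le[of z' z] dz sy True by simp
          then have "(dist (to_S3 y) ?N)\<^sup>2 < d\<^sup>2"
            by (intro power_strict_mono) auto
          then have "4 / ((norm y)\<^sup>2 + 1) < 4 / (\<bar>B'\<bar>\<^sup>2 + 1)"
            unfolding dist_to_S3_pole d_def by (simp add: power_divide add_nonneg_nonneg)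
          then have "\<bar>B'\<bar>\<^sup>2 < (norm y)\<^sup>2"
            using norm_sq_add_one_pos[of y] norm_sq_add_one_pos[of "\<bar>B'\<bar>"]
            by (simp add: field_simps)
          then have "\<bar>B'\<bar> < norm y" by (simp add: power2_less_imp_less)
          then have "norm (F (fst z', y)) > B" using B'[OF t', of y] by linarith
          moreover have "B > 0" using e by (simp add: B_def)
          ultimately have "(norm (F (fst z', y)))\<^sup>2 > B\<^sup>2" by (intro power_strict_mono) auto
          then have "4 / ((norm (F (fst z', y)))\<^sup>2 + 1) < 4 / B\<^sup>2"
            using \<open>B > 0\<close> by (intro divide_strict_left_mono mult_pos_pos) (auto intro: norm_sq_add_one_pos)
          also have "4 / B\<^sup>2 = e\<^sup>2" using e by (simp add: B_def power_divide)
          finally have "(dist (to_S3 (F (fst z', y))) ?N)\<^sup>2 < e\<^sup>2"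
            by (simp add: dist_to_S3_pole)
          then have "dist (to_S3 (F (fst z', y))) ?N < e" using e by (simp add: power2_less_imp_less)
          then show ?thesis using F \<open>snd z = ?N\<close> by (simp add: case_prod_beta y_def)
        qed
        then show "\<exists>d>0. \<forall>z'\<in>?S. dist z' z < d \<longrightarrow> dist (?H z') (?H z) < e"
          using dpos by blast
      qed
    qed
  qed
qed

lemma bij_betw_sphere_extension:
  assumes b: "bij f"
  shows "bij_betw (\<lambda>y. if y = (0, 1) then (0, 1) else to_S3 (f (from_S3 y))) S3 S3"
  (is "bij_betw ?H _ _")
proof -
  have "bij_betw (\<lambda>y. to_S3 (f (from_S3 y))) (S3 - {(0,1)}) (S3 - {(0,1)})"
  proof (rule bij_betw_byWitness[where f' = "\<lambda>y. to_S3 (inv f (from_S3 y))"])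
  qed (use b in \<open>auto simp: to_from_S3 bij_is_inj bij_is_surj surj_f_inv_f\<close>)
  then have 1: "bij_betw ?H (S3 - {(0,1)}) (S3 - {(0,1)})"
    by (rule bij_betw_cong[THEN iffD1, rotated]) auto
  have N: "(0,1) \<in> S3" by (simp add: in_S3_iff)
  have "bij_betw ?H ((S3 - {(0,1)}) \<union> {(0,1)}) ((S3 - {(0,1)}) \<union> {(0,1)})"
    by (rule bij_betw_combine[OF 1]) (auto simp: bij_betw_def)
  then show ?thesis using N by (simp add: insert_absorb)
qed

lemma ambient_isotopic:
  assumes f: "ambient f" and L: "\<And>\<gamma>. \<gamma> \<in> L \<Longrightarrow> range \<gamma> \<subseteq> range to_S3"
  shows "isotopic L ((\<lambda>\<gamma>. to_S3 \<circ> f \<circ> from_S3 \<circ> \<gamma>) ` L)"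
proof -
  obtain F where F: "continuous_on ({0..1} \<times> UNIV) F" "\<And>t. t\<in>{0..1} \<Longrightarrow> bij (\<lambda>x. F (t, x))"
     "proper_family F" "\<And>x. F (0, x) = x" "\<And>x. F (1, x) = f x"
    using f unfolding ambient_def by auto
  let ?H = "\<lambda>(t, y). if y = (0, 1) then (0, 1) else to_S3 (F (t, from_S3 y))"
  show ?thesis
  proof (rule isotopicI[where H = ?H])
    show "continuous_on ({0..1} \<times> S3) ?H" using F by (intro continuous_on_sphere_extension)
    show "bij_betw (\<lambda>x. ?H (t, x)) S3 S3" if "t \<in> {0..1}" for t
      using bij_betw_sphere_extension[OF F(2)[OF that]] by simp
    show "?H (0, x) = x" if "x \<in> S3" for x using that F(4) by (simp add: to_from_S3)
    have "to_S3 \<circ> f \<circ> from_S3 \<circ> \<gamma> = (\<lambda>x. ?H (1, x)) \<circ> \<gamma>" if "\<gamma> \<in> L" for \<gamma>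
    proof
      fix s
      have "\<gamma> s \<noteq> (0,1)" using L[OF that] by (metis rangeI subset_iff to_S3_ne_pole(1) imageE)
      then show "(to_S3 \<circ> f \<circ> from_S3 \<circ> \<gamma>) s = ((\<lambda>x. ?H (1, x)) \<circ> \<gamma>) s" by (simp add: F(5))
    qed
    then show "(\<lambda>\<gamma>. to_S3 \<circ> f \<circ> from_S3 \<circ> \<gamma>) ` L = (\<lambda>\<gamma>. (\<lambda>x. ?H (1, x)) \<circ> \<gamma>) ` L"
      by (intro image_cong) auto
  qed
qed

lemma isotopic_refl: "isotopic L L"
  by (rule isotopicI[where H = snd]) (auto intro!: continuous_intros simp: bij_betw_def comp_def)

lemma isotopic_trans:
  assumes "isotopic L L'" "isotopic L' L''"
  shows "isotopic L L''"
proof -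
  obtain H :: "real \<times> R4 \<Rightarrow> R4" where H: "continuous_on ({0..1} \<times> S3) H" "\<And>t. t\<in>{0..1} \<Longrightarrow> \<exists>g. homeomorphism S3 S3 (\<lambda>x. H (t, x)) g"
     "\<And>x. x\<in>S3 \<Longrightarrow> H (0, x) = x" "L' = (\<lambda>\<gamma>. (\<lambda>x. H (1, x)) \<circ> \<gamma>) ` L"
    using assms(1) unfolding isotopic_def by blast
  obtain K :: "real \<times> R4 \<Rightarrow> R4" where K: "continuous_on ({0..1} \<times> S3) K" "\<And>t. t\<in>{0..1} \<Longrightarrow> \<exists>g. homeomorphism S3 S3 (\<lambda>x. K (t, x)) g"
     "\<And>x. x\<in>S3 \<Longrightarrow> K (0, x) = x" "L'' = (\<lambda>\<gamma>. (\<lambda>x. K (1, x)) \<circ> \<gamma>) ` L'"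
    using assms(2) unfolding isotopic_def by blast
  have bH: "bij_betw (\<lambda>x. H (t, x)) S3 S3" and bK: "bij_betw (\<lambda>x. K (t, x)) S3 S3" if "t \<in> {0..1}" for t
    using H(2)[OF that] K(2)[OF that] homeomorphism_bij_betw by blast+
  show ?thesis
  proof (rule isotopicI[where H = "\<lambda>z. K (fst z, H z)"])
    have m: "H z \<in> S3" if "z \<in> {0..1} \<times> S3" for z
      using bij_betwE[OF bH[of "fst z"]] that by (cases z) auto
    show "continuous_on ({0..1} \<times> S3) (\<lambda>z. K (fst z, H z))"
      by (rule continuous_on_compose2[OF K(1)]) (use H(1) m in \<open>auto intro!: continuous_intros\<close>)
    show "bij_betw (\<lambda>x. K (fst (t, x), H (t, x))) S3 S3" if "t \<in> {0..1}" for t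
      using bij_betw_trans[OF bH[OF that] bK[OF that]] by (simp add: comp_def)
    show "L'' = (\<lambda>\<gamma>. (\<lambda>x. K (fst (1, x), H (1, x))) \<circ> \<gamma>) ` L"
      unfolding K(4) H(4) by (simp add: image_image comp_def)
  qed (use H K in auto)
qed

text \<open>The track \<open>(t, x) \<mapsto> (t, H (t, x))\<close> is a continuous bijection of a compact space.
  Its inverse is therefore continuous in both variables, and it is the track of the inverse
  isotopy.\<close>

lemma isotopic_sym:
  assumes "isotopic L L'" and L: "\<And>\<gamma>. \<gamma> \<in> L \<Longrightarrow> range \<gamma> \<subseteq> S3"
  shows "isotopic L' L"
proof -
  obtain H :: "real \<times> R4 \<Rightarrow> R4" where H: "continuous_on ({0..1} \<times> S3) H" "\<And>t. t\<in>{0..1} \<Longrightarrow> \<exists>g. homeomorphism S3 S3 (\<lambda>x. H (t, x)) g"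
     "\<And>x. x\<in>S3 \<Longrightarrow> H (0, x) = x" "L' = (\<lambda>\<gamma>. (\<lambda>x. H (1, x)) \<circ> \<gamma>) ` L"
    using assms(1) unfolding isotopic_def by blast
  have bH: "bij_betw (\<lambda>x. H (t, x)) S3 S3" if "t \<in> {0..1}" for t
    using H(2)[OF that] homeomorphism_bij_betw by blast
  let ?S = "{0..1} \<times> S3 :: (real \<times> R4) set"
  have cS: "compact ?S" by (auto intro!: compact_Times simp: S3_def)
  let ?h = "\<lambda>z. (fst z, H z)"
  have ch: "continuous_on ?S ?h" using H(1) by (intro continuous_intros)
  have im: "?h ` ?S = ?S"
  proof (intro equalityI subsetI)
    fix z assume "z \<in> ?h ` ?S"
    then obtain t x where "t \<in> {0..1}" "x \<in> S3" "z = (t, H (t, x))" by auto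
    then show "z \<in> ?S" using bij_betwE[OF bH[of t]] by auto
  next
    fix z assume z: "z \<in> ?S"
    then have "snd z \<in> (\<lambda>x. H (fst z, x)) ` S3"
      using bij_betw_imp_surj_on[OF bH[of "fst z"]] by (cases z) simp
    then obtain x where "x \<in> S3" "snd z = H (fst z, x)" by blast
    then show "z \<in> ?h ` ?S" using z by (intro image_eqI[where x = "(fst z, x)"]) auto
  qed
  have inj: "inj_on ?h ?S"
  proof (rule inj_onI)
    fix z z' assume z: "z \<in> ?S" "z' \<in> ?S" "?h z = ?h z'"
    then obtain t x x' where "z = (t, x)" "z' = (t, x')" "t \<in> {0..1}" "x \<in> S3" "x' \<in> S3" by auto
    then show "z = z'" using z(3) inj_onD[OF bij_betw_imp_inj_on[OF bH[of t]]] by simp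
  qed
  obtain g where g: "homeomorphism ?S ?S ?h g"
    using homeomorphism_compact[OF cS ch im inj] by blast
  define G where "G = snd \<circ> g"
  have cG: "continuous_on ?S G" unfolding G_def comp_def
    using g by (intro continuous_intros) (auto simp: homeomorphism_def)
  have gh: "g (t, H (t, x)) = (t, x)" if "t \<in> {0..1}" "x \<in> S3" for t x
    using homeomorphism_apply1[OF g, of "(t, x)"] that by simp
  have GH: "G (t, H (t, x)) = x" if "t \<in> {0..1}" "x \<in> S3" for t x
    using gh[OF that] by (simp add: G_def)
  have bG: "bij_betw (\<lambda>y. G (t, y)) S3 S3" if t: "t \<in> {0..1}" for t
  proof (rule bij_betw_byWitness[where f' = "\<lambda>x. H (t, x)"])
    have *: "G (t, y) \<in> S3 \<and> H (t, G (t, y)) = y" if y: "y \<in> S3" for y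
    proof -
      have "y \<in> (\<lambda>x. H (t, x)) ` S3" using bij_betw_imp_surj_on[OF bH[OF t]] y by simp
      then obtain x where x: "y = H (t, x)" "x \<in> S3" by (rule imageE)
      then show ?thesis using GH[OF t x(2)] by simp
    qed
    then show "\<forall>y\<in>S3. H (t, G (t, y)) = y" by blast
    show "(\<lambda>y. G (t, y)) ` S3 \<subseteq> S3" using * by (intro image_subsetI) blast
    show "\<forall>x\<in>S3. G (t, H (t, x)) = x" using GH[OF t] by blast
    show "(\<lambda>x. H (t, x)) ` S3 \<subseteq> S3" using bij_betw_imp_surj_on[OF bH[OF t]] by blast
  qed
  show ?thesis
  proof (rule isotopicI[OF cG bG])
    show "G (0, x) = x" if "x \<in> S3" for x using GH[of 0 x] H(3)[OF that] that by simp
    have "(\<lambda>x. G (1, x)) \<circ> ((\<lambda>x. H (1, x)) \<circ> \<gamma>) = \<gamma>" if "\<gamma> \<in> L" for \<gamma>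
    proof
      fix s
      have "\<gamma> s \<in> S3" using L[OF that] by blast
      then show "((\<lambda>x. G (1, x)) \<circ> ((\<lambda>x. H (1, x)) \<circ> \<gamma>)) s = \<gamma> s" using GH[of 1 "\<gamma> s"] by simp
    qed
    then show "L = (\<lambda>\<gamma>. (\<lambda>x. G (1, x)) \<circ> \<gamma>) ` L'"
      unfolding H(4) image_image by simp
  qed
qed

lemma reparametrization_id: "reparametrization (\<lambda>t. t)"
  by (auto simp: reparametrization_def strict_mono_def)

lemma subset_olink_of: "C \<subseteq> olink_of C"
  using reparametrization_id unfolding olink_of_def by (force simp: comp_def)

lemma points_olink_of: "points (olink_of C) = (\<Union>\<gamma>\<in>C. range \<gamma>)"
proof -
  have "points (olink_of C) \<subseteq> (\<Union>\<gamma>\<in>C. range \<gamma>)"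
    by (auto simp: points_def olink_of_def)
  moreover have "(\<Union>\<gamma>\<in>C. range \<gamma>) \<subseteq> points (olink_of C)"
    using subset_olink_of[of C] by (auto simp: points_def)
  ultimately show ?thesis by blast
qed

lemma link_curves_S3: "link L \<Longrightarrow> \<gamma> \<in> L \<Longrightarrow> range \<gamma> \<subseteq> S3"
  by (auto simp: link_def olink_of_def simple_closed_curve_def) blast

lemma image_olink_of: "(\<lambda>\<gamma>. f \<circ> \<gamma>) ` olink_of C = olink_of ((\<lambda>\<gamma>. f \<circ> \<gamma>) ` C)"
proof (intro equalityI subsetI)
  fix x assume "x \<in> (\<lambda>\<gamma>. f \<circ> \<gamma>) ` olink_of C"
  then obtain \<gamma> \<tau> where "\<gamma> \<in> C" "reparametrization \<tau>" "x = f \<circ> (\<gamma> \<circ> \<tau>)"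
    by (auto simp: olink_of_def)
  then show "x \<in> olink_of ((\<lambda>\<gamma>. f \<circ> \<gamma>) ` C)" unfolding olink_of_def by (force simp: comp_assoc)
next
  fix x assume "x \<in> olink_of ((\<lambda>\<gamma>. f \<circ> \<gamma>) ` C)"
  then obtain \<gamma> \<tau> where "\<gamma> \<in> C" "reparametrization \<tau>" "x = f \<circ> (\<gamma> \<circ> \<tau>)"
    by (auto simp: olink_of_def comp_assoc)
  then show "x \<in> (\<lambda>\<gamma>. f \<circ> \<gamma>) ` olink_of C" unfolding olink_of_def by blast
qed

lemma locally_flat_homeomorphic_image:
  assumes K: "locally_flat K" "K \<subseteq> S3" and h: "homeomorphism S3 S3 h g"
  shows "locally_flat (h ` K)"
  unfolding locally_flat_def
proof
  fix y assume "y \<in> h ` K"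
  then obtain x where x: "x \<in> K" "y = h x" by auto
  obtain U f f' where U: "openin (top_of_set S3) U" "x \<in> U" "homeomorphism U (UNIV :: R3 set) f f'"
     "f ` (U \<inter> K) = {0} \<times> UNIV"
    using K(1) x(1) unfolding locally_flat_def by meson
  have US: "U \<subseteq> S3" using U(1) openin_imp_subset by blast
  have gh: "\<And>x. x \<in> S3 \<Longrightarrow> g (h x) = x" using h by (simp add: homeomorphism_def)
  have 1: "openin (top_of_set S3) (h ` U)"
    using homeomorphism_imp_open_map[OF h U(1)] .
  have 2: "homeomorphism (h ` U) U g h"
    using homeomorphism_symD[OF homeomorphism_of_subsets[OF h US _ refl]] US h
    by (auto simp: homeomorphism_def)
  have 3: "homeomorphism (h ` U) UNIV (f \<circ> g) (h \<circ> f')"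
    using homeomorphism_compose[OF 2 U(3)] by (simp add: comp_def)
  have "h ` U \<inter> h ` K = h ` (U \<inter> K)"
    using inj_on_image_Int[of h S3 U K] US K(2) gh by (metis inj_onI)
  then have "(f \<circ> g) ` (h ` U \<inter> h ` K) = f ` (g ` h ` (U \<inter> K))" by (simp add: image_comp)
  also have "g ` h ` (U \<inter> K) = U \<inter> K" using gh US by (force simp: image_iff)
  finally have "(f \<circ> g) ` (h ` U \<inter> h ` K) = {0} \<times> UNIV" using U(4) by simp
  with 1 3 show "\<exists>U h' g'. openin (top_of_set S3) U \<and> y \<in> U \<and>
       homeomorphism U (UNIV :: R3 set) h' g' \<and> h' ` (U \<inter> h ` K) = {0} \<times> UNIV"
    using U(2) x(2) by blast
qed

lemma link_isotopic:
  assumes "link L" "isotopic L L'"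
  shows "link L'"
proof -
  obtain H where H: "\<And>t. t\<in>{0..1} \<Longrightarrow> \<exists>g. homeomorphism S3 S3 (\<lambda>x. H (t, x)) g"
     "L' = (\<lambda>\<gamma>. (\<lambda>x. H (1::real, x)) \<circ> \<gamma>) ` L"
    using assms(2) unfolding isotopic_def by blast
  define h where "h = (\<lambda>x. H (1::real, x))"
  obtain g where g: "homeomorphism S3 S3 h g" using H(1)[of 1] unfolding h_def by auto
  have L': "L' = (\<lambda>\<gamma>. h \<circ> \<gamma>) ` L" using H(2) by (simp add: h_def)
  obtain C where C': "finite C \<and> C \<noteq> {} \<and> (\<forall>\<gamma>\<in>C. simple_closed_curve \<gamma>) \<and>
       (\<forall>\<gamma>\<in>C. \<forall>\<gamma>'\<in>C. \<gamma> \<noteq> \<gamma>' \<longrightarrow> range \<gamma> \<inter> range \<gamma>' = {}) \<and> L = olink_of C"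
    using assms(1)[unfolded link_def, THEN conjunct1] by (elim exE) (rule that)
  have fl: "locally_flat (points L)" using assms(1) unfolding link_def by (rule conjunct2)
  have C: "finite C" "C \<noteq> {}" "L = olink_of C"
    using C' by simp_all
  have C3: "simple_closed_curve \<gamma>" if "\<gamma> \<in> C" for \<gamma>
    using C' that by simp
  have C4: "range \<gamma> \<inter> range \<gamma>' = {}" if "\<gamma> \<in> C" "\<gamma>' \<in> C" "\<gamma> \<noteq> \<gamma>'" for \<gamma> \<gamma>'
    using C'[THEN conjunct2, THEN conjunct2, THEN conjunct2, THEN conjunct1, rule_format, OF that] .
  have inj: "inj_on h S3" by (rule inj_on_inverseI[of S3 g h]) (rule homeomorphism_apply1[OF g])
  have hS: "h ` S3 = S3" and hc: "continuous_on S3 h" using g by (auto simp: homeomorphism_def)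
  have CS: "range \<gamma> \<subseteq> S3" if "\<gamma> \<in> C" for \<gamma> using C3[OF that] by (simp add: simple_closed_curve_def)
  have scc: "simple_closed_curve (h \<circ> \<gamma>)" if "\<gamma> \<in> C" for \<gamma>
  proof -
    have s: "simple_closed_curve \<gamma>" using C3 that .
    then have r: "range \<gamma> \<subseteq> S3" by (simp add: simple_closed_curve_def)
    have "continuous_on UNIV (h \<circ> \<gamma>)"
      using s r hc by (intro continuous_on_compose) (auto simp: simple_closed_curve_def intro: continuous_on_subset)
    moreover have "inj_on (h \<circ> \<gamma>) {0..<1}"
      using s r inj by (intro comp_inj_on) (auto simp: simple_closed_curve_def intro: inj_on_subset)
    ultimately show ?thesis using s r hS by (auto simp: simple_closed_curve_def)
  qed
  have pts: "points L' = h ` points L" by (auto simp: points_def L')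
  have "points L \<subseteq> S3" using CS by (auto simp: C(3) points_olink_of)
  then have 2: "locally_flat (points L')" unfolding pts
    using locally_flat_homeomorphic_image[OF fl _ g] by simp
  have "range (h \<circ> \<gamma>) \<inter> range (h \<circ> \<gamma>') = {}" if "\<gamma>\<in>C" "\<gamma>'\<in>C" "h \<circ> \<gamma> \<noteq> h \<circ> \<gamma>'" for \<gamma> \<gamma>'
  proof -
    have "range \<gamma> \<inter> range \<gamma>' = {}" by (intro C4 that) (use that in auto)
    moreover have "h ` range \<gamma> \<inter> h ` range \<gamma>' = h ` (range \<gamma> \<inter> range \<gamma>')"
      using inj_on_image_Int[OF inj CS[OF that(1)] CS[OF that(2)]] by simp
    ultimately show ?thesis by (simp add: image_comp)
  qed
  then show ?thesis
    unfolding link_def using 2 scc C(1,2)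
    by (intro conjI exI[of _ "(\<lambda>\<gamma>. h \<circ> \<gamma>) ` C"]) (auto simp: L' C(3) image_olink_of)
qed

definition space_link :: "(real \<Rightarrow> R3) set \<Rightarrow> olink"
  where "space_link C = olink_of ((\<lambda>c. to_S3 \<circ> c) ` C)"

lemma space_link_in_range: "\<gamma> \<in> space_link C \<Longrightarrow> range \<gamma> \<subseteq> range to_S3"
  by (auto simp: space_link_def olink_of_def)

lemma ambient_space_link:
  assumes "ambient f"
  shows "isotopic (space_link C) (space_link ((\<lambda>c. f \<circ> c) ` C))"
proof -
  have *: "(\<lambda>\<gamma>. to_S3 \<circ> f \<circ> from_S3 \<circ> \<gamma>) ` space_link C = space_link ((\<lambda>c. f \<circ> c) ` C)"
    unfolding space_link_def image_olink_of image_image by (simp add: comp_def)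
  show ?thesis using ambient_isotopic[OF assms, of "space_link C"] space_link_in_range
    unfolding * by blast
qed

lemma isotopic_sym_space:
  assumes "isotopic L L'" "\<And>\<gamma>. \<gamma> \<in> L \<Longrightarrow> range \<gamma> \<subseteq> range to_S3"
  shows "isotopic L' L"
  using assms(2) unfolding range_to_S3 by (intro isotopic_sym[OF assms(1)]) blast


section \<open>Closed braids and isotopies that preserve the pages\<close>

text \<open>The curves of a closed braid, with an arbitrary set of points in place of the union of the
  slices: only this set has to be followed when a closed braid is moved by a homeomorphism.\<close>

definition braided :: "R3 set \<Rightarrow> olink"
  where "braided X =
    {\<gamma>. simple_closed_curve \<gamma> \<and> range \<gamma> \<subseteq> to_S3 ` X \<and>
        (\<exists>p \<theta>. continuous_on UNIV \<theta> \<and> strict_mono \<theta> \<and>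
           (\<forall>t. Re (p t) > 0 \<and> \<gamma> t = to_S3 (page (p t) (\<theta> t))))}"

lemma braid_closure_eq: "braid_closure N w = braided (closed_braid_points N w)"
  by (simp add: braid_closure_def braided_def)

lemma cis_eq_iff: "cis a = cis b \<longleftrightarrow> (\<exists>k::int. a = b + 2 * pi * of_int k)"
proof -
  have "cis a = cis b \<longleftrightarrow> cos a = cos b \<and> sin a = sin b" by (simp add: complex_eq_iff)
  also have "\<dots> \<longleftrightarrow> (\<exists>k::int. a = b + 2 * pi * of_int k)"
    using sin_cos_eq_iff[of a b] by auto
  finally show ?thesis .
qed

lemma norm_fst_page: "Re w > 0 \<Longrightarrow> cmod (fst (page w \<theta>)) = Re w"
  by (simp add: page_def norm_mult)

lemma snd_page [simp]: "snd (page w \<theta>) = Im w"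
  by (simp add: page_def)

lemma page_eq_iff:
  assumes "Re w > 0" "Re w' > 0"
  shows "page w \<theta> = page w' \<theta>' \<longleftrightarrow> w = w' \<and> (\<exists>k::int. \<theta> = \<theta>' + 2 * pi * of_int k)"
proof
  assume e: "page w \<theta> = page w' \<theta>'"
  have 1: "Re w = Re w'" using arg_cong[OF e, of "\<lambda>x. cmod (fst x)"] assms by (simp only: norm_fst_page)
  moreover have "Im w = Im w'" using arg_cong[OF e, of snd] by simp
  ultimately have "w = w'" by (simp add: complex_eq_iff)
  moreover have "cis \<theta> = cis \<theta>'" using e 1 assms by (simp add: page_def)
  ultimately show "w = w' \<and> (\<exists>k::int. \<theta> = \<theta>' + 2 * pi * of_int k)" by (simp add: cis_eq_iff)
next
  assume "w = w' \<and> (\<exists>k::int. \<theta> = \<theta>' + 2 * pi * of_int k)"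
  then show "page w \<theta> = page w' \<theta>'" by (metis cis_eq_iff page_def)
qed

lemma page_polar:
  assumes "\<zeta> \<noteq> 0"
  shows "page (Complex (cmod \<zeta>) h) (Arg \<zeta>) = (\<zeta>, h)"
  using Arg_eq[OF assms] by (simp add: page_def cis_conv_exp mult.commute)

definition half_plane :: "real \<Rightarrow> R3 set"
  where "half_plane \<theta> = {page w \<theta> | w. Re w > 0}"

text \<open>The inverse is continuous by invariance of domain.\<close>

lemma ambient_homeomorphism:
  assumes "ambient f"
  shows "bij f" "continuous_on UNIV f" "continuous_on UNIV (inv f)"
proof -
  obtain F where F: "continuous_on ({0..1::real} \<times> UNIV) F" "\<And>t. t\<in>{0..1} \<Longrightarrow> bij (\<lambda>x. F (t, x))"
     "\<And>x. F (1, x) = f x"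
    using assms unfolding ambient_def by auto
  show b: "bij f" using F(2)[of 1] F(3) by simp
  have "continuous_on UNIV (\<lambda>x. F (1, x))"
    by (rule continuous_on_compose2[OF F(1)]) (auto intro!: continuous_intros)
  then show c: "continuous_on UNIV f" using F(3) by simp
  obtain g where "homeomorphism UNIV (f ` UNIV) f g"
    using invariance_of_domain_homeomorphism[OF open_UNIV c] b by (auto simp: bij_is_inj)
  then have g: "homeomorphism UNIV UNIV f g" using b by (simp add: bij_is_surj)
  have "g = inv f" using g b unfolding homeomorphism_def
    by (metis UNIV_I inj_imp_inv_eq bij_is_inj)
  then show "continuous_on UNIV (inv f)" using g by (simp add: homeomorphism_def)
qed

lemma braided_image_subset:
  assumes f: "bij f" "continuous_on UNIV f"
    and p: "\<And>\<theta>. f ` half_plane \<theta> \<subseteq> half_plane \<theta>"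
    and g: "\<gamma> \<in> braided X"
  shows "to_S3 \<circ> f \<circ> from_S3 \<circ> \<gamma> \<in> braided (f ` X)"
proof -
  obtain q \<theta> where q: "continuous_on UNIV \<theta>" "strict_mono \<theta>" "\<And>t. Re (q t) > 0"
     "\<And>t. \<gamma> t = to_S3 (page (q t) (\<theta> t))"
    using g unfolding braided_def by blast
  have s: "simple_closed_curve \<gamma>" "range \<gamma> \<subseteq> to_S3 ` X"
    using g unfolding braided_def by blast+
  let ?g = "to_S3 \<circ> f \<circ> from_S3 \<circ> \<gamma>"
  have gt: "?g t = to_S3 (f (page (q t) (\<theta> t)))" for t by (simp add: q(4))
  have c: "continuous_on UNIV (\<lambda>t. from_S3 (\<gamma> t))"
    using s by (intro continuous_on_from_S3) (auto simp: simple_closed_curve_def q(4))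
  have "continuous_on UNIV ?g"
    unfolding comp_def
    by (intro continuous_on_to_S3 continuous_on_compose2[OF f(2) c]) auto
  moreover have "inj_on ?g {0..<1}"
  proof (rule inj_onI)
    fix x y :: real assume x: "x \<in> {0..<1}" "y \<in> {0..<1}" "?g x = ?g y"
    then have "f (page (q x) (\<theta> x)) = f (page (q y) (\<theta> y))" by (simp only: gt to_S3_inj)
    then have "page (q x) (\<theta> x) = page (q y) (\<theta> y)" by (rule injD[OF bij_is_inj[OF f(1)]])
    then have "\<gamma> x = \<gamma> y" by (simp add: q(4))
    then show "x = y" using s(1) x unfolding simple_closed_curve_def by (meson inj_onD)
  qed
  ultimately have "simple_closed_curve ?g"
    using s(1) by (auto simp: simple_closed_curve_def)
  moreover have "range ?g \<subseteq> to_S3 ` f ` X"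
  proof
    fix y assume "y \<in> range ?g"
    then obtain t where y: "y = to_S3 (f (page (q t) (\<theta> t)))" unfolding gt by (rule imageE)
    have "\<gamma> t \<in> to_S3 ` X" using s(2) by (rule subsetD) (rule rangeI)
    then have "page (q t) (\<theta> t) \<in> X" unfolding q(4) by (rule imageE) (simp only: to_S3_inj)
    then show "y \<in> to_S3 ` f ` X" unfolding y by (intro imageI)
  qed
  moreover have "\<exists>w. Re w > 0 \<and> f (page (q t) (\<theta> t)) = page w (\<theta> t)" for t
  proof -
    have "page (q t) (\<theta> t) \<in> half_plane (\<theta> t)" using q(3) by (auto simp: half_plane_def)
    then have "f (page (q t) (\<theta> t)) \<in> half_plane (\<theta> t)" using p by blast
    then show ?thesis by (auto simp: half_plane_def)
  qed
  then obtain q' where "\<And>t. Re (q' t) > 0 \<and> f (page (q t) (\<theta> t)) = page (q' t) (\<theta> t)" by metis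
  then have "\<exists>p \<theta>. continuous_on UNIV \<theta> \<and> strict_mono \<theta> \<and>
           (\<forall>t. Re (p t) > 0 \<and> ?g t = to_S3 (page (p t) (\<theta> t)))"
    using q(1,2) gt by metis
  ultimately show ?thesis unfolding braided_def by blast
qed

lemma braided_in_range: "\<gamma> \<in> braided X \<Longrightarrow> range \<gamma> \<subseteq> range to_S3"
  by (auto simp: braided_def)

text \<open>A homeomorphism that maps every page to itself keeps the polar angle along every curve,
  and the monotonicity of this angle is what distinguishes the curves of a closed braid.\<close>

lemma braided_isotopic_image:
  assumes f: "ambient f" and p: "\<And>\<theta>. f ` half_plane \<theta> = half_plane \<theta>"
  shows "isotopic (braided X) (braided (f ` X))"
proof -
  note h = ambient_homeomorphism[OF f]
  have inv: "inv f ` half_plane \<theta> \<subseteq> half_plane \<theta>" for \<theta>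
    using p[of \<theta>] h(1) by (metis bij_is_inj image_inv_f_f subset_refl)
  have "(\<lambda>\<gamma>. to_S3 \<circ> f \<circ> from_S3 \<circ> \<gamma>) ` braided X = braided (f ` X)"
  proof (intro equalityI subsetI)
    fix \<gamma> assume "\<gamma> \<in> braided (f ` X)"
    then have "to_S3 \<circ> inv f \<circ> from_S3 \<circ> \<gamma> \<in> braided (inv f ` f ` X)"
      by (intro braided_image_subset inv h(3) bij_imp_bij_inv h(1))
    then have 1: "to_S3 \<circ> inv f \<circ> from_S3 \<circ> \<gamma> \<in> braided X"
      using h(1) by (simp add: image_inv_f_f bij_is_inj)
    have "\<gamma> t \<in> range to_S3" for t using braided_in_range[OF \<open>\<gamma> \<in> _\<close>] by blast
    then have "to_S3 (from_S3 (\<gamma> t)) = \<gamma> t" for t by (metis from_to_S3 imageE)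
    then have "\<gamma> = to_S3 \<circ> f \<circ> from_S3 \<circ> (to_S3 \<circ> inv f \<circ> from_S3 \<circ> \<gamma>)"
      using h(1) by (auto simp: fun_eq_iff surj_f_inv_f bij_is_surj)
    with 1 show "\<gamma> \<in> (\<lambda>\<gamma>. to_S3 \<circ> f \<circ> from_S3 \<circ> \<gamma>) ` braided X" by blast
  qed (use braided_image_subset[OF h(1,2)] p in auto)
  with ambient_isotopic[OF f, of "braided X"] braided_in_range show ?thesis by metis
qed

section \<open>Loops of configurations\<close>

text \<open>A closed braid as a motion of labelled points in the right half-plane. One turn around the
  axis takes unit time and permutes the labels by \<open>\<pi>\<close>.\<close>

definition closed_braid :: "('n::finite \<Rightarrow> 'n) \<Rightarrow> (real \<Rightarrow> complex ^ 'n) \<Rightarrow> bool"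
  where "closed_braid \<pi> W \<longleftrightarrow> continuous_on UNIV W \<and> (\<forall>s i. W (s + 1) $ i = W s $ \<pi> i) \<and>
     (\<forall>s i j. W s $ i = W s $ j \<longrightarrow> i = j) \<and> (\<forall>s i. Re (W s $ i) > 0)"

definition strand_points :: "(real \<Rightarrow> complex ^ 'n::finite) \<Rightarrow> R3 set"
  where "strand_points W = {page (W s $ i) (2 * pi * s) | s i. True}"

lemma closed_braid_bij: "closed_braid \<pi> W \<Longrightarrow> bij \<pi>"
proof -
  assume W: "closed_braid \<pi> W"
  have "inj \<pi>"
  proof (rule injI)
    fix i j assume "\<pi> i = \<pi> j"
    then have "W (0 + 1) $ i = W (0 + 1) $ j" using W unfolding closed_braid_def by metis
    then show "i = j" using W unfolding closed_braid_def by blast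
  qed
  then show ?thesis by (simp add: bij_def finite_UNIV_inj_surj)
qed

lemma closed_braid_shift:
  assumes "closed_braid \<pi> W"
  shows "W (s + real n) $ i = W s $ (\<pi> ^^ n) i"
proof (induction n arbitrary: i)
  case (Suc n)
  have "W (s + real (Suc n)) $ i = W (s + real n + 1) $ i" by (simp add: ac_simps)
  also have "\<dots> = W (s + real n) $ \<pi> i" using assms by (simp add: closed_braid_def)
  finally show ?case by (simp add: Suc funpow_swap1)
qed simp

text \<open>The relabelling \<open>\<sigma>\<close> depends only on \<open>s\<close> and \<open>\<pi>\<close>; thus it serves all stages of a
  homotopy of closed braids at once.\<close>

lemma closed_braid_reduce:
  fixes \<pi> :: "'n::finite \<Rightarrow> 'n" and s :: real
  assumes "bij \<pi>"
  obtains s' \<sigma> where "s' \<in> {0..<1}" "bij \<sigma>" "\<exists>k::int. s = s' + of_int k"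
    "\<And>W i. closed_braid \<pi> W \<Longrightarrow> W s $ i = W s' $ \<sigma> i"
proof (cases "s \<ge> 0")
  case True
  define n where "n = nat \<lfloor>s\<rfloor>"
  have n: "s = frac s + real n" using True by (simp add: frac_def n_def)
  show thesis
  proof (rule that[of "frac s" "\<pi> ^^ n"])
    show "W s $ i = W (frac s) $ (\<pi> ^^ n) i" if "closed_braid \<pi> W" for W i
      using closed_braid_shift[OF that, of "frac s" n i] n by simp
    show "\<exists>k::int. s = frac s + of_int k" using n by (metis of_int_of_nat_eq)
  qed (use assms in \<open>auto simp: frac_lt_1 bij_betw_funpow\<close>)
next
  case False
  define n where "n = nat (- \<lfloor>s\<rfloor>)"
  have n: "frac s = s + real n" using False by (simp add: frac_def n_def)
  have b: "bij (\<pi> ^^ n)" using assms by (simp add: bij_betw_funpow)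
  show thesis
  proof (rule that[of "frac s" "inv (\<pi> ^^ n)"])
    show "W s $ i = W (frac s) $ inv (\<pi> ^^ n) i" if "closed_braid \<pi> W" for W i
      using closed_braid_shift[OF that, of s n "inv (\<pi> ^^ n) i"] n b
      by (simp add: surj_f_inv_f bij_is_surj)
    show "\<exists>k::int. s = frac s + of_int k" by (metis frac_def diff_add_cancel)
  qed (use b in \<open>auto simp: frac_lt_1 bij_imp_bij_inv\<close>)
qed

lemma strand_points_unit:
  assumes W: "closed_braid \<pi> W"
  shows "strand_points W = {page (W s $ i) (2 * pi * s) | s i. s \<in> {0..1}}"
proof -
  have "page (W s $ i) (2 * pi * s) \<in> {page (W s $ i) (2 * pi * s) | s i. s \<in> {0..1}}" for s i
  proof -
    obtain s' \<sigma> where s': "s' \<in> {0..<1}" "\<exists>k::int. s = s' + of_int k" "W s $ i = W s' $ \<sigma> i"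
      using closed_braid_reduce[OF closed_braid_bij[OF W]] W by metis
    then have "page (W s $ i) (2 * pi * s) = page (W s' $ \<sigma> i) (2 * pi * s')"
      using W by (subst page_eq_iff) (auto simp: closed_braid_def algebra_simps)
    then show ?thesis using s'(1) by force
  qed
  then show ?thesis by (auto simp: strand_points_def)
qed

subsection \<open>Moving the strands a little\<close>

definition bump :: "real \<Rightarrow> real \<Rightarrow> real"
  where "bump r x = max 0 (1 - x / r)"

lemma bump_lipschitz: "r > 0 \<Longrightarrow> \<bar>bump r x - bump r y\<bar> \<le> \<bar>x - y\<bar> / r"
  by (simp add: bump_def max_def field_simps abs_if)

text \<open>A solution of \<open>w + g w = y\<close> is a fixed point of the contraction \<open>\<lambda>w. y - g w\<close>.\<close>

lemma bij_add_contraction: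
  fixes g :: "complex \<Rightarrow> complex"
  assumes "\<And>w w'. cmod (g w - g w') \<le> cmod (w - w') / 2"
  shows "bij (\<lambda>w. w + g w)"
proof (rule bijI)
  show "inj (\<lambda>w. w + g w)"
  proof (rule injI)
    fix w w' assume "w + g w = w' + g w'"
    then have "w - w' = g w' - g w" by (simp add: algebra_simps)
    then have "cmod (w - w') \<le> cmod (w - w') / 2"
      using assms[of w' w] by (metis norm_minus_commute)
    then show "w = w'" by simp
  qed
  show "surj (\<lambda>w. w + g w)"
    unfolding surj_def
  proof
    fix y
    have "\<exists>!x. y - g x = x"
    proof (rule banach_fix_type[where c = "1/2"])
      show "\<forall>x. \<forall>z. dist (y - g x) (y - g z) \<le> 1/2 * dist x z"
        using assms by (auto simp: dist_norm norm_minus_commute)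
    qed auto
    then show "\<exists>x. y = x + g x" by (metis diff_eq_eq)
  qed
qed

text \<open>Two closed braids that are close to each other in comparison with the distances between
  the strands and to the axis. Every point of a page is pushed by \<open>S\<close>, the sum of the
  displacements of the strands, each weighted by a bump around its strand. At a strand all other
  bumps vanish, so the strands of \<open>W\<close> are carried to those of \<open>W'\<close>; and the displacements are so
  small that \<open>S\<close> is a contraction, so each page is mapped bijectively to itself. \<open>G\<close> is the
  resulting vector field on 3-space.\<close>

locale small_move =
  fixes \<pi> :: "'n::finite \<Rightarrow> 'n" and W W' :: "real \<Rightarrow> complex ^ 'n" and r :: real
  assumes W: "closed_braid \<pi> W" and W': "closed_braid \<pi> W'" and r: "r > 0"
    and sep: "\<And>s i j. i \<noteq> j \<Longrightarrow> r \<le> cmod (W s $ i - W s $ j)"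
    and Re: "\<And>s i. 2 * r \<le> Re (W s $ i)"
    and close: "\<And>s. (\<Sum>i\<in>UNIV. cmod (W' s $ i - W s $ i)) \<le> r / 2"
begin

definition S :: "real \<Rightarrow> complex \<Rightarrow> complex"
  where "S s w = (\<Sum>i\<in>UNIV. bump r (cmod (w - W s $ i)) *\<^sub>R (W' s $ i - W s $ i))"

definition V :: "R3 \<Rightarrow> complex"
  where "V x = S (Arg (fst x) / (2 * pi)) (Complex (cmod (fst x)) (snd x))"

definition G :: "R3 \<Rightarrow> R3"
  where "G x = (of_real (Re (V x)) * sgn (fst x), Im (V x))"

lemma bump_le_1: "bump r (cmod w) \<le> 1" "0 \<le> bump r x"
  using r by (auto simp: bump_def)

text \<open>A full turn permutes the summands.\<close>

lemma S_periodic: "S (s + of_int k) w = S s w"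
proof -
  obtain s' \<sigma> where s': "s' \<in> {0..<1}" "bij \<sigma>" "\<exists>k::int. s = s' + of_int k"
    "\<And>W i. closed_braid \<pi> W \<Longrightarrow> W s $ i = W s' $ \<sigma> i"
    using closed_braid_reduce[OF closed_braid_bij[OF W], of s] by metis
  obtain s'' \<sigma>' where s'': "s'' \<in> {0..<1}" "bij \<sigma>'" "\<exists>j::int. s + of_int k = s'' + of_int j"
    "\<And>W i. closed_braid \<pi> W \<Longrightarrow> W (s + of_int k) $ i = W s'' $ \<sigma>' i"
    using closed_braid_reduce[OF closed_braid_bij[OF W], of "s + of_int k"] by metis
  have "s' = frac s" using s'(1,3) frac_unique_iff[of s s'] by (auto simp: Ints_def)
  moreover have "s'' = frac s" using s''(1,3) frac_unique_iff[of "s + of_int k" s'']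
    by (auto simp: Ints_def frac_add_int_right)
  ultimately have e: "s'' = s'" by simp
  have r: "(\<Sum>i\<in>UNIV. f (\<sigma> i)) = sum f UNIV" "(\<Sum>i\<in>UNIV. f (\<sigma>' i)) = sum f UNIV" for f :: "'n \<Rightarrow> complex"
    using sum.reindex_bij_betw[OF s'(2)] sum.reindex_bij_betw[OF s''(2)] by auto
  let ?f = "\<lambda>i. bump r (cmod (w - W s' $ i)) *\<^sub>R (W' s' $ i - W s' $ i)"
  show ?thesis unfolding S_def
    using r(1)[of ?f] r(2)[of ?f] by (simp add: s'(4)[OF W] s'(4)[OF W'] s''(4)[OF W] s''(4)[OF W'] e)
qed

lemma S_lipschitz: "cmod (S s w - S s w') \<le> cmod (w - w') / 2"
proof -
  have "cmod (S s w - S s w') = cmod (\<Sum>i\<in>UNIV. (bump r (cmod (w - W s $ i)) - bump r (cmod (w' - W s $ i))) *\<^sub>R (W' s $ i - W s $ i))"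
    by (simp add: S_def sum_subtractf scaleR_left_diff_distrib)
  also have "\<dots> \<le> (\<Sum>i\<in>UNIV. cmod (w - w') / r * cmod (W' s $ i - W s $ i))"
  proof (rule sum_norm_le)
    fix i
    have "\<bar>bump r (cmod (w - W s $ i)) - bump r (cmod (w' - W s $ i))\<bar> \<le> \<bar>cmod (w - W s $ i) - cmod (w' - W s $ i)\<bar> / r"
      by (rule bump_lipschitz[OF r])
    also have "\<dots> \<le> cmod (w - w') / r"
      using norm_triangle_ineq3[of "w - W s $ i" "w' - W s $ i"] r by (simp add: divide_right_mono)
    finally show "cmod ((bump r (cmod (w - W s $ i)) - bump r (cmod (w' - W s $ i))) *\<^sub>R (W' s $ i - W s $ i))
       \<le> cmod (w - w') / r * cmod (W' s $ i - W s $ i)"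
      unfolding norm_scaleR by (intro mult_right_mono) auto
  qed
  also have "\<dots> = cmod (w - w') / r * (\<Sum>i\<in>UNIV. cmod (W' s $ i - W s $ i))"
    by (simp add: sum_distrib_left)
  also have "\<dots> \<le> cmod (w - w') / r * (r / 2)"
    by (intro mult_left_mono close) (use r in auto)
  finally show ?thesis using r by simp
qed

lemma S_bound: "cmod (S s w) \<le> r / 2"
proof -
  have "cmod (S s w) \<le> (\<Sum>i\<in>UNIV. cmod (W' s $ i - W s $ i))"
    unfolding S_def
  proof (rule sum_norm_le)
    fix i
    show "cmod (bump r (cmod (w - W s $ i)) *\<^sub>R (W' s $ i - W s $ i)) \<le> cmod (W' s $ i - W s $ i)"
      using bump_le_1 by (simp add: mult_left_le_one_le)
  qed
  then show ?thesis using close[of s] by linarith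
qed

lemma S_zero: "Re w \<le> r \<Longrightarrow> S s w = 0"
proof -
  assume w: "Re w \<le> r"
  have "bump r (cmod (w - W s $ i)) = 0" for i
  proof -
    have "r \<le> \<bar>Re (w - W s $ i)\<bar>" using w Re[of s i] r by simp
    also have "\<dots> \<le> cmod (w - W s $ i)" by (rule abs_Re_le_cmod)
    finally show ?thesis using r by (simp add: bump_def)
  qed
  then show ?thesis by (simp add: S_def)
qed

lemma S_strand: "S s (W s $ i) = W' s $ i - W s $ i"
proof -
  have "bump r (cmod (W s $ i - W s $ j)) *\<^sub>R (W' s $ j - W s $ j) = (if j = i then W' s $ i - W s $ i else 0)" for j
    using sep[of i j s] r by (auto simp: bump_def max_def)
  then show ?thesis by (simp add: S_def)
qed

lemma continuous_S: "continuous_on UNIV (\<lambda>z. S (fst z) (snd z))"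
proof -
  have c: "continuous_on UNIV (\<lambda>z::real \<times> complex. W (fst z))" "continuous_on UNIV (\<lambda>z::real \<times> complex. W' (fst z))"
    using W W' by (auto simp: closed_braid_def intro!: continuous_on_compose2[of UNIV _ UNIV fst] continuous_intros)
  show ?thesis unfolding S_def bump_def using r
    by (intro continuous_intros c) auto
qed

lemma V_page: "Re w > 0 \<Longrightarrow> V (page w \<theta>) = S (\<theta> / (2 * pi)) w"
proof -
  assume w: "Re w > 0"
  define a where "a = Arg (fst (page w \<theta>))"
  have nz: "fst (page w \<theta>) \<noteq> 0" using norm_fst_page[OF w, of \<theta>] w by auto
  have "page (Complex (cmod (fst (page w \<theta>))) (snd (page w \<theta>))) a = page w \<theta>"
    using page_polar[OF nz, of "snd (page w \<theta>)"] by (simp only: a_def prod.collapse)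
  then have "page w a = page w \<theta>" using w by (simp add: norm_fst_page)
  then obtain k :: int where "a = \<theta> + 2 * pi * k" using w by (auto simp: page_eq_iff)
  then have "a / (2 * pi) = \<theta> / (2 * pi) + k" by (simp add: field_simps)
  then show ?thesis using w by (simp add: V_def norm_fst_page a_def[symmetric] S_periodic)
qed

lemma G_page: "Re w > 0 \<Longrightarrow> page w \<theta> + t *\<^sub>R G (page w \<theta>) = page (w + t *\<^sub>R S (\<theta> / (2 * pi)) w) \<theta>"
  by (simp add: G_def V_page) (simp add: page_def sgn_mult sgn_of_real scaleR_conv_of_real algebra_simps)

text \<open>On the negative real axis, where \<open>Arg\<close> jumps, it can be replaced by \<open>Arg2pi\<close> because \<open>S\<close>
  has period one.\<close>

lemma continuous_V: "continuous_on {x. fst x \<noteq> 0} V"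
proof -
  have V2: "V x = S (Arg2pi (fst x) / (2 * pi)) (Complex (cmod (fst x)) (snd x))" if "fst x \<noteq> 0" for x
  proof -
    have "page (Complex (cmod (fst x)) (snd x)) (Arg2pi (fst x)) = x"
      using Arg2pi_eq[of "fst x"] by (cases x) (simp add: page_def cis_conv_exp mult.commute)
    then show ?thesis using V_page[of "Complex (cmod (fst x)) (snd x)" "Arg2pi (fst x)"] that by simp
  qed
  have cS: "isCont (\<lambda>x. S (A (fst x) / (2 * pi)) (Complex (cmod (fst x)) (snd x))) x"
    if "isCont A (fst x)" for A :: "complex \<Rightarrow> real" and x :: R3
  proof -
    have c: "isCont (\<lambda>x::R3. A (fst x)) x"
      using that by (rule isCont_o2[rotated]) (intro continuous_intros)
    have "isCont (\<lambda>x. (A (fst x) / (2 * pi), Complex (cmod (fst x)) (snd x))) x"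
      unfolding Complex_eq by (intro continuous_intros c) auto
    moreover have "isCont (\<lambda>z. S (fst z) (snd z)) y" for y
      using continuous_S unfolding continuous_on_eq_continuous_at[OF open_UNIV] by (rule bspec) simp
    ultimately show ?thesis
      using isCont_o2[of x "\<lambda>x. (A (fst x) / (2 * pi), Complex (cmod (fst x)) (snd x))" "\<lambda>z. S (fst z) (snd z)"] by simp
  qed
  have "isCont V x" if "fst x \<noteq> 0" for x
  proof (cases "fst x \<in> \<real>\<^sub>\<le>\<^sub>0")
    case False
    then have "isCont Arg (fst x)" by (rule continuous_at_Arg)
    from cS[OF this] show ?thesis by (simp add: V_def[abs_def])
  next
    case True
    then have "fst x \<notin> \<real>\<^sub>\<ge>\<^sub>0" using that by (auto simp: complex_nonpos_Reals_iff complex_nonneg_Reals_iff complex_eq_iff)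
    then have "isCont Arg2pi (fst x)" by (rule continuous_at_Arg2pi)
    from cS[OF this] have c: "isCont (\<lambda>x. S (Arg2pi (fst x) / (2 * pi)) (Complex (cmod (fst x)) (snd x))) x" .
    have "open {x::R3. fst x \<noteq> 0}" by (intro open_Collect_neq continuous_intros)
    then have "\<forall>\<^sub>F y in nhds x. fst y \<noteq> 0" using eventually_nhds_in_open[of "{x::R3. fst x \<noteq> 0}" x] that by simp
    then have "\<forall>\<^sub>F y in nhds x. V y = S (Arg2pi (fst y) / (2 * pi)) (Complex (cmod (fst y)) (snd y))"
      by eventually_elim (rule V2)
    then show ?thesis using isCont_cong[of V "\<lambda>x. S (Arg2pi (fst x) / (2 * pi)) (Complex (cmod (fst x)) (snd x))" x] c by simp
  qed
  then show ?thesis by (intro continuous_at_imp_continuous_on) auto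
qed

lemma continuous_G: "continuous_on UNIV G"
proof -
  have "continuous_on {x. fst x \<noteq> 0} G"
    unfolding G_def by (intro continuous_intros continuous_V) auto
  moreover have "G x = 0" if "cmod (fst x) < r" for x
    using that by (simp add: G_def V_def S_zero zero_prod_def)
  then have "continuous_on {x. cmod (fst x) < r} G"
    by (intro continuous_on_eq[OF continuous_on_const[of _ 0]]) auto
  moreover have "open {x::R3. fst x \<noteq> 0}" "open {x::R3. cmod (fst x) < r}"
    by (intro open_Collect_neq open_Collect_less continuous_intros)+
  ultimately have "continuous_on ({x. fst x \<noteq> 0} \<union> {x. cmod (fst x) < r}) G"
    by (intro continuous_on_open_Un) auto
  moreover have "{x::R3. fst x \<noteq> 0} \<union> {x. cmod (fst x) < r} = UNIV" using r by auto
  ultimately show ?thesis by simp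
qed

lemma bij_fibre: "t \<in> {0..1} \<Longrightarrow> bij (\<lambda>w. w + t *\<^sub>R S s w)"
proof (rule bij_add_contraction)
  fix w w' assume t: "t \<in> {0..1::real}"
  have "cmod (t *\<^sub>R S s w - t *\<^sub>R S s w') = t * cmod (S s w - S s w')"
    using t by (simp flip: scaleR_diff_right)
  also have "\<dots> \<le> 1 * cmod (S s w - S s w')" using t by (intro mult_right_mono) auto
  finally show "cmod (t *\<^sub>R S s w - t *\<^sub>R S s w') \<le> cmod (w - w') / 2"
    using S_lipschitz[of s w w'] by linarith
qed

text \<open>Outside the open half-plane \<open>S\<close> vanishes, so that the map is the identity there; being
  injective, it cannot send a point of the half-plane out of it.\<close>

lemma fibre_pos_iff:
  assumes t: "t \<in> {0..1}"
  shows "Re (w + t *\<^sub>R S s w) > 0 \<longleftrightarrow> Re w > 0"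
proof
  assume "Re w > 0"
  show "Re (w + t *\<^sub>R S s w) > 0"
  proof (rule ccontr)
    define w' where "w' = w + t *\<^sub>R S s w"
    assume "\<not> ?thesis"
    then have "Re w' \<le> 0" by (simp add: w'_def)
    then have "w' + t *\<^sub>R S s w' = w'" using r by (simp add: S_zero)
    then have "w' + t *\<^sub>R S s w' = w + t *\<^sub>R S s w" by (simp only: w'_def)
    then have "w' = w" by (rule injD[OF bij_is_inj[OF bij_fibre[OF t, of s]]])
    with \<open>Re w > 0\<close> \<open>Re w' \<le> 0\<close> show False by simp
  qed
next
  assume a: "Re (w + t *\<^sub>R S s w) > 0"
  show "Re w > 0"
  proof (rule ccontr)
    assume "\<not> Re w > 0"
    then have "S s w = 0" using r by (intro S_zero) simp
    with a \<open>\<not> Re w > 0\<close> show False by simp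
  qed
qed

lemma fibre_surj:
  assumes t: "t \<in> {0..1}" and y: "Re y > 0"
  obtains w where "Re w > 0" "w + t *\<^sub>R S s w = y"
proof -
  obtain w where w: "w + t *\<^sub>R S s w = y"
    using bij_is_surj[OF bij_fibre[OF t, of s]] unfolding surj_def by metis
  then have "Re w > 0" using fibre_pos_iff[OF t, of w s] y by simp
  with w show thesis using that by blast
qed

lemma G_axis: "fst x = 0 \<Longrightarrow> G x = 0"
  using r by (simp add: G_def V_def S_zero zero_prod_def)

lemma off_axis: "fst x \<noteq> 0 \<Longrightarrow> \<exists>w \<theta>. Re w > 0 \<and> x = page w \<theta>"
  using page_polar[of "fst x" "snd x"] by (intro exI[of _ "Complex (cmod (fst x)) (snd x)"] exI[of _ "Arg (fst x)"]) simp

lemma page_off_axis: "Re w > 0 \<Longrightarrow> fst (page w \<theta>) \<noteq> 0"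
  using norm_fst_page[of w \<theta>] by fastforce

lemma S_mod: "\<theta> = \<theta>' + 2 * pi * of_int k \<Longrightarrow> S (\<theta> / (2 * pi)) = S (\<theta>' / (2 * pi))"
  using S_periodic[of "\<theta>' / (2 * pi)" k] by (auto simp: fun_eq_iff add_divide_distrib)

lemma bij_move:
  assumes t: "t \<in> {0..1}"
  shows "bij (\<lambda>x. x + t *\<^sub>R G x)"
proof (rule bijI)
  let ?F = "\<lambda>x. x + t *\<^sub>R G x"
  have off: "fst (?F x) = 0 \<longleftrightarrow> fst x = 0" for x
  proof
    assume 0: "fst (?F x) = 0"
    show "fst x = 0"
    proof (rule ccontr)
      assume "fst x \<noteq> 0"
      then obtain w \<theta> where w: "Re w > 0" "x = page w \<theta>" using off_axis by blast
      then have "?F x = page (w + t *\<^sub>R S (\<theta> / (2 * pi)) w) \<theta>" using G_page by simp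
      then show False using page_off_axis fibre_pos_iff[OF t] w(1) 0 by metis
    qed
  qed (simp add: G_axis)
  show "inj ?F"
  proof (rule injI)
    fix x y assume e: "?F x = ?F y"
    show "x = y"
    proof (cases "fst x = 0")
      case True
      then have "fst y = 0" using e off by metis
      then show ?thesis using True e by (simp add: G_axis)
    next
      case False
      then have "fst y \<noteq> 0" using e off by metis
      then obtain w \<theta> w' \<theta>' where w: "Re w > 0" "x = page w \<theta>" "Re w' > 0" "y = page w' \<theta>'"
        using False off_axis by metis
      have "page (w + t *\<^sub>R S (\<theta> / (2 * pi)) w) \<theta> = page (w' + t *\<^sub>R S (\<theta>' / (2 * pi)) w') \<theta>'"
        using e w by (simp only: G_page)
      then have 1: "w + t *\<^sub>R S (\<theta> / (2 * pi)) w = w' + t *\<^sub>R S (\<theta>' / (2 * pi)) w'"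
        and "\<exists>k::int. \<theta> = \<theta>' + 2 * pi * of_int k"
        using fibre_pos_iff[OF t] w by (auto simp: page_eq_iff)
      then obtain k :: int where k: "\<theta> = \<theta>' + 2 * pi * of_int k" by blast
      have "w + t *\<^sub>R S (\<theta> / (2 * pi)) w = w' + t *\<^sub>R S (\<theta> / (2 * pi)) w'" using 1 S_mod[OF k] by simp
      then have "w = w'" by (rule injD[OF bij_is_inj[OF bij_fibre[OF t]]])
      then show ?thesis using w k by (metis page_eq_iff)
    qed
  qed
  show "surj ?F"
    unfolding surj_def
  proof
    fix y show "\<exists>x. y = ?F x"
    proof (cases "fst y = 0")
      case True then show ?thesis using G_axis[of y] by (intro exI[of _ y]) simp
    next
      case False
      then obtain w' \<theta> where w': "Re w' > 0" "y = page w' \<theta>" using off_axis by blast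
      then obtain w where "Re w > 0" "w + t *\<^sub>R S (\<theta> / (2 * pi)) w = w'" using fibre_surj[OF t] by metis
      then show ?thesis using G_page[of w \<theta> t] w'(2) by metis
    qed
  qed
qed

lemma G_bound: "norm (G x) \<le> r"
proof -
  have "norm (G x) \<le> norm (fst (G x)) + norm (snd (G x))"
    unfolding norm_prod_def by (rule sqrt_sum_squares_le_sum) auto
  also have "norm (fst (G x)) \<le> \<bar>Re (V x)\<bar>" by (simp add: G_def norm_mult norm_sgn)
  also have "norm (snd (G x)) = \<bar>Im (V x)\<bar>" by (simp add: G_def)
  also have "\<bar>Re (V x)\<bar> \<le> r / 2" using S_bound abs_Re_le_cmod order_trans unfolding V_def by blast
  also have "\<bar>Im (V x)\<bar> \<le> r / 2" using S_bound abs_Im_le_cmod order_trans unfolding V_def by blast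
  finally show ?thesis by simp
qed

lemma ambient_move: "ambient (\<lambda>x. x + G x)"
  unfolding ambient_def
proof (intro exI[of _ "\<lambda>z. snd z + fst z *\<^sub>R G (snd z)"] conjI ballI allI)
  show "continuous_on ({0..1} \<times> UNIV) (\<lambda>z. snd z + fst z *\<^sub>R G (snd z))"
    by (intro continuous_intros continuous_on_compose2[OF continuous_G]) auto
  show "proper_family (\<lambda>z. snd z + fst z *\<^sub>R G (snd z))"
    unfolding proper_family_def
  proof (intro allI exI ballI impI)
    fix B t :: real and x :: R3 assume t: "t \<in> {0..1}" and n: "norm (snd (t, x) + fst (t, x) *\<^sub>R G (snd (t, x))) \<le> B"
    have "norm (t *\<^sub>R G x) \<le> 1 * r" using t G_bound[of x] r unfolding norm_scaleR by (intro mult_mono) auto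
    then show "norm x \<le> B + r" using n norm_triangle_ineq2[of "x + t *\<^sub>R G x" "t *\<^sub>R G x"]
        norm_triangle_ineq4[of "x + t *\<^sub>R G x" "t *\<^sub>R G x"] by simp
  qed
qed (use bij_move in auto)

lemma move_half_plane: "(\<lambda>x. x + G x) ` half_plane \<theta> = half_plane \<theta>"
proof (intro equalityI subsetI)
  fix x assume "x \<in> (\<lambda>x. x + G x) ` half_plane \<theta>"
  then obtain w where "Re w > 0" "x = page w \<theta> + 1 *\<^sub>R G (page w \<theta>)" by (auto simp: half_plane_def)
  then have "x = page (w + 1 *\<^sub>R S (\<theta> / (2 * pi)) w) \<theta>" "0 < Re (w + 1 *\<^sub>R S (\<theta> / (2 * pi)) w)"
    using fibre_pos_iff[of 1 w "\<theta> / (2 * pi)"] by (simp_all only: G_page) simp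
  then show "x \<in> half_plane \<theta>" unfolding half_plane_def by blast
next
  fix x assume "x \<in> half_plane \<theta>"
  then obtain w' where w': "Re w' > 0" "x = page w' \<theta>" by (auto simp: half_plane_def)
  then obtain w where "Re w > 0" "w + 1 *\<^sub>R S (\<theta> / (2 * pi)) w = w'" using fibre_surj[of 1 w'] by auto
  then show "x \<in> (\<lambda>x. x + G x) ` half_plane \<theta>"
    using G_page[of w \<theta> 1] w' by (intro image_eqI[of _ _ "page w \<theta>"]) (auto simp: half_plane_def)
qed

lemma move_strand_points: "(\<lambda>x. x + G x) ` strand_points W = strand_points W'"
proof -
  have "page (W s $ i) (2 * pi * s) + G (page (W s $ i) (2 * pi * s)) = page (W' s $ i) (2 * pi * s)" for s i
  proof -
    have "Re (W s $ i) > 0" using W by (simp add: closed_braid_def)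
    from G_page[OF this, of "2 * pi * s" 1] show ?thesis by (simp add: S_strand)
  qed
  note * = this
  show ?thesis
  proof (intro equalityI subsetI)
    fix y assume "y \<in> (\<lambda>x. x + G x) ` strand_points W"
    then obtain s i where "y = page (W s $ i) (2 * pi * s) + G (page (W s $ i) (2 * pi * s))"
      unfolding strand_points_def by blast
    then show "y \<in> strand_points W'" unfolding * strand_points_def by blast
  next
    fix y assume "y \<in> strand_points W'"
    then obtain s i where "y = page (W' s $ i) (2 * pi * s)" unfolding strand_points_def by blast
    then have "y = (\<lambda>x. x + G x) (page (W s $ i) (2 * pi * s))" by (simp only: *)
    then show "y \<in> (\<lambda>x. x + G x) ` strand_points W" unfolding strand_points_def by blast
  qed
qed

lemma isotopic: "isotopic (braided (strand_points W)) (braided (strand_points W'))"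
  using braided_isotopic_image[OF ambient_move move_half_plane, of "strand_points W"]
  by (simp add: move_strand_points)

end

lemma compact_uniform_positive:
  fixes f :: "'m::finite \<Rightarrow> 'a::metric_space \<Rightarrow> real"
  assumes K: "compact K" and c: "\<And>i. continuous_on K (f i)" and p: "\<And>i x. x \<in> K \<Longrightarrow> f i x > 0"
  obtains r where "r > 0" "\<And>i x. x \<in> K \<Longrightarrow> r \<le> f i x"
proof (cases "K = {}")
  case False
  have "\<exists>r>0. \<forall>x\<in>K. r \<le> f i x" for i
    using continuous_attains_inf[OF K False c[of i]] p by metis
  then obtain R where R: "\<And>i. R i > 0" "\<And>i x. x \<in> K \<Longrightarrow> R i \<le> f i x" by metis
  show thesis
  proof (rule that[of "Min (range R)"])
    show "Min (range R) > 0" using R(1) by (subst Min_gr_iff) auto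
    show "Min (range R) \<le> f i x" if "x \<in> K" for i x
      using R(2)[OF that, of i] Min_le[of "range R" "R i"] by (meson finite finite_imageI order_trans rangeI)
  qed
qed (use that[of 1] in auto)

text \<open>By compactness one scale \<open>r\<close> bounds the distances between the strands and to the axis from
  below during the whole homotopy, and short pieces of the homotopy are small moves at this
  scale.\<close>

theorem homotopic_closed_braids_isotopic:
  fixes W :: "real \<Rightarrow> real \<Rightarrow> complex ^ 'n::finite"
  assumes c: "continuous_on ({0..1} \<times> UNIV) (\<lambda>z. W (fst z) (snd z))"
    and W: "\<And>t. t \<in> {0..1} \<Longrightarrow> closed_braid \<pi> (W t)"
  shows "isotopic (braided (strand_points (W 0))) (braided (strand_points (W 1)))"
proof -
  let ?K = "{0..1} \<times> {0..1} :: (real \<times> real) set"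
  have cK: "continuous_on ?K (\<lambda>z. W (fst z) (snd z))"
    by (rule continuous_on_subset[OF c]) auto
  have K: "compact ?K" by (intro compact_Times) auto
  have bij: "bij \<pi>" using W[of 0] closed_braid_bij by auto
  obtain r1 where r1: "r1 > 0" "\<And>ij z. z \<in> ?K \<Longrightarrow> r1 \<le> (case ij of (i, j) \<Rightarrow> if i = j then 1 else cmod (W (fst z) (snd z) $ i - W (fst z) (snd z) $ j))"
  proof (rule compact_uniform_positive[OF K, of "\<lambda>ij z. (case ij of (i, j) \<Rightarrow> if i = j then 1 else cmod (W (fst z) (snd z) $ i - W (fst z) (snd z) $ j))"])
    fix ij :: "'n \<times> 'n"
    show "continuous_on ?K (\<lambda>z. case ij of (i, j) \<Rightarrow> if i = j then 1 else cmod (W (fst z) (snd z) $ i - W (fst z) (snd z) $ j))"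
      by (cases ij; cases "fst ij = snd ij") (auto intro!: continuous_intros cK)
    show "0 < (case ij of (i, j) \<Rightarrow> if i = j then 1 else cmod (W (fst z) (snd z) $ i - W (fst z) (snd z) $ j))"
      if "z \<in> ?K" for z
      using W[of "fst z"] that by (cases ij) (auto simp: closed_braid_def)
  qed blast
  obtain r2 where r2: "r2 > 0" "\<And>i z. z \<in> ?K \<Longrightarrow> r2 \<le> Re (W (fst z) (snd z) $ i)"
  proof (rule compact_uniform_positive[OF K, of "\<lambda>i z. Re (W (fst z) (snd z) $ i)"])
    show "continuous_on ?K (\<lambda>z. Re (W (fst z) (snd z) $ i))" for i
      by (intro continuous_intros cK)
    show "0 < Re (W (fst z) (snd z) $ i)" if "z \<in> ?K" for z i
      using W[of "fst z"] that by (auto simp: closed_braid_def)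
  qed blast
  define r where "r = min r1 (r2 / 2)"
  have r: "r > 0" using r1 r2 by (simp add: r_def)
  let ?n = "real CARD('n)"
  have n: "?n > 0" by simp
  obtain d where d: "d > 0" "\<And>z z'. z \<in> ?K \<Longrightarrow> z' \<in> ?K \<Longrightarrow> dist z' z < d \<Longrightarrow>
       dist (W (fst z') (snd z')) (W (fst z) (snd z)) < r / (2 * ?n)"
    using compact_uniformly_continuous[OF cK K] r n unfolding uniformly_continuous_on_def
    by (metis divide_pos_pos mult_pos_pos zero_less_numeral)
  have step: "isotopic (braided (strand_points (W t))) (braided (strand_points (W t')))"
    if t: "t \<in> {0..1}" "t' \<in> {0..1}" "\<bar>t' - t\<bar> < d" for t t'
  proof -
    have sm: "small_move \<pi> (W t) (W t') r"
    proof
      fix s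
      obtain s' \<sigma> where s': "s' \<in> {0..<1}" "bij \<sigma>" "\<And>W i. closed_braid \<pi> W \<Longrightarrow> W s $ i = W s' $ \<sigma> i"
        using closed_braid_reduce[OF bij] by metis
      have in1: "(t, s') \<in> ?K" "(t', s') \<in> ?K" using t s' by auto
      show "r \<le> cmod (W t s $ i - W t s $ j)" if "i \<noteq> j" for i j
      proof -
        have "\<sigma> i \<noteq> \<sigma> j" using that s'(2) by (metis bij_pointE)
        then show ?thesis using r1(2)[OF in1(1), of "(\<sigma> i, \<sigma> j)"] s'(3)[OF W[OF t(1)]] by (simp add: r_def)
      qed
      show "2 * r \<le> Re (W t s $ i)" for i
        using r2(2)[OF in1(1), of "\<sigma> i"] s'(3)[OF W[OF t(1)]] by (simp add: r_def)
      have "(\<Sum>i\<in>UNIV. cmod (W t' s $ i - W t s $ i)) = (\<Sum>i\<in>UNIV. cmod (W t' s' $ \<sigma> i - W t s' $ \<sigma> i))"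
        using s'(3)[OF W[OF t(1)]] s'(3)[OF W[OF t(2)]] by simp
      also have "\<dots> \<le> ?n * (r / (2 * ?n))"
      proof (rule sum_bounded_above)
        fix i
        have "cmod (W t' s' $ \<sigma> i - W t s' $ \<sigma> i) \<le> norm (W t' s' - W t s')"
          using Finite_Cartesian_Product.norm_nth_le[of "W t' s' - W t s'" "\<sigma> i"] by simp
        also have "\<dots> < r / (2 * ?n)"
          using d(2)[OF in1] t(3) by (simp add: dist_norm norm_Pair)
        finally show "cmod (W t' s' $ \<sigma> i - W t s' $ \<sigma> i) \<le> r / (2 * ?n)" by simp
      qed
      finally show "(\<Sum>i\<in>UNIV. cmod (W t' s $ i - W t s $ i)) \<le> r / 2" using n by simp
    qed (use W t r in auto)
    show ?thesis by (rule small_move.isotopic[OF sm])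
  qed
  obtain N :: nat where N: "N > 0" "1 / real N < d"
    using d(1) by (metis reals_Archimedean inverse_eq_divide zero_less_Suc)
  have "k \<le> N \<Longrightarrow> isotopic (braided (strand_points (W 0))) (braided (strand_points (W (real k / real N))))" for k
  proof (induction k)
    case 0 then show ?case by (simp add: isotopic_refl)
  next
    case (Suc k)
    have "isotopic (braided (strand_points (W (real k / real N)))) (braided (strand_points (W (real (Suc k) / real N))))"
      using Suc.prems N by (intro step) (auto simp: field_simps)
    then show ?case using Suc isotopic_trans by (meson Suc_leD)
  qed
  from this[of N] N show ?thesis by simp
qed


section \<open>Periodic extension of loops of configurations\<close>

lemma continuous_on_glue_unit_intervals:
  fixes f :: "'b::t2_space \<times> real \<Rightarrow> 'a::topological_space"
  assumes T: "closed T" and c: "\<And>n::int. continuous_on (T \<times> {of_int n..of_int n + 1}) f"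
  shows "continuous_on (T \<times> UNIV) f"
  unfolding continuous_on_eq_continuous_within
proof
  fix z assume z: "z \<in> T \<times> (UNIV :: real set)"
  define n where "n = \<lfloor>snd z\<rfloor>"
  have "continuous_on (T \<times> {of_int (n - 1)..of_int (n - 1) + 1} \<union> T \<times> {of_int n..of_int n + 1}) f"
    using T by (intro continuous_on_closed_Un c closed_Times) auto
  then have c2: "continuous_on (T \<times> {of_int n - 1<..<of_int n + 1}) f"
    by (rule continuous_on_subset) auto
  have "T \<times> {of_int n - 1<..<of_int n + 1} = (T \<times> UNIV) \<inter> (UNIV \<times> {of_int n - 1<..<of_int n + 1 :: real})"
    by auto
  moreover have "open (UNIV \<times> {of_int n - 1<..<of_int n + 1} :: ('b \<times> real) set)"
    by (intro open_Times) auto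
  ultimately have "openin (top_of_set (T \<times> UNIV)) (T \<times> {of_int n - 1<..<of_int n + 1 :: real})"
    by (metis openin_open_Int)
  moreover have "z \<in> T \<times> {of_int n - 1<..<of_int n + 1}"
  proof -
    have "of_int n \<le> snd z" "snd z < of_int n + 1" unfolding n_def by linarith+
    then show ?thesis using z by (cases z) auto
  qed
  ultimately show "continuous (at z within T \<times> UNIV) f"
    using c2 by (intro continuous_on_openin_at) auto
qed

lemma continuous_on_glue_unit_intervals_real:
  fixes f :: "real \<Rightarrow> 'a::topological_space"
  assumes c: "\<And>n::int. continuous_on {of_int n..of_int n + 1} f"
  shows "continuous_on UNIV f"
proof -
  have "continuous_on ({0::real} \<times> {of_int n..of_int n + 1}) (\<lambda>z. f (snd z))" for n :: int
    by (rule continuous_on_compose2[OF c]) (auto intro!: continuous_intros)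
  then have "continuous_on ({0::real} \<times> UNIV) (\<lambda>z. f (snd z))"
    by (intro continuous_on_glue_unit_intervals) auto
  then have "continuous_on UNIV (\<lambda>s. f (snd (0::real, s)))"
    by (rule continuous_on_compose2) (auto intro!: continuous_intros)
  then show ?thesis by simp
qed

definition int_power :: "('n \<Rightarrow> 'n) \<Rightarrow> int \<Rightarrow> 'n \<Rightarrow> 'n"
  where "int_power \<pi> k = (if k \<ge> 0 then \<pi> ^^ nat k else (inv \<pi>) ^^ nat (- k))"

lemma int_power_0 [simp]: "int_power \<pi> 0 i = i"
  by (simp add: int_power_def)

lemma int_power_add_one:
  assumes "bij \<pi>"
  shows "int_power \<pi> (k + 1) i = \<pi> (int_power \<pi> k i)" "int_power \<pi> (k + 1) i = int_power \<pi> k (\<pi> i)"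
proof -
  have b: "\<pi> (inv \<pi> j) = j" "inv \<pi> (\<pi> j) = j" for j
    using assms by (simp_all add: surj_f_inv_f bij_is_surj bij_is_inj)
  have "int_power \<pi> (k + 1) i = \<pi> (int_power \<pi> k i) \<and> int_power \<pi> (k + 1) i = int_power \<pi> k (\<pi> i)"
  proof (cases "k \<ge> 0")
    case True
    then have "nat (k + 1) = Suc (nat k)" by simp
    then show ?thesis using True by (simp add: int_power_def funpow_swap1)
  next
    case False
    then have e: "nat (- k) = Suc (nat (- (k + 1)))" by simp
    have "int_power \<pi> (k + 1) = (inv \<pi>) ^^ nat (- (k + 1))"
      using False by (cases "k = -1") (auto simp: int_power_def)
    moreover have "int_power \<pi> k = (inv \<pi>) ^^ Suc (nat (- (k + 1)))"
      using False e by (simp add: int_power_def)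
    ultimately show ?thesis by (simp add: b) (simp add: b funpow_swap1)
  qed
  then show "int_power \<pi> (k + 1) i = \<pi> (int_power \<pi> k i)" "int_power \<pi> (k + 1) i = int_power \<pi> k (\<pi> i)"
    by auto
qed

lemma inj_int_power: "bij \<pi> \<Longrightarrow> int_power \<pi> k i = int_power \<pi> k j \<Longrightarrow> i = j"
proof (induction k rule: int_induct[where k = 0])
  case (step1 k) then show ?case using int_power_add_one(1)[of \<pi> k] by (metis bij_pointE)
next
  case (step2 k) then show ?case using int_power_add_one(1)[of \<pi> "k - 1"] by (metis diff_add_cancel)
qed simp

text \<open>Positions in the \<open>k\<close>-th turn are those in the first one, relabelled by the \<open>k\<close>-th power of
  \<open>\<pi>\<close>. The condition on the ends of the paths makes the turns fit together.\<close>

lemma closed_braid_extension: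
  fixes Z :: "real \<Rightarrow> real \<Rightarrow> complex ^ 'n::finite"
  assumes \<pi>: "bij \<pi>"
    and c: "continuous_on ({0..1} \<times> {0..1}) (\<lambda>z. Z (fst z) (snd z))"
    and e: "\<And>t i. t \<in> {0..1} \<Longrightarrow> Z t 1 $ i = Z t 0 $ \<pi> i"
    and inj: "\<And>t s i j. t \<in> {0..1} \<Longrightarrow> s \<in> {0..1} \<Longrightarrow> Z t s $ i = Z t s $ j \<Longrightarrow> i = j"
    and pos: "\<And>t s i. t \<in> {0..1} \<Longrightarrow> s \<in> {0..1} \<Longrightarrow> Re (Z t s $ i) > 0"
  obtains W where "continuous_on ({0..1} \<times> UNIV) (\<lambda>z. W (fst z) (snd z))"
    "\<And>t. t \<in> {0..1} \<Longrightarrow> closed_braid \<pi> (W t)"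
    "\<And>t s. t \<in> {0..1} \<Longrightarrow> s \<in> {0..1} \<Longrightarrow> W t s = Z t s"
proof -
  define W where "W t s = (\<chi> i. Z t (frac s) $ int_power \<pi> \<lfloor>s\<rfloor> i)" for t s
  have W_on: "W t s = (\<chi> i. Z t (s - of_int n) $ int_power \<pi> n i)"
    if t: "t \<in> {0..1}" and s: "s \<in> {of_int n..of_int n + 1}" for t s and n :: int
  proof (cases "s = of_int n + 1")
    case True
    have "\<lfloor>s\<rfloor> = n + 1" unfolding True by simp
    moreover have "frac s = 0" unfolding frac_def using True calculation by simp
    moreover have "s - of_int n = 1" unfolding True by simp
    ultimately show ?thesis
      unfolding W_def by (simp add: vec_eq_iff e[OF t] int_power_add_one(1)[OF \<pi>] del: frac_eq_0_iff)
  next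
    case False
    then have "\<lfloor>s\<rfloor> = n" using s by (simp add: floor_eq_iff)
    then show ?thesis unfolding W_def by (simp add: frac_def)
  qed
  have cW: "continuous_on ({0..1} \<times> UNIV) (\<lambda>z. W (fst z) (snd z))"
  proof (rule continuous_on_glue_unit_intervals)
    fix n :: int
    have "continuous_on ({0..1} \<times> {of_int n..of_int n + 1}) (\<lambda>z. Z (fst z) (snd z - of_int n))"
    proof -
      have "continuous_on ({0..1} \<times> {of_int n..of_int n + 1}) (\<lambda>z. (\<lambda>z. Z (fst z) (snd z)) (fst z, snd z - of_int n))"
        by (rule continuous_on_compose2[OF c]) (auto intro!: continuous_intros)
      then show ?thesis by simp
    qed
    then have "continuous_on ({0..1} \<times> {of_int n..of_int n + 1}) (\<lambda>z. \<chi> i. Z (fst z) (snd z - of_int n) $ int_power \<pi> n i)"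
      by (intro continuous_intros)
    then show "continuous_on ({0..1} \<times> {of_int n..of_int n + 1}) (\<lambda>z. W (fst z) (snd z))"
      by (rule continuous_on_eq) (use W_on in auto)
  qed simp
  show thesis
  proof (rule that[OF cW])
    fix t :: real assume t: "t \<in> {0..1}"
    have "continuous_on UNIV (W t)"
    proof -
      have "continuous_on UNIV (\<lambda>s. (\<lambda>z. W (fst z) (snd z)) (t, s))"
        by (rule continuous_on_compose2[OF cW]) (use t in \<open>auto intro!: continuous_intros\<close>)
      then show ?thesis by simp
    qed
    moreover have f: "frac s \<in> {0..1}" for s :: real by (simp add: less_imp_le frac_lt_1)
    moreover have "W t (s + 1) $ i = W t s $ \<pi> i" for s i
      by (simp add: W_def int_power_add_one(2)[OF \<pi>] frac_def)
    moreover have "i = j" if "W t s $ i = W t s $ j" for s i j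
      using that inj[OF t f] inj_int_power[OF \<pi>] by (fastforce simp: W_def)
    ultimately show "closed_braid \<pi> (W t)"
      using pos[OF t] by (simp add: closed_braid_def W_def)
  next
    fix t s :: real assume t: "t \<in> {0..1}" "s \<in> {0..1}"
    then show "W t s = Z t s" using W_on[of t s 0] by (simp add: vec_eq_iff)
  qed
qed

definition path_points :: "(real \<Rightarrow> complex ^ 'n::finite) \<Rightarrow> R3 set"
  where "path_points Z = {page (Z s $ i) (2 * pi * s) | s i. s \<in> {0..1}}"

lemma path_points_cong: "(\<And>s. s \<in> {0..1} \<Longrightarrow> Z s = Z' s) \<Longrightarrow> path_points Z = path_points Z'"
  unfolding path_points_def by (intro Collect_cong) metis

text \<open>Isotopies of closed braids are obtained from homotopies of loops of unlabelled
  configurations; a path of labelled configurations is such a loop if its ends differ by a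
  permutation.\<close>

theorem homotopic_loops_isotopic:
  fixes Z :: "real \<Rightarrow> real \<Rightarrow> complex ^ 'n::finite"
  assumes "bij \<pi>"
    and "continuous_on ({0..1} \<times> {0..1}) (\<lambda>z. Z (fst z) (snd z))"
    and "\<And>t i. t \<in> {0..1} \<Longrightarrow> Z t 1 $ i = Z t 0 $ \<pi> i"
    and "\<And>t s i j. t \<in> {0..1} \<Longrightarrow> s \<in> {0..1} \<Longrightarrow> Z t s $ i = Z t s $ j \<Longrightarrow> i = j"
    and "\<And>t s i. t \<in> {0..1} \<Longrightarrow> s \<in> {0..1} \<Longrightarrow> Re (Z t s $ i) > 0"
  shows "isotopic (braided (path_points (Z 0))) (braided (path_points (Z 1)))"
proof -
  obtain W where W: "continuous_on ({0..1} \<times> UNIV) (\<lambda>z. W (fst z) (snd z))"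
    "\<And>t. t \<in> {0..1} \<Longrightarrow> closed_braid \<pi> (W t)"
    "\<And>t s. t \<in> {0..1} \<Longrightarrow> s \<in> {0..1} \<Longrightarrow> W t s = Z t s"
    using closed_braid_extension[of \<pi> Z] assms by blast
  have "strand_points (W t) = path_points (Z t)" if "t \<in> {0..1}" for t
    using strand_points_unit[OF W(2)[OF that]] path_points_cong[of "W t" "Z t"] W(3)[OF that]
    by (simp add: path_points_def)
  then show ?thesis using homotopic_closed_braids_isotopic[OF W(1,2)] by simp
qed

section \<open>The components of a closed braid\<close>

text \<open>\<open>R\<close> contains one label from each orbit of \<open>\<pi>\<close> and \<open>m\<close> gives the lengths of the orbits:
  the components of a closed braid are indexed by \<open>R\<close>, and \<open>m\<close> counts their turns around the
  axis.\<close>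

definition orbit_data :: "('n \<Rightarrow> 'n) \<Rightarrow> 'n set \<Rightarrow> ('n \<Rightarrow> nat) \<Rightarrow> bool"
  where "orbit_data \<pi> R m \<longleftrightarrow> (\<forall>i. \<exists>j\<in>R. \<exists>n. (\<pi> ^^ n) j = i) \<and>
    (\<forall>i\<in>R. \<forall>j\<in>R. \<forall>n. (\<pi> ^^ n) i = j \<longrightarrow> i = j) \<and>
    (\<forall>i\<in>R. m i > 0 \<and> (\<forall>n. (\<pi> ^^ n) i = i \<longleftrightarrow> m i dvd n))"

lemma funpow_period: "(\<pi> ^^ m) i = i \<Longrightarrow> (\<pi> ^^ (m * n)) i = (i::'n)"
  by (induction n) (simp_all add: funpow_add)

lemma exists_orbit_data:
  fixes \<pi> :: "'n::finite \<Rightarrow> 'n"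
  assumes "bij \<pi>"
  obtains R m where "orbit_data \<pi> R m"
proof -
  have ex: "\<exists>n>0. (\<pi> ^^ n) i = i" for i
    using funpow_inj_finite[of \<pi> i] assms by (metis bij_is_inj finite)
  define m where "m i = (LEAST n. n > 0 \<and> (\<pi> ^^ n) i = i)" for i
  have m: "m i > 0" "(\<pi> ^^ m i) i = i" for i
    using LeastI_ex[OF ex[of i]] by (simp_all add: m_def)
  have least: "m i \<le> n" if "n > 0" "(\<pi> ^^ n) i = i" for i n
    using that unfolding m_def by (intro Least_le) auto
  have dvd: "(\<pi> ^^ n) i = i \<longleftrightarrow> m i dvd n" for i n
  proof
    assume n: "(\<pi> ^^ n) i = i"
    have "(\<pi> ^^ (n mod m i + m i * (n div m i))) i = i" using n by simp
    then have "(\<pi> ^^ (n mod m i)) i = i"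
      by (simp only: funpow_add comp_apply funpow_period[OF m(2)])
    then show "m i dvd n" using least[of "n mod m i" i] m(1)[of i] by (metis mod_less_divisor
          not_le dvd_eq_mod_eq_0 neq0_conv)
  qed (auto simp: funpow_period[OF m(2)])
  define E where "E = {(i, j). \<exists>n. (\<pi> ^^ n) i = j}"
  have "equiv UNIV E"
  proof (rule equivI)
    show "refl E" by (auto simp: E_def intro!: refl_onI exI[of _ 0])
    show "sym E"
    proof (rule symI)
      fix i j assume "(i, j) \<in> E"
      then obtain n where n: "(\<pi> ^^ n) i = j" by (auto simp: E_def)
      have "(\<pi> ^^ ((m i * n - n) + n)) i = i"
        using m(1)[of i] funpow_period[OF m(2)] by simp
      then have "(\<pi> ^^ (m i * n - n)) j = i" using n by (simp add: funpow_add del: add_diff_inverse_nat)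
      then show "(j, i) \<in> E" by (auto simp: E_def)
    qed
    show "trans E"
      by (rule transI) (auto simp: E_def funpow_add[symmetric, unfolded o_def fun_eq_iff, rule_format] intro: exI)
  qed auto
  define rep where "rep i = (SOME j. j \<in> E `` {i})" for i
  have rep: "(i, rep i) \<in> E" for i
  proof -
    have "i \<in> E `` {i}" using \<open>equiv UNIV E\<close> by (simp add: equiv_def refl_on_def)
    then have "rep i \<in> E `` {i}" unfolding rep_def by (rule someI)
    then show ?thesis by simp
  qed
  have rep_eq: "rep i = rep j" if "(i, j) \<in> E" for i j
    using equiv_class_eq[OF \<open>equiv UNIV E\<close> that] by (simp add: rep_def)
  have "orbit_data \<pi> (range rep) m"
    unfolding orbit_data_def
  proof (intro conjI allI ballI impI)
    fix i show "\<exists>j\<in>range rep. \<exists>n. (\<pi> ^^ n) j = i"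
    proof -
      have "(rep i, i) \<in> E" using rep[of i] \<open>equiv UNIV E\<close> by (meson equivE symE)
      then show ?thesis by (auto simp: E_def)
    qed
  next
    fix i j n assume "i \<in> range rep" "j \<in> range rep" "(\<pi> ^^ n) i = j"
    then obtain i' j' where "i = rep i'" "j = rep j'" by auto
    moreover have "(i, j) \<in> E" using \<open>(\<pi> ^^ n) i = j\<close> by (auto simp: E_def)
    ultimately show "i = j" using rep_eq rep by metis
  qed (use m dvd in auto)
  then show thesis by (rule that)
qed

lemma point_label:
  assumes W: "closed_braid \<pi> W" and p: "Re p > 0" "page p (2 * pi * g) \<in> strand_points W"
  shows "\<exists>i. p = W g $ i"
proof -
  obtain s j where sj: "page p (2 * pi * g) = page (W s $ j) (2 * pi * s)"
    using p(2) unfolding strand_points_def by blast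
  then have pe: "p = W s $ j" and "\<exists>k::int. 2 * pi * g = 2 * pi * s + 2 * pi * of_int k"
    using p(1) W by (auto simp: page_eq_iff closed_braid_def)
  then obtain k :: int where "2 * pi * g = 2 * pi * (s + of_int k)" by (auto simp: algebra_simps)
  then have k: "g = s + of_int k" by simp
  have b: "bij (\<pi> ^^ n)" for n using closed_braid_bij[OF W] by (simp add: bij_betw_funpow)
  show ?thesis
  proof (cases "k \<ge> 0")
    case True
    then have "W g $ i = W s $ (\<pi> ^^ nat k) i" for i using closed_braid_shift[OF W, of s "nat k"] k by simp
    then have "W g $ inv (\<pi> ^^ nat k) j = W s $ j" using b by (simp add: surj_f_inv_f bij_is_surj)
    then show ?thesis using pe by metis
  next
    case False
    then have "W s $ j = W g $ (\<pi> ^^ nat (- k)) j" using closed_braid_shift[OF W, of g "nat (- k)"] k by simp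
    then show ?thesis using pe by metis
  qed
qed

text \<open>The label of the strand that passes through a point of a closed braid is locally constant,
  because the strands are disjoint.\<close>

lemma strand_label:
  fixes W :: "real \<Rightarrow> complex ^ 'n::finite"
  assumes W: "closed_braid \<pi> W" and I: "connected I" "I \<noteq> {}"
    and G: "continuous_on I G"
    and c: "continuous_on I (\<lambda>t. page (P t) (2 * pi * G t))"
    and P: "\<And>t. t \<in> I \<Longrightarrow> Re (P t) > 0" "\<And>t. t \<in> I \<Longrightarrow> page (P t) (2 * pi * G t) \<in> strand_points W"
  obtains i where "\<And>t. t \<in> I \<Longrightarrow> P t = W (G t) $ i"
proof -
  have "continuous_on I (\<lambda>t. Complex (cmod (fst (page (P t) (2 * pi * G t)))) (snd (page (P t) (2 * pi * G t))))"
    unfolding Complex_eq by (intro continuous_intros c)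
  then have cP: "continuous_on I P"
    by (rule continuous_on_eq) (simp add: norm_fst_page P(1))
  have cW: "continuous_on I (\<lambda>t. W (G t))"
    by (rule continuous_on_compose2[of UNIV W]) (use W G in \<open>auto simp: closed_braid_def\<close>)
  define T where "T i = {t \<in> I. P t - W (G t) $ i = 0}" for i
  have cl: "closedin (top_of_set I) (T i)" for i
    unfolding T_def by (intro continuous_closedin_preimage_constant continuous_intros cP cW)
  obtain t0 where t0: "t0 \<in> I" using I by blast
  obtain i where i: "P t0 = W (G t0) $ i" using point_label[OF W P(1)[OF t0] P(2)[OF t0]] by blast
  have "I - T i = \<Union> (T ` (- {i}))"
  proof (intro equalityI subsetI)
    fix t assume t: "t \<in> I - T i"
    then obtain j where j: "P t = W (G t) $ j" using point_label[OF W P(1) P(2)] by blast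
    then have "j \<noteq> i" using t by (auto simp: T_def)
    then show "t \<in> \<Union> (T ` (- {i}))" using t j by (auto simp: T_def)
  next
    fix t assume "t \<in> \<Union> (T ` (- {i}))"
    then obtain j where j: "j \<noteq> i" "t \<in> I" "P t = W (G t) $ j" by (auto simp: T_def)
    have "W (G t) $ j \<noteq> W (G t) $ i" using W j(1) unfolding closed_braid_def by blast
    then show "t \<in> I - T i" using j by (simp add: T_def)
  qed
  moreover have "closedin (top_of_set I) (\<Union> (T ` (- {i})))"
    by (intro closedin_Union) (auto simp: cl)
  ultimately have "closedin (top_of_set I) (I - T i)" by simp
  then have "openin (top_of_set I) (T i)"
    using openin_closedin_eq by (metis (no_types, lifting) T_def mem_Collect_eq subsetI topspace_euclidean_subtopology)
  then have "T i = {} \<or> T i = I" using I(1) cl[of i] connected_clopen by blast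
  moreover have "t0 \<in> T i" using t0 i by (simp add: T_def)
  ultimately have "T i = I" by blast
  then show thesis using that[of i] by (auto simp: T_def)
qed

text \<open>The component through the label \<open>i\<close>, with period one if it closes up after \<open>m\<close> turns.\<close>

definition strand_curve :: "(real \<Rightarrow> complex ^ 'n::finite) \<Rightarrow> nat \<Rightarrow> 'n \<Rightarrow> real \<Rightarrow> R3"
  where "strand_curve W m i t = page (W (real m * t) $ i) (2 * pi * (real m * t))"

lemma strand_curve_eq_iff:
  assumes W: "closed_braid \<pi> W"
  shows "page (W s $ i) (2 * pi * s) = page (W s' $ j) (2 * pi * s') \<longleftrightarrow>
     (\<exists>n::nat. s = s' + real n \<and> (\<pi> ^^ n) i = j \<or> s' = s + real n \<and> (\<pi> ^^ n) j = i)"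
proof
  assume "page (W s $ i) (2 * pi * s) = page (W s' $ j) (2 * pi * s')"
  then have e: "W s $ i = W s' $ j" and "\<exists>k::int. 2 * pi * s = 2 * pi * s' + 2 * pi * of_int k"
    using W by (auto simp: page_eq_iff closed_braid_def)
  then obtain k :: int where "2 * pi * s = 2 * pi * (s' + of_int k)" by (auto simp: algebra_simps)
  then have k: "s = s' + of_int k" by simp
  show "\<exists>n::nat. s = s' + real n \<and> (\<pi> ^^ n) i = j \<or> s' = s + real n \<and> (\<pi> ^^ n) j = i"
  proof (cases "k \<ge> 0")
    case True
    then have n: "s = s' + real (nat k)" using k by simp
    then have "W s' $ (\<pi> ^^ nat k) i = W s' $ j" using closed_braid_shift[OF W, of s' "nat k" i] e by simp
    then show ?thesis using W n unfolding closed_braid_def by blast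
  next
    case False
    then have n: "s' = s + real (nat (- k))" using k by simp
    then have "W s $ (\<pi> ^^ nat (- k)) j = W s $ i" using closed_braid_shift[OF W, of s "nat (- k)" j] e by simp
    then show ?thesis using W n unfolding closed_braid_def by blast
  qed
next
  have *: "page (W (s + real n) $ i) (2 * pi * (s + real n)) = page (W s $ (\<pi> ^^ n) i) (2 * pi * s)" for s n i
  proof -
    have "2 * pi * (s + real n) = 2 * pi * s + 2 * pi * of_int (int n)" by (simp add: algebra_simps)
    moreover have "Re (W s' $ j) > 0" for s' j using W by (simp add: closed_braid_def)
    ultimately show ?thesis
      by (subst page_eq_iff) (auto simp only: closed_braid_shift[OF W])
  qed
  assume "\<exists>n::nat. s = s' + real n \<and> (\<pi> ^^ n) i = j \<or> s' = s + real n \<and> (\<pi> ^^ n) j = i"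
  then show "page (W s $ i) (2 * pi * s) = page (W s' $ j) (2 * pi * s')" using * by metis
qed

lemma page_shift:
  assumes W: "closed_braid \<pi> W" and "(\<pi> ^^ n) j = i"
  shows "page (W s $ i) (2 * pi * s) = page (W (s + real n) $ j) (2 * pi * (s + real n))"
  using strand_curve_eq_iff[OF W, of s i "s + real n" j] assms(2) by blast

lemma int_diff_cases:
  fixes a b :: real
  assumes "a - b \<in> \<int>"
  shows "\<exists>n::nat. a = b + real n \<or> b = a + real n"
proof -
  obtain k :: int where k: "a - b = of_int k" using assms by (auto elim: Ints_cases)
  show ?thesis
  proof (cases "k \<ge> 0")
    case True then show ?thesis using k by (intro exI[of _ "nat k"]) simp
  next
    case False then show ?thesis using k by (intro exI[of _ "nat (- k)"]) simp
  qed
qed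

lemma strand_curve_inj:
  assumes W: "closed_braid \<pi> W" and o: "orbit_data \<pi> R m" "i \<in> R"
  shows "strand_curve W (m i) i a = strand_curve W (m i) i b \<longleftrightarrow> a - b \<in> \<int>"
proof -
  have m: "m i > 0" "\<And>n. (\<pi> ^^ n) i = i \<longleftrightarrow> m i dvd n" using o by (auto simp: orbit_data_def)
  have *: "(\<exists>n::nat. real (m i) * a = real (m i) * b + real n \<and> (\<pi> ^^ n) i = i) \<longleftrightarrow> (\<exists>n::nat. a = b + real n)" for a b
  proof
    assume "\<exists>n::nat. real (m i) * a = real (m i) * b + real n \<and> (\<pi> ^^ n) i = i"
    then obtain n k where "real (m i) * a = real (m i) * b + real n" "n = m i * k" using m by blast
    then have "real (m i) * a = real (m i) * (b + real k)" by (simp add: algebra_simps)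
    then show "\<exists>n::nat. a = b + real n" using m(1) by auto
  next
    assume "\<exists>n::nat. a = b + real n"
    then obtain n :: nat where "a = b + real n" by blast
    then show "\<exists>n::nat. real (m i) * a = real (m i) * b + real n \<and> (\<pi> ^^ n) i = i"
      using m by (intro exI[of _ "m i * n"]) (auto simp: algebra_simps)
  qed
  have "strand_curve W (m i) i a = strand_curve W (m i) i b \<longleftrightarrow> (\<exists>n::nat. a = b + real n) \<or> (\<exists>n::nat. b = a + real n)"
    unfolding strand_curve_def strand_curve_eq_iff[OF W] using *[of a b] *[of b a] by blast
  also have "\<dots> \<longleftrightarrow> a - b \<in> \<int>" using int_diff_cases[of a b] by (auto simp: algebra_simps)
  finally show ?thesis .
qed

lemma continuous_strand_curve:
  assumes W: "closed_braid \<pi> W"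
  shows "continuous_on UNIV (strand_curve W m i)"
proof -
  have "continuous_on UNIV (\<lambda>t. W (real m * t))"
    by (rule continuous_on_compose2[of UNIV W]) (use W in \<open>auto simp: closed_braid_def intro!: continuous_intros\<close>)
  then show ?thesis unfolding strand_curve_def page_def cis_conv_exp by (intro continuous_intros)
qed

lemma strand_curve_period:
  assumes "closed_braid \<pi> W" "orbit_data \<pi> R m" "i \<in> R"
  shows "strand_curve W (m i) i (t + 1) = strand_curve W (m i) i t"
  using strand_curve_inj[OF assms, of "t + 1" t] by simp

lemma scc_strand_curve:
  assumes W: "closed_braid \<pi> W" and o: "orbit_data \<pi> R m" "i \<in> R"
    and \<tau>: "reparametrization \<tau>"
  shows "simple_closed_curve (to_S3 \<circ> strand_curve W (m i) i \<circ> \<tau>)"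
proof -
  have c: "continuous_on UNIV \<tau>" and sm: "strict_mono \<tau>" and p: "\<And>t. \<tau> (t + 1) = \<tau> t + 1"
    using \<tau> by (auto simp: reparametrization_def)
  have "continuous_on UNIV (to_S3 \<circ> strand_curve W (m i) i \<circ> \<tau>)"
    unfolding comp_def
    by (intro continuous_on_to_S3 continuous_on_compose2[OF continuous_strand_curve[OF W] c]) auto
  moreover have "inj_on (to_S3 \<circ> strand_curve W (m i) i \<circ> \<tau>) {0..<1}"
  proof (rule inj_onI)
    fix a b :: real assume ab: "a \<in> {0..<1}" "b \<in> {0..<1}"
      "(to_S3 \<circ> strand_curve W (m i) i \<circ> \<tau>) a = (to_S3 \<circ> strand_curve W (m i) i \<circ> \<tau>) b"
    then have "\<tau> a - \<tau> b \<in> \<int>" using strand_curve_inj[OF W o] by simp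
    moreover have "\<tau> a \<ge> \<tau> 0" "\<tau> b \<ge> \<tau> 0" "\<tau> a < \<tau> 1" "\<tau> b < \<tau> 1"
      using ab sm by (auto simp: strict_mono_less_eq strict_mono_less)
    moreover have "\<tau> 1 = \<tau> 0 + 1" using p[of 0] by simp
    ultimately have "\<tau> a = \<tau> b" by (auto elim!: Ints_cases) (smt (verit) of_int_less_1_iff of_int_minus of_int_0_less_iff)+
    then show "a = b" using sm strict_mono_eq by blast
  qed
  moreover have "range (to_S3 \<circ> strand_curve W (m i) i \<circ> \<tau>) \<subseteq> S3"
    by (rule image_subsetI) (simp only: comp_def to_S3_in)
  ultimately show ?thesis
    unfolding simple_closed_curve_def by (simp add: p strand_curve_period[OF W o])
qed

lemma scc_eq_imp_int:
  assumes g: "simple_closed_curve \<gamma>" and e: "\<gamma> a = \<gamma> b"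
  shows "a - b \<in> \<int>"
proof -
  have per: "\<gamma> (t + 1) = \<gamma> t" for t using g by (simp add: simple_closed_curve_def)
  have n: "\<gamma> (t + real n) = \<gamma> t" for t n
  proof (induction n)
    case (Suc n) then show ?case using per[of "t + real n"] by (simp add: ac_simps)
  qed simp
  have fr: "\<gamma> (frac t) = \<gamma> t" for t
  proof -
    have "t - frac t \<in> \<int>" by (simp add: frac_def)
    then obtain k :: nat where "t = frac t + real k \<or> frac t = t + real k" using int_diff_cases by blast
    then show ?thesis using n by metis
  qed
  have "inj_on \<gamma> {0..<1}" using g by (simp add: simple_closed_curve_def)
  moreover have "\<gamma> (frac a) = \<gamma> (frac b)" using e fr by metis
  ultimately have "frac a = frac b"
    by (rule inj_onD) (simp_all add: frac_lt_1)
  then have "a - b = of_int (\<lfloor>a\<rfloor> - \<lfloor>b\<rfloor>)" by (simp add: frac_def)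
  then show ?thesis by (metis Ints_of_int)
qed

lemma orbit_rep:
  assumes "orbit_data \<pi> R m"
  obtains j n where "j \<in> R" "(\<pi> ^^ n) j = i"
  using assms unfolding orbit_data_def by meson

text \<open>A curve of a closed braid stays on the strand of one label, and the number of turns made,
  divided by the length \<open>m\<close> of the orbit, is a reparametrization. For this the curve has to make
  exactly \<open>m\<close> turns per period: the number of turns is a positive multiple of \<open>m\<close> since the
  curve closes up, and it is not larger since the curve is injective on a period.\<close>

theorem braided_eq_space_link:
  fixes W :: "real \<Rightarrow> complex ^ 'n::finite"
  assumes W: "closed_braid \<pi> W" and o: "orbit_data \<pi> R m"
  shows "braided (strand_points W) = space_link ((\<lambda>i. strand_curve W (m i) i) ` R)"
proof (intro equalityI subsetI)
  fix \<gamma> assume g: "\<gamma> \<in> braided (strand_points W)"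
  then have "\<exists>p \<theta>. continuous_on UNIV \<theta> \<and> strict_mono \<theta> \<and>
           (\<forall>t. Re (p t) > 0 \<and> \<gamma> t = to_S3 (page (p t) (\<theta> t)))"
    unfolding braided_def by blast
  then obtain p \<theta> where th: "continuous_on UNIV \<theta>" "strict_mono \<theta>" and p: "\<And>t. Re (p t) > 0"
     and gt: "\<And>t. \<gamma> t = to_S3 (page (p t) (\<theta> t))"
    by blast
  have s: "simple_closed_curve \<gamma>" "range \<gamma> \<subseteq> to_S3 ` strand_points W"
    using g unfolding braided_def by blast+
  define G where "G t = \<theta> t / (2 * pi)" for t
  have \<theta>: "\<theta> t = 2 * pi * G t" for t by (simp add: G_def)
  have cG: "continuous_on UNIV G" unfolding G_def using th by (intro continuous_intros) auto
  have mG: "strict_mono G" using th(2) by (auto simp: strict_mono_def G_def divide_strict_right_mono)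
  have cg: "continuous_on UNIV (\<lambda>t. page (p t) (2 * pi * G t))"
  proof -
    have "continuous_on UNIV \<gamma>" using s by (simp add: simple_closed_curve_def)
    then show ?thesis unfolding gt[abs_def] \<theta> continuous_on_compose_to_S3_iff .
  qed
  have mem: "page (p t) (2 * pi * G t) \<in> strand_points W" for t
  proof -
    have "\<gamma> t \<in> to_S3 ` strand_points W" using s(2) by (rule subsetD) (rule rangeI)
    then show ?thesis unfolding gt \<theta> by (rule imageE) (simp only: to_S3_inj)
  qed
  obtain i where i: "\<And>t. p t = W (G t) $ i"
    using strand_label[OF W connected_UNIV UNIV_not_empty cG cg p mem] by auto
  obtain j n where j: "j \<in> R" "(\<pi> ^^ n) j = i" using orbit_rep[OF o] by metis
  define H where "H t = G t + real n" for t
  have mH: "strict_mono H" using mG by (simp add: H_def strict_mono_def)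
  have cH: "continuous_on UNIV H" unfolding H_def by (intro continuous_intros cG)
  have gH: "\<gamma> t = to_S3 (page (W (H t) $ j) (2 * pi * H t))" for t
    unfolding gt \<theta> i H_def page_shift[OF W j(2)] ..
  have m: "m j > 0" "\<And>n. (\<pi> ^^ n) j = j \<longleftrightarrow> m j dvd n" using o j(1) by (auto simp: orbit_data_def)
  have geq: "\<gamma> t = \<gamma> t' \<longleftrightarrow> H t / m j - H t' / m j \<in> \<int>" for t t'
    using strand_curve_inj[OF W o j(1), of "H t / m j" "H t' / m j"] m(1) by (simp add: gH strand_curve_def)
  \<comment> \<open>a period makes at least \<open>m j\<close> turns since it closes up, and not more by the
    intermediate value theorem and injectivity\<close>
  have per: "H (t + 1) = H t + m j" for t
  proof -
    have "\<gamma> (t + 1) = \<gamma> t" using s(1) by (simp add: simple_closed_curve_def)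
    then have "H (t + 1) / m j - H t / m j \<in> \<int>" unfolding geq .
    then obtain k :: int where k: "H (t + 1) / m j - H t / m j = of_int k" by (auto elim: Ints_cases)
    have "H t < H (t + 1)" using mH by (simp add: strict_mono_less)
    then have "H t / m j < H (t + 1) / m j" using m(1) by (simp add: divide_strict_right_mono)
    then have "of_int k > (0::real)" using k by linarith
    then have "k \<ge> 1" by simp
    then have "of_int k \<ge> (1::real)" by simp
    then have "H (t + 1) / m j \<ge> H t / m j + 1" using k by linarith
    then have "(H t / m j + 1) * m j \<le> H (t + 1) / m j * m j" by (intro mult_right_mono) auto
    then have ge: "H (t + 1) \<ge> H t + m j" using m(1) by (simp add: distrib_right)
    show ?thesis
    proof (rule ccontr)
      assume ne: "H (t + 1) \<noteq> H t + m j"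
      have "H t \<le> H t + m j" by simp
      then obtain t' where t': "t \<le> t'" "t' \<le> t + 1" "H t' = H t + m j"
        using IVT'[of H t "H t + m j" "t + 1"] ge continuous_on_subset[OF cH] by auto
      then have "t' \<noteq> t" "t' \<noteq> t + 1" using ne m(1) by auto
      have "H t' / m j - H t / m j = 1" using t'(3) m(1) by (simp add: field_simps)
      then have "\<gamma> t' = \<gamma> t" unfolding geq by simp
      then have "t' - t \<in> \<int>" by (rule scc_eq_imp_int[OF s(1)])
      then obtain k :: int where k: "t' - t = of_int k" by (auto elim: Ints_cases)
      then have "0 < (of_int k :: real)" "of_int k < (1 :: real)"
        using t' \<open>t' \<noteq> t\<close> \<open>t' \<noteq> t + 1\<close> by linarith+
      then show False by simp
    qed
  qed
  have \<tau>: "reparametrization (\<lambda>t. H t / m j)"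
    unfolding reparametrization_def
  proof (intro conjI allI)
    show "continuous_on UNIV (\<lambda>t. H t / m j)" using m(1) by (intro continuous_intros cH) auto
    show "strict_mono (\<lambda>t. H t / m j)" using mH m(1) by (simp add: strict_mono_def divide_strict_right_mono)
    show "H (t + 1) / m j = H t / m j + 1" for t using m(1) by (simp add: per add_divide_distrib)
  qed
  have "\<gamma> = (to_S3 \<circ> strand_curve W (m j) j) \<circ> (\<lambda>t. H t / m j)"
    using m(1) by (simp add: fun_eq_iff gH strand_curve_def)
  then show "\<gamma> \<in> space_link ((\<lambda>i. strand_curve W (m i) i) ` R)"
    unfolding space_link_def olink_of_def using \<tau> j(1) by blast
next
  fix \<gamma> assume "\<gamma> \<in> space_link ((\<lambda>i. strand_curve W (m i) i) ` R)"
  then obtain i \<tau> where i: "i \<in> R" and \<tau>: "reparametrization \<tau>"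
    and g: "\<gamma> = to_S3 \<circ> strand_curve W (m i) i \<circ> \<tau>"
    unfolding space_link_def olink_of_def by blast
  have m: "m i > 0" using o i by (auto simp: orbit_data_def)
  have "simple_closed_curve \<gamma>" unfolding g by (rule scc_strand_curve[OF W o i \<tau>])
  moreover have "range \<gamma> \<subseteq> to_S3 ` strand_points W"
    unfolding g by (rule image_subsetI) (auto simp: strand_curve_def strand_points_def intro!: imageI)
  moreover have "\<exists>p \<theta>. continuous_on UNIV \<theta> \<and> strict_mono \<theta> \<and>
           (\<forall>t. Re (p t) > 0 \<and> \<gamma> t = to_S3 (page (p t) (\<theta> t)))"
  proof (intro exI[of _ "\<lambda>t. W (real (m i) * \<tau> t) $ i"] exI[of _ "\<lambda>t. 2 * pi * (real (m i) * \<tau> t)"] conjI allI)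
    show "continuous_on UNIV (\<lambda>t. 2 * pi * (real (m i) * \<tau> t))"
      using \<tau> by (intro continuous_intros) (auto simp: reparametrization_def)
    show "strict_mono (\<lambda>t. 2 * pi * (real (m i) * \<tau> t))"
      using \<tau> m by (auto simp: strict_mono_def reparametrization_def)
    show "\<gamma> t = to_S3 (page (W (real (m i) * \<tau> t) $ i) (2 * pi * (real (m i) * \<tau> t)))" for t
      by (simp add: g strand_curve_def)
  qed (use W in \<open>auto simp: closed_braid_def\<close>)
  ultimately show "\<gamma> \<in> braided (strand_points W)" unfolding braided_def by blast
qed

lemma points_braided:
  fixes W :: "real \<Rightarrow> complex ^ 'n::finite"
  assumes W: "closed_braid \<pi> W"
  shows "points (braided (strand_points W)) = to_S3 ` strand_points W"
proof -
  obtain R m where o: "orbit_data \<pi> R m" using exists_orbit_data closed_braid_bij[OF W] by metis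
  have "points (braided (strand_points W)) = (\<Union>i\<in>R. range (to_S3 \<circ> strand_curve W (m i) i))"
    unfolding braided_eq_space_link[OF W o] space_link_def points_olink_of by simp
  also have "\<dots> = to_S3 ` (\<Union>i\<in>R. range (strand_curve W (m i) i))"
    by (simp add: image_UN image_comp)
  also have "(\<Union>i\<in>R. range (strand_curve W (m i) i)) = strand_points W"
  proof (intro equalityI subsetI)
    fix x assume "x \<in> strand_points W"
    then obtain s i where x: "x = page (W s $ i) (2 * pi * s)" unfolding strand_points_def by blast
    obtain j n where j: "j \<in> R" "(\<pi> ^^ n) j = i" using orbit_rep[OF o] by metis
    have "m j > 0" using o j(1) by (auto simp: orbit_data_def)
    then have "x = strand_curve W (m j) j ((s + real n) / m j)"
      unfolding x page_shift[OF W j(2)] by (simp add: strand_curve_def)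
    then show "x \<in> (\<Union>i\<in>R. range (strand_curve W (m i) i))" using j(1) by blast
  qed (auto simp: strand_points_def strand_curve_def)
  finally show ?thesis .
qed

lemma squash_open_disc:
  fixes w w' :: complex
  assumes "(1 / (1 + cmod w)) *\<^sub>R w = (1 / (1 + cmod w')) *\<^sub>R w'"
  shows "w = w'"
proof -
  have p: "1 + cmod w > 0" "1 + cmod w' > 0" by (smt (verit) norm_ge_zero)+
  have "cmod ((1 / (1 + cmod w)) *\<^sub>R w) = cmod ((1 / (1 + cmod w')) *\<^sub>R w')" using assms by simp
  then have "cmod w / (1 + cmod w) = cmod w' / (1 + cmod w')" using p by simp
  then have "cmod w = cmod w'" using p by (simp add: field_simps)
  then show ?thesis using assms p by simp
qed

text \<open>Around each of its points a strand has a tubular neighbourhood with 3-space as its model: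
  \<open>\<sigma>\<close> squeezes the real line into a half turn around the given page, and \<open>\<rho>\<close>
  squeezes the plane into a disc that avoids the other strands. Invariance of domain makes the
  neighbourhood open.\<close>

lemma locally_flat_braided:
  fixes W :: "real \<Rightarrow> complex ^ 'n::finite"
  assumes W: "closed_braid \<pi> W"
  shows "locally_flat (to_S3 ` strand_points W)"
  unfolding locally_flat_def
proof
  fix x assume "x \<in> to_S3 ` strand_points W"
  then obtain s0 i where x: "x = to_S3 (page (W s0 $ i) (2 * pi * s0))"
    unfolding strand_points_def by blast
  have cW: "continuous_on A W" for A using W continuous_on_subset by (auto simp: closed_braid_def)
  let ?K = "{s0 - 1/4..s0 + 1/4}"
  obtain r1 where r1: "r1 > 0" "\<And>j s. s \<in> ?K \<Longrightarrow> r1 \<le> (if j = i then 1 else cmod (W s $ j - W s $ i))"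
  proof (rule compact_uniform_positive[of ?K "\<lambda>j s. if j = i then 1 else cmod (W s $ j - W s $ i)"])
    show "continuous_on ?K (\<lambda>s. if j = i then 1 else cmod (W s $ j - W s $ i))" for j
      by (cases "j = i") (auto intro!: continuous_intros cW)
    show "0 < (if j = i then 1 else cmod (W s $ j - W s $ i))" for j s
      using W by (auto simp: closed_braid_def)
  qed auto
  obtain r2 where r2: "r2 > 0" "\<And>j s. s \<in> ?K \<Longrightarrow> r2 \<le> Re (W s $ j)"
  proof (rule compact_uniform_positive[of ?K "\<lambda>j s. Re (W s $ j)"])
    show "continuous_on ?K (\<lambda>s. Re (W s $ j))" for j by (intro continuous_intros cW)
    show "0 < Re (W s $ j)" for s j using W by (auto simp: closed_braid_def)
  qed auto
  define r where "r = min r1 r2"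
  have r: "r > 0" using r1 r2 by (simp add: r_def)
  define \<sigma> where "\<sigma> u = s0 + arctan u / (2 * pi)" for u
  have \<sigma>K: "\<sigma> u \<in> ?K" and \<sigma>lt: "\<bar>\<sigma> u - s0\<bar> < 1/4" for u
  proof -
    have "\<bar>arctan u\<bar> < pi / 2" using arctan_bounded[of u] by auto
    then show "\<bar>\<sigma> u - s0\<bar> < 1/4" by (simp add: \<sigma>_def field_simps abs_if split: if_splits)
    then have "- (1/4) < \<sigma> u - s0 \<and> \<sigma> u - s0 < 1/4" by linarith
    then show "\<sigma> u \<in> ?K" by simp
  qed
  define \<rho> where "\<rho> w = (r / (1 + cmod w)) *\<^sub>R w" for w :: complex
  have \<rho>: "cmod (\<rho> w) < r" for w
  proof -
    have "1 + cmod w > 0" by (smt (verit) norm_ge_zero)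
    then show ?thesis using r by (simp add: \<rho>_def field_simps)
  qed
  have \<rho>inj: "w = w'" if "\<rho> w = \<rho> w'" for w w'
  proof (rule squash_open_disc)
    have "(1 / r) *\<^sub>R \<rho> w = (1 / r) *\<^sub>R \<rho> w'" using that by simp
    then show "(1 / (1 + cmod w)) *\<^sub>R w = (1 / (1 + cmod w')) *\<^sub>R w'" using r by (simp add: \<rho>_def)
  qed
  have \<rho>0: "\<rho> w = 0 \<longleftrightarrow> w = 0" for w using \<rho>inj[of w 0] by (auto simp: \<rho>_def)
  define f :: "R3 \<Rightarrow> R3" where "f y = page (W (\<sigma> (snd y)) $ i + \<rho> (fst y)) (2 * pi * \<sigma> (snd y))" for y
  have pos: "Re (W (\<sigma> u) $ i + \<rho> w) > 0" for u w
  proof -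
    have "\<bar>Re (\<rho> w)\<bar> < r" using \<rho>[of w] abs_Re_le_cmod[of "\<rho> w"] by linarith
    moreover have "r \<le> Re (W (\<sigma> u) $ i)" using r2(2)[OF \<sigma>K] by (simp add: r_def min.coboundedI2)
    ultimately show ?thesis by simp
  qed
  have key: "page (W (\<sigma> u) $ i + \<rho> w) (2 * pi * \<sigma> u) = page p (2 * pi * \<sigma> u') \<longleftrightarrow> W (\<sigma> u) $ i + \<rho> w = p \<and> u = u'"
    if "Re p > 0" for u u' w p
  proof
    assume "page (W (\<sigma> u) $ i + \<rho> w) (2 * pi * \<sigma> u) = page p (2 * pi * \<sigma> u')"
    then have e: "W (\<sigma> u) $ i + \<rho> w = p" and "\<exists>k::int. 2 * pi * \<sigma> u = 2 * pi * \<sigma> u' + 2 * pi * of_int k"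
      using that pos by (auto simp: page_eq_iff)
    then obtain k :: int where "2 * pi * \<sigma> u = 2 * pi * (\<sigma> u' + of_int k)" by (auto simp: algebra_simps)
    then have k: "\<sigma> u - \<sigma> u' = of_int k" by simp
    then have "\<bar>of_int k :: real\<bar> < 1" using \<sigma>lt[of u] \<sigma>lt[of u'] by linarith
    then have "k = 0" by linarith
    then have "arctan u = arctan u'" using k by (simp add: \<sigma>_def)
    then show "W (\<sigma> u) $ i + \<rho> w = p \<and> u = u'" using e by (metis tan_arctan)
  qed auto
  have injf: "inj f"
  proof (rule injI)
    fix y y' assume "f y = f y'"
    then have "W (\<sigma> (snd y)) $ i + \<rho> (fst y) = W (\<sigma> (snd y')) $ i + \<rho> (fst y') \<and> snd y = snd y'"
      unfolding f_def key[OF pos] .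
    then have "fst y = fst y'" "snd y = snd y'" using \<rho>inj by auto
    then show "y = y'" by (rule prod_eqI)
  qed
  have cf: "continuous_on UNIV f"
  proof -
    have c1: "continuous_on UNIV (\<lambda>y::R3. \<sigma> (snd y))" unfolding \<sigma>_def by (intro continuous_intros) auto
    have c2: "continuous_on UNIV (\<lambda>y::R3. W (\<sigma> (snd y)))"
      by (rule continuous_on_compose2[OF cW c1]) auto
    have c3: "continuous_on UNIV (\<lambda>y::R3. \<rho> (fst y))"
      unfolding \<rho>_def by (intro continuous_intros) (smt (verit) norm_ge_zero)+
    show ?thesis unfolding f_def page_def cis_conv_exp by (intro continuous_intros c1 c2 c3)
  qed
  obtain f' where f': "homeomorphism UNIV (f ` UNIV) f f'"
    using invariance_of_domain_homeomorphism[OF open_UNIV cf _ injf] by auto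
  have of: "open (f ` UNIV)" using invariance_of_domain[OF cf open_UNIV injf] .
  let ?U = "to_S3 ` f ` UNIV"
  have "openin (top_of_set (S3 - {(0,1)})) ?U"
  proof -
    have h: "homeomorphism UNIV (S3 - {(0,1)}) to_S3 from_S3"
      unfolding homeomorphism_def
      by (intro conjI ballI continuous_intros)
         (auto simp: to_from_S3 range_to_S3[symmetric] image_iff intro!: continuous_intros)
    show ?thesis using homeomorphism_imp_open_map[OF h, of "f ` UNIV"] of by simp
  qed
  moreover have "openin (top_of_set S3) (S3 - {(0,1)})"
    using openin_open_Int[of "- {(0,1)}" S3] by (simp add: Diff_eq open_Compl)
  ultimately have oU: "openin (top_of_set S3) ?U" by (rule openin_trans)
  have hom: "homeomorphism ?U UNIV (f' \<circ> from_S3) (to_S3 \<circ> f)"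
  proof -
    have "homeomorphism (f ` UNIV) ?U to_S3 from_S3"
      unfolding homeomorphism_def
      by (intro conjI ballI continuous_intros) (auto simp: image_comp comp_def intro!: continuous_intros)
    from homeomorphism_symD[OF homeomorphism_compose[OF f' this]] show ?thesis .
  qed
  have f'f: "f' (f y) = y" for y using homeomorphism_apply1[OF f'] by simp
  have xU: "x \<in> ?U"
  proof -
    have "f (0, 0) = page (W s0 $ i) (2 * pi * s0)" by (simp add: f_def \<sigma>_def \<rho>_def)
    then have "x = to_S3 (f (0,0))" using x by simp
    then show ?thesis by simp
  qed
  have mem: "f y \<in> strand_points W \<longleftrightarrow> fst y = 0" for y
  proof
    assume "f y \<in> strand_points W"
    then obtain j where j: "W (\<sigma> (snd y)) $ i + \<rho> (fst y) = W (\<sigma> (snd y)) $ j"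
      unfolding f_def using point_label[OF W pos] by blast
    have "j = i"
    proof (rule ccontr)
      assume "j \<noteq> i"
      then have "r \<le> cmod (W (\<sigma> (snd y)) $ j - W (\<sigma> (snd y)) $ i)"
        using r1(2)[OF \<sigma>K[of "snd y"], of j] by (simp add: r_def)
      also have "W (\<sigma> (snd y)) $ j - W (\<sigma> (snd y)) $ i = \<rho> (fst y)" using j by (simp add: algebra_simps)
      finally show False using \<rho>[of "fst y"] by simp
    qed
    then show "fst y = 0" using j \<rho>0 by simp
  next
    assume "fst y = 0"
    then show "f y \<in> strand_points W" by (auto simp: f_def \<rho>_def strand_points_def)
  qed
  have "?U \<inter> to_S3 ` strand_points W = to_S3 ` f ` ({0} \<times> UNIV)"
  proof -
    have "?U \<inter> to_S3 ` strand_points W = to_S3 ` (f ` UNIV \<inter> strand_points W)"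
      using image_Int[OF inj_to_S3] by blast
    also have "f ` UNIV \<inter> strand_points W = f ` ({0} \<times> UNIV)"
    proof (intro equalityI subsetI)
      fix z assume "z \<in> f ` UNIV \<inter> strand_points W"
      then obtain y where y: "z = f y" "f y \<in> strand_points W" by blast
      then have "fst y = 0" using mem by simp
      then have "y \<in> {0} \<times> UNIV" by (cases y) simp
      then show "z \<in> f ` ({0} \<times> UNIV)" using y(1) by blast
    next
      fix z assume "z \<in> f ` ({0} \<times> UNIV)"
      then obtain u where z: "z = f (0, u)" by blast
      then have "z \<in> strand_points W" using mem[of "(0, u)"] by simp
      then show "z \<in> f ` UNIV \<inter> strand_points W" using z by blast
    qed
    finally show ?thesis .
  qed
  then have "(f' \<circ> from_S3) ` (?U \<inter> to_S3 ` strand_points W) = {0} \<times> UNIV"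
    by (simp add: image_image f'f)
  with oU xU hom show "\<exists>U h g. openin (top_of_set S3) U \<and> x \<in> U \<and>
       homeomorphism U (UNIV :: R3 set) h g \<and> h ` (U \<inter> to_S3 ` strand_points W) = {0} \<times> UNIV"
    by blast
qed

theorem link_braided:
  fixes W :: "real \<Rightarrow> complex ^ 'n::finite"
  assumes W: "closed_braid \<pi> W"
  shows "link (braided (strand_points W))"
proof -
  obtain R m where o: "orbit_data \<pi> R m" using exists_orbit_data closed_braid_bij[OF W] by metis
  let ?C = "(\<lambda>i. to_S3 \<circ> strand_curve W (m i) i) ` R"
  have "finite ?C" by simp
  moreover have "?C \<noteq> {}" using orbit_rep[OF o] by blast
  moreover have "\<forall>\<gamma>\<in>?C. simple_closed_curve \<gamma>"
    using scc_strand_curve[OF W o _ reparametrization_id] by (auto simp: comp_def)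
  moreover have "\<forall>\<gamma>\<in>?C. \<forall>\<gamma>'\<in>?C. \<gamma> \<noteq> \<gamma>' \<longrightarrow> range \<gamma> \<inter> range \<gamma>' = {}"
  proof (intro ballI impI)
    fix \<gamma> \<gamma>' assume "\<gamma> \<in> ?C" "\<gamma>' \<in> ?C" and ne: "\<gamma> \<noteq> \<gamma>'"
    then obtain i j where i: "i \<in> R" "\<gamma> = to_S3 \<circ> strand_curve W (m i) i" and j: "j \<in> R" "\<gamma>' = to_S3 \<circ> strand_curve W (m j) j"
      by blast
    have no: False if "\<gamma> a = \<gamma>' b" for a b
    proof -
      have "strand_curve W (m i) i a = strand_curve W (m j) j b" using that i(2) j(2) by simp
      then have "\<exists>n. (\<pi> ^^ n) i = j \<or> (\<pi> ^^ n) j = i"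
        unfolding strand_curve_def strand_curve_eq_iff[OF W] by blast
      then have "i = j" using o i(1) j(1) unfolding orbit_data_def by metis
      then show False using ne i(2) j(2) by simp
    qed
    show "range \<gamma> \<inter> range \<gamma>' = {}"
    proof (rule equals0I)
      fix y assume y: "y \<in> range \<gamma> \<inter> range \<gamma>'"
      then obtain a where "y = \<gamma> a" by (meson IntE rangeE)
      moreover obtain b where "y = \<gamma>' b" using y by (meson IntE rangeE)
      ultimately show False using no[of a b] by simp
    qed
  qed
  moreover have "braided (strand_points W) = olink_of ?C"
    unfolding braided_eq_space_link[OF W o] space_link_def by (simp add: image_image)
  moreover have "locally_flat (points (braided (strand_points W)))"
    unfolding points_braided[OF W] by (rule locally_flat_braided[OF W])
  ultimately show ?thesis unfolding link_def by blast
qed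

section \<open>Arcs of a closed braid\<close>

lemma reparametrization_extend:
  assumes c: "continuous_on {0..1} h" and sm: "strict_mono_on {0..1} h" and e: "h 1 = h 0 + 1"
  shows "reparametrization (\<lambda>t. h (frac t) + of_int \<lfloor>t\<rfloor>)" (is "reparametrization ?\<tau>")
proof -
  have on: "?\<tau> t = h (t - of_int n) + of_int n" if "t \<in> {of_int n..of_int n + 1}" for t and n :: int
  proof (cases "t = of_int n + 1")
    case True
    have "\<lfloor>t\<rfloor> = n + 1" "t - of_int n = 1" unfolding True by simp_all
    moreover from this have "frac t = 0" unfolding frac_def using True by simp
    ultimately show ?thesis using e by (simp del: frac_eq_0_iff)
  next
    case False
    then have "\<lfloor>t\<rfloor> = n" using that by (simp add: floor_eq_iff)
    then show ?thesis by (simp add: frac_def)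
  qed
  have "continuous_on UNIV ?\<tau>"
  proof (rule continuous_on_glue_unit_intervals_real)
    fix n :: int
    have "continuous_on {of_int n..of_int n + 1} (\<lambda>t. h (t - of_int n) + of_int n)"
      by (intro continuous_intros continuous_on_compose2[OF c]) auto
    then show "continuous_on {of_int n..of_int n + 1} ?\<tau>"
      by (rule continuous_on_eq) (use on in auto)
  qed
  moreover have "strict_mono ?\<tau>"
  proof (rule strict_monoI)
    fix a b :: real assume ab: "a < b"
    have lt: "h x < h y" if "x \<in> {0..1}" "y \<in> {0..1}" "x < y" for x y
      using sm that by (auto simp: strict_mono_on_def)
    have fr: "frac x \<in> {0..1}" "frac x < 1" for x :: real by (simp_all add: less_imp_le frac_lt_1)
    show "?\<tau> a < ?\<tau> b"
    proof (cases "\<lfloor>a\<rfloor> = \<lfloor>b\<rfloor>")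
      case True
      then have "frac a < frac b" using ab by (simp add: frac_def)
      then show ?thesis using lt fr True by simp
    next
      case False
      then have "\<lfloor>a\<rfloor> + 1 \<le> \<lfloor>b\<rfloor>" using ab floor_mono[of a b] by simp
      then have "of_int \<lfloor>a\<rfloor> + 1 \<le> (of_int \<lfloor>b\<rfloor> :: real)" by linarith
      moreover have "h (frac a) < h 1" using lt fr by simp
      moreover have "h 0 \<le> h (frac b)"
      proof (cases "0 < frac b")
        case True then show ?thesis using lt[of 0 "frac b"] fr by (simp add: less_imp_le)
      next
        case False
        then have "frac b = 0" using frac_ge_0[of b] by linarith
        then show ?thesis by (simp del: frac_eq_0_iff)
      qed
      ultimately show ?thesis using e by linarith
    qed
  qed
  moreover have "?\<tau> (t + 1) = ?\<tau> t + 1" for t by (simp add: frac_def)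
  ultimately show ?thesis by (simp add: reparametrization_def)
qed

text \<open>By this criterion an arc depends on the closed braid only through the set of its points;
  so an arc can be transferred to another closed braid that contains the same points. For the
  converse the arc is completed to a closed curve: being injective it makes less than a full
  period, and the rest of its component is traversed linearly in the second half of the unit
  interval.\<close>

theorem runs_along_braided_iff:
  fixes W :: "real \<Rightarrow> complex ^ 'n::finite"
  assumes W: "closed_braid \<pi> W"
  shows "runs_along (braided (strand_points W)) q \<longleftrightarrow>
    inj_on q {0..1} \<and> continuous_on {0..1} q \<and>
    (\<exists>P G. continuous_on {0..1} G \<and> strict_mono_on {0..1} G \<and>
       (\<forall>s\<in>{0..1}. Re (P s) > 0 \<and> page (P s) (2 * pi * G s) \<in> strand_points W \<and>
          q s = to_S3 (page (P s) (2 * pi * G s))))"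
    (is "?lhs \<longleftrightarrow> ?rhs")
proof
  assume ?lhs
  then obtain \<gamma> where g: "\<gamma> \<in> braided (strand_points W)" "\<And>s. s \<in> {0..1} \<Longrightarrow> q s = \<gamma> (s / 2)"
    unfolding runs_along_def by blast
  then have "\<exists>p \<theta>. continuous_on UNIV \<theta> \<and> strict_mono \<theta> \<and>
           (\<forall>t. Re (p t) > 0 \<and> \<gamma> t = to_S3 (page (p t) (\<theta> t)))"
    unfolding braided_def by blast
  then obtain p \<theta> where th: "continuous_on UNIV \<theta>" "strict_mono \<theta>" and p: "\<And>t. Re (p t) > 0"
     and gt: "\<And>t. \<gamma> t = to_S3 (page (p t) (\<theta> t))"
    by blast
  have s: "simple_closed_curve \<gamma>" "range \<gamma> \<subseteq> to_S3 ` strand_points W"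
    using g unfolding braided_def by blast+
  have mem: "page (p t) (\<theta> t) \<in> strand_points W" for t
  proof -
    have "\<gamma> t \<in> to_S3 ` strand_points W" using s(2) by (rule subsetD) (rule rangeI)
    then show ?thesis unfolding gt by (rule imageE) (simp only: to_S3_inj)
  qed
  have "inj_on q {0..1}"
  proof (rule inj_onI)
    fix x y :: real assume xy: "x \<in> {0..1}" "y \<in> {0..1}" "q x = q y"
    then have "\<gamma> (x / 2) = \<gamma> (y / 2)" by (simp add: g(2))
    then have "x / 2 - y / 2 \<in> \<int>" by (rule scc_eq_imp_int[OF s(1)])
    then obtain k :: int where k: "x / 2 - y / 2 = of_int k" by (auto elim: Ints_cases)
    then have "\<bar>of_int k :: real\<bar> < 1" using xy by auto
    then have "k = 0" by linarith
    then show "x = y" using k by simp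
  qed
  moreover have "continuous_on {0..1} q"
  proof -
    have "continuous_on UNIV \<gamma>" using s by (simp add: simple_closed_curve_def)
    then have "continuous_on {0..1} (\<lambda>s::real. \<gamma> (s / 2))"
      by (rule continuous_on_compose2) (auto intro!: continuous_intros)
    then show ?thesis by (rule continuous_on_eq) (simp add: g(2))
  qed
  moreover have "\<exists>P G. continuous_on {0..1} G \<and> strict_mono_on {0..1} G \<and>
       (\<forall>s\<in>{0..1}. Re (P s) > 0 \<and> page (P s) (2 * pi * G s) \<in> strand_points W \<and>
          q s = to_S3 (page (P s) (2 * pi * G s)))"
  proof (intro exI[of _ "\<lambda>s. p (s / 2)"] exI[of _ "\<lambda>s. \<theta> (s / 2) / (2 * pi)"] conjI ballI)
    show "continuous_on {0..1} (\<lambda>s. \<theta> (s / 2) / (2 * pi))"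
      by (intro continuous_intros continuous_on_compose2[OF th(1)]) auto
    show "strict_mono_on {0..1} (\<lambda>s. \<theta> (s / 2) / (2 * pi))"
      using th(2) by (auto simp: strict_mono_on_def strict_mono_def divide_strict_right_mono)
  qed (use p mem g(2) gt in auto)
  ultimately show ?rhs by blast
next
  assume ?rhs
  then obtain P G where q: "inj_on q {0..1}" "continuous_on {0..1} q"
    and G: "continuous_on {0..1} G" "strict_mono_on {0..1} G"
    and P: "\<And>s. s \<in> {0..1} \<Longrightarrow> Re (P s) > 0" "\<And>s. s \<in> {0..1} \<Longrightarrow> page (P s) (2 * pi * G s) \<in> strand_points W"
      "\<And>s. s \<in> {0..1} \<Longrightarrow> q s = to_S3 (page (P s) (2 * pi * G s))"
    by blast
  obtain R m where o: "orbit_data \<pi> R m" using exists_orbit_data closed_braid_bij[OF W] by metis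
  have "continuous_on {0..1} (\<lambda>s. to_S3 (page (P s) (2 * pi * G s)))"
    using q(2) by (rule continuous_on_eq) (simp add: P(3))
  then have cp: "continuous_on {0..1} (\<lambda>s. page (P s) (2 * pi * G s))"
    unfolding continuous_on_compose_to_S3_iff .
  obtain i where i: "\<And>s. s \<in> {0..1} \<Longrightarrow> P s = W (G s) $ i"
    using strand_label[OF W _ _ G(1) cp P(1,2)] by (metis atLeastAtMost_iff connected_Icc empty_iff
        le_numeral_extra(3) zero_le_one)
  obtain j n where j: "j \<in> R" "(\<pi> ^^ n) j = i" using orbit_rep[OF o] by metis
  have m: "m j > 0" using o j(1) by (auto simp: orbit_data_def)
  define H where "H s = (G s + real n) / m j" for s
  have qH: "q s = to_S3 (strand_curve W (m j) j (H s))" if "s \<in> {0..1}" for s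
    unfolding P(3)[OF that] i[OF that] page_shift[OF W j(2)] using m by (simp add: strand_curve_def H_def)
  have cH: "continuous_on {0..1} H" unfolding H_def using m by (intro continuous_intros G) auto
  have mH: "H x < H y" if "x \<in> {0..1}" "y \<in> {0..1}" "x < y" for x y
    using G(2) that m by (auto simp: H_def strict_mono_on_def divide_strict_right_mono)
  have H1: "H 1 < H 0 + 1"
  proof (rule ccontr)
    assume "\<not> H 1 < H 0 + 1"
    then obtain x where x: "0 \<le> x" "x \<le> 1" "H x = H 0 + 1"
      using IVT'[of H 0 "H 0 + 1" 1] cH by auto
    then have "strand_curve W (m j) j (H x) = strand_curve W (m j) j (H 0)"
      using strand_curve_inj[OF W o j(1)] by simp
    then have "q x = q 0" using qH x by simp
    then have "x = 0" using q(1) x by (auto simp: inj_on_def)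
    then show False using x by simp
  qed
  define h where "h x = (if x \<le> 1/2 then H (2 * x) else H 1 + (2 * x - 1) * (H 0 + 1 - H 1))" for x
  have ch: "continuous_on {0..1} h"
  proof -
    have "continuous_on ({0..1/2} \<union> {1/2..1}) h"
      unfolding h_def
    proof (rule continuous_on_cases)
      show "continuous_on {0..1/2} (\<lambda>x. H (2 * x))"
        by (rule continuous_on_compose2[OF cH]) (auto intro!: continuous_intros)
      have e: "H (2 * x) = H 1 + (2 * x - 1) * (H 0 + 1 - H 1)" if "2 * x = 1" for x
        unfolding that by simp
      have "2 * x = 1" if "x \<in> {0..1/2} \<and> \<not> x \<le> 1/2 \<or> x \<in> {1/2..1} \<and> x \<le> 1/2" for x :: real
        using that by auto
      then show "\<forall>x. x \<in> {0..1/2} \<and> \<not> x \<le> 1/2 \<or> x \<in> {1/2..1} \<and> x \<le> 1/2 \<longrightarrow>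
          H (2 * x) = H 1 + (2 * x - 1) * (H 0 + 1 - H 1)" using e by blast
    qed (auto intro!: continuous_intros)
    moreover have "{0..1/2} \<union> {1/2..1} = {0..1::real}" by auto
    ultimately show ?thesis by simp
  qed
  have mh: "strict_mono_on {0..1} h"
  proof (rule strict_mono_onI)
    fix x y :: real assume xy: "x \<in> {0..1}" "y \<in> {0..1}" "x < y"
    consider "y \<le> 1/2" | "x \<le> 1/2" "y > 1/2" | "x > 1/2" by linarith
    then show "h x < h y"
    proof cases
      case 1 then show ?thesis using xy mH[of "2 * x" "2 * y"] by (simp add: h_def)
    next
      case 2
      have "H (2 * x) \<le> H 1" using mH[of "2 * x" 1] 2 xy by (cases "2 * x = 1") (auto simp: less_le)
      moreover have "0 < (2 * y - 1) * (H 0 + 1 - H 1)" using 2 H1 by simp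
      ultimately show ?thesis using 2 by (simp add: h_def)
    next
      case 3
      then have "(2 * x - 1) * (H 0 + 1 - H 1) < (2 * y - 1) * (H 0 + 1 - H 1)"
        using xy H1 by (intro mult_strict_right_mono) auto
      then show ?thesis using 3 xy by (simp add: h_def)
    qed
  qed
  have h1: "h 1 = h 0 + 1" by (simp add: h_def)
  let ?\<tau> = "\<lambda>t. h (frac t) + of_int \<lfloor>t\<rfloor>"
  have \<tau>: "reparametrization ?\<tau>" using reparametrization_extend[OF ch mh h1] .
  let ?\<gamma> = "(to_S3 \<circ> strand_curve W (m j) j) \<circ> ?\<tau>"
  have "?\<gamma> \<in> braided (strand_points W)"
    unfolding braided_eq_space_link[OF W o] space_link_def olink_of_def using \<tau> j(1) by blast
  moreover have "q s = ?\<gamma> (s / 2)" if s: "s \<in> {0..1}" for s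
  proof -
    have "\<lfloor>s / 2\<rfloor> = 0" using s by (simp add: floor_eq_iff)
    then have "?\<tau> (s / 2) = H s" using s by (simp add: frac_def h_def)
    then show ?thesis using qH[OF s] by simp
  qed
  ultimately show ?lhs unfolding runs_along_def by blast
qed


section \<open>Configurations of three points and braid words\<close>

text \<open>Configurations of three labelled points of the right half-plane. Paths in this space up to
  homotopy are braids on three strands.\<close>

definition config :: "(complex ^ 3) set"
  where "config = {p. p $ 1 \<noteq> p $ 2 \<and> p $ 1 \<noteq> p $ 3 \<and> p $ 2 \<noteq> p $ 3 \<and> Re (p $ 1) > 0 \<and> Re (p $ 2) > 0 \<and> Re (p $ 3) > 0}"

definition relabel :: "('n \<Rightarrow> 'n) \<Rightarrow> complex ^ 'n \<Rightarrow> complex ^ 'n"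
  where "relabel \<sigma> p = (\<chi> i. p $ \<sigma> i)"

lemma relabel_nth [simp]: "relabel \<sigma> p $ i = p $ \<sigma> i"
  by (simp add: relabel_def)

lemma config_iff: "p \<in> config \<longleftrightarrow> inj (\<lambda>i. p $ i) \<and> (\<forall>i. Re (p $ i) > 0)"
proof -
  have "inj (\<lambda>i. p $ i) \<longleftrightarrow> (\<forall>i j::3. p $ i = p $ j \<longrightarrow> i = j)" by (auto simp: inj_def)
  then show ?thesis by (auto simp: config_def forall_3)
qed

lemma config_relabel: "bij \<sigma> \<Longrightarrow> p \<in> config \<Longrightarrow> relabel \<sigma> p \<in> config"
  unfolding config_iff by (auto simp: inj_def bij_def)

definition std :: "complex ^ 3"
  where "std = vector [1, 2, 3]"

lemma std_nth [simp]: "std $ 1 = 1" "std $ 2 = 2" "std $ 3 = 3"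
  by (simp_all add: std_def)

definition standard :: "complex ^ 3 \<Rightarrow> bool"
  where "standard p \<longleftrightarrow> (\<exists>\<sigma>. bij \<sigma> \<and> p = relabel \<sigma> std)"

lemma standard_std: "standard std"
  unfolding standard_def by (intro exI[of _ id]) (simp add: vec_eq_iff)

lemma standard_config: "standard p \<Longrightarrow> p \<in> config"
proof -
  have "std \<in> config" by (simp add: config_def)
  then show "standard p \<Longrightarrow> p \<in> config" by (auto simp: standard_def config_relabel)
qed

lemma standard_positions: "standard p \<Longrightarrow> range (\<lambda>i. p $ i) = {1, 2, 3}"
proof -
  assume "standard p"
  then obtain \<sigma> where s: "bij \<sigma>" "p = relabel \<sigma> std" by (auto simp: standard_def)
  have "range (\<lambda>i. p $ i) = (\<lambda>i. std $ i) ` range \<sigma>" by (auto simp: s(2))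
  also have "range \<sigma> = {1, 2, 3}" using bij_is_surj[OF s(1)] UNIV_3 by metis
  finally show ?thesis by simp
qed

lemma relabel_relabel: "relabel \<sigma> (relabel \<tau> p) = relabel (\<tau> \<circ> \<sigma>) p"
  by (simp add: vec_eq_iff)

lemma standard_relabel: "bij \<sigma> \<Longrightarrow> standard p \<Longrightarrow> standard (relabel \<sigma> p)"
  unfolding standard_def by (metis bij_comp relabel_relabel)

text \<open>The function \<open>slice\<close> only records the set of the positions at each time; here the point that starts
  at \<open>x\<close> is followed while a letter is read.\<close>

definition motion :: "int \<Rightarrow> real \<Rightarrow> complex \<Rightarrow> complex"
  where "motion k s x =
    (if k \<noteq> 0 \<and> x = of_nat (nat \<bar>k\<bar>) then of_nat (nat \<bar>k\<bar>) + 1/2 - cis (- of_int (sgn k) * pi * s) / 2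
     else if k \<noteq> 0 \<and> x = of_nat (nat \<bar>k\<bar>) + 1 then of_nat (nat \<bar>k\<bar>) + 1/2 + cis (- of_int (sgn k) * pi * s) / 2
     else x)"

definition letter :: "int \<Rightarrow> bool"
  where "letter k \<longleftrightarrow> k = 0 \<or> k = 1 \<or> k = 2 \<or> k = -1 \<or> k = -2"

lemma motion_simps [simp]:
  "motion 0 s x = x"
  "motion 1 s 1 = 3/2 - cis (- (pi * s)) / 2" "motion 1 s 2 = 3/2 + cis (- (pi * s)) / 2" "motion 1 s 3 = 3"
  "motion (-1) s 1 = 3/2 - cis (pi * s) / 2" "motion (-1) s 2 = 3/2 + cis (pi * s) / 2" "motion (-1) s 3 = 3"
  "motion 2 s 1 = 1" "motion 2 s 2 = 5/2 - cis (- (pi * s)) / 2" "motion 2 s 3 = 5/2 + cis (- (pi * s)) / 2"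
  "motion (-2) s 1 = 1" "motion (-2) s 2 = 5/2 - cis (pi * s) / 2" "motion (-2) s 3 = 5/2 + cis (pi * s) / 2"
  by (simp_all add: motion_def)

lemma continuous_motion: "continuous_on A (\<lambda>s. motion k s x)"
proof -
  have c: "continuous_on A (\<lambda>s. cis (- of_int (sgn k) * pi * s))"
    unfolding cis_conv_exp by (intro continuous_intros)
  show ?thesis
    by (cases "k \<noteq> 0 \<and> x = of_nat (nat \<bar>k\<bar>)"; cases "k \<noteq> 0 \<and> x = of_nat (nat \<bar>k\<bar>) + 1")
      (auto simp: motion_def intro!: continuous_intros c)
qed

definition lpath :: "int \<Rightarrow> complex ^ 3 \<Rightarrow> real \<Rightarrow> complex ^ 3"
  where "lpath k p s = (\<chi> i. motion k s (p $ i))"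

lemma lpath_nth [simp]: "lpath k p s $ i = motion k s (p $ i)"
  by (simp add: lpath_def)

lemma lpath_relabel: "lpath k (relabel \<sigma> p) s = relabel \<sigma> (lpath k p s)"
  by (simp add: vec_eq_iff)

lemma continuous_lpath: "continuous_on A (lpath k p)"
  unfolding lpath_def by (intro continuous_intros continuous_motion)

lemma path_lpath: "path (lpath k p)"
  by (simp add: path_def continuous_lpath)

lemma lpath_std_config: "letter k \<Longrightarrow> lpath k std s \<in> config"
proof -
  have a: "3 / 2 + z / 2 \<noteq> 3 / 2 - z / 2" "5 / 2 + z / 2 \<noteq> 5 / 2 - z / 2" if "z \<noteq> 0" for z :: complex
    using that by (auto simp: field_simps)
  have b: "Re (3/2 + cis x / 2) \<in> {1..2}" "Re (3/2 - cis x / 2) \<in> {1..2}"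
      "Re (5/2 + cis x / 2) \<in> {2..3}" "Re (5/2 - cis x / 2) \<in> {2..3}" for x
  proof -
    have "-1 \<le> cos x" "cos x \<le> 1" by simp_all
    then show "Re (3/2 + cis x / 2) \<in> {1..2}" "Re (3/2 - cis x / 2) \<in> {1..2}"
      "Re (5/2 + cis x / 2) \<in> {2..3}" "Re (5/2 - cis x / 2) \<in> {2..3}"
      by (simp_all add: field_simps, linarith+)
  qed
  have c: "3/2 + cis x / 2 \<noteq> 3" "3/2 - cis x / 2 \<noteq> 3" "1 \<noteq> 5/2 + cis x / 2" "1 \<noteq> 5/2 - cis x / 2" for x
    using b[of x] by force+
  have d: "0 < 3 / 2 + cos x / 2" "cos x < 3" "0 < 5 / 2 + cos x / 2" "cos x < 5" for x :: real
  proof -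
    have "-1 \<le> cos x" "cos x \<le> 1" by simp_all
    then show "0 < 3 / 2 + cos x / 2" "cos x < 3" "0 < 5 / 2 + cos x / 2" "cos x < 5" by linarith+
  qed
  show "letter k \<Longrightarrow> lpath k std s \<in> config"
    unfolding letter_def config_def using a[of "cis (pi * s)"] a[of "cis (- (pi * s))"] c d by auto
qed

lemma lpath_config: "letter k \<Longrightarrow> standard p \<Longrightarrow> lpath k p s \<in> config"
  by (auto simp: standard_def lpath_relabel intro!: config_relabel lpath_std_config)

lemma lpath_0 [simp]: "letter k \<Longrightarrow> standard p \<Longrightarrow> lpath k p 0 = p"
proof -
  have "letter k \<Longrightarrow> lpath k std 0 = std" by (auto simp: letter_def vec_eq_iff forall_3)
  then show "letter k \<Longrightarrow> standard p \<Longrightarrow> lpath k p 0 = p" by (auto simp: standard_def lpath_relabel)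
qed

definition swap3 :: "int \<Rightarrow> 3 \<Rightarrow> 3"
  where "swap3 k = (if \<bar>k\<bar> = 1 then Transposition.transpose 1 2 else if \<bar>k\<bar> = 2 then Transposition.transpose 2 3 else id)"

lemma bij_swap3: "bij (swap3 k)"
  by (simp add: swap3_def)

lemma lpath_std_1: "letter k \<Longrightarrow> lpath k std 1 = relabel (swap3 k) std"
  by (auto simp: letter_def vec_eq_iff forall_3 swap3_def Transposition.transpose_def cis_minus_pi_half complex_eq_iff)

lemma standard_lpath_1: "letter k \<Longrightarrow> standard p \<Longrightarrow> standard (lpath k p 1)"
  by (auto simp: standard_def[of p] lpath_relabel lpath_std_1 intro!: standard_relabel bij_swap3 standard_std)

lemma lpath_uminus: "letter k \<Longrightarrow> standard p \<Longrightarrow> lpath (- k) (lpath k p 1) s = lpath k p (1 - s)"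
proof -
  have e: "cis (pi * (1 - s)) = - cis (- (pi * s))" "cis (- (pi * (1 - s))) = - cis (pi * s)"
    by (simp_all add: right_diff_distrib complex_eq_iff cos_diff sin_diff)
  assume k: "letter k" "standard p"
  then obtain \<sigma> where s: "bij \<sigma>" "p = relabel \<sigma> std" by (auto simp: standard_def)
  have "lpath (- k) (relabel (swap3 k) std) s = lpath k std (1 - s)"
    using k(1) by (auto simp: letter_def vec_eq_iff forall_3 swap3_def Transposition.transpose_def e)
  then show ?thesis using k(1) by (simp add: s(2) lpath_relabel lpath_std_1)
qed

definition word :: "int list \<Rightarrow> bool"
  where "word u \<longleftrightarrow> (\<forall>k\<in>set u. letter k)"

lemma word_simps [simp]: "word []" "word (k # u) \<longleftrightarrow> letter k \<and> word u" "word (u @ v) \<longleftrightarrow> word u \<and> word v"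
  by (auto simp: word_def)

lemma letter_uminus [simp]: "letter (- k) \<longleftrightarrow> letter k"
  by (auto simp: letter_def)

lemma braid_word_word: "braid_word 3 w \<Longrightarrow> word w"
  by (auto simp: braid_word_def word_def letter_def)

text \<open>The constant path at the end represents the empty word; because of it, words compose like
  paths only up to homotopy.\<close>

fun wpath :: "int list \<Rightarrow> complex ^ 3 \<Rightarrow> real \<Rightarrow> complex ^ 3" where
  "wpath [] p = linepath p p"
| "wpath (k # u) p = lpath k p +++ wpath u (lpath k p 1)"

fun wend :: "int list \<Rightarrow> complex ^ 3 \<Rightarrow> complex ^ 3" where
  "wend [] p = p"
| "wend (k # u) p = wend u (lpath k p 1)"

lemma standard_wend: "word u \<Longrightarrow> standard p \<Longrightarrow> standard (wend u p)"
  by (induction u arbitrary: p) (auto simp: standard_lpath_1)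

lemma wpath_basic:
  "word u \<Longrightarrow> standard p \<Longrightarrow> pathstart (wpath u p) = p \<and> pathfinish (wpath u p) = wend u p \<and>
    path (wpath u p) \<and> path_image (wpath u p) \<subseteq> config"
proof (induction u arbitrary: p)
  case Nil then show ?case
    by (auto simp: standard_config pathstart_def pathfinish_def path_def path_image_def)
next
  case (Cons k u)
  have s: "pathstart (lpath k p) = p" "pathfinish (lpath k p) = lpath k p 1"
    using Cons.prems by (auto simp: pathstart_def pathfinish_def)
  have "path_image (lpath k p) \<subseteq> config" using Cons.prems lpath_config by (auto simp: path_image_def)
  moreover have "standard (lpath k p 1)" using Cons.prems standard_lpath_1 by simp
  ultimately show ?case
    using Cons.IH[of "lpath k p 1"] Cons.prems path_lpath[of k p] s
    by (auto simp: path_image_join)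
qed

lemmas wpath_start [simp] = wpath_basic[THEN conjunct1]
lemmas wpath_finish [simp] = wpath_basic[THEN conjunct2, THEN conjunct1]
lemmas path_wpath [simp] = wpath_basic[THEN conjunct2, THEN conjunct2, THEN conjunct1]
lemmas wpath_config [simp] = wpath_basic[THEN conjunct2, THEN conjunct2, THEN conjunct2]

lemma wpath_relabel: "wpath u (relabel \<sigma> p) = relabel \<sigma> \<circ> wpath u p"
proof (induction u arbitrary: p)
  case Nil show ?case by (simp add: fun_eq_iff vec_eq_iff linepath_def)
next
  case (Cons k u)
  have "lpath k (relabel \<sigma> p) = relabel \<sigma> \<circ> lpath k p" by (simp add: fun_eq_iff lpath_relabel)
  then show ?case using Cons[of "lpath k p 1"] by (simp add: lpath_relabel joinpaths_def fun_eq_iff)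
qed

lemma wpath_append:
  assumes "word u" "word v" "standard p"
  shows "homotopic_paths config (wpath (u @ v) p) (wpath u p +++ wpath v (wend u p))"
  using assms
proof (induction u arbitrary: p)
  case Nil
  have "homotopic_paths config (linepath (pathstart (wpath v p)) (pathstart (wpath v p)) +++ wpath v p) (wpath v p)"
    using Nil by (intro homotopic_paths_lid) auto
  then show ?case using Nil by (simp add: homotopic_paths_sym linepath_refl)
next
  case (Cons k u)
  let ?p = "lpath k p 1"
  have s: "standard ?p" using Cons.prems by (simp add: standard_lpath_1)
  have l: "path (lpath k p)" "path_image (lpath k p) \<subseteq> config" "pathfinish (lpath k p) = ?p" "pathstart (lpath k p) = p"
    using Cons.prems lpath_config path_lpath by (auto simp: path_image_def pathfinish_def pathstart_def)
  have "homotopic_paths config (wpath (u @ v) ?p) (wpath u ?p +++ wpath v (wend u ?p))"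
    using Cons s by simp
  then have "homotopic_paths config (lpath k p +++ wpath (u @ v) ?p) (lpath k p +++ (wpath u ?p +++ wpath v (wend u ?p)))"
    using l Cons.prems s by (intro homotopic_paths_join) (auto simp: homotopic_paths_refl)
  also have "homotopic_paths config (lpath k p +++ (wpath u ?p +++ wpath v (wend u ?p))) ((lpath k p +++ wpath u ?p) +++ wpath v (wend u ?p))"
    using l Cons.prems s standard_wend by (intro homotopic_paths_assoc) auto
  finally show ?case by simp
qed

text \<open>The homotopy is required for every labelling of the standard positions, so that the
  relation can be used in the middle of a word.\<close>

definition weq :: "int list \<Rightarrow> int list \<Rightarrow> bool"
  where "weq u v \<longleftrightarrow> (\<forall>p. standard p \<longrightarrow> homotopic_paths config (wpath u p) (wpath v p))"

lemma weq_std: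
  assumes "homotopic_paths config (wpath u std) (wpath v std)"
  shows "weq u v"
  unfolding weq_def
proof (intro allI impI)
  fix p assume "standard p"
  then obtain \<sigma> where s: "bij \<sigma>" "p = relabel \<sigma> std" by (auto simp: standard_def)
  have "continuous_on config (relabel \<sigma>)" unfolding relabel_def by (intro continuous_intros)
  moreover have "relabel \<sigma> \<in> config \<rightarrow> config" using s(1) config_relabel by auto
  ultimately show "homotopic_paths config (wpath u p) (wpath v p)"
    unfolding s(2) wpath_relabel by (intro homotopic_paths_continuous_image[OF assms])
qed

lemma weq_context:
  assumes e: "weq u v" and w: "word a" "word u" "word v" "word b"
  shows "weq (a @ u @ b) (a @ v @ b)"
  unfolding weq_def
proof (intro allI impI)
  fix p assume p: "standard p"
  let ?q = "wend a p"
  have q: "standard ?q" using standard_wend w p by blast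
  have h: "homotopic_paths config (wpath u ?q) (wpath v ?q)" using e q by (simp add: weq_def)
  have fin: "wend u ?q = wend v ?q"
    using homotopic_paths_imp_pathfinish[OF h] w q by simp
  have sv: "standard (wend v ?q)" using standard_wend w q by blast
  have "homotopic_paths config (wpath u ?q +++ wpath b (wend u ?q)) (wpath v ?q +++ wpath b (wend v ?q))"
    using h w q fin sv by (intro homotopic_paths_join) (auto simp: homotopic_paths_refl)
  then have "homotopic_paths config (wpath (u @ b) ?q) (wpath (v @ b) ?q)"
    using wpath_append[of u b ?q] wpath_append[of v b ?q] w q by (meson homotopic_paths_sym homotopic_paths_trans)
  then have "homotopic_paths config (wpath a p +++ wpath (u @ b) ?q) (wpath a p +++ wpath (v @ b) ?q)"
    using w p q by (intro homotopic_paths_join) (auto simp: homotopic_paths_refl)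
  then show "homotopic_paths config (wpath (a @ u @ b) p) (wpath (a @ v @ b) p)"
    using wpath_append[of a "u @ b" p] wpath_append[of a "v @ b" p] w p
    by (meson homotopic_paths_sym homotopic_paths_trans word_simps(3))
qed

lemma wpath_single:
  assumes "letter k" "standard p"
  shows "homotopic_paths config (wpath [k] p) (lpath k p)"
proof -
  have "homotopic_paths config (lpath k p +++ linepath (pathfinish (lpath k p)) (pathfinish (lpath k p))) (lpath k p)"
    using assms lpath_config path_lpath by (intro homotopic_paths_rid) (auto simp: path_image_def)
  then show ?thesis by (simp add: pathfinish_def)
qed

lemma weq_cancel:
  assumes "letter k"
  shows "weq [k, - k] []"
  unfolding weq_def
proof (intro allI impI)
  fix p assume p: "standard p"
  let ?q = "lpath k p 1"
  have q: "standard ?q" using standard_lpath_1 assms p by blast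
  have l: "path (lpath k p)" "path_image (lpath k p) \<subseteq> config" "pathfinish (lpath k p) = ?q" "pathstart (lpath k p) = p"
    using assms p lpath_config path_lpath by (auto simp: path_image_def pathfinish_def pathstart_def)
  have "lpath (- k) ?q = reversepath (lpath k p)"
    using lpath_uminus[OF assms p] by (simp add: fun_eq_iff reversepath_def)
  then have "homotopic_paths config (wpath [- k] ?q) (reversepath (lpath k p))"
    using wpath_single[of "- k" ?q] assms q by (simp del: wpath.simps)
  then have "homotopic_paths config (lpath k p +++ wpath [- k] ?q) (lpath k p +++ reversepath (lpath k p))"
    using l assms q wpath_start[of "[- k]" ?q]
    by (intro homotopic_paths_join) (auto simp: homotopic_paths_refl simp del: wpath.simps)
  then have "homotopic_paths config (wpath [k, - k] p) (lpath k p +++ reversepath (lpath k p))" by simp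
  also have "homotopic_paths config (lpath k p +++ reversepath (lpath k p)) (linepath (pathstart (lpath k p)) (pathstart (lpath k p)))"
    using l by (intro homotopic_paths_rinv)
  finally show "homotopic_paths config (wpath [k, - k] p) (wpath [] p)" using l by simp
qed

text \<open>A layered path: a point with a smaller label always passes above a point with a larger
  one. The layers can be moved independently of each other, so two such paths with the same ends
  are homotopic. Both sides of the braid relation are layered.\<close>

definition label_ordered :: "(real \<Rightarrow> complex ^ 3) \<Rightarrow> bool"
  where "label_ordered A \<longleftrightarrow> (\<forall>s\<in>{0..1}.
    (Re (A s $ 1) = Re (A s $ 2) \<longrightarrow> Im (A s $ 1) > Im (A s $ 2)) \<and>
    (Re (A s $ 1) = Re (A s $ 3) \<longrightarrow> Im (A s $ 1) > Im (A s $ 3)) \<and>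
    (Re (A s $ 2) = Re (A s $ 3) \<longrightarrow> Im (A s $ 2) > Im (A s $ 3)))"

lemma label_ordered_join:
  assumes "label_ordered A" "label_ordered B"
  shows "label_ordered (A +++ B)"
  unfolding label_ordered_def
proof
  fix s :: real assume s: "s \<in> {0..1}"
  show "(Re ((A +++ B) s $ 1) = Re ((A +++ B) s $ 2) \<longrightarrow> Im ((A +++ B) s $ 1) > Im ((A +++ B) s $ 2)) \<and>
    (Re ((A +++ B) s $ 1) = Re ((A +++ B) s $ 3) \<longrightarrow> Im ((A +++ B) s $ 1) > Im ((A +++ B) s $ 3)) \<and>
    (Re ((A +++ B) s $ 2) = Re ((A +++ B) s $ 3) \<longrightarrow> Im ((A +++ B) s $ 2) > Im ((A +++ B) s $ 3))"
  proof (cases "s \<le> 1/2")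
    case True
    then have "2 * s \<in> {0..1}" using s by auto
    then show ?thesis using assms(1) True unfolding label_ordered_def joinpaths_def by auto
  next
    case False
    then have "2 * s - 1 \<in> {0..1}" using s by auto
    then show ?thesis using assms(2) False unfolding label_ordered_def joinpaths_def by auto
  qed
qed

text \<open>Heights that separate the layers strictly between the ends of a path.\<close>

definition raise :: "real \<Rightarrow> complex ^ 3" where
  "raise s = vector [Complex 0 (s * (1 - s)), 0, Complex 0 (- (s * (1 - s)))]"

lemma raise_alt: "raise s = (\<chi> i. Complex 0 ((if i = 1 then 1 else if i = 2 then 0 else -1) * (s * (1 - s))))"
  unfolding vec_eq_iff forall_3 by (simp add: raise_def complex_eq_iff)

definition spread :: "(real \<Rightarrow> complex ^ 3) \<Rightarrow> real \<Rightarrow> complex ^ 3"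
  where "spread A s = (\<chi> i. Complex (Re (A s $ i)) (Im (raise s $ i)))"

lemma raise_nth [simp]:
  "raise s $ 1 = Complex 0 (s * (1 - s))" "raise s $ 2 = 0" "raise s $ 3 = Complex 0 (- (s * (1 - s)))"
  by (simp_all add: raise_def)

lemma closed_segment_vec_nth:
  fixes a b :: "complex ^ 'n"
  assumes "x \<in> closed_segment a b"
  obtains u where "0 \<le> u" "u \<le> 1" "\<And>i. Re (x $ i) = (1 - u) * Re (a $ i) + u * Re (b $ i)"
    "\<And>i. Im (x $ i) = (1 - u) * Im (a $ i) + u * Im (b $ i)"
proof -
  obtain u where "0 \<le> u" "u \<le> 1" "x = (1 - u) *\<^sub>R a + u *\<^sub>R b"
    using assms by (auto simp: closed_segment_def)
  then show thesis by (intro that[of u]) auto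
qed

lemma convex_comb_pos:
  fixes a b u :: real
  assumes "0 \<le> u" "u \<le> 1" "a > 0" "b > 0"
  shows "(1 - u) * a + u * b > 0"
  using assms by (cases "u = 0") (auto intro: add_nonneg_pos)

lemma path_spread:
  assumes "path A" shows "path (spread A)"
proof -
  have "continuous_on {0..1} (\<lambda>s. raise s)"
    unfolding raise_alt Complex_eq by (intro continuous_intros)
  then show ?thesis using assms unfolding path_def spread_def Complex_eq
    by (intro continuous_intros) auto
qed

text \<open>Along the segments the real parts are constant, so points can only collide when their real
  parts agree; in that case both ends of the segment have the same vertical order of the
  points.\<close>

lemma spread_homotopic:
  assumes A: "path A" "path_image A \<subseteq> config" "label_ordered A"
    and e: "\<And>i. Im (A 0 $ i) = 0" "\<And>i. Im (A 1 $ i) = 0"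
  shows "homotopic_paths config A (spread A)"
proof (rule homotopic_paths_linear)
  have z: "Im (raise 0 $ i) = 0" "Im (raise 1 $ i) = 0" for i
    using exhaust_3[of i] by auto
  show "pathstart (spread A) = pathstart A" "pathfinish (spread A) = pathfinish A"
    using e z by (auto simp: pathstart_def pathfinish_def spread_def vec_eq_iff complex_eq_iff)
  fix s :: real assume s: "s \<in> {0..1}"
  show "closed_segment (A s) (spread A s) \<subseteq> config"
  proof
    fix x assume "x \<in> closed_segment (A s) (spread A s)"
    then obtain u where u: "0 \<le> u" "u \<le> 1" "\<And>i. Re (x $ i) = (1 - u) * Re (A s $ i) + u * Re (spread A s $ i)"
       "\<And>i. Im (x $ i) = (1 - u) * Im (A s $ i) + u * Im (spread A s $ i)" by (rule closed_segment_vec_nth) blast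
    have re: "Re (x $ i) = Re (A s $ i)" for i unfolding u(3) spread_def by (simp add: algebra_simps)
    have im: "Im (x $ i) = (1 - u) * Im (A s $ i) + u * Im (raise s $ i)" for i unfolding u(4) spread_def by simp
    have c: "A s \<in> config" using A(2) s by (auto simp: path_image_def)
    have ne: "x $ i \<noteq> x $ j" if o: "Re (A s $ i) = Re (A s $ j) \<longrightarrow> Im (A s $ i) > Im (A s $ j)"
      and r: "Im (raise s $ i) - Im (raise s $ j) \<ge> s * (1 - s)" for i j
    proof
      assume x: "x $ i = x $ j"
      then have "Re (A s $ i) = Re (A s $ j)" using re by metis
      then have lt: "Im (A s $ i) > Im (A s $ j)" using o by simp
      then have "s \<noteq> 0" "s \<noteq> 1" using e by auto
      then have "s * (1 - s) > 0" using s by auto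
      then have "(1 - u) * (Im (A s $ i) - Im (A s $ j)) + u * (Im (raise s $ i) - Im (raise s $ j)) > 0"
        using lt r by (intro convex_comb_pos u) auto
      moreover have "Im (x $ i) = Im (x $ j)" using x by simp
      ultimately show False unfolding im by (simp add: algebra_simps)
    qed
    have nn: "s * (1 - s) \<ge> 0" using s by auto
    have "x $ 1 \<noteq> x $ 2" "x $ 1 \<noteq> x $ 3" "x $ 2 \<noteq> x $ 3"
      using A(3) s nn by (intro ne; auto simp: label_ordered_def)+
    then show "x \<in> config" using c re by (auto simp: config_def)
  qed
qed (use A path_spread in auto)

text \<open>After spreading, the heights are those of \<open>raise\<close> for both paths and keep the points apart
  while the real parts are interpolated.\<close>

lemma label_ordered_homotopic:
  assumes A: "path A" "path_image A \<subseteq> config" "label_ordered A"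
    and B: "path B" "path_image B \<subseteq> config" "label_ordered B"
    and e: "\<And>i. Im (A 0 $ i) = 0" "\<And>i. Im (A 1 $ i) = 0" "B 0 = A 0" "B 1 = A 1"
  shows "homotopic_paths config A B"
proof -
  have 1: "homotopic_paths config A (spread A)" using A e by (intro spread_homotopic)
  have 2: "homotopic_paths config B (spread B)" using B e by (intro spread_homotopic) auto
  have "homotopic_paths config (spread A) (spread B)"
  proof (rule homotopic_paths_linear)
    show "pathstart (spread B) = pathstart (spread A)" "pathfinish (spread B) = pathfinish (spread A)"
      using e by (auto simp: pathstart_def pathfinish_def spread_def)
    fix s :: real assume s: "s \<in> {0..1}"
    have c: "spread A s \<in> config" "spread B s \<in> config"
      using homotopic_paths_imp_subset[OF 1] homotopic_paths_imp_subset[OF 2] s by (auto simp: path_image_def)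
    show "closed_segment (spread A s) (spread B s) \<subseteq> config"
    proof (cases "s = 0 \<or> s = 1")
      case True
      then have "spread A s = spread B s" using e by (auto simp: spread_def)
      then show ?thesis using c by simp
    next
      case False
      then have p: "s * (1 - s) > 0" using s by auto
      show ?thesis
      proof
        fix x assume "x \<in> closed_segment (spread A s) (spread B s)"
        then obtain u where u: "0 \<le> u" "u \<le> 1" "\<And>i. Re (x $ i) = (1 - u) * Re (spread A s $ i) + u * Re (spread B s $ i)"
          "\<And>i. Im (x $ i) = (1 - u) * Im (spread A s $ i) + u * Im (spread B s $ i)" by (rule closed_segment_vec_nth) blast
        have im: "Im (x $ i) = Im (raise s $ i)" for i unfolding u(4) spread_def by (simp add: algebra_simps)
        have "Im (x $ 1) \<noteq> Im (x $ 2)" "Im (x $ 1) \<noteq> Im (x $ 3)" "Im (x $ 2) \<noteq> Im (x $ 3)"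
          unfolding im using p by auto
        then have "x $ 1 \<noteq> x $ 2" "x $ 1 \<noteq> x $ 3" "x $ 2 \<noteq> x $ 3" by metis+
        moreover have "Re (x $ i) > 0" for i
          unfolding u(3) using c by (intro convex_comb_pos u) (auto simp: config_iff)
        ultimately show "x \<in> config" by (simp add: config_def)
      qed
    qed
  qed (use A B path_spread in auto)
  with 1 2 show ?thesis by (meson homotopic_paths_sym homotopic_paths_trans)
qed

lemma cos_zero_sin_pos:
  assumes "cos (pi * s) = 0" "s \<in> {0..1}"
  shows "sin (pi * s) > 0"
proof -
  have "sin (pi * s) \<ge> 0" using assms(2) by (intro sin_ge_zero) (auto simp: mult_left_le)
  moreover have "sin (pi * s) \<noteq> 0" using assms(1) sin_cos_squared_add[of "pi * s"] by auto
  ultimately show ?thesis by simp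
qed

lemma label_ordered_lpath:
  "label_ordered (lpath 1 (vector [1, 2, 3]))" "label_ordered (lpath 1 (vector [1, 3, 2]))"
  "label_ordered (lpath 1 (vector [3, 1, 2]))"
  "label_ordered (lpath 2 (vector [1, 2, 3]))" "label_ordered (lpath 2 (vector [2, 1, 3]))"
  "label_ordered (lpath 2 (vector [2, 3, 1]))"
proof -
  have c: "cos x \<noteq> 3" "cos x \<noteq> -3" "3 + cos x \<noteq> 6" "3 - cos x \<noteq> 6" "5 + cos x \<noteq> 2" "5 - cos x \<noteq> 2"
     "6 \<noteq> 3 + cos x" "6 \<noteq> 3 - cos x" "2 \<noteq> 5 + cos x" "2 \<noteq> 5 - cos x" "3 + cos x \<noteq> 0" "5 + cos x \<noteq> 0" for x :: real
    using cos_ge_minus_one[of x] cos_le_one[of x] by linarith+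
  show "label_ordered (lpath 1 (vector [1, 2, 3]))" "label_ordered (lpath 1 (vector [1, 3, 2]))"
  "label_ordered (lpath 1 (vector [3, 1, 2]))"
  "label_ordered (lpath 2 (vector [1, 2, 3]))" "label_ordered (lpath 2 (vector [2, 1, 3]))"
  "label_ordered (lpath 2 (vector [2, 3, 1]))"
    unfolding label_ordered_def using cos_zero_sin_pos
    by (auto simp: field_simps c)
qed

lemma lpath_ends:
  "lpath 1 (vector [1, 2, 3]) 1 = vector [2, 1, 3]" "lpath 2 (vector [2, 1, 3]) 1 = vector [3, 1, 2]"
  "lpath 1 (vector [3, 1, 2]) 1 = vector [3, 2, 1]"
  "lpath 2 (vector [1, 2, 3]) 1 = vector [1, 3, 2]" "lpath 1 (vector [1, 3, 2]) 1 = vector [2, 3, 1]"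
  "lpath 2 (vector [2, 3, 1]) 1 = vector [3, 2, 1]"
  by (simp_all add: vec_eq_iff forall_3 complex_eq_iff)

text \<open>All six letter paths that occur keep the points in layers in the order of their labels.\<close>

lemma weq_braid: "weq [1, 2, 1] [2, 1, 2]"
proof (rule weq_std, rule label_ordered_homotopic)
  have lin: "label_ordered (linepath (vector [3, 2, 1]) (vector [3, 2, 1]))"
    by (auto simp: label_ordered_def linepath_def algebra_simps)
  have l: "letter 1" "letter 2" by (auto simp: letter_def)
  then have w: "word [1, 2, 1]" "word [2, 1, 2]" by auto
  show "path (wpath [1, 2, 1] std)" "path (wpath [2, 1, 2] std)"
     "path_image (wpath [1, 2, 1] std) \<subseteq> config" "path_image (wpath [2, 1, 2] std) \<subseteq> config"
    using w standard_std by (simp_all only: path_wpath wpath_config)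
  show "label_ordered (wpath [1, 2, 1] std)" "label_ordered (wpath [2, 1, 2] std)"
    unfolding wpath.simps std_def lpath_ends
    by (intro label_ordered_join label_ordered_lpath lin)+
  have e: "wpath u std 0 = std" "wpath u std 1 = wend u std" if "word u" for u
    using wpath_basic[OF that standard_std] by (auto simp: pathstart_def pathfinish_def)
  have f: "wend [1, 2, 1] std = vector [3, 2, 1]" "wend [2, 1, 2] std = vector [3, 2, 1]"
    unfolding wend.simps std_def lpath_ends by auto
  show "wpath [2, 1, 2] std 0 = wpath [1, 2, 1] std 0" "wpath [2, 1, 2] std 1 = wpath [1, 2, 1] std 1"
    using e(1)[OF w(1)] e(1)[OF w(2)] e(2)[OF w(1)] e(2)[OF w(2)] f by metis+
  show "Im (wpath [1, 2, 1] std 0 $ i) = 0" "Im (wpath [1, 2, 1] std 1 $ i) = 0" for i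
    unfolding e(1)[OF w(1)] e(2)[OF w(1)] f using exhaust_3[of i] by auto
qed

section \<open>From words to closed braids\<close>

text \<open>Each letter takes unit time here, as in the sectors of a closed braid, whereas joining
  paths gives the letters of \<open>wpath\<close> shorter and shorter times.\<close>

fun upath :: "int list \<Rightarrow> complex ^ 3 \<Rightarrow> real \<Rightarrow> complex ^ 3" where
  "upath [] p s = p"
| "upath (k # u) p s = (if s \<le> 1 then lpath k p s else upath u (lpath k p 1) (s - 1))"

lemma upath_0: "word u \<Longrightarrow> standard p \<Longrightarrow> upath u p 0 = p"
  by (cases u) auto

lemma upath_Suc: "word (k # u) \<Longrightarrow> standard p \<Longrightarrow> 0 \<le> x \<Longrightarrow> upath (k # u) p (1 + x) = upath u (lpath k p 1) x"
  by (cases "x = 0") (auto simp: upath_0 standard_lpath_1)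

lemma slice_motion:
  assumes "letter k" "standard p"
  shows "slice 3 k s = range (\<lambda>i. lpath k p s $ i)"
proof -
  have "range (\<lambda>i. lpath k p s $ i) = motion k s ` {1, 2, 3}"
    using standard_positions[OF assms(2)] by (simp add: image_image[symmetric, of "motion k s" "\<lambda>i. p $ i"])
  moreover have "{1..3} = {1, 2, 3::nat}" by auto
  then have "slice 3 0 s = {1, 2, 3}"
    "slice 3 1 s = {3, 3/2 - cis (- (pi * s)) / 2, 3/2 + cis (- (pi * s)) / 2}"
    "slice 3 (-1) s = {3, 3/2 - cis (pi * s) / 2, 3/2 + cis (pi * s) / 2}"
    "slice 3 2 s = {1, 5/2 - cis (- (pi * s)) / 2, 5/2 + cis (- (pi * s)) / 2}"
    "slice 3 (-2) s = {1, 5/2 - cis (pi * s) / 2, 5/2 + cis (pi * s) / 2}"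
    by (simp_all add: slice_def Let_def insert_Diff_if) (simp_all add: insert_commute)
  ultimately show ?thesis using assms(1) unfolding letter_def by (elim disjE; simp add: insert_commute)
qed

lemma upath_slice:
  "word u \<Longrightarrow> standard p \<Longrightarrow> j < length u \<Longrightarrow> s \<in> {0..1} \<Longrightarrow>
    slice 3 (u ! j) s = range (\<lambda>i. upath u p (real j + s) $ i)"
proof (induction u arbitrary: p j)
  case (Cons k u)
  show ?case
  proof (cases j)
    case 0
    then show ?thesis using Cons.prems slice_motion[of k p s] by simp
  next
    case (Suc j')
    have "upath (k # u) p (real j + s) = upath u (lpath k p 1) (real j' + s)"
      using upath_Suc[of k u p "real j' + s"] Cons.prems Suc by (simp add: add.assoc del: upath.simps)
    then show ?thesis using Cons.IH[of "lpath k p 1" j'] Cons.prems Suc by (simp add: standard_lpath_1 del: upath.simps)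
  qed
qed simp

lemma closed_braid_points_eq:
  assumes "word w"
  shows "closed_braid_points 3 w = path_points (\<lambda>s. upath (w @ [0]) std (real (length (w @ [0])) * s))"
proof -
  define u where "u = w @ [0::int]"
  define n where "n = length u"
  have u: "word u" using assms by (simp add: u_def letter_def)
  have n: "n > 0" by (simp add: n_def u_def)
  have "closed_braid_points 3 w =
     {page p (2 * pi * (real j + s) / real n) | j s p. j < n \<and> s \<in> {0..1} \<and> p \<in> slice 3 (u ! j) s}"
    unfolding closed_braid_points_def u_def[symmetric] Let_def n_def ..
  also have "\<dots> = path_points (\<lambda>s. upath u std (real n * s))" (is "?A = ?B")
  proof (intro equalityI subsetI)
    fix x assume "x \<in> ?A"
    then obtain j s p where x: "x = page p (2 * pi * (real j + s) / real n)" "j < n" "s \<in> {0..1}" "p \<in> slice 3 (u ! j) s"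
      by blast
    then obtain i where i: "p = upath u std (real j + s) $ i"
      using upath_slice[OF u standard_std, of j s] by (auto simp: n_def)
    have "real j + s \<le> real n" using x(2,3) by auto
    then have t: "(real j + s) / real n \<in> {0..1}" using x(3) n by auto
    have "x = page (upath u std (real n * ((real j + s) / real n)) $ i) (2 * pi * ((real j + s) / real n))"
      using x(1) i n by simp
    then show "x \<in> ?B" unfolding path_points_def using t by blast
  next
    fix x assume "x \<in> ?B"
    then obtain t i where x: "t \<in> {0..1}" "x = page (upath u std (real n * t) $ i) (2 * pi * t)"
      unfolding path_points_def by blast
    obtain j s where js: "j < n" "s \<in> {0..1}" "real j + s = real n * t"
    proof (cases "t = 1")
      case True
      show thesis using n by (intro that[of "n - 1" 1]) (auto simp: True)
    next
      case False
      then have nt: "0 \<le> real n * t" "real n * t < real n" using x(1) n by auto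
      define j where "j = nat \<lfloor>real n * t\<rfloor>"
      have "real j \<le> real n * t" "real n * t < real j + 1" unfolding j_def using nt by linarith+
      moreover from this nt have "j < n" by linarith
      ultimately show thesis by (intro that[of j "real n * t - real j"]) auto
    qed
    have "upath u std (real n * t) $ i \<in> slice 3 (u ! j) s"
      using upath_slice[OF u standard_std, of j s] js by (auto simp: n_def)
    moreover have "x = page (upath u std (real n * t) $ i) (2 * pi * (real j + s) / real n)"
      unfolding x(2) js(3) using n by (simp add: mult.assoc)
    ultimately show "x \<in> ?A" using js by blast
  qed
  finally show ?thesis by (simp add: u_def n_def)
qed

lemma continuous_upath: "word u \<Longrightarrow> standard p \<Longrightarrow> continuous_on {0..real (length u)} (upath u p)"
proof (induction u arbitrary: p)
  case Nil then show ?case by simp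
next
  case (Cons k u)
  have s: "standard (lpath k p 1)" using Cons.prems standard_lpath_1 by simp
  have "continuous_on {1..1 + real (length u)} (\<lambda>s. upath u (lpath k p 1) (s - 1))"
    by (rule continuous_on_compose2[OF Cons.IH[OF _ s]]) (use Cons.prems in \<open>auto intro!: continuous_intros\<close>)
  then have "continuous_on {1..1 + real (length u)} (upath (k # u) p)"
    by (rule continuous_on_eq) (use Cons.prems s in \<open>auto simp: upath_0\<close>)
  moreover have "continuous_on {0..1} (upath (k # u) p)"
    by (rule continuous_on_eq[OF continuous_lpath[of _ k p]]) auto
  ultimately have "continuous_on ({0..1} \<union> {1..1 + real (length u)}) (upath (k # u) p)"
    by (intro continuous_on_closed_Un) auto
  moreover have "{0..1} \<union> {1..1 + real (length u)} = {0..real (length (k # u))}" by auto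
  ultimately show ?case by simp
qed

lemma upath_config: "word u \<Longrightarrow> standard p \<Longrightarrow> upath u p s \<in> config"
  by (induction u arbitrary: p s) (auto simp: standard_config lpath_config standard_lpath_1)

lemma upath_homotopic:
  "word u \<Longrightarrow> standard p \<Longrightarrow> u \<noteq> [] \<Longrightarrow>
    homotopic_paths config (\<lambda>s. upath u p (real (length u) * s)) (wpath u p)"
proof (induction u arbitrary: p)
  case (Cons k u)
  have path: "path (\<lambda>s. upath v q (real (length v) * s))" if "word v" "standard q" for v q
    unfolding path_def
    by (rule continuous_on_compose2[OF continuous_upath[OF that]]) (auto intro!: continuous_intros mult_left_le)
  have im: "path_image (\<lambda>s. upath v q (real (length v) * s)) \<subseteq> config" if "word v" "standard q" for v q
    using upath_config[OF that] by (auto simp: path_image_def)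
  show ?case
  proof (cases "u = []")
    case True
    have "homotopic_paths config (lpath k p) (\<lambda>s. upath (k # u) p (real (length (k # u)) * s))"
      using Cons.prems True path_lpath lpath_config by (intro homotopic_paths_eq) (auto simp: path_image_def)
    moreover have "homotopic_paths config (wpath (k # u) p) (lpath k p)"
      using wpath_single[of k p] Cons.prems True by simp
    ultimately show ?thesis by (meson homotopic_paths_sym homotopic_paths_trans)
  next
    case False
    define n where "n = length u"
    let ?q = "lpath k p 1"
    have q: "standard ?q" using standard_lpath_1 Cons.prems by simp
    define g where "g = (\<lambda>s. upath (k # u) p (real (length (k # u)) * s))"
    define h where "h = (\<lambda>s. upath u ?q (real (length u) * s))"
    have g: "path g" "path_image g \<subseteq> config"
      unfolding g_def using path[OF Cons.prems(1,2)] im[OF Cons.prems(1,2)] by blast+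
    have h: "path h" "path_image h \<subseteq> config" using path im Cons.prems q by (auto simp: h_def)
    let ?c = "1 / (real n + 1)"
    have c: "?c \<in> {0..1}" by simp
    have "homotopic_paths config (subpath 0 ?c g +++ subpath ?c 1 g) (subpath 0 1 g)"
      using g c by (intro homotopic_join_subpaths) auto
    moreover have "homotopic_paths config (lpath k p) (subpath 0 ?c g)"
    proof (rule homotopic_paths_eq)
      show "path (lpath k p)" "path_image (lpath k p) \<subseteq> config"
        using path_lpath lpath_config Cons.prems by (auto simp: path_image_def)
      show "lpath k p t = subpath 0 ?c g t" if "t \<in> {0..1}" for t
      proof -
        have "real (length (k # u)) * (?c * t) = t" by (simp add: n_def field_simps)
        then have "subpath 0 ?c g t = upath (k # u) p t" unfolding subpath_def g_def by (simp only: diff_0_right add_0_right add_0_left)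
        then show ?thesis using that by simp
      qed
    qed
    moreover have "homotopic_paths config h (subpath ?c 1 g)"
    proof (rule homotopic_paths_eq[OF h])
      show "h t = subpath ?c 1 g t" if "t \<in> {0..1}" for t
      proof -
        have "real (length (k # u)) * ((1 - ?c) * t + ?c) = 1 + real n * t" by (simp add: n_def field_simps)
        then show ?thesis using that upath_Suc[of k u p "real n * t"] Cons.prems
          by (simp add: subpath_def g_def h_def n_def del: upath.simps)
      qed
    qed
    moreover have IH: "homotopic_paths config h (wpath u ?q)"
      using Cons.IH[of ?q] False q Cons.prems by (simp add: h_def)
    moreover have "pathfinish (lpath k p) = pathstart h"
      using Cons.prems q by (simp add: pathfinish_def pathstart_def h_def upath_0)
    ultimately have "homotopic_paths config (lpath k p +++ wpath u ?q) (subpath 0 1 g)"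
      by (meson homotopic_paths_join homotopic_paths_refl homotopic_paths_sym homotopic_paths_trans
          homotopic_paths_imp_path homotopic_paths_imp_subset homotopic_paths_imp_pathstart homotopic_paths_imp_pathfinish)
    then show ?thesis by (simp add: g_def homotopic_paths_sym del: upath.simps)
  qed
qed simp

lemma homotopic_paths_isotopic:
  assumes h: "homotopic_paths config p q" and e: "pathfinish p = relabel \<pi> (pathstart p)" "bij \<pi>"
  shows "isotopic (braided (path_points p)) (braided (path_points q))"
proof -
  obtain H :: "real \<times> real \<Rightarrow> complex ^ 3" where H: "continuous_on ({0..1} \<times> {0..1}) H" "H \<in> ({0..1} \<times> {0..1}) \<rightarrow> config"
    "\<And>x. x \<in> {0..1} \<Longrightarrow> H (0, x) = p x" "\<And>x. x \<in> {0..1} \<Longrightarrow> H (1, x) = q x"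
    "\<And>t. t \<in> {0..1} \<Longrightarrow> pathstart (H \<circ> Pair t) = pathstart p" "\<And>t. t \<in> {0..1} \<Longrightarrow> pathfinish (H \<circ> Pair t) = pathfinish p"
    using h unfolding homotopic_paths by metis
  have "isotopic (braided (path_points ((\<lambda>t s. H (t, s)) 0))) (braided (path_points ((\<lambda>t s. H (t, s)) 1)))"
  proof (rule homotopic_loops_isotopic[OF e(2)])
    show "continuous_on ({0..1} \<times> {0..1}) (\<lambda>z. H (fst z, snd z))" using H(1) by simp
    show "H (t, 1) $ i = H (t, 0) $ \<pi> i" if "t \<in> {0..1}" for t i
      using H(5,6)[OF that] e(1) by (simp add: pathstart_def pathfinish_def)
    have c: "H (t, s) \<in> config" if "t \<in> {0..1}" "s \<in> {0..1}" for t s using H(2) that by auto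
    show "i = j" if "t \<in> {0..1}" "s \<in> {0..1}" "H (t, s) $ i = H (t, s) $ j" for t s i j
      using c[OF that(1,2)] that(3) by (auto simp: config_iff inj_def)
    show "Re (H (t, s) $ i) > 0" if "t \<in> {0..1}" "s \<in> {0..1}" for t s i
      using c[OF that] by (auto simp: config_iff)
  qed
  moreover have "path_points (\<lambda>s. H (0, s)) = path_points p" "path_points (\<lambda>s. H (1, s)) = path_points q"
    using H(3,4) by (auto intro!: path_points_cong)
  ultimately show ?thesis by simp
qed

lemma wend_standard_relabel: "word u \<Longrightarrow> \<exists>\<pi>. bij \<pi> \<and> wend u std = relabel \<pi> std"
  using standard_wend[OF _ standard_std] by (simp add: standard_def)

text \<open>The trivial letter that closes the braid does not change the homotopy class.\<close>

lemma isotopic_path_points_braid_closure: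
  assumes w: "braid_word 3 w" and h: "homotopic_paths config q (wpath w std)"
  shows "isotopic (braid_closure 3 w) (braided (path_points q))"
    "isotopic (braided (path_points q)) (braid_closure 3 w)"
proof -
  have w': "word w" using braid_word_word w by blast
  let ?g = "\<lambda>s. upath (w @ [0]) std (real (length (w @ [0])) * s)"
  have l0: "letter 0" by (simp add: letter_def)
  have "weq (w @ [0] @ []) (w @ [] @ [])"
  proof (rule weq_context)
    have "homotopic_paths config (wpath [0] std) (lpath 0 std)" by (rule wpath_single[OF l0 standard_std])
    moreover have "lpath 0 std = linepath std std" by (simp add: fun_eq_iff vec_eq_iff linepath_def)
    ultimately show "weq [0] []" by (intro weq_std) simp
  qed (use w' l0 in auto)
  then have "homotopic_paths config (wpath (w @ [0]) std) (wpath w std)"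
    using standard_std by (simp add: weq_def)
  moreover have "homotopic_paths config ?g (wpath (w @ [0]) std)"
    using w' l0 standard_std by (intro upath_homotopic) auto
  ultimately have hg: "homotopic_paths config ?g q" using h by (meson homotopic_paths_sym homotopic_paths_trans)
  obtain \<pi> where \<pi>: "bij \<pi>" "wend w std = relabel \<pi> std" using wend_standard_relabel[OF w'] by blast
  have eq: "pathstart q = std" "pathfinish q = relabel \<pi> std"
    using homotopic_paths_imp_pathstart[OF h] homotopic_paths_imp_pathfinish[OF h] w' standard_std \<pi> by auto
  have eg: "pathstart ?g = std" "pathfinish ?g = relabel \<pi> std"
    using homotopic_paths_imp_pathstart[OF hg] homotopic_paths_imp_pathfinish[OF hg] eq by auto
  show "isotopic (braid_closure 3 w) (braided (path_points q))"
    unfolding braid_closure_eq closed_braid_points_eq[OF w']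
    using hg eg \<pi>(1) by (intro homotopic_paths_isotopic) auto
  show "isotopic (braided (path_points q)) (braid_closure 3 w)"
    unfolding braid_closure_eq closed_braid_points_eq[OF w']
    using homotopic_paths_sym[OF hg] eq \<pi>(1) by (intro homotopic_paths_isotopic) auto
qed

lemma closed_braid_of_path:
  assumes p: "path p" "path_image p \<subseteq> config" and e: "pathfinish p = relabel \<pi> (pathstart p)" "bij \<pi>"
  obtains W where "closed_braid \<pi> W" "\<And>s. s \<in> {0..1} \<Longrightarrow> W s = p s" "strand_points W = path_points p"
proof -
  have c: "p s \<in> config" if "s \<in> {0..1}" for s using p(2) that by (auto simp: path_image_def)
  obtain W where W: "\<And>t. t \<in> {0..1::real} \<Longrightarrow> closed_braid \<pi> (W t)"
    "\<And>t s. t \<in> {0..1::real} \<Longrightarrow> s \<in> {0..1} \<Longrightarrow> W t s = p s"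
  proof (rule closed_braid_extension[of \<pi> "\<lambda>t. p"])
    show "continuous_on ({0..1::real} \<times> {0..1}) (\<lambda>z. p (snd z))"
      by (rule continuous_on_compose2[of "{0..1}" p]) (use p in \<open>auto simp: path_def intro!: continuous_intros\<close>)
    show "i = j" if "t \<in> {0..1::real}" "s \<in> {0..1}" "p s $ i = p s $ j" for t s i j
      using c[OF that(2)] that(3) by (auto simp: config_iff inj_def)
    show "Re (p s $ i) > 0" if "t \<in> {0..1::real}" "s \<in> {0..1}" for t s i
      using c[OF that(2)] by (auto simp: config_iff)
  qed (use e in \<open>auto simp: pathstart_def pathfinish_def\<close>)
  have "strand_points (W 0) = path_points p"
    using strand_points_unit[OF W(1)[of 0]] path_points_cong[of "W 0" p] W(2)[of 0]
    by (simp add: path_points_def)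
  then show thesis using that[of "W 0"] W by simp
qed

lemma link_braid_closure:
  assumes w: "braid_word 3 w"
  shows "link (braid_closure 3 w)"
proof -
  have w': "word w" using braid_word_word w by blast
  obtain \<pi> where \<pi>: "bij \<pi>" "wend w std = relabel \<pi> std" using wend_standard_relabel[OF w'] by blast
  obtain W where W: "closed_braid \<pi> W" "strand_points W = path_points (wpath w std)"
    using closed_braid_of_path[of "wpath w std" \<pi>] wpath_basic[OF w' standard_std] \<pi> by metis
  have "isotopic (braided (path_points (wpath w std))) (braid_closure 3 w)"
    using w w' standard_std by (intro isotopic_path_points_braid_closure) (auto simp: homotopic_paths_refl)
  then show ?thesis using link_braided[OF W(1)] link_isotopic W(2) by metis
qed

lemma path_points_relabel:
  assumes "bij \<sigma>"
  shows "path_points (\<lambda>s. relabel \<sigma> (Z s)) = path_points Z"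
proof -
  have "page (Z s $ i) (2 * pi * s) \<in> path_points (\<lambda>s. relabel \<sigma> (Z s))" if "s \<in> {0..1}" for s i
  proof -
    obtain j where "\<sigma> j = i" using assms by (metis bij_pointE)
    then have "page (Z s $ i) (2 * pi * s) = page (relabel \<sigma> (Z s) $ j) (2 * pi * s)" by simp
    then show ?thesis using that unfolding path_points_def by blast
  qed
  then show ?thesis unfolding path_points_def by auto
qed

lemma weq_isotopic:
  assumes "braid_word 3 u" "braid_word 3 v" "weq u v"
  shows "isotopic (braid_closure 3 u) (braid_closure 3 v)"
proof -
  have h: "homotopic_paths config (wpath u std) (wpath v std)" using assms(3) standard_std by (simp add: weq_def)
  have r: "homotopic_paths config (wpath u std) (wpath u std)"
    using homotopic_paths_imp_path[OF h] homotopic_paths_imp_subset[OF h] by (simp add: homotopic_paths_refl)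
  show ?thesis
    using isotopic_trans[OF isotopic_path_points_braid_closure(1)[OF assms(1) r] isotopic_path_points_braid_closure(2)[OF assms(2) h]] .
qed

lemma rotate_isotopic:
  assumes W: "closed_braid \<pi> W"
  shows "isotopic (braided (strand_points W)) (braided (strand_points (\<lambda>s. W (s + a))))"
proof -
  have "isotopic (braided (strand_points ((\<lambda>t s. W (s + t * a)) 0))) (braided (strand_points ((\<lambda>t s. W (s + t * a)) 1)))"
  proof (rule homotopic_closed_braids_isotopic)
    have c: "continuous_on UNIV W" using W by (simp add: closed_braid_def)
    show "continuous_on ({0..1} \<times> UNIV) (\<lambda>z. W (snd z + fst z * a))"
      by (rule continuous_on_compose2[OF c]) (auto intro!: continuous_intros)
    fix t :: real
    have "continuous_on UNIV (\<lambda>s. W (s + t * a))"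
      by (rule continuous_on_compose2[OF c]) (auto intro!: continuous_intros)
    moreover have "W (s + 1 + t * a) $ i = W (s + t * a) $ \<pi> i" for s i
    proof -
      have "s + 1 + t * a = (s + t * a) + 1" by simp
      then show ?thesis using W unfolding closed_braid_def by metis
    qed
    ultimately show "closed_braid \<pi> (\<lambda>s. W (s + t * a))"
      using W by (simp add: closed_braid_def)
  qed
  then show ?thesis by simp
qed

text \<open>Turning the closed braid of \<open>u @ v\<close> by half a turn about the axis exchanges the two
  factors, up to relabelling the strands by the permutation \<open>\<alpha>\<close> of \<open>u\<close>.\<close>

theorem conjugate_isotopic:
  assumes u: "braid_word 3 u" and v: "braid_word 3 v"
  shows "isotopic (braid_closure 3 (u @ v)) (braid_closure 3 (v @ u))"
proof -
  have wu: "word u" "word v" using braid_word_word u v by blast+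
  have uv: "braid_word 3 (u @ v)" "braid_word 3 (v @ u)" using u v by (auto simp: braid_word_def)
  obtain \<alpha> where \<alpha>: "bij \<alpha>" "wend u std = relabel \<alpha> std" using wend_standard_relabel wu by blast
  obtain \<beta> where \<beta>: "bij \<beta>" "wend v std = relabel \<beta> std" using wend_standard_relabel wu by blast
  define \<pi> where "\<pi> = \<beta> \<circ> \<alpha>"
  have \<pi>: "bij \<pi>" using \<alpha> \<beta> by (simp add: \<pi>_def bij_comp)
  let ?A = "wpath u std" and ?B = "wpath v std"
  let ?Z = "?A +++ (relabel \<alpha> \<circ> ?B)"
  have hZ: "homotopic_paths config ?Z (wpath (u @ v) std)"
    using wpath_append[OF wu standard_std] \<alpha> by (simp add: wpath_relabel homotopic_paths_sym)
  have end_Z: "pathfinish ?Z = relabel \<pi> (pathstart ?Z)"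
    using wu standard_std \<beta>(2) by (simp add: pathfinish_compose relabel_relabel \<pi>_def)
  obtain W where W: "closed_braid \<pi> W" "\<And>s. s \<in> {0..1} \<Longrightarrow> W s = ?Z s" "strand_points W = path_points ?Z"
    using closed_braid_of_path[OF homotopic_paths_imp_path(1)[OF hZ, THEN conjunct1] homotopic_paths_imp_subset(1)[OF hZ, THEN conjunct1] end_Z \<pi>] by blast
  let ?Y = "?B +++ (relabel \<beta> \<circ> ?A)"
  have hY: "homotopic_paths config ?Y (wpath (v @ u) std)"
    using wpath_append[OF wu(2,1) standard_std] \<beta> by (simp add: wpath_relabel homotopic_paths_sym)
  have cs: "closed_braid \<pi> (\<lambda>s. W (s + 1/2))"
  proof -
    have c: "continuous_on UNIV W" using W by (simp add: closed_braid_def)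
    have "continuous_on UNIV (\<lambda>s. W (s + 1/2))"
      by (rule continuous_on_compose2[OF c]) (auto intro!: continuous_intros)
    moreover have "W (s + 1 + 1/2) $ i = W (s + 1/2) $ \<pi> i" for s i
    proof -
      have "s + 1 + 1/2 = (s + 1/2) + 1" by simp
      then show ?thesis using W(1) unfolding closed_braid_def by metis
    qed
    ultimately show ?thesis using W(1) by (simp add: closed_braid_def)
  qed
  have "W (s + 1/2) = relabel \<alpha> (?Y s)" if s: "s \<in> {0..1}" for s
  proof (cases "s \<le> 1/2")
    case True
    have "W (s + 1/2) = ?Z (s + 1/2)" using s True by (intro W(2)) auto
    also have "\<dots> = relabel \<alpha> (?Y s)"
    proof (cases "s = 0")
      case True
      have "?A 1 = relabel \<alpha> std" "?B 0 = std" using wpath_basic wu standard_std \<alpha>(2) by (metis pathfinish_def, metis pathstart_def)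
      then show ?thesis using True by (simp add: joinpaths_def)
    next
      case False
      then show ?thesis using True s by (simp add: joinpaths_def)
    qed
    finally show ?thesis .
  next
    case False
    have "W ((s - 1/2) + 1) $ i = W (s - 1/2) $ \<pi> i" for i using W(1) unfolding closed_braid_def by blast
    moreover have "W (s - 1/2) = ?Z (s - 1/2)" using s False by (intro W(2)) auto
    moreover have "?Z (s - 1/2) = ?A (2 * s - 1)" using s False by (simp add: joinpaths_def algebra_simps)
    moreover have "?Y s = relabel \<beta> (?A (2 * s - 1))" using False by (simp add: joinpaths_def)
    moreover have "s - 1/2 + 1 = s + 1/2" by simp
    ultimately show ?thesis by (simp add: vec_eq_iff \<pi>_def del: diff_add_eq)
  qed
  then have "path_points (\<lambda>s. W (s + 1/2)) = path_points (\<lambda>s. relabel \<alpha> (?Y s))" by (intro path_points_cong) auto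
  then have "strand_points (\<lambda>s. W (s + 1/2)) = path_points ?Y"
    unfolding strand_points_unit[OF cs] path_points_relabel[OF \<alpha>(1)] unfolding path_points_def .
  then have "isotopic (braided (path_points ?Z)) (braided (path_points ?Y))"
    using rotate_isotopic[OF W(1), of "1/2"] W(3) by simp
  then show ?thesis
    using isotopic_path_points_braid_closure(1)[OF uv(1) hZ] isotopic_path_points_braid_closure(2)[OF uv(2) hY] isotopic_trans by blast
qed


section \<open>Two families of homeomorphisms of 3-space\<close>

text \<open>Complex affine maps of the horizontal planes. Writing the linear part as an exponential
  gives the isotopy to the identity: \<open>E\<close> and \<open>l\<close> are multiplied by the time.\<close>

lemma fibred_affine_ambient:
  fixes E l :: "real \<Rightarrow> complex"
  assumes E: "continuous_on UNIV E" and l: "continuous_on UNIV l"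
  shows "ambient (\<lambda>x. (E (snd x) + exp (l (snd x)) * fst x, snd x))"
  unfolding ambient_def
proof (intro exI[of _ "\<lambda>z. (of_real (fst z) * E (snd (snd z)) + exp (of_real (fst z) * l (snd (snd z))) * fst (snd z), snd (snd z))"]
    conjI ballI allI)
  let ?F = "\<lambda>z::real \<times> R3. (of_real (fst z) * E (snd (snd z)) + exp (of_real (fst z) * l (snd (snd z))) * fst (snd z), snd (snd z))"
  have c: "continuous_on A (\<lambda>z::real \<times> R3. E (snd (snd z)))" "continuous_on A (\<lambda>z::real \<times> R3. l (snd (snd z)))" for A
    by (auto intro!: continuous_on_compose2[OF E] continuous_on_compose2[OF l] continuous_intros)
  show "continuous_on ({0..1} \<times> UNIV) ?F" by (intro continuous_intros c)
  show "bij (\<lambda>x. ?F (t, x))" for t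
  proof (rule o_bij[of "\<lambda>x. (exp (- of_real t * l (snd x)) * (fst x - of_real t * E (snd x)), snd x)"])
    show "(\<lambda>x. (exp (- of_real t * l (snd x)) * (fst x - of_real t * E (snd x)), snd x)) \<circ> (\<lambda>x. ?F (t, x)) = id"
      "(\<lambda>x. ?F (t, x)) \<circ> (\<lambda>x. (exp (- of_real t * l (snd x)) * (fst x - of_real t * E (snd x)), snd x)) = id"
      by (simp_all add: fun_eq_iff exp_minus flip: mult.assoc)
  qed
  show "proper_family ?F"
    unfolding proper_family_def
  proof
    fix B :: real
    have cB: "compact {-B..B}" by simp
    have "bounded (E ` {-B..B})"
      by (intro compact_imp_bounded compact_continuous_image continuous_on_subset[OF E]) auto
    then obtain K where K: "\<And>h. h \<in> {-B..B} \<Longrightarrow> cmod (E h) \<le> K" unfolding bounded_iff by blast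
    have "bounded (l ` {-B..B})"
      by (intro compact_imp_bounded compact_continuous_image continuous_on_subset[OF l]) auto
    then obtain M where M: "\<And>h. h \<in> {-B..B} \<Longrightarrow> cmod (l h) \<le> M" unfolding bounded_iff by blast
    have "norm x \<le> exp M * (B + K) + B" if t: "t \<in> {0..1}" and n: "norm (?F (t, x)) \<le> B" for t x
    proof -
      let ?w' = "fst (?F (t, x))"
      have ns: "norm (snd y) \<le> norm y" "norm (fst y) \<le> norm y" for y :: R3
        using norm_snd_le[of "snd y" "fst y"] norm_fst_le[of "fst y" "snd y"] by simp_all
      have h: "\<bar>snd x\<bar> \<le> B" using ns(1)[of "?F (t, x)"] n by (simp only: snd_conv real_norm_def)
      have w: "norm ?w' \<le> B" using ns(2)[of "?F (t, x)"] n by linarith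
      have h': "snd x \<in> {-B..B}" using h by (auto simp: abs_le_iff)
      have "fst x = exp (- of_real t * l (snd x)) * (?w' - of_real t * E (snd x))" by (simp add: exp_minus)
      then have "cmod (fst x) = exp (Re (- of_real t * l (snd x))) * cmod (?w' - of_real t * E (snd x))"
        by (metis norm_mult norm_exp_eq_Re)
      also have "\<dots> \<le> exp M * (B + K)"
      proof (intro mult_mono)
        have "Re (- of_real t * l (snd x)) \<le> \<bar>t * Re (l (snd x))\<bar>" by simp
        also have "\<dots> = t * \<bar>Re (l (snd x))\<bar>" using t by (simp add: abs_mult)
        also have "\<dots> \<le> 1 * cmod (l (snd x))" using t abs_Re_le_cmod by (intro mult_mono) auto
        also have "\<dots> \<le> M" using M[OF h'] by simp
        finally show "exp (Re (- of_real t * l (snd x))) \<le> exp M" by simp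
        have "cmod (of_real t * E (snd x)) \<le> 1 * K" unfolding norm_mult using t K[OF h'] by (intro mult_mono) auto
        then show "cmod (?w' - of_real t * E (snd x)) \<le> B + K" using w norm_triangle_ineq4[of ?w' "of_real t * E (snd x)"] by linarith
      qed auto
      finally have "cmod (fst x) \<le> exp M * (B + K)" .
      moreover have "norm x \<le> cmod (fst x) + \<bar>snd x\<bar>"
        unfolding norm_prod_def real_norm_def[symmetric] by (rule sqrt_sum_squares_le_sum) auto
      ultimately show ?thesis using h by linarith
    qed
    then show "\<exists>B'. \<forall>t\<in>{0..1}. \<forall>x. norm (?F (t, x)) \<le> B \<longrightarrow> norm x \<le> B'" by blast
  qed
qed auto

text \<open>The rotation by the angle \<open>a\<close> about the first coordinate axis.\<close>

definition tilt :: "real \<Rightarrow> R3 \<Rightarrow> R3"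
  where "tilt a x = (Complex (Re (fst x)) (cos a * Im (fst x) - sin a * snd x), sin a * Im (fst x) + cos a * snd x)"

lemma tilt_tilt: "tilt a (tilt b x) = tilt (a + b) x"
  by (simp add: tilt_def cos_add sin_add algebra_simps)

lemma tilt_0 [simp]: "tilt 0 x = x"
  by (simp add: tilt_def)

lemma norm_tilt [simp]: "norm (tilt a x) = norm x"
proof -
  have "(norm (tilt a x))\<^sup>2 = (Re (fst x))\<^sup>2 + ((cos a * Im (fst x) - sin a * snd x)\<^sup>2 + (sin a * Im (fst x) + cos a * snd x)\<^sup>2)"
    by (simp add: norm_prod_def tilt_def cmod_power2 sum_power2_ge_zero)
  also have "(cos a * Im (fst x) - sin a * snd x)\<^sup>2 + (sin a * Im (fst x) + cos a * snd x)\<^sup>2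
    = (cos a)\<^sup>2 * ((Im (fst x))\<^sup>2 + (snd x)\<^sup>2) + (sin a)\<^sup>2 * ((Im (fst x))\<^sup>2 + (snd x)\<^sup>2)"
    by (simp add: power2_eq_square algebra_simps)
  also have "\<dots> = ((cos a)\<^sup>2 + (sin a)\<^sup>2) * ((Im (fst x))\<^sup>2 + (snd x)\<^sup>2)" by (simp only: distrib_right)
  also have "(Re (fst x))\<^sup>2 + ((cos a)\<^sup>2 + (sin a)\<^sup>2) * ((Im (fst x))\<^sup>2 + (snd x)\<^sup>2) = (norm x)\<^sup>2"
    by (simp add: norm_prod_def cmod_power2 sum_power2_ge_zero)
  finally show ?thesis by (simp add: power2_eq_iff_nonneg)
qed

text \<open>Each sphere about the origin is rotated by an angle that depends on its radius; rotating
  it back gives the inverse.\<close>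

lemma twist_ambient:
  assumes f: "continuous_on UNIV f"
  shows "ambient (\<lambda>x. tilt (f (norm x)) x)"
  unfolding ambient_def
proof (intro exI[of _ "\<lambda>z. tilt (fst z * f (norm (snd z))) (snd z)"] conjI ballI allI)
  have c: "continuous_on A (\<lambda>z::real \<times> R3. f (norm (snd z)))" for A
    by (auto intro!: continuous_on_compose2[OF f] continuous_intros)
  show "continuous_on ({0..1} \<times> UNIV) (\<lambda>z. tilt (fst z * f (norm (snd z))) (snd z))"
    unfolding tilt_def Complex_eq by (intro continuous_intros c)
  show "bij (\<lambda>x. tilt (fst (t, x) * f (norm (snd (t, x)))) (snd (t, x)))" for t
    by (rule o_bij[of "\<lambda>x. tilt (- t * f (norm x)) x"]) (auto simp: fun_eq_iff tilt_tilt)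
  show "proper_family (\<lambda>z. tilt (fst z * f (norm (snd z))) (snd z))"
    unfolding proper_family_def by auto
qed auto

section \<open>Unlinks\<close>

definition circle_at :: "real \<Rightarrow> real \<Rightarrow> real \<Rightarrow> R3"
  where "circle_at \<rho> h t = (of_real \<rho> * cis (2 * pi * t), h)"

lemma unlink_space_link: "unlink n = space_link ((\<lambda>k. circle_at 1 (real k)) ` {..<n})"
proof -
  have "(\<lambda>t. to_S3 (cis (2 * pi * t), real k)) = to_S3 \<circ> circle_at 1 (real k)" for k
    by (simp add: fun_eq_iff circle_at_def)
  then have "{\<lambda>t. to_S3 (cis (2 * pi * t), real k) | k. k < n} = (\<lambda>c. to_S3 \<circ> c) ` (\<lambda>k. circle_at 1 (real k)) ` {..<n}"
    by auto
  then show ?thesis by (simp add: unlink_def space_link_def)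
qed

lemma reparametrization_shift: "reparametrization \<tau> \<Longrightarrow> reparametrization (\<lambda>t. \<tau> t + a)"
  by (auto simp: reparametrization_def strict_mono_def intro!: continuous_intros)

lemma space_link_shift: "space_link (insert (\<lambda>t. c (t + a)) S) = space_link (insert c S)"
proof -
  have sub: "space_link (insert (\<lambda>t. c (t + a)) S) \<subseteq> space_link (insert c S)" for c a
  proof
    fix \<gamma> assume "\<gamma> \<in> space_link (insert (\<lambda>t. c (t + a)) S)"
    then obtain d \<tau> where d: "d = (\<lambda>t. c (t + a)) \<or> d \<in> S" "reparametrization \<tau>" "\<gamma> = (to_S3 \<circ> d) \<circ> \<tau>"
      unfolding space_link_def olink_of_def by blast
    show "\<gamma> \<in> space_link (insert c S)"
    proof (cases "d \<in> S")
      case True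
      then show ?thesis using d unfolding space_link_def olink_of_def by blast
    next
      case False
      then have "\<gamma> = (to_S3 \<circ> c) \<circ> (\<lambda>t. \<tau> t + a)" using d by (auto simp: comp_def)
      then show ?thesis using reparametrization_shift[OF d(2), of a] unfolding space_link_def olink_of_def by blast
    qed
  qed
  show ?thesis
  proof
    show "space_link (insert c S) \<subseteq> space_link (insert (\<lambda>t. c (t + a)) S)"
      using sub[of "\<lambda>t. c (t + a)" "- a"] by simp
  qed (rule sub)
qed

text \<open>A curve whose height rises and falls once meets each horizontal plane between its extremes
  in two points, and an affine map of the plane brings these two points into any prescribed
  position. To obtain it from the unlink, the lowest circle is shrunk, turned upright inside a
  ball that misses the other circles, and then moved by affine maps of the planes at its
  heights.\<close>

lemma unimodal_curve_unlink:
  fixes E l :: "real \<Rightarrow> complex"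
  assumes E: "continuous_on UNIV E" and l: "continuous_on UNIV l" and \<rho>: "\<rho> > 0" and n: "n \<ge> 1"
  shows "isotopic (unlink n) (space_link (insert
      (\<lambda>t. (E (cos (2 * pi * t) / 2) + of_real (sin (2 * pi * t) / 2) * exp (l (cos (2 * pi * t) / 2)), cos (2 * pi * t) / 2))
      ((\<lambda>k. circle_at \<rho> (real k)) ` {1..<n})))"
proof -
  let ?S = "(\<lambda>k. circle_at \<rho> (real k)) ` {1..<n}"
  \<comment> \<open>scales the circle at height \<open>0\<close> to radius \<open>1/2\<close> and those at heights \<open>\<ge> 1\<close> to
    radius \<open>\<rho>\<close>\<close>
  define l1 :: "real \<Rightarrow> complex" where "l1 h = of_real (ln (1/2) * (1 - max 0 (min h 1)) + ln \<rho> * max 0 (min h 1))" for h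
  define f1 :: "R3 \<Rightarrow> R3" where "f1 x = (0 + exp (l1 (snd x)) * fst x, snd x)" for x
  have "continuous_on UNIV l1" unfolding l1_def by (intro continuous_intros)
  then have a1: "ambient f1" unfolding f1_def[abs_def] by (intro fibred_affine_ambient) auto
  have l10: "exp (l1 0) = 1/2" by (simp add: l1_def exp_of_real[symmetric] del: of_real_exp)
      (simp add: exp_of_real exp_minus)
  have l1k: "exp (l1 (real k)) = of_real \<rho>" if "k \<ge> 1" for k
    using that \<rho> by (simp add: l1_def exp_of_real)
  have "f1 \<circ> circle_at 1 0 = circle_at (1/2) 0"
    by (simp add: fun_eq_iff f1_def circle_at_def l10)
  moreover have "f1 \<circ> circle_at 1 (real k) = circle_at \<rho> (real k)" if "k \<ge> 1" for k
    using l1k[OF that] by (simp add: fun_eq_iff f1_def circle_at_def)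
  moreover have "{..<n} = insert 0 {1..<n}" using n by auto
  ultimately have i1: "(\<lambda>c. f1 \<circ> c) ` (\<lambda>k. circle_at 1 (real k)) ` {..<n} = insert (circle_at (1/2) 0) ?S"
    by (auto simp: image_image)
  \<comment> \<open>a quarter turn of the ball of radius \<open>1/2\<close> that fades out towards the unit sphere\<close>
  define f2 :: "R3 \<Rightarrow> R3" where "f2 x = tilt (- (pi / 2) * max 0 (min 1 (2 - 2 * norm x))) x" for x
  have a2: "ambient f2" unfolding f2_def[abs_def] by (intro twist_ambient continuous_intros)
  have nc: "norm (circle_at \<sigma> h t) = sqrt (\<sigma>\<^sup>2 + h\<^sup>2)" for \<sigma> h t
    by (simp add: circle_at_def norm_prod_def norm_mult)
  have "f2 (circle_at \<rho> (real k) t) = circle_at \<rho> (real k) t" if "k \<ge> 1" for k t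
  proof -
    have "1 \<le> sqrt (\<rho>\<^sup>2 + (real k)\<^sup>2)" using that by (intro real_le_rsqrt) (simp add: add_increasing)
    then have "max 0 (min 1 (2 - 2 * sqrt (\<rho>\<^sup>2 + (real k)\<^sup>2))) = 0" by (simp del: real_sqrt_ge_1_iff)
    then show ?thesis unfolding f2_def nc by (simp only: mult_zero_right tilt_0)
  qed
  then have "f2 \<circ> circle_at \<rho> (real k) = circle_at \<rho> (real k)" if "k \<ge> 1" for k using that by (simp add: fun_eq_iff)
  moreover have v: "f2 \<circ> circle_at (1/2) 0 = (\<lambda>t. (of_real (cos (2 * pi * t) / 2), - sin (2 * pi * t) / 2))"
  proof
    fix t
    have "norm (circle_at (1/2) 0 t) = 1/2" by (simp add: nc)
    then show "(f2 \<circ> circle_at (1/2) 0) t = (of_real (cos (2 * pi * t) / 2), - sin (2 * pi * t) / 2)"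
      by (simp add: f2_def) (simp add: tilt_def circle_at_def complex_eq_iff)
  qed
  ultimately have i2: "(\<lambda>c. f2 \<circ> c) ` insert (circle_at (1/2) 0) ?S
      = insert (\<lambda>t. (of_real (cos (2 * pi * t) / 2), - sin (2 * pi * t) / 2)) ?S"
    by (auto simp: image_image)
  define V :: "real \<Rightarrow> R3" where "V t = (of_real (sin (2 * pi * t) / 2), cos (2 * pi * t) / 2)" for t
  define v where "v = (\<lambda>t. (of_real (cos (2 * pi * t) / 2), - sin (2 * pi * t) / 2) :: R3)"
  \<comment> \<open>the parametrization that starts at the top of the upright circle\<close>
  have V: "V = (\<lambda>t. v (t + (-1/4)))"
  proof
    fix t :: real
    have e: "2 * pi * (t + - 1 / 4) = 2 * pi * t - pi / 2" by (simp add: algebra_simps)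
    show "V t = v (t + (-1/4))"
      unfolding V_def v_def e by (simp add: cos_diff sin_diff)
  qed
  have i3: "space_link (insert (\<lambda>t. (of_real (cos (2 * pi * t) / 2), - sin (2 * pi * t) / 2)) ?S) = space_link (insert V ?S)"
    unfolding V space_link_shift by (simp add: v_def)
  \<comment> \<open>equal to \<open>1\<close> on the heights of the upright circle and to \<open>0\<close> on those of the other
    circles\<close>
  define \<mu> where "\<mu> h = max 0 (min 1 (2 - 2 * \<bar>h\<bar>))" for h :: real
  have \<mu>: "continuous_on UNIV \<mu>" unfolding \<mu>_def by (intro continuous_intros)
  define f3 :: "R3 \<Rightarrow> R3" where "f3 x = (of_real (\<mu> (snd x)) * E (snd x) + exp (of_real (\<mu> (snd x)) * l (snd x)) * fst x, snd x)" for x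
  have a3: "ambient f3" unfolding f3_def[abs_def]
    by (intro fibred_affine_ambient continuous_intros E l \<mu>)
  have "f3 \<circ> circle_at \<rho> (real k) = circle_at \<rho> (real k)" if "k \<ge> 1" for k
    using that by (simp add: fun_eq_iff f3_def circle_at_def \<mu>_def)
  moreover have "f3 \<circ> V = (\<lambda>t. (E (cos (2 * pi * t) / 2) + of_real (sin (2 * pi * t) / 2) * exp (l (cos (2 * pi * t) / 2)), cos (2 * pi * t) / 2))"
  proof
    fix t :: real
    have "\<mu> (cos (2 * pi * t) / 2) = 1"
      using abs_cos_le_one[of "2 * pi * t"] by (simp add: \<mu>_def)
    then show "(f3 \<circ> V) t = (E (cos (2 * pi * t) / 2) + of_real (sin (2 * pi * t) / 2) * exp (l (cos (2 * pi * t) / 2)), cos (2 * pi * t) / 2)"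
      by (simp add: f3_def V_def)
  qed
  ultimately have i4: "(\<lambda>c. f3 \<circ> c) ` insert V ?S = insert
      (\<lambda>t. (E (cos (2 * pi * t) / 2) + of_real (sin (2 * pi * t) / 2) * exp (l (cos (2 * pi * t) / 2)), cos (2 * pi * t) / 2)) ?S"
    by (auto simp: image_image)
  show ?thesis
    using ambient_space_link[OF a1, of "(\<lambda>k. circle_at 1 (real k)) ` {..<n}"]
      ambient_space_link[OF a2, of "insert (circle_at (1/2) 0) ?S"] ambient_space_link[OF a3, of "insert V ?S"]
    unfolding unlink_space_link i1 i2 i3 i4 using isotopic_trans by blast
qed

text \<open>A nowhere vanishing continuous function on the line is an exponential.\<close>

lemma nonvanishing_difference_unlink:
  fixes E D :: "real \<Rightarrow> complex"
  assumes E: "continuous_on UNIV E" and D: "continuous_on UNIV D" "\<And>c. D c \<noteq> 0" and \<rho>: "\<rho> > 0" and n: "n \<ge> 1"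
  shows "isotopic (unlink n) (space_link (insert
      (\<lambda>t. (E (cos (2 * pi * t)) + of_real (sin (2 * pi * t) / 2) * D (cos (2 * pi * t)), cos (2 * pi * t) / 2))
      ((\<lambda>k. circle_at \<rho> (real k)) ` {1..<n})))"
proof -
  have "contractible (UNIV :: real set)" by (intro convex_imp_contractible) auto
  then obtain g where g: "continuous_on UNIV g" "\<And>c. D c = exp (g c)"
    using continuous_logarithm_on_contractible[OF D(1)] D(2) by (metis UNIV_I)
  have "isotopic (unlink n) (space_link (insert
      (\<lambda>t. (E (2 * (cos (2 * pi * t) / 2)) + of_real (sin (2 * pi * t) / 2) * exp (g (2 * (cos (2 * pi * t) / 2))), cos (2 * pi * t) / 2))
      ((\<lambda>k. circle_at \<rho> (real k)) ` {1..<n})))"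
    by (rule unimodal_curve_unlink[OF _ _ \<rho> n])
      (auto intro!: continuous_on_compose2[OF E] continuous_on_compose2[OF g(1)] continuous_intros)
  then show ?thesis by (simp add: g(2))
qed

section \<open>Closed braids that are unlinks\<close>

lemma vector_3_eq: "(vector [a, b, c] :: 'a::zero ^ 3) = (\<chi> i. if i = 1 then a else if i = 2 then b else c)"
  by (simp add: vec_eq_iff forall_3)

lemma continuous_on_vector_3:
  fixes f g h :: "'b::topological_space \<Rightarrow> complex"
  assumes "continuous_on A f" "continuous_on A g" "continuous_on A h"
  shows "continuous_on A (\<lambda>x. vector [f x, g x, h x] :: complex ^ 3)"
proof -
  have "continuous_on A (\<lambda>x. if i = 1 then f x else if i = 2 then g x else h x)" for i :: 3
    using assms by (cases "i = 1"; cases "i = 2") auto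
  then show ?thesis unfolding vector_3_eq by (intro continuous_on_vec_lambda)
qed

lemma closed_braidI:
  fixes W :: "real \<Rightarrow> complex ^ 3"
  assumes \<pi>: "bij \<pi>" and c: "continuous_on UNIV W" and p: "\<And>s i. W (s + 1) $ i = W s $ \<pi> i"
    and g: "\<And>s. s \<in> {0..1} \<Longrightarrow> W s \<in> config"
  shows "closed_braid \<pi> W"
proof -
  have step: "W (s + 1) \<in> config \<longleftrightarrow> W s \<in> config" for s
  proof -
    have e: "W (s + 1) = relabel \<pi> (W s)" by (simp add: vec_eq_iff p)
    have "W s = relabel (inv \<pi>) (W (s + 1))"
      using \<pi> by (simp add: e vec_eq_iff surj_f_inv_f bij_is_surj)
    then show ?thesis using config_relabel[OF \<pi>, of "W s"] config_relabel[OF bij_imp_bij_inv[OF \<pi>], of "W (s + 1)"] e by metis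
  qed
  have "W (s + of_int k) \<in> config" if "s \<in> {0..1}" for s k
  proof (induction k rule: int_induct[where k = 0])
    case base then show ?case using g[OF that] by simp
  next
    case (step1 i) then show ?case using step[of "s + of_int i"] by (simp add: ac_simps)
  next
    case (step2 i) then show ?case using step[of "s + of_int (i - 1)"] by (simp add: algebra_simps)
  qed
  from this[of "frac s" "\<lfloor>s\<rfloor>" for s] have "W s \<in> config" for s
    by (simp add: less_imp_le frac_lt_1) (simp add: frac_def)
  then show ?thesis using c p by (auto simp: closed_braid_def config_iff inj_def)
qed

lemma loops_isotopic:
  fixes Z :: "real \<Rightarrow> real \<Rightarrow> complex ^ 3"
  assumes "bij \<pi>" "continuous_on ({0..1} \<times> {0..1}) (\<lambda>z. Z (fst z) (snd z))"
    and "\<And>t. t \<in> {0..1} \<Longrightarrow> Z t 1 = relabel \<pi> (Z t 0)"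
    and c: "\<And>t s. t \<in> {0..1} \<Longrightarrow> s \<in> {0..1} \<Longrightarrow> Z t s \<in> config"
  shows "isotopic (braided (path_points (Z 0))) (braided (path_points (Z 1)))"
  by (rule homotopic_loops_isotopic[OF assms(1,2)]) (use assms(3) c in \<open>auto simp: config_iff inj_def\<close>)

lemma strand_points_path_points: "closed_braid \<pi> W \<Longrightarrow> strand_points W = path_points W"
  by (simp add: strand_points_unit path_points_def)

text \<open>The three circles are moved, without meeting, to the same radius and different heights.\<close>

theorem unlink_3_braid: "isotopic (braid_closure 3 []) (unlink 3)"
proof -
  define Z :: "real \<Rightarrow> real \<Rightarrow> complex ^ 3"
    where "Z t s = vector [1, Complex (2 - t) t, Complex (3 - 2 * t) (2 * t)]" for t s
  have cfg: "Z t s \<in> config" if "t \<in> {0..1}" for t s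
    using that by (auto simp: Z_def config_def complex_eq_iff)
  have 1: "isotopic (braided (path_points (Z 0))) (braided (path_points (Z 1)))"
  proof (rule loops_isotopic[of id])
    show "continuous_on ({0..1} \<times> {0..1}) (\<lambda>z. Z (fst z) (snd z))"
      unfolding Z_def Complex_eq by (intro continuous_on_vector_3 continuous_intros)
  qed (use cfg in \<open>auto simp: Z_def vec_eq_iff\<close>)
  have Z0: "Z 0 = wpath [] std"
    by (simp add: fun_eq_iff vec_eq_iff forall_3 Z_def linepath_def algebra_simps complex_eq_iff)
  have "homotopic_paths config (wpath [] std) (wpath [] std)"
    using wpath_basic[of "[]" std] standard_std by (simp add: homotopic_paths_refl del: wpath.simps)
  then have 0: "isotopic (braid_closure 3 []) (braided (path_points (Z 0)))"
    unfolding Z0 by (intro isotopic_path_points_braid_closure) (auto simp: braid_word_def)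
  have W: "closed_braid id (Z 1)"
    by (rule closed_braidI) (use cfg[of 1] in \<open>simp_all, simp_all add: Z_def\<close>)
  have o: "orbit_data (id :: 3 \<Rightarrow> 3) UNIV (\<lambda>_. 1)"
    by (auto simp: orbit_data_def)
  have s: "strand_curve (Z 1) 1 1 = circle_at 1 0" "strand_curve (Z 1) 1 2 = circle_at 1 1" "strand_curve (Z 1) 1 3 = circle_at 1 2"
    by (simp_all add: fun_eq_iff strand_curve_def Z_def page_def circle_at_def)
  have k: "{..<3::nat} = {0, 1, 2}" by auto
  have "braided (path_points (Z 1)) = space_link ((\<lambda>i. strand_curve (Z 1) 1 i) ` UNIV)"
    using braided_eq_space_link[OF W o] strand_points_path_points[OF W] by simp
  also have "\<dots> = unlink 3"
    unfolding unlink_space_link UNIV_3 k by (simp add: s[unfolded One_nat_def])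
  finally show ?thesis using isotopic_trans[OF 0 1] by simp
qed

lemma funpow_transpose: "(Transposition.transpose a b ^^ n) i = (if even n then i else Transposition.transpose a b i)"
  by (induction n) auto

text \<open>Two points rotate about each other by half a turn. Shifting the phase of this rotation by
  a quarter turn makes the height of the component that they trace equal to half a cosine, which
  rises and falls once during its two turns about the axis; the third strand is meanwhile lifted
  out of the way to height one.\<close>

theorem unlink_2_braid:
  assumes \<epsilon>: "\<epsilon> \<in> {1, -1}"
  shows "isotopic (unlink 2) (braid_closure 3 [\<epsilon>])"
proof -
  define e :: real where "e = of_int \<epsilon>"
  have e: "e = 1 \<or> e = -1" using \<epsilon> by (auto simp: e_def)
  have l: "letter \<epsilon>" using \<epsilon> by (auto simp: letter_def)
  define \<pi> :: "3 \<Rightarrow> 3" where "\<pi> = Transposition.transpose 1 2"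
  have \<pi>: "bij \<pi>" by (simp add: \<pi>_def)
  have \<pi>s: "\<pi> 1 = 2" "\<pi> 2 = 1" "\<pi> 3 = 3" by (simp_all add: \<pi>_def)
  define Z :: "real \<Rightarrow> real \<Rightarrow> complex ^ 3"
    where "Z t s = vector [3/2 - cis (t * pi / 2 - e * pi * s) / 2, 3/2 + cis (t * pi / 2 - e * pi * s) / 2, Complex 3 t]" for t s
  have cfg: "Z t s \<in> config" for t s
  proof -
    let ?z = "cis (t * pi / 2 - e * pi * s)"
    define a b where "a = 3/2 - ?z / 2" and "b = 3/2 + ?z / 2"
    have r: "-1 \<le> Re ?z" "Re ?z \<le> 1" by simp_all
    have "b - a = ?z" by (simp add: a_def b_def field_simps)
    then have "a \<noteq> b" by auto
    moreover have "Re a = 3/2 - Re ?z / 2" "Re b = 3/2 + Re ?z / 2" by (simp_all add: a_def b_def)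
    then have "Re a \<le> 2" "Re b \<le> 2" "Re a > 0" "Re b > 0" using r by linarith+
    moreover from this have "a \<noteq> Complex 3 t" "b \<noteq> Complex 3 t" by auto
    ultimately show ?thesis unfolding Z_def config_def a_def[symmetric] b_def[symmetric] by simp
  qed
  have cis_flip: "cis (x - e * pi * (s + 1)) = - cis (x - e * pi * s)" for x s
    using e by (auto simp: complex_eq_iff cos_diff sin_diff distrib_left cos_add sin_add)
  have flip: "Z t (s + 1) = relabel \<pi> (Z t s)" for t s
    unfolding Z_def vec_eq_iff forall_3 by (simp add: \<pi>s cis_flip)
  have cis_c: "continuous_on A (\<lambda>z. cis (f z))" if "continuous_on A f" for A and f :: "'b::topological_space \<Rightarrow> real"
    unfolding cis_conv_exp by (intro continuous_intros that)
  have 1: "isotopic (braided (path_points (Z 0))) (braided (path_points (Z 1)))"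
  proof (rule loops_isotopic[OF \<pi>])
    show "continuous_on ({0..1} \<times> {0..1}) (\<lambda>z. Z (fst z) (snd z))"
      unfolding Z_def Complex_eq by (intro continuous_on_vector_3 continuous_intros cis_c) auto
    show "Z t 1 = relabel \<pi> (Z t 0)" for t using flip[of t 0] by simp
  qed (use cfg in auto)
  have Z0: "Z 0 = lpath \<epsilon> std"
    using \<epsilon> by (auto simp: fun_eq_iff vec_eq_iff forall_3 Z_def e_def complex_eq_iff)
  have b: "braid_word 3 [\<epsilon>]" using \<epsilon> by (auto simp: braid_word_def)
  have 0: "isotopic (braid_closure 3 [\<epsilon>]) (braided (path_points (Z 0)))"
    "isotopic (braided (path_points (Z 0))) (braid_closure 3 [\<epsilon>])"
    unfolding Z0 using wpath_single[OF l standard_std]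
    by (intro isotopic_path_points_braid_closure b; simp add: homotopic_paths_sym)+
  have W: "closed_braid \<pi> (Z 1)"
  proof (rule closed_braidI[OF \<pi>])
    show "continuous_on UNIV (Z 1)"
      unfolding Z_def[abs_def] by (intro continuous_on_vector_3 continuous_intros cis_c) auto
    show "Z 1 (s + 1) $ i = Z 1 s $ \<pi> i" for s i by (simp add: flip)
  qed (rule cfg)
  define m :: "3 \<Rightarrow> nat" where "m i = (if i = 2 then 2 else 1)" for i
  have ex: "\<exists>j\<in>{2, 3}. \<exists>n. (\<pi> ^^ n) j = i" for i
  proof -
    have "(\<pi> ^^ 1) 2 = 1" "(\<pi> ^^ 0) 2 = 2" "(\<pi> ^^ 0) 3 = 3" by (simp_all add: \<pi>s)
    then show ?thesis using exhaust_3[of i] by blast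
  qed
  have o: "orbit_data \<pi> {2, 3} m"
    unfolding orbit_data_def using ex
    by (auto simp: m_def \<pi>_def funpow_transpose split: if_splits)
  have s3: "strand_curve (Z 1) 1 3 = circle_at 3 1"
    by (simp add: fun_eq_iff strand_curve_def Z_def page_def circle_at_def)
  \<comment> \<open>the polynomials in \<open>cos \<phi>\<close> come from the formulas for the double angle\<close>
  define E :: "real \<Rightarrow> complex" where "E c = Complex (3/2 * (2 * c^2 - 1)) (e * (1 - c^2) * c)" for c
  define D :: "real \<Rightarrow> complex" where "D c = Complex (e * (2 * c^2 - 1)) (6 * c)" for c
  have cE: "continuous_on UNIV E" and cD: "continuous_on UNIV D"
    unfolding E_def D_def Complex_eq by (intro continuous_intros)+
  have D0: "D c \<noteq> 0" for c using e by (auto simp: D_def complex_eq_iff)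
  have s2: "strand_curve (Z 1) 2 2 =
     (\<lambda>t. (E (cos (2 * pi * t)) + of_real (sin (2 * pi * t) / 2) * D (cos (2 * pi * t)), cos (2 * pi * t) / 2))"
  proof
    fix t :: real
    define \<phi> where "\<phi> = 2 * pi * t"
    have a: "cis (1 * pi / 2 - e * pi * (real 2 * t)) = Complex (e * sin \<phi>) (cos \<phi>)"
      using e by (auto simp: complex_eq_iff cos_diff sin_diff \<phi>_def ac_simps)
    have b: "2 * pi * (real 2 * t) = 2 * \<phi>" by (simp add: \<phi>_def)
    have "strand_curve (Z 1) 2 2 t = page (3/2 + Complex (e * sin \<phi>) (cos \<phi>) / 2) (2 * \<phi>)"
      unfolding strand_curve_def Z_def vector_3 a b ..
    also have "\<dots> = (of_real (3/2 + e * sin \<phi> / 2) * cis (2 * \<phi>), cos \<phi> / 2)"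
      by (simp add: page_def)
    also have "of_real (3/2 + e * sin \<phi> / 2) * cis (2 * \<phi>) = E (cos \<phi>) + of_real (sin \<phi> / 2) * D (cos \<phi>)"
    proof -
      have s2: "(sin \<phi>)\<^sup>2 = 1 - (cos \<phi>)\<^sup>2" using sin_cos_squared_add[of \<phi>] by linarith
      have "Re (of_real (3/2 + e * sin \<phi> / 2) * cis (2 * \<phi>)) = (3/2 + e * sin \<phi> / 2) * (2 * (cos \<phi>)\<^sup>2 - 1)"
        by (simp flip: cos_double_cos)
      also have "\<dots> = Re (E (cos \<phi>) + of_real (sin \<phi> / 2) * D (cos \<phi>))"
        by (simp add: E_def D_def field_simps)
      finally have re: "Re (of_real (3/2 + e * sin \<phi> / 2) * cis (2 * \<phi>)) = Re (E (cos \<phi>) + of_real (sin \<phi> / 2) * D (cos \<phi>))" .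
      have "Im (of_real (3/2 + e * sin \<phi> / 2) * cis (2 * \<phi>)) = (3/2 + e * sin \<phi> / 2) * (2 * sin \<phi> * cos \<phi>)"
        by (simp flip: sin_double)
      also have "\<dots> = 3 * sin \<phi> * cos \<phi> + e * (sin \<phi>)\<^sup>2 * cos \<phi>" by (simp add: power2_eq_square algebra_simps)
      also have "\<dots> = Im (E (cos \<phi>) + of_real (sin \<phi> / 2) * D (cos \<phi>))"
        unfolding s2 by (simp add: E_def D_def algebra_simps)
      finally show ?thesis using re by (simp add: complex_eq_iff)
    qed
    finally show "strand_curve (Z 1) 2 2 t =
     (E (cos (2 * pi * t)) + of_real (sin (2 * pi * t) / 2) * D (cos (2 * pi * t)), cos (2 * pi * t) / 2)"
      by (simp add: \<phi>_def)
  qed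
  have "braided (path_points (Z 1)) = space_link ((\<lambda>i. strand_curve (Z 1) (m i) i) ` {2, 3})"
    using braided_eq_space_link[OF W o] strand_points_path_points[OF W] by simp
  also have "\<dots> = space_link (insert (strand_curve (Z 1) 2 2) ((\<lambda>k. circle_at 3 (real k)) ` {1..<2}))"
  proof -
    have "{1..<2} = {1::nat}" by auto
    then show ?thesis using s3 by (simp add: m_def)
  qed
  finally have "isotopic (unlink 2) (braided (path_points (Z 1)))"
    unfolding s2 using nonvanishing_difference_unlink[OF cE cD D0, of 3 2] by simp
  moreover have "isotopic (braided (path_points (Z 1))) (braided (path_points (Z 0)))"
    using isotopic_sym_space[OF 1] braided_in_range by blast
  ultimately show ?thesis using 0(2) isotopic_trans by blast
qed

text \<open>The three strands chase one another along the closed curve \<open>(cos \<phi>, g \<phi>)\<close>, a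
  third of a period apart. The assumptions on \<open>g\<close> say that, whenever two of the points exchange
  their order from left to right, they pass each other on the same side as in the letter of the
  word; therefore the chase is homotopic to the word path along straight lines. All strands
  trace the same curve, and after a quarter turn of the half-plane its height is half a cosine,
  which rises and falls once during the three turns about the axis. The form of \<open>g\<close> makes the
  horizontal coordinate a combination of \<open>1\<close> and \<open>sin \<phi>\<close> with coefficients that depend on
  \<open>cos \<phi>\<close>.\<close>

lemma unknot_choreography:
  fixes b :: "real \<Rightarrow> real"
  assumes \<epsilon>: "\<epsilon>1 \<in> {1, -1}" "\<epsilon>2 \<in> {1, -1}" and b: "continuous_on UNIV b" "\<And>c. 4 * c^2 = 1 \<Longrightarrow> b c \<noteq> 0"
    and g: "\<And>\<phi>. g \<phi> = - 2 * b (cos \<phi>) * sin \<phi>" "\<And>\<phi>. \<bar>g \<phi>\<bar> \<le> 1"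
    and H1: "\<And>\<phi>. \<phi> \<in> {- (5 * pi / 6)..- (pi / 2)} \<Longrightarrow> of_int \<epsilon>1 * (g \<phi> - g (\<phi> + 4 * pi / 3)) > 0"
    and H2: "\<And>\<phi>. \<phi> \<in> {- (pi / 2)..- (pi / 6)} \<Longrightarrow> of_int \<epsilon>2 * (g \<phi> - g (\<phi> + 2 * pi / 3)) > 0"
  shows "isotopic (unlink 1) (braid_closure 3 [\<epsilon>1, 2 * \<epsilon>2])"
proof -
  let ?w = "[\<epsilon>1, 2 * \<epsilon>2]"
  have l: "letter \<epsilon>1" "letter (2 * \<epsilon>2)" using \<epsilon> by (auto simp: letter_def)
  have bw: "braid_word 3 ?w" using \<epsilon> by (auto simp: braid_word_def)
  define \<pi> :: "3 \<Rightarrow> 3" where "\<pi> i = (if i = 1 then 3 else if i = 2 then 1 else 2)" for i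
  have \<pi>s: "\<pi> 1 = 3" "\<pi> 2 = 1" "\<pi> 3 = 2" by (simp_all add: \<pi>_def)
  have \<pi>: "bij \<pi>"
  proof -
    have "inj \<pi>" unfolding inj_def forall_3 by (simp add: \<pi>s)
    then show ?thesis by (simp add: bij_def finite_UNIV_inj_surj)
  qed
  define e1 e2 :: real where "e1 = of_int \<epsilon>1" and "e2 = of_int \<epsilon>2"
  have e: "e1 = 1 \<or> e1 = -1" "e2 = 1 \<or> e2 = -1" using \<epsilon> by (auto simp: e1_def e2_def)
  have gp: "g (\<phi> + 2 * pi) = g \<phi>" for \<phi> by (simp add: g(1))
  have cg: "continuous_on A (\<lambda>z. g (f z))" if "continuous_on A f" for A and f :: "'b::real_normed_vector \<Rightarrow> real"
    unfolding g(1) by (intro continuous_intros continuous_on_compose2[OF b(1)] that) auto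
  \<comment> \<open>the word path, with the constant last piece removed\<close>
  define A where "A = lpath \<epsilon>1 std +++ lpath (2 * \<epsilon>2) (vector [2, 1, 3])"
  have p1: "lpath \<epsilon>1 std 1 = vector [2, 1, 3]" using \<epsilon>(1) by (auto simp: vec_eq_iff forall_3 complex_eq_iff)
  have st1: "standard (vector [2, 1, 3])" using standard_lpath_1[OF l(1) standard_std] p1 by simp
  have A1: "A s = vector [3/2 - cis (- (e1 * pi * (2 * s))) / 2, 3/2 + cis (- (e1 * pi * (2 * s))) / 2, 3]" if "s \<le> 1/2" for s
    using that \<epsilon>(1) by (auto simp: A_def joinpaths_def vec_eq_iff forall_3 e1_def)
  have A2: "A s = vector [5/2 - cis (- (e2 * pi * (2 * s - 1))) / 2, 1, 5/2 + cis (- (e2 * pi * (2 * s - 1))) / 2]" if "s > 1/2" for s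
    using that \<epsilon>(2) by (auto simp: A_def joinpaths_def vec_eq_iff forall_3 e2_def)
  have hA: "homotopic_paths config A (wpath ?w std)"
  proof -
    have "homotopic_paths config (lpath \<epsilon>1 std +++ lpath (2 * \<epsilon>2) (vector [2, 1, 3])) (lpath \<epsilon>1 std +++ wpath [2 * \<epsilon>2] (vector [2, 1, 3]))"
    proof (rule homotopic_paths_join)
      show "homotopic_paths config (lpath \<epsilon>1 std) (lpath \<epsilon>1 std)"
        using path_lpath lpath_config[OF l(1) standard_std] by (auto simp: homotopic_paths_refl path_image_def)
      show "homotopic_paths config (lpath (2 * \<epsilon>2) (vector [2, 1, 3])) (wpath [2 * \<epsilon>2] (vector [2, 1, 3]))"
        using wpath_single[OF l(2) st1] by (rule homotopic_paths_sym)
      show "pathfinish (lpath \<epsilon>1 std) = pathstart (lpath (2 * \<epsilon>2) (vector [2, 1, 3]))"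
        using p1 l(2) st1 by (simp add: pathfinish_def pathstart_def)
    qed
    then show ?thesis by (simp add: A_def p1)
  qed
  have "path A" and cA: "continuous_on {0..1} A"
    using homotopic_paths_imp_path[OF hA] by (auto simp: path_def)
  have cfgA: "A s \<in> config" if "s \<in> {0..1}" for s
    using homotopic_paths_imp_subset[OF hA] that by (auto simp: path_image_def)
  have A01: "A 0 = std" "A 1 = vector [3, 1, 2]"
    using A1[of 0] A2[of 1] e by (auto simp: vec_eq_iff forall_3 complex_eq_iff)
  \<comment> \<open>three points that follow one another on the same closed curve\<close>
  \<comment> \<open>at this phase the cosines of the three points increase in the order of the labels\<close>
  define \<phi> where "\<phi> s = - (5 * pi / 6) + 2 * pi * s / 3" for s
  define c where "c x = Complex (cos x) (g x)" for x
  define B :: "real \<Rightarrow> complex ^ 3"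
    where "B s = vector [c (\<phi> s), c (\<phi> s + 4 * pi / 3), c (\<phi> s + 2 * pi / 3)]" for s
  have cp: "c (x + 2 * pi) = c x" for x by (simp add: c_def gp)
  have Bflip: "B (s + 1) = relabel \<pi> (B s)" for s
  proof -
    have "\<phi> (s + 1) = \<phi> s + 2 * pi / 3" by (simp add: \<phi>_def field_simps)
    moreover have "c (\<phi> s + 2 * pi / 3 + 4 * pi / 3) = c (\<phi> s)" using cp[of "\<phi> s"] by (simp add: algebra_simps)
    moreover have "\<phi> s + 2 * pi / 3 + 2 * pi / 3 = \<phi> s + 4 * pi / 3" by simp
    ultimately show ?thesis unfolding B_def vec_eq_iff forall_3 by (simp add: \<pi>s add.commute)
  qed
  have cosneg: "cos x < 0" if "x \<in> {5 * pi / 6..7 * pi / 6}" for x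
  proof -
    have "cos (x - pi) > 0" using that[unfolded atLeastAtMost_iff] pi_gt_zero by (intro cos_gt_zero_pi) linarith+
    then show ?thesis by (simp add: cos_diff)
  qed
  have B1: "Re (B s $ 1) < Re (B s $ 3)" "Re (B s $ 2) < Re (B s $ 3)" "e1 * (Im (B s $ 1) - Im (B s $ 2)) > 0"
    if s: "s \<in> {0..1/2}" for s
  proof -
    have "pi * 0 \<le> pi * s" "pi * s \<le> pi * (1/2)" using s by (intro mult_left_mono; simp)+
    then have r: "\<phi> s \<in> {- (5 * pi / 6)..- (pi / 2)}" unfolding \<phi>_def atLeastAtMost_iff by linarith
    have "cos (\<phi> s) \<le> 0"
    proof -
      have "cos (\<phi> s + pi) \<ge> 0" using r[unfolded atLeastAtMost_iff] pi_gt_zero by (intro cos_ge_zero) linarith+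
      then show ?thesis by (simp add: cos_add)
    qed
    moreover have "cos (\<phi> s + 4 * pi / 3) \<le> 0"
    proof -
      define x where "x = \<phi> s + 4 * pi / 3"
      have "cos (x - pi) \<ge> 0" using r[unfolded atLeastAtMost_iff] pi_gt_zero unfolding x_def by (intro cos_ge_zero) linarith+
      then show ?thesis by (simp add: cos_diff flip: x_def)
    qed
    moreover have "cos (\<phi> s + 2 * pi / 3) > 0" using r[unfolded atLeastAtMost_iff] pi_gt_zero by (intro cos_gt_zero_pi) linarith+
    ultimately show "Re (B s $ 1) < Re (B s $ 3)" "Re (B s $ 2) < Re (B s $ 3)" by (simp_all add: B_def c_def)
    show "e1 * (Im (B s $ 1) - Im (B s $ 2)) > 0" using H1[OF r] by (simp add: B_def c_def e1_def)
  qed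
  have B2: "Re (B s $ 2) < Re (B s $ 1)" "Re (B s $ 2) < Re (B s $ 3)" "e2 * (Im (B s $ 1) - Im (B s $ 3)) > 0"
    if s: "s \<in> {1/2..1}" for s
  proof -
    have "pi * (1/2) \<le> pi * s" "pi * s \<le> pi * 1" using s by (intro mult_left_mono; simp)+
    then have r: "\<phi> s \<in> {- (pi / 2)..- (pi / 6)}" unfolding \<phi>_def atLeastAtMost_iff by linarith
    have "cos (\<phi> s) \<ge> 0" using r[unfolded atLeastAtMost_iff] pi_gt_zero by (intro cos_ge_zero) linarith+
    moreover have "cos (\<phi> s + 4 * pi / 3) < 0" using r[unfolded atLeastAtMost_iff] pi_gt_zero by (intro cosneg, unfold atLeastAtMost_iff) linarith
    moreover have "cos (\<phi> s + 2 * pi / 3) \<ge> 0" using r[unfolded atLeastAtMost_iff] pi_gt_zero by (intro cos_ge_zero) linarith+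
    ultimately show "Re (B s $ 2) < Re (B s $ 1)" "Re (B s $ 2) < Re (B s $ 3)" by (simp_all add: B_def c_def)
    show "e2 * (Im (B s $ 1) - Im (B s $ 3)) > 0" using H2[OF r] by (simp add: B_def c_def e2_def)
  qed
  have Bneq: "B s $ 1 \<noteq> B s $ 2" "B s $ 1 \<noteq> B s $ 3" "B s $ 2 \<noteq> B s $ 3" if "s \<in> {0..1}" for s
  proof -
    have "s \<in> {0..1/2} \<or> s \<in> {1/2..1}" using that by auto
    then have "B s $ 1 \<noteq> B s $ 2 \<and> B s $ 1 \<noteq> B s $ 3 \<and> B s $ 2 \<noteq> B s $ 3"
      using B1[of s] B2[of s] by (metis diff_self less_irrefl mult_zero_right)
    then show "B s $ 1 \<noteq> B s $ 2" "B s $ 1 \<noteq> B s $ 3" "B s $ 2 \<noteq> B s $ 3" by auto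
  qed
  have cB: "continuous_on A' (\<lambda>z. B (f z))" if "continuous_on A' f" for A' and f :: "'b::real_normed_vector \<Rightarrow> real"
    unfolding B_def c_def \<phi>_def Complex_eq using that
    by (intro continuous_on_vector_3 continuous_intros cg) auto
  have ReB: "\<bar>Re (B s $ i)\<bar> \<le> 1" for s i
    using exhaust_3[of i] by (auto simp: B_def c_def)
  \<comment> \<open>from the word path to the chase, along straight lines\<close>
  define Y :: "real \<Rightarrow> real \<Rightarrow> complex ^ 3"
    where "Y t s = (1 - t) *\<^sub>R A s + t *\<^sub>R (\<chi> i. 2 + B s $ i)" for t s
  have Ynth: "Re (Y t s $ i) = (1 - t) * Re (A s $ i) + t * (2 + Re (B s $ i))"
    "Im (Y t s $ i) = (1 - t) * Im (A s $ i) + t * Im (B s $ i)" for t s i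
    by (simp_all add: Y_def)
  have less_comb: "(1 - t) * a + t * (2 + b) < (1 - t) * a' + t * (2 + b')" if "a < a'" "b < b'" "0 \<le> t" "t \<le> 1" for t a b a' b' :: real
    using convex_comb_pos[of t "a' - a" "b' - b"] that by (simp add: algebra_simps)
  have crossing_neq: "(1 - t) *\<^sub>R p + t *\<^sub>R q \<noteq> (1 - t) *\<^sub>R p' + t *\<^sub>R q'"
    if t: "0 \<le> t" "t \<le> 1" and p: "p \<noteq> p'" "e' * (Im p - Im p') \<ge> 0" and q: "e' * (Im q - Im q') > 0" for t e' and p p' q q' :: complex
  proof
    assume eq: "(1 - t) *\<^sub>R p + t *\<^sub>R q = (1 - t) *\<^sub>R p' + t *\<^sub>R q'"
    show False
    proof (cases "t = 0")
      case True then show False using eq p by simp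
    next
      case False
      have "Im ((1 - t) *\<^sub>R p + t *\<^sub>R q) = Im ((1 - t) *\<^sub>R p' + t *\<^sub>R q')" using eq by simp
      then have "e' * ((1 - t) * (Im p - Im p') + t * (Im q - Im q')) = 0" by (simp add: algebra_simps)
      then have "(1 - t) * (e' * (Im p - Im p')) + t * (e' * (Im q - Im q')) = 0" by (simp add: algebra_simps)
      moreover have "(1 - t) * (e' * (Im p - Im p')) \<ge> 0" using t p by simp
      moreover have "t * (e' * (Im q - Im q')) > 0" using False t q by simp
      ultimately show False by linarith
    qed
  qed
  have Ycfg: "Y t s \<in> config" if t: "t \<in> {0..1}" and s: "s \<in> {0..1}" for t s
  proof -
    have pos: "Re (Y t s $ i) > 0" for i
      unfolding Ynth using cfgA[OF s] ReB[of s i] t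
      by (intro convex_comb_pos) (auto simp: config_iff abs_le_iff)
    have An: "A s $ 1 \<noteq> A s $ 2" "A s $ 1 \<noteq> A s $ 3" using cfgA[OF s] by (auto simp: config_def)
    have Ye: "Y t s $ i = (1 - t) *\<^sub>R (A s $ i) + t *\<^sub>R (2 + B s $ i)" for i by (simp add: Y_def)
    have "Y t s $ 1 \<noteq> Y t s $ 2 \<and> Y t s $ 1 \<noteq> Y t s $ 3 \<and> Y t s $ 2 \<noteq> Y t s $ 3"
    proof (cases "s \<le> 1/2")
      case True
      have s': "s \<in> {0..1/2}" using True s by auto
      let ?x = "e1 * pi * (2 * s)"
      have "Re (A s $ 1) < Re (A s $ 3)" "Re (A s $ 2) < Re (A s $ 3)"
        unfolding A1[OF True] using cos_ge_minus_one[of ?x] cos_le_one[of ?x] by (auto simp del: cos_ge_minus_one cos_le_one)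
      then have "Re (Y t s $ 1) < Re (Y t s $ 3)" "Re (Y t s $ 2) < Re (Y t s $ 3)"
        unfolding Ynth using B1[OF s'] t by (auto intro!: less_comb)
      moreover have "Y t s $ 1 \<noteq> Y t s $ 2"
        unfolding Ye
      proof (rule crossing_neq[of _ _ _ e1])
        have "sin (pi * (2 * s)) \<ge> 0" using s' by (intro sin_ge_zero) (auto simp: mult_le_cancel_left1)
        then show "e1 * (Im (A s $ 1) - Im (A s $ 2)) \<ge> 0"
          unfolding A1[OF True] using e(1) by auto
      qed (use t An B1[OF s'] in auto)
      ultimately show ?thesis by auto
    next
      case False
      have s': "s \<in> {1/2..1}" using False s by auto
      have f: "s > 1/2" using False by simp
      let ?x = "e2 * pi * (2 * s - 1)"
      have "Re (A s $ 2) < Re (A s $ 1)" "Re (A s $ 2) < Re (A s $ 3)"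
        unfolding A2[OF f] using cos_ge_minus_one[of ?x] cos_le_one[of ?x] by (auto simp del: cos_ge_minus_one cos_le_one)
      then have "Re (Y t s $ 2) < Re (Y t s $ 1)" "Re (Y t s $ 2) < Re (Y t s $ 3)"
        unfolding Ynth using B2[OF s'] t by (auto intro!: less_comb)
      moreover have "Y t s $ 1 \<noteq> Y t s $ 3"
        unfolding Ye
      proof (rule crossing_neq[of _ _ _ e2])
        have "sin (pi * (2 * s - 1)) \<ge> 0" using s' by (intro sin_ge_zero) (auto simp: mult_le_cancel_left1)
        then show "e2 * (Im (A s $ 1) - Im (A s $ 3)) \<ge> 0"
          unfolding A2[OF f] using e(2) by auto
      qed (use t An B2[OF s'] in auto)
      ultimately show ?thesis by auto
    qed
    then show ?thesis using pos by (auto simp: config_def)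
  qed
  have B01: "B 1 = relabel \<pi> (B 0)" using Bflip[of 0] by simp
  have 1: "isotopic (braided (path_points (Y 0))) (braided (path_points (Y 1)))"
  proof (rule loops_isotopic[OF \<pi>])
    show "continuous_on ({0..1} \<times> {0..1}) (\<lambda>z. Y (fst z) (snd z))"
      unfolding Y_def by (intro continuous_intros cB continuous_on_compose2[OF cA]) auto
    show "Y t 1 = relabel \<pi> (Y t 0)" for t
      unfolding Y_def A01 B01 vec_eq_iff forall_3 by (simp add: \<pi>s)
  qed (rule Ycfg)
  \<comment> \<open>a quarter turn about the point \<open>2\<close>, with scaling by \<open>1/2\<close>, makes the real direction vertical\<close>
  define X :: "real \<Rightarrow> real \<Rightarrow> complex ^ 3"
    where "X t s = (\<chi> i. 2 + of_real (1 - t / 2) * cis (t * pi / 2) * B s $ i)" for t s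
  have Xcfg: "X t s \<in> config" if t: "t \<in> {0..1}" and s: "s \<in> {0..1}" for t s
  proof -
    have "cmod (B s $ i) < 2" for i
    proof -
      have "cmod (c x) < 2" for x
      proof -
        have "(cmod (c x))\<^sup>2 = (cos x)\<^sup>2 + (g x)\<^sup>2" by (simp add: c_def cmod_power2)
        moreover have "(cos x)\<^sup>2 \<le> 1" "(g x)\<^sup>2 \<le> 1" using g(2)[of x] by (auto simp: abs_square_le_1)
        ultimately have "(cmod (c x))\<^sup>2 < 2\<^sup>2" by (simp add: power2_eq_square)
        then show ?thesis by (rule power2_less_imp_less) simp
      qed
      then show ?thesis using exhaust_3[of i] by (auto simp: B_def)
    qed
    then have "cmod (of_real (1 - t / 2) * cis (t * pi / 2) * B s $ i) < 2" for i
    proof -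
      have "cmod (of_real (1 - t / 2) * cis (t * pi / 2) * B s $ i) = (1 - t / 2) * cmod (B s $ i)"
        using t by (simp add: norm_mult del: of_real_diff of_real_divide)
      also have "\<dots> \<le> 1 * cmod (B s $ i)" using t by (intro mult_right_mono) auto
      finally show ?thesis using \<open>cmod (B s $ i) < 2\<close> by simp
    qed
    then have pos: "Re (X t s $ i) > 0" for i
    proof -
      define z where "z = of_real (1 - t / 2) * cis (t * pi / 2) * B s $ i"
      have "\<bar>Re z\<bar> \<le> cmod z" "cmod z < 2"
        using \<open>\<And>i. cmod (of_real (1 - t / 2) * cis (t * pi / 2) * B s $ i) < 2\<close>[of i] abs_Re_le_cmod[of z]
        by (simp_all only: z_def)
      moreover have "Re (X t s $ i) = 2 + Re z" by (simp only: X_def vec_lambda_beta z_def plus_complex.sel) simp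
      ultimately show ?thesis by linarith
    qed
    have "complex_of_real (1 - t / 2) \<noteq> 0" using t by (subst of_real_eq_0_iff) auto
    then have nz: "of_real (1 - t / 2) * cis (t * pi / 2) \<noteq> 0" by (simp del: of_real_diff of_real_divide)
    have "X t s $ i \<noteq> X t s $ j" if "B s $ i \<noteq> B s $ j" for i j
      using that nz unfolding X_def by (simp del: of_real_diff of_real_divide mult_eq_0_iff)
    then show ?thesis using Bneq[OF s] pos by (simp add: config_def)
  qed
  have 2: "isotopic (braided (path_points (X 0))) (braided (path_points (X 1)))"
  proof (rule loops_isotopic[OF \<pi>])
    show "continuous_on ({0..1} \<times> {0..1}) (\<lambda>z. X (fst z) (snd z))"
      unfolding X_def cis_conv_exp by (intro continuous_intros cB) auto
    show "X t 1 = relabel \<pi> (X t 0)" for t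
      unfolding X_def B01 vec_eq_iff by simp
  qed (rule Xcfg)
  have Y0: "Y 0 = A" by (simp add: fun_eq_iff Y_def)
  have Y1: "Y 1 = X 0" by (simp add: fun_eq_iff Y_def X_def vec_eq_iff)
  have W: "closed_braid \<pi> (X 1)"
  proof (rule closed_braidI[OF \<pi>])
    show "continuous_on UNIV (X 1)"
      unfolding X_def[abs_def] by (intro continuous_intros cB)
    show "X 1 (s + 1) $ i = X 1 s $ \<pi> i" for s i by (simp add: X_def Bflip)
  qed (rule Xcfg, auto)
  have p3: "(\<pi> ^^ 3) i = i" for i using exhaust_3[of i] by (auto simp: eval_nat_numeral \<pi>s)
  have ex: "\<exists>j\<in>{1}. \<exists>n. (\<pi> ^^ n) j = i" for i
  proof -
    have "(\<pi> ^^ 0) 1 = 1" "(\<pi> ^^ 2) 1 = 2" "(\<pi> ^^ 1) 1 = 3" by (simp_all add: \<pi>s eval_nat_numeral)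
    then show ?thesis using exhaust_3[of i] by blast
  qed
  have dvd3: "(\<pi> ^^ n) 1 = 1 \<longleftrightarrow> 3 dvd n" for n
  proof -
    have "(\<pi> ^^ n) 1 = (\<pi> ^^ (n mod 3 + 3 * (n div 3))) 1" by simp
    also have "\<dots> = (\<pi> ^^ (n mod 3)) 1" unfolding funpow_add comp_apply using funpow_period[OF p3] by metis
    finally have "(\<pi> ^^ n) 1 = (\<pi> ^^ (n mod 3)) 1" .
    moreover have "n mod 3 = 0 \<or> n mod 3 = 1 \<or> n mod 3 = 2" by linarith
    moreover have "(\<pi> ^^ 0) 1 = 1" "(\<pi> ^^ 1) 1 = 3" "(\<pi> ^^ 2) 1 = 2" by (simp_all add: \<pi>s eval_nat_numeral)
    ultimately show ?thesis unfolding dvd_eq_mod_eq_0 by (elim disjE) simp_all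
  qed
  have o: "orbit_data \<pi> {1} (\<lambda>_. 3)"
    unfolding orbit_data_def using ex dvd3 by auto
  \<comment> \<open>the polynomials in \<open>cos x\<close> come from the formulas for the triple angle\<close>
  define E :: "real \<Rightarrow> complex" where "E x = Complex (- b x * (1 - x^2) * (4 * x^2 - 1)) (2 * (4 * x^3 - 3 * x))" for x
  define D :: "real \<Rightarrow> complex" where "D x = Complex (- 4 * (4 * x^2 - 1)) (2 * b x * (4 * x^3 - 3 * x))" for x
  have cE: "continuous_on UNIV E" and cD: "continuous_on UNIV D"
    unfolding E_def D_def Complex_eq by (intro continuous_intros b(1))+
  have D0: "D x \<noteq> 0" for x
  proof
    assume D: "D x = 0"
    then have x: "4 * x^2 = 1" by (simp add: D_def complex_eq_iff)
    have "4 * x^3 - 3 * x = (4 * x^2) * x - 3 * x" by (simp add: power3_eq_cube power2_eq_square)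
    then have "4 * x^3 - 3 * x = - 2 * x" unfolding x by simp
    moreover have "x \<noteq> 0" using x by auto
    ultimately show False using D b(2)[OF x] by (simp add: D_def complex_eq_iff)
  qed
  define \<psi> where "\<psi> = (\<lambda>t. (E (cos (2 * pi * t)) + of_real (sin (2 * pi * t) / 2) * D (cos (2 * pi * t)), cos (2 * pi * t) / 2))"
  have curve: "strand_curve (X 1) 3 1 t = \<psi> (t + (-5/12))" for t
  proof -
    define x where "x = \<phi> (3 * t)"
    have x: "x = 2 * pi * (t + (-5/12))" by (simp add: x_def \<phi>_def field_simps)
    have a: "cis (2 * pi * (real 3 * t)) = \<i> * cis (3 * x)"
    proof -
      have "2 * pi * (real 3 * t) = (pi / 2 + 3 * x) + 2 * pi" by (simp add: x field_simps)
      then have "cis (2 * pi * (real 3 * t)) = cis (pi / 2 + 3 * x)" by (metis cis_mult cis_2pi mult.right_neutral)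
      also have "\<dots> = \<i> * cis (3 * x)" by (simp flip: cis_mult)
      finally show ?thesis .
    qed
    have "X 1 (3 * t) $ 1 = 2 + \<i> * c x / 2" by (simp add: X_def B_def x_def)
    then have "strand_curve (X 1) 3 1 t = page (2 + \<i> * c x / 2) (2 * pi * (real 3 * t))"
      by (simp add: strand_curve_def)
    also have "\<dots> = (of_real (2 - g x / 2) * (\<i> * cis (3 * x)), cos x / 2)"
      unfolding page_def a by (simp add: c_def)
    also have "of_real (2 - g x / 2) * (\<i> * cis (3 * x)) = E (cos x) + of_real (sin x / 2) * D (cos x)"
    proof -
      have s2: "sin x * sin x = 1 - (cos x)\<^sup>2" using sin_cos_squared_add[of x] by (simp add: power2_eq_square)
      have c3: "cos (3 * x) = 4 * cos x ^ 3 - 3 * cos x" by (rule cos_treble_cos)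
      have s3: "sin (3 * x) = sin x * (4 * (cos x)\<^sup>2 - 1)"
      proof -
        have "sin (3 * x) = sin (2 * x + x)" by simp
        also have "\<dots> = sin x * (4 * (cos x)\<^sup>2 - 1)"
          unfolding sin_add sin_double cos_double_cos by (simp add: power2_eq_square algebra_simps)
        finally show ?thesis .
      qed
      have "Re (of_real (2 - g x / 2) * (\<i> * cis (3 * x))) = - (2 + b (cos x) * sin x) * sin (3 * x)" by (simp add: g(1) algebra_simps)
      also have "\<dots> = - 2 * sin x * (4 * (cos x)\<^sup>2 - 1) - b (cos x) * (sin x * sin x) * (4 * (cos x)\<^sup>2 - 1)"
        unfolding s3 by (simp add: algebra_simps)
      also have "\<dots> = Re (E (cos x) + of_real (sin x / 2) * D (cos x))"
        unfolding s2 by (simp add: E_def D_def field_simps)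
      finally have re: "Re (of_real (2 - g x / 2) * (\<i> * cis (3 * x))) = Re (E (cos x) + of_real (sin x / 2) * D (cos x))" .
      have "Im (of_real (2 - g x / 2) * (\<i> * cis (3 * x))) = (2 + b (cos x) * sin x) * cos (3 * x)" by (simp add: g(1))
      also have "\<dots> = Im (E (cos x) + of_real (sin x / 2) * D (cos x))"
        unfolding c3 by (simp add: E_def D_def field_simps)
      finally show ?thesis using re by (simp add: complex_eq_iff)
    qed
    finally show ?thesis by (simp add: \<psi>_def x)
  qed
  have "braided (path_points (X 1)) = space_link ((\<lambda>i. strand_curve (X 1) 3 i) ` {1})"
    using braided_eq_space_link[OF W o] strand_points_path_points[OF W] by simp
  also have "\<dots> = space_link (insert (\<lambda>t. \<psi> (t + (-5/12))) {})"
  proof -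
    have "strand_curve (X 1) 3 1 = (\<lambda>t. \<psi> (t + (-5/12)))" using curve by (rule ext)
    then show ?thesis by simp
  qed
  also have "\<dots> = space_link (insert \<psi> {})" by (rule space_link_shift)
  finally have "isotopic (unlink 1) (braided (path_points (X 1)))"
    using nonvanishing_difference_unlink[OF cE cD D0, of 1 1] by (simp add: \<psi>_def)
  moreover have "isotopic (braided (path_points (X 1))) (braided (path_points (X 0)))"
    using isotopic_sym_space[OF 2] braided_in_range by blast
  moreover have "isotopic (braided (path_points (X 0))) (braided (path_points A))"
    using isotopic_sym_space[OF 1] braided_in_range unfolding Y0 Y1 by blast
  moreover have "isotopic (braided (path_points A)) (braid_closure 3 ?w)"
    by (rule isotopic_path_points_braid_closure(2)[OF bw hA])
  ultimately show ?thesis using isotopic_trans by blast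
qed

lemma sin_shift_diff: "sin (x + 2 * d) - sin x = 2 * sin d * cos (x + d)" for x d :: real
  unfolding sin_diff_sin by (simp add: add_divide_distrib)

text \<open>For equal signs the points run along a circle, for opposite signs along a figure eight.\<close>

theorem unlink_1_braid:
  assumes \<epsilon>: "\<epsilon>1 \<in> {1, -1}" "\<epsilon>2 \<in> {1, -1}"
  shows "isotopic (unlink 1) (braid_closure 3 [\<epsilon>1, 2 * \<epsilon>2])"
proof -
  define e :: real where "e = of_int \<epsilon>1"
  have e: "e * e = 1" "e \<noteq> 0" "\<bar>e\<bar> = 1" using \<epsilon>(1) by (auto simp: e_def)
  have s3: "sin (pi / 3) > 0" "sin (2 * pi / 3) > 0" "sin (4 * pi / 3) < 0"
    by (auto intro!: sin_gt_zero sin_lt_zero)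
  show ?thesis
  proof (cases "\<epsilon>2 = \<epsilon>1")
    case True
    show ?thesis
    proof (rule unknot_choreography[OF \<epsilon>, of "\<lambda>_. e / 2" "\<lambda>\<phi>. - e * sin \<phi>"])
      show "\<bar>- e * sin \<phi>\<bar> \<le> 1" for \<phi> using e by (simp add: abs_mult)
      show "of_int \<epsilon>1 * (- e * sin \<phi> - - e * sin (\<phi> + 4 * pi / 3)) > 0" if "\<phi> \<in> {- (5 * pi / 6)..- (pi / 2)}" for \<phi>
      proof -
        have "of_int \<epsilon>1 * (- e * sin \<phi> - - e * sin (\<phi> + 4 * pi / 3)) = (e * e) * (sin (\<phi> + 4 * pi / 3) - sin \<phi>)"
          by (simp add: e_def[symmetric] algebra_simps)
        also have "\<dots> = 2 * sin (2 * pi / 3) * cos (\<phi> + 2 * pi / 3)"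
          unfolding e(1) using sin_shift_diff[of \<phi> "2 * pi / 3"] by simp
        also have "\<dots> > 0"
          using that[unfolded atLeastAtMost_iff] s3 pi_gt_zero by (intro mult_pos_pos cos_gt_zero_pi) linarith+
        finally show ?thesis .
      qed
      show "of_int \<epsilon>2 * (- e * sin \<phi> - - e * sin (\<phi> + 2 * pi / 3)) > 0" if "\<phi> \<in> {- (pi / 2)..- (pi / 6)}" for \<phi>
      proof -
        have "of_int \<epsilon>2 * (- e * sin \<phi> - - e * sin (\<phi> + 2 * pi / 3)) = (e * e) * (sin (\<phi> + 2 * pi / 3) - sin \<phi>)"
          unfolding True by (simp add: e_def[symmetric] algebra_simps)
        also have "\<dots> = 2 * sin (pi / 3) * cos (\<phi> + pi / 3)"
          unfolding e(1) using sin_shift_diff[of \<phi> "pi / 3"] by simp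
        also have "\<dots> > 0"
          using that[unfolded atLeastAtMost_iff] s3 pi_gt_zero by (intro mult_pos_pos cos_gt_zero_pi) linarith+
        finally show ?thesis .
      qed
    qed (use e in auto)
  next
    case False
    then have e2: "of_int \<epsilon>2 = - e" using \<epsilon> by (auto simp: e_def)
    show ?thesis
    proof (rule unknot_choreography[OF \<epsilon>, of "\<lambda>c. - e * c" "\<lambda>\<phi>. e * sin (2 * \<phi>)"])
      show "- e * c \<noteq> 0" if "4 * c^2 = 1" for c :: real using that e by auto
      show "e * sin (2 * \<phi>) = - 2 * (- e * cos \<phi>) * sin \<phi>" for \<phi> by (simp add: sin_double)
      show "\<bar>e * sin (2 * \<phi>)\<bar> \<le> 1" for \<phi> using e by (simp add: abs_mult)
      show "of_int \<epsilon>1 * (e * sin (2 * \<phi>) - e * sin (2 * (\<phi> + 4 * pi / 3))) > 0" if "\<phi> \<in> {- (5 * pi / 6)..- (pi / 2)}" for \<phi>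
      proof -
        have "of_int \<epsilon>1 * (e * sin (2 * \<phi>) - e * sin (2 * (\<phi> + 4 * pi / 3))) = - ((e * e) * (sin (2 * (\<phi> + 4 * pi / 3)) - sin (2 * \<phi>)))"
          by (simp add: e_def[symmetric] algebra_simps)
        also have "\<dots> = 2 * (- sin (4 * pi / 3)) * cos (2 * \<phi> + 4 * pi / 3)"
          unfolding e(1) using sin_shift_diff[of "2 * \<phi>" "4 * pi / 3"] by (simp add: distrib_left)
        also have "\<dots> > 0"
          using that[unfolded atLeastAtMost_iff] s3 pi_gt_zero by (intro mult_pos_pos cos_gt_zero_pi) linarith+
        finally show ?thesis .
      qed
      show "of_int \<epsilon>2 * (e * sin (2 * \<phi>) - e * sin (2 * (\<phi> + 2 * pi / 3))) > 0" if "\<phi> \<in> {- (pi / 2)..- (pi / 6)}" for \<phi>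
      proof -
        have "of_int \<epsilon>2 * (e * sin (2 * \<phi>) - e * sin (2 * (\<phi> + 2 * pi / 3))) = (e * e) * (sin (2 * (\<phi> + 2 * pi / 3)) - sin (2 * \<phi>))"
          unfolding e2 by (simp add: algebra_simps)
        also have "\<dots> = 2 * sin (2 * pi / 3) * cos (2 * \<phi> + 2 * pi / 3)"
          unfolding e(1) using sin_shift_diff[of "2 * \<phi>" "2 * pi / 3"] by (simp add: distrib_left)
        also have "\<dots> > 0"
          using that[unfolded atLeastAtMost_iff] s3 pi_gt_zero by (intro mult_pos_pos cos_gt_zero_pi) linarith+
        finally show ?thesis .
      qed
    qed (auto intro!: continuous_intros)
  qed
qed


section \<open>Moving a crossing of a closed braid into the standard box\<close>

lemma ambient_comp:
  assumes "ambient f" "ambient g"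
  shows "ambient (g \<circ> f)"
proof -
  obtain F where F: "continuous_on ({0..1} \<times> UNIV) F" "\<And>t. t\<in>{0..1} \<Longrightarrow> bij (\<lambda>x. F (t, x))"
     "proper_family F" "\<And>x. F (0, x) = x" "\<And>x. F (1, x) = f x"
    using assms(1) unfolding ambient_def by auto
  obtain G where G: "continuous_on ({0..1} \<times> UNIV) G" "\<And>t. t\<in>{0..1} \<Longrightarrow> bij (\<lambda>x. G (t, x))"
     "proper_family G" "\<And>x. G (0, x) = x" "\<And>x. G (1, x) = g x"
    using assms(2) unfolding ambient_def by auto
  show ?thesis unfolding ambient_def
  proof (intro exI[of _ "\<lambda>z. G (fst z, F z)"] conjI ballI allI)
    show "continuous_on ({0..1} \<times> UNIV) (\<lambda>z. G (fst z, F z))"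
      by (rule continuous_on_compose2[OF G(1)]) (use F(1) in \<open>auto intro!: continuous_intros\<close>)
    show "bij (\<lambda>x. G (fst (t, x), F (t, x)))" if "t \<in> {0..1}" for t
      using bij_comp[OF F(2)[OF that] G(2)[OF that]] by (simp add: comp_def)
    show "proper_family (\<lambda>z. G (fst z, F z))"
      unfolding proper_family_def
    proof
      fix B
      obtain B' where B': "\<And>t x. t \<in> {0..1} \<Longrightarrow> norm (G (t, x)) \<le> B \<Longrightarrow> norm x \<le> B'"
        using G(3) unfolding proper_family_def by meson
      obtain B'' where "\<And>t x. t \<in> {0..1} \<Longrightarrow> norm (F (t, x)) \<le> B' \<Longrightarrow> norm x \<le> B''"
        using F(3) unfolding proper_family_def by meson
      then show "\<exists>B'. \<forall>t\<in>{0..1}. \<forall>x. norm (G (fst (t, x), F (t, x))) \<le> B \<longrightarrow> norm x \<le> B'"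
        using B' by (intro exI[of _ B'']) auto
    qed
  qed (use F G in auto)
qed

text \<open>Scaling the second coordinate of a point \<open>(x, x * tan \<theta>)\<close> by \<open>10 / x\<close> sends it to
  \<open>(x, 10 * tan \<theta>)\<close>, so that the pages become parallel planes. This is done for \<open>x\<close>
  between \<open>9\<close> and \<open>11\<close>, where the crossing will be, and continued by constants to keep a
  homeomorphism.\<close>

definition stretch :: "real \<Rightarrow> real"
  where "stretch x = 10 / max 9 (min 11 x)"

lemma stretch_bounds: "1/2 < stretch x" "stretch x < 2"
  by (auto simp: stretch_def field_simps max_def min_def)

definition shear :: "R3 \<Rightarrow> R3"
  where "shear x = (Complex (Re (fst x)) (stretch (Re (fst x)) * Im (fst x)), snd x)"

lemma shear_ambient: "ambient shear"
  unfolding ambient_def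
proof (intro exI[of _ "\<lambda>z. (Complex (Re (fst (snd z))) (((1 - fst z) + fst z * stretch (Re (fst (snd z)))) * Im (fst (snd z))), snd (snd z))"]
    conjI ballI allI)
  let ?F = "\<lambda>z::real \<times> R3. (Complex (Re (fst (snd z))) (((1 - fst z) + fst z * stretch (Re (fst (snd z)))) * Im (fst (snd z))), snd (snd z))"
  show "continuous_on ({0..1} \<times> UNIV) ?F"
    unfolding stretch_def Complex_eq by (intro continuous_intros) auto
  have half: "1/2 \<le> (1 - t) + t * stretch x" if "t \<in> {0..1}" for t x
  proof -
    have "t * (1/2) \<le> t * stretch x" using stretch_bounds[of x] that by (intro mult_left_mono) auto
    then show ?thesis using that by auto
  qed
  show "bij (\<lambda>x. ?F (t, x))" if t: "t \<in> {0..1}" for t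
  proof (rule o_bij[of "\<lambda>x. (Complex (Re (fst x)) (Im (fst x) / ((1 - t) + t * stretch (Re (fst x)))), snd x)"])
    have "(1 - t) + t * stretch x \<noteq> 0" for x using half[OF t, of x] by linarith
    then show "(\<lambda>x. (Complex (Re (fst x)) (Im (fst x) / ((1 - t) + t * stretch (Re (fst x)))), snd x)) \<circ> (\<lambda>x. ?F (t, x)) = id"
      "(\<lambda>x. ?F (t, x)) \<circ> (\<lambda>x. (Complex (Re (fst x)) (Im (fst x) / ((1 - t) + t * stretch (Re (fst x)))), snd x)) = id"
      by (simp_all add: fun_eq_iff complex_eq_iff)
  qed
  show "proper_family ?F"
    unfolding proper_family_def
  proof (intro allI exI ballI impI)
    fix B t :: real and x :: R3 assume t: "t \<in> {0..1}" and n: "norm (?F (t, x)) \<le> B"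
    have ns: "norm (snd y) \<le> norm y" "norm (fst y) \<le> norm y" for y :: R3
      using norm_snd_le[of "snd y" "fst y"] norm_fst_le[of "fst y" "snd y"] by simp_all
    let ?w = "Complex (Re (fst x)) (((1 - t) + t * stretch (Re (fst x))) * Im (fst x))"
    have h: "\<bar>snd x\<bar> \<le> B" using ns(1)[of "?F (t, x)"] n by (simp only: snd_conv real_norm_def)
    have w: "cmod ?w \<le> B" using ns(2)[of "?F (t, x)"] n by (simp only: fst_conv snd_conv)
    have re: "\<bar>Re (fst x)\<bar> \<le> B" using abs_Re_le_cmod[of ?w] w by simp
    have "\<bar>Im ?w\<bar> \<le> B" using abs_Im_le_cmod[of ?w] w by linarith
    then have "\<bar>(1 - t) + t * stretch (Re (fst x))\<bar> * \<bar>Im (fst x)\<bar> \<le> B" by (simp add: abs_mult)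
    moreover have "1/2 * \<bar>Im (fst x)\<bar> \<le> \<bar>(1 - t) + t * stretch (Re (fst x))\<bar> * \<bar>Im (fst x)\<bar>"
      using half[OF t, of "Re (fst x)"] by (intro mult_right_mono) auto
    ultimately have im: "\<bar>Im (fst x)\<bar> \<le> 2 * B" by linarith
    have "cmod (fst x) \<le> \<bar>Re (fst x)\<bar> + \<bar>Im (fst x)\<bar>" by (rule cmod_le)
    moreover have "norm x \<le> cmod (fst x) + \<bar>snd x\<bar>"
      unfolding norm_prod_def real_norm_def[symmetric] by (rule sqrt_sum_squares_le_sum) auto
    ultimately show "norm x \<le> 4 * B" using re im h by linarith
  qed
qed (auto simp: shear_def complex_eq_iff)

text \<open>The page at angle \<open>3 * pi / 2\<close> is turned to the positive real axis, and after the shear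
  the point at distance \<open>10\<close> from the axis is moved to the origin.\<close>

definition to_box :: "R3 \<Rightarrow> R3"
  where "to_box = (\<lambda>x. (-10 + exp 0 * fst x, snd x)) \<circ> (shear \<circ> (\<lambda>x. (0 + exp (\<i> * of_real (pi / 2)) * fst x, snd x)))"

lemma to_box_ambient: "ambient to_box"
  unfolding to_box_def
  by (intro ambient_comp shear_ambient fibred_affine_ambient[of "\<lambda>_. -10" "\<lambda>_. 0"]
      fibred_affine_ambient[of "\<lambda>_. 0" "\<lambda>_. \<i> * of_real (pi / 2)"] continuous_intros)

lemma to_box_eq: "to_box x = (Complex (- Im (fst x) - 10) (stretch (- Im (fst x)) * Re (fst x)), snd x)"
proof -
  have "exp (\<i> * of_real (pi / 2)) = \<i>" unfolding cis_conv_exp[symmetric] by simp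
  then show ?thesis by (simp add: to_box_def shear_def complex_eq_iff)
qed

lemma to_box_page:
  "to_box (page w (\<theta> + 3 * pi / 2)) =
     (Complex (Re w * cos \<theta> - 10) (stretch (Re w * cos \<theta>) * (Re w * sin \<theta>)), Im w)"
proof -
  have "cos (\<theta> + 3 * pi / 2) = sin \<theta>" "sin (\<theta> + 3 * pi / 2) = - cos \<theta>"
    using cos_3over2_pi sin_3over2_pi by (simp_all add: cos_add sin_add)
  then show ?thesis by (simp add: to_box_eq page_def)
qed

text \<open>The three tangles of the skein relation, indexed by the letter that produces them.\<close>

definition tangle :: "int \<Rightarrow> real \<Rightarrow> real \<Rightarrow> R3"
  where "tangle k = (if k = 0 then smoothing else crossing (of_int k))"

definition crossing_letter :: "int \<Rightarrow> bool"
  where "crossing_letter k \<longleftrightarrow> k = 0 \<or> k = 1 \<or> k = -1"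

lemma crossing_letter_letter: "crossing_letter k \<Longrightarrow> letter k"
  by (auto simp: crossing_letter_def letter_def)

lemma motion_tangle:
  assumes "crossing_letter k" "\<delta> \<in> {-1, 1}"
  shows "(Complex (Re (motion k s (of_real (3/2 + \<delta>/2))) - 3/2) (2 * s - 1), Im (motion k s (of_real (3/2 + \<delta>/2)))) = tangle k \<delta> s"
  using assms by (auto simp: crossing_letter_def tangle_def smoothing_def crossing_def)

lemma tangle_bounds:
  assumes "crossing_letter k" "\<delta> \<in> {-1, 1}"
  shows "\<bar>Re (fst (tangle k \<delta> s))\<bar> \<le> 1/2" "Im (fst (tangle k \<delta> s)) = 2 * s - 1" "\<bar>snd (tangle k \<delta> s)\<bar> \<le> 1/2"
  using assms abs_cos_le_one[of "pi * s"] abs_sin_le_one[of "pi * s"]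
  by (auto simp: crossing_letter_def tangle_def smoothing_def crossing_def abs_mult)

lemma in_skein_box: "x \<in> skein_box \<longleftrightarrow> \<bar>Re (fst x)\<bar> \<le> 1 \<and> \<bar>Im (fst x)\<bar> \<le> 1 \<and> \<bar>snd x\<bar> \<le> 1"
  by (cases x) (simp add: skein_box_def)

lemma interior_skein_box: "\<bar>Re (fst x)\<bar> < 1 \<Longrightarrow> \<bar>Im (fst x)\<bar> < 1 \<Longrightarrow> \<bar>snd x\<bar> < 1 \<Longrightarrow> x \<in> interior skein_box"
proof -
  have "open {x::R3. \<bar>Re (fst x)\<bar> < 1 \<and> \<bar>Im (fst x)\<bar> < 1 \<and> \<bar>snd x\<bar> < 1}"
    by (intro open_Collect_conj open_Collect_less continuous_intros)
  moreover have "{x::R3. \<bar>Re (fst x)\<bar> < 1 \<and> \<bar>Im (fst x)\<bar> < 1 \<and> \<bar>snd x\<bar> < 1} \<subseteq> skein_box"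
    by (auto simp: skein_box_def)
  ultimately have "{x::R3. \<bar>Re (fst x)\<bar> < 1 \<and> \<bar>Im (fst x)\<bar> < 1 \<and> \<bar>snd x\<bar> < 1} \<subseteq> interior skein_box"
    by (rule interior_maximal[rotated])
  then show "\<bar>Re (fst x)\<bar> < 1 \<Longrightarrow> \<bar>Im (fst x)\<bar> < 1 \<Longrightarrow> \<bar>snd x\<bar> < 1 \<Longrightarrow> x \<in> interior skein_box" by blast
qed

abbreviation transport :: "(R3 \<Rightarrow> R3) \<Rightarrow> olink \<Rightarrow> olink"
  where "transport f L \<equiv> (\<lambda>\<gamma>. to_S3 \<circ> f \<circ> from_S3 \<circ> \<gamma>) ` L"

lemma runs_along_transport:
  assumes "runs_along L (to_S3 \<circ> c)" "\<And>s. s \<in> {0..1} \<Longrightarrow> p s = to_S3 (f (c s))"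
  shows "runs_along (transport f L) p"
proof -
  obtain \<gamma> where g: "\<gamma> \<in> L" "\<And>s. s \<in> {0..1} \<Longrightarrow> to_S3 (c s) = \<gamma> (s / 2)"
    using assms(1) unfolding runs_along_def by auto
  have "p s = (to_S3 \<circ> f \<circ> from_S3 \<circ> \<gamma>) (s / 2)" if s: "s \<in> {0..1}" for s
    using assms(2)[OF s] g(2)[OF s, symmetric] by simp
  then show ?thesis unfolding runs_along_def using g(1) by blast
qed

lemma runs_along_transportD:
  assumes "runs_along (transport f L) p" and L: "\<And>\<gamma>. \<gamma> \<in> L \<Longrightarrow> range \<gamma> \<subseteq> range to_S3"
  obtains c where "runs_along L (to_S3 \<circ> c)" "\<And>s. s \<in> {0..1} \<Longrightarrow> p s = to_S3 (f (c s))"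
proof -
  obtain \<gamma> where g: "\<gamma> \<in> L" "\<And>s. s \<in> {0..1} \<Longrightarrow> p s = (to_S3 \<circ> f \<circ> from_S3 \<circ> \<gamma>) (s / 2)"
    using assms(1) unfolding runs_along_def by auto
  have "to_S3 (from_S3 (\<gamma> s)) = \<gamma> s" for s
  proof -
    have "\<gamma> s \<in> range to_S3" using L[OF g(1)] by (rule subsetD) (rule rangeI)
    then show ?thesis by (rule imageE) simp
  qed
  then have "runs_along L (to_S3 \<circ> (\<lambda>s. from_S3 (\<gamma> (s / 2))))"
    unfolding runs_along_def using g(1) by auto
  then show thesis by (rule that) (simp add: g(2))
qed

text \<open>The crossing takes place in the pages with angles within \<open>halfwidth\<close> of \<open>3 * pi / 2\<close>. Its
  parameter \<open>progress\<close> is chosen such that the second coordinate in the box, which is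
  \<open>10 * tan \<theta>\<close>, equals \<open>2 * progress - 1\<close> as in the standard crossing.\<close>

definition halfwidth :: real
  where "halfwidth = arctan (1/10)"

definition clamped :: "real \<Rightarrow> real"
  where "clamped s = max (- halfwidth) (min halfwidth (2 * pi * s - 3 * pi / 2))"

definition progress :: "real \<Rightarrow> real"
  where "progress s = (10 * tan (clamped s) + 1) / 2"

lemma halfwidth: "0 < halfwidth" "halfwidth < pi / 2" "tan halfwidth = 1/10"
  using arctan_bounded[of "1/10"] by (auto simp: halfwidth_def tan_arctan)

lemma clamped_bounds: "- halfwidth \<le> clamped s" "clamped s \<le> halfwidth" "- (pi / 2) < clamped s" "clamped s < pi / 2"
proof -
  show 1: "- halfwidth \<le> clamped s" "clamped s \<le> halfwidth" using halfwidth by (auto simp: clamped_def)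
  then show "- (pi / 2) < clamped s" "clamped s < pi / 2" using halfwidth by linarith+
qed

lemma cos_clamped: "cos (clamped s) > 0"
  using clamped_bounds by (intro cos_gt_zero_pi) auto

lemma progress_bounds: "0 \<le> progress s" "progress s \<le> 1"
proof -
  have "tan (clamped s) \<le> tan halfwidth" "tan (- halfwidth) \<le> tan (clamped s)"
    using clamped_bounds[of s] halfwidth by (intro tan_mono_le; auto)+
  then show "0 \<le> progress s" "progress s \<le> 1" by (simp_all add: progress_def halfwidth)
qed

lemma continuous_progress: "continuous_on A progress" "continuous_on A clamped"
proof -
  show c: "continuous_on A clamped" for A unfolding clamped_def by (intro continuous_intros)
  have "cos (clamped s) \<noteq> 0" for s using cos_clamped[of s] by simp
  then show "continuous_on A progress" unfolding progress_def by (intro continuous_intros c) auto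
qed

lemma clamped_early: "s \<le> 1/2 \<Longrightarrow> clamped s = - halfwidth"
proof -
  assume "s \<le> 1/2"
  then have "2 * pi * s \<le> pi" using mult_left_mono[of s "1/2" "2 * pi"] by simp
  then have "2 * pi * s - 3 * pi / 2 \<le> - halfwidth" using halfwidth by linarith
  then show ?thesis using halfwidth by (simp add: clamped_def)
qed

lemma progress_early: "s \<le> 1/2 \<Longrightarrow> progress s = 0"
  by (simp add: progress_def clamped_early halfwidth)

lemma clamped_1: "clamped 1 = halfwidth"
  using halfwidth by (simp add: clamped_def)

lemma progress_1: "progress 1 = 1"
  by (simp add: progress_def clamped_1 halfwidth)

text \<open>The closure of \<open>\<beta>\<close> followed by one more letter \<open>k\<close>, arranged in such a way that the
  last letter ends up in the standard box and no point outside the box depends on \<open>k\<close>.\<close>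

locale crossing_loops =
  fixes \<beta> :: "int list"
  assumes \<beta>: "braid_word 3 \<beta>"
begin

definition start :: "complex ^ 3"
  where "start = wend \<beta> std"

text \<open>The word \<open>\<beta>\<close> is read in the first half turn.\<close>

definition loop :: "int \<Rightarrow> real \<Rightarrow> complex ^ 3"
  where "loop k s = (if s \<le> 1/2 then wpath \<beta> std (2 * s) else lpath k start (progress s))"

text \<open>The strands are pushed away from the axis. The shift by \<open>17/2\<close> moves the centre of the
  crossing from distance \<open>3/2\<close> to distance \<open>10\<close>, and dividing by the cosine replaces arcs of
  circles about the axis by straight segments inside the sector of the crossing.\<close>

definition family :: "int \<Rightarrow> real \<Rightarrow> real \<Rightarrow> complex ^ 3"
  where "family k t s = (\<chi> i. Complex (((1 - t) + t / cos (clamped s)) * (Re (loop k s $ i) + t * (17/2))) (Im (loop k s $ i)))"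

lemma word: "word \<beta>"
  using \<beta> braid_word_word by blast

lemma standard_start: "standard start"
  using standard_wend[OF word standard_std] by (simp add: start_def)

lemma wpath_ends: "wpath \<beta> std 0 = std" "wpath \<beta> std 1 = start"
  using wpath_basic[OF word standard_std] by (simp_all add: pathstart_def pathfinish_def start_def)

lemma loop_homotopic:
  assumes k: "crossing_letter k"
  shows "homotopic_paths config (loop k) (wpath \<beta> std +++ lpath k start)"
proof -
  note l = crossing_letter_letter[OF k]
  have p: "path (lpath k start)" "path_image (lpath k start) \<subseteq> config"
    using path_lpath lpath_config[OF l standard_start] by (auto simp: path_image_def)
  define f where "f x = progress ((x + 1) / 2)" for x
  have "homotopic_paths config (lpath k start) (lpath k start \<circ> f)"
  proof (rule homotopic_paths_reparametrize[OF p, of f])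
    show "continuous_on {0..1} f" unfolding f_def
      by (intro continuous_on_compose2[OF continuous_progress(1)[of UNIV]] continuous_intros) auto
    show "f \<in> {0..1} \<rightarrow> {0..1}" using progress_bounds by (auto simp: f_def)
    show "f 0 = 0" "f 1 = 1" by (simp_all add: f_def progress_early progress_1)
  qed simp
  then have "homotopic_paths config (wpath \<beta> std +++ lpath k start) (wpath \<beta> std +++ (lpath k start \<circ> f))"
    using word standard_std l standard_start
    by (intro homotopic_paths_join) (auto simp: homotopic_paths_refl pathstart_def[of "lpath k start"] start_def[symmetric])
  moreover have "wpath \<beta> std +++ (lpath k start \<circ> f) = loop k"
    by (auto simp: fun_eq_iff joinpaths_def loop_def f_def)
  ultimately show ?thesis by (simp add: homotopic_paths_sym)
qed

lemma loop_config: "crossing_letter k \<Longrightarrow> s \<in> {0..1} \<Longrightarrow> loop k s \<in> config"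
  using homotopic_paths_imp_subset[OF loop_homotopic[of k]] by (auto simp: path_image_def)

lemma loop_ends:
  assumes "crossing_letter k"
  obtains \<pi> where "bij \<pi>" "loop k 1 = relabel \<pi> (loop k 0)"
proof -
  have 0: "loop k 0 = std" by (simp add: loop_def wpath_ends)
  have "loop k 1 = lpath k start 1" by (simp add: loop_def progress_1)
  moreover have "standard (lpath k start 1)"
    using standard_lpath_1[OF crossing_letter_letter[OF assms] standard_start] .
  ultimately obtain \<pi> where "bij \<pi>" "loop k 1 = relabel \<pi> std" by (auto simp: standard_def)
  then show thesis using that 0 by metis
qed

lemma family_isotopic:
  assumes k: "crossing_letter k"
  shows "isotopic (braided (path_points (loop k))) (braided (path_points (family k 1)))"
proof -
  obtain \<pi> where \<pi>: "bij \<pi>" "loop k 1 = relabel \<pi> (loop k 0)" using loop_ends[OF k] .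
  have c: "continuous_on {0..1} (loop k)"
    using homotopic_paths_imp_path[OF loop_homotopic[OF k]] by (simp add: path_def)
  have cc: "cos (clamped s) \<noteq> 0" for s using cos_clamped[of s] by simp
  have "isotopic (braided (path_points (family k 0))) (braided (path_points (family k 1)))"
  proof (rule loops_isotopic[OF \<pi>(1)])
    have cl: "continuous_on ({0..1} \<times> {0..1}) (\<lambda>z::real \<times> real. loop k (snd z))"
      by (rule continuous_on_compose2[OF c]) (auto intro!: continuous_intros)
    have ccl: "continuous_on ({0..1} \<times> {0..1}) (\<lambda>z::real \<times> real. clamped (snd z))"
      by (rule continuous_on_compose2[OF continuous_progress(2)[of UNIV]]) (auto intro!: continuous_intros)
    show "continuous_on ({0..1} \<times> {0..1}) (\<lambda>z. family k (fst z) (snd z))"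
      unfolding family_def Complex_eq by (intro continuous_intros cl ccl) (use cc in auto)
    show "family k t 1 = relabel \<pi> (family k t 0)" if "t \<in> {0..1}" for t
      by (simp add: family_def vec_eq_iff \<pi>(2) clamped_1 clamped_early)
    show "family k t s \<in> config" if t: "t \<in> {0..1}" and s: "s \<in> {0..1}" for t s
    proof -
      have cfg: "loop k s \<in> config" using loop_config[OF k s] .
      have "0 < (1 - t) * 1 + t * (1 / cos (clamped s))"
        using t cos_clamped[of s] by (intro convex_comb_pos) auto
      then have f: "0 < (1 - t) + t / cos (clamped s)" by simp
      have "family k t s $ i = family k t s $ j \<longrightarrow> loop k s $ i = loop k s $ j" for i j
        using f by (auto simp: family_def complex_eq_iff)
      moreover have "Re (family k t s $ i) > 0" for i
        using cfg f t by (auto simp: family_def config_iff intro!: mult_pos_pos add_pos_nonneg)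
      ultimately show ?thesis using cfg unfolding config_def by blast
    qed
  qed
  moreover have "family k 0 = loop k" by (simp add: fun_eq_iff vec_eq_iff family_def)
  ultimately show ?thesis by simp
qed

lemma family_braid:
  assumes k: "crossing_letter k"
  obtains \<pi> W where "closed_braid \<pi> W" "\<And>s. s \<in> {0..1} \<Longrightarrow> W s = family k 1 s" "strand_points W = path_points (family k 1)"
proof -
  obtain \<pi> where \<pi>: "bij \<pi>" "loop k 1 = relabel \<pi> (loop k 0)" using loop_ends[OF k] .
  have c: "continuous_on {0..1} (loop k)"
    using homotopic_paths_imp_path[OF loop_homotopic[OF k]] by (simp add: path_def)
  have cc: "cos (clamped s) \<noteq> 0" for s using cos_clamped[of s] by simp
  have "path (family k 1)"
    unfolding path_def family_def Complex_eq by (intro continuous_intros c continuous_progress) (use cc in auto)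
  moreover have "path_image (family k 1) \<subseteq> config"
  proof -
    have "family k 1 s \<in> config" if s: "s \<in> {0..1}" for s
    proof -
      have cfg: "loop k s \<in> config" using loop_config[OF k s] .
      have "family k 1 s $ i = family k 1 s $ j \<longrightarrow> loop k s $ i = loop k s $ j" for i j
        using cc[of s] by (auto simp: family_def complex_eq_iff)
      moreover have "Re (family k 1 s $ i) > 0" for i
        using cfg cos_clamped[of s] by (auto simp: family_def config_iff intro!: divide_pos_pos add_pos_nonneg)
      ultimately show ?thesis using cfg unfolding config_def by blast
    qed
    then show ?thesis by (auto simp: path_image_def)
  qed
  moreover have "pathfinish (family k 1) = relabel \<pi> (pathstart (family k 1))"
    by (simp add: pathfinish_def pathstart_def family_def vec_eq_iff \<pi>(2) clamped_1 clamped_early)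
  ultimately show thesis using closed_braid_of_path[of "family k 1" \<pi>] \<pi>(1) that by metis
qed

lemma family_braid_points:
  assumes k: "crossing_letter k"
  obtains \<pi> and W :: "real \<Rightarrow> complex ^ 3" where "closed_braid \<pi> W" "strand_points W = path_points (family k 1)"
proof (rule family_braid[OF k])
  fix \<pi> and W :: "real \<Rightarrow> complex ^ 3" assume "closed_braid \<pi> W" "strand_points W = path_points (family k 1)"
  then show thesis by (rule that)
qed

definition crossing_label :: "3 \<Rightarrow> real \<Rightarrow> bool"
  where "crossing_label i \<delta> \<longleftrightarrow> \<delta> \<in> {-1, 1} \<and> start $ i = of_real (3/2 + \<delta>/2)"

lemma label_cases: "(\<exists>\<delta>. crossing_label i \<delta>) \<or> start $ i = 3"
proof -
  have "start $ i \<in> {1, 2, 3}" using standard_positions[OF standard_start] by blast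
  moreover have "crossing_label i (-1)" if "start $ i = 1" using that by (simp add: crossing_label_def)
  moreover have "crossing_label i 1" if "start $ i = 2" using that by (simp add: crossing_label_def)
  ultimately show ?thesis by auto
qed

lemma label_exists: "\<delta> \<in> {-1, 1} \<Longrightarrow> \<exists>i. crossing_label i \<delta>"
proof -
  assume d: "\<delta> \<in> {-1, 1}"
  have "of_real (3/2 + \<delta>/2) \<in> range (\<lambda>i. start $ i)"
    unfolding standard_positions[OF standard_start] using d by auto
  then show ?thesis using d by (auto simp: crossing_label_def)
qed

lemma motion_3: "crossing_letter k \<Longrightarrow> motion k s 3 = 3"
  by (auto simp: crossing_letter_def)

lemma family_in_sector:
  assumes s: "\<bar>2 * pi * s - 3 * pi / 2\<bar> \<le> halfwidth"
  defines "\<theta> \<equiv> 2 * pi * s - 3 * pi / 2"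
  shows "family k 1 s $ i = Complex ((Re (motion k (progress s) (start $ i)) + 17/2) / cos \<theta>) (Im (motion k (progress s) (start $ i)))"
    and "progress s = (10 * tan \<theta> + 1) / 2" and "cos \<theta> > 0"
proof -
  have cl: "clamped s = \<theta>" using s by (auto simp: clamped_def \<theta>_def abs_le_iff)
  show "progress s = (10 * tan \<theta> + 1) / 2" by (simp add: progress_def cl)
  show "cos \<theta> > 0" using cos_clamped[of s] by (simp add: cl)
  have "\<not> s \<le> 1/2"
  proof
    assume "s \<le> 1/2"
    then have "2 * pi * s \<le> pi" using mult_left_mono[of s "1/2" "2 * pi"] by simp
    moreover have "3 * pi / 2 - 2 * pi * s \<le> halfwidth" using s by (simp add: abs_le_iff)
    ultimately show False using halfwidth by linarith
  qed
  then show "family k 1 s $ i = Complex ((Re (motion k (progress s) (start $ i)) + 17/2) / cos \<theta>) (Im (motion k (progress s) (start $ i)))"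
    by (simp add: family_def loop_def cl)
qed

text \<open>In the sector the homeomorphism undoes the division by the cosine and the shift. The two
  crossing strands then run through the standard tangle, and the third one passes beside the
  box.\<close>

lemma to_box_sector:
  assumes k: "crossing_letter k" and s: "\<bar>2 * pi * s - 3 * pi / 2\<bar> \<le> halfwidth"
  defines "z \<equiv> \<lambda>i. motion k (progress s) (start $ i)"
  shows "crossing_label i \<delta> \<Longrightarrow> to_box (page (family k 1 s $ i) (2 * pi * s)) = tangle k \<delta> (progress s)"
    and "start $ i = 3 \<Longrightarrow> Re (fst (to_box (page (family k 1 s $ i) (2 * pi * s)))) = 3/2"
proof -
  define \<theta> where "\<theta> = 2 * pi * s - 3 * pi / 2"
  note f = family_in_sector[OF s, folded \<theta>_def]
  have \<theta>: "2 * pi * s = \<theta> + 3 * pi / 2" by (simp add: \<theta>_def)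
  have w: "Re (family k 1 s $ i) * cos \<theta> = Re (z i) + 17/2" "Im (family k 1 s $ i) = Im (z i)"
      "Re (family k 1 s $ i) * sin \<theta> = (Re (z i) + 17/2) * tan \<theta>"
    using f(3) unfolding f(1) z_def by (simp_all add: tan_def)
  have tb: "to_box (page (family k 1 s $ i) (2 * pi * s)) =
      (Complex (Re (z i) - 3/2) (stretch (Re (z i) + 17/2) * ((Re (z i) + 17/2) * tan \<theta>)), Im (z i))"
    unfolding \<theta> to_box_page w by simp
  show "Re (fst (to_box (page (family k 1 s $ i) (2 * pi * s)))) = 3/2" if "start $ i = 3"
    unfolding tb z_def that motion_3[OF k] by simp
  show "to_box (page (family k 1 s $ i) (2 * pi * s)) = tangle k \<delta> (progress s)" if c: "crossing_label i \<delta>"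
  proof -
    have d: "\<delta> \<in> {-1, 1}" and st: "start $ i = of_real (3/2 + \<delta>/2)" using c by (auto simp: crossing_label_def)
    have zt: "(Complex (Re (z i) - 3/2) (2 * progress s - 1), Im (z i)) = tangle k \<delta> (progress s)"
      using motion_tangle[OF k d] unfolding z_def st .
    have "\<bar>Re (z i) - 3/2\<bar> \<le> 1/2" using tangle_bounds(1)[OF k d, of "progress s"] unfolding zt[symmetric] by simp
    then have "9 \<le> Re (z i) + 17/2" "Re (z i) + 17/2 \<le> 11" by linarith+
    then have "stretch (Re (z i) + 17/2) = 10 / (Re (z i) + 17/2)" "Re (z i) + 17/2 \<noteq> 0"
      by (auto simp: stretch_def)
    then have "stretch (Re (z i) + 17/2) * ((Re (z i) + 17/2) * tan \<theta>) = 10 * tan \<theta>" by simp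
    also have "10 * tan \<theta> = 2 * progress s - 1" unfolding f(2) by (simp add: field_simps)
    finally show ?thesis unfolding tb zt[symmetric] by simp
  qed
qed

text \<open>The first coordinate puts a point of the box where \<open>stretch X = 10 / X\<close>, so that its
  second coordinate is \<open>10 * tan \<theta>\<close>; as this is at most one in absolute value, the page
  is in the sector.\<close>

lemma in_box_imp_sector:
  assumes k: "crossing_letter k" and s: "s \<in> {0..1}"
    and b: "to_box (page (family k 1 s $ i) (2 * pi * s)) \<in> skein_box"
  shows "\<bar>2 * pi * s - 3 * pi / 2\<bar> \<le> halfwidth \<and> (\<exists>\<delta>. crossing_label i \<delta>)"
proof -
  define \<theta> where "\<theta> = 2 * pi * s - 3 * pi / 2"
  have \<theta>: "2 * pi * s = \<theta> + 3 * pi / 2" by (simp add: \<theta>_def)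
  define X where "X = Re (family k 1 s $ i) * cos \<theta>"
  have bb: "\<bar>X - 10\<bar> \<le> 1" "\<bar>stretch X * (Re (family k 1 s $ i) * sin \<theta>)\<bar> \<le> 1"
    using b unfolding \<theta> to_box_page in_skein_box X_def by auto
  then have X: "9 \<le> X" "X \<le> 11" by (auto simp: abs_le_iff)
  have pos: "Re (family k 1 s $ i) > 0"
  proof -
    obtain \<pi> W where W: "closed_braid \<pi> W" "\<And>s. s \<in> {0..1} \<Longrightarrow> W s = family k 1 s" using family_braid[OF k] by metis
    then have "family k 1 s = W s" using s by simp
    then show ?thesis using W(1) by (simp add: closed_braid_def)
  qed
  have c: "cos \<theta> > 0"
  proof (rule ccontr)
    assume "\<not> cos \<theta> > 0"
    then have "X \<le> 0" using pos by (simp add: X_def mult_nonneg_nonpos)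
    then show False using X by simp
  qed
  have "2 * pi * 0 \<le> 2 * pi * s" "2 * pi * s \<le> 2 * pi * 1" using s by (intro mult_left_mono; simp)+
  then have r: "- (3 * pi / 2) \<le> \<theta>" "\<theta> \<le> pi / 2" by (auto simp: \<theta>_def)
  have "- (pi / 2) < \<theta>"
  proof (rule ccontr)
    assume "\<not> - (pi / 2) < \<theta>"
    then have "cos (\<theta> + pi) \<ge> 0" using r pi_gt_zero by (intro cos_ge_zero) linarith+
    then show False using c by (simp add: cos_add)
  qed
  moreover have "\<theta> < pi / 2"
  proof -
    have "\<theta> \<noteq> pi / 2" using c cos_pi_half by (metis less_irrefl)
    then show ?thesis using r by simp
  qed
  ultimately have at: "arctan (tan \<theta>) = \<theta>" by (intro arctan_tan) auto
  have "Re (family k 1 s $ i) * sin \<theta> = X * tan \<theta>" using c by (simp add: X_def tan_def)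
  moreover have "stretch X = 10 / X" using X by (simp add: stretch_def)
  ultimately have "\<bar>10 * tan \<theta>\<bar> \<le> 1" using bb(2) X by simp
  then have "tan \<theta> \<le> 1/10" "- (1/10) \<le> tan \<theta>" by (auto simp: abs_le_iff)
  then have "arctan (tan \<theta>) \<le> arctan (1/10)" "arctan (- (1/10)) \<le> arctan (tan \<theta>)" by (simp_all add: arctan_le_iff)
  then have sec: "\<bar>2 * pi * s - 3 * pi / 2\<bar> \<le> halfwidth"
    unfolding at halfwidth_def arctan_minus \<theta>_def[symmetric] by (simp add: abs_le_iff)
  have "start $ i \<noteq> 3"
  proof
    assume "start $ i = 3"
    from to_box_sector(2)[OF k sec this] b show False by (simp add: in_skein_box)
  qed
  then show ?thesis using sec label_cases by blast
qed

text \<open>The time at which the crossing has reached the parameter \<open>s\<close>.\<close>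

definition time :: "real \<Rightarrow> real"
  where "time s = (arctan ((2 * s - 1) / 10) + 3 * pi / 2) / (2 * pi)"

lemma time:
  assumes s: "s \<in> {0..1}"
  shows "\<bar>2 * pi * time s - 3 * pi / 2\<bar> \<le> halfwidth" "progress (time s) = s" "0 < time s" "time s < 1"
proof -
  have t: "2 * pi * time s - 3 * pi / 2 = arctan ((2 * s - 1) / 10)" by (simp add: time_def)
  have "arctan ((2 * s - 1) / 10) \<le> arctan (1/10)" "arctan (- (1/10)) \<le> arctan ((2 * s - 1) / 10)"
    using s by (auto simp: arctan_le_iff)
  then show h: "\<bar>2 * pi * time s - 3 * pi / 2\<bar> \<le> halfwidth"
    unfolding t halfwidth_def arctan_minus by (simp add: abs_le_iff)
  show "progress (time s) = s" unfolding family_in_sector(2)[OF h] t by (simp add: tan_arctan field_simps)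
  have "- (pi / 2) < arctan ((2 * s - 1) / 10)" "arctan ((2 * s - 1) / 10) < pi / 2" using arctan_bounded by auto
  then show "0 < time s" "time s < 1" by (simp_all add: time_def field_simps)
qed

lemma time_mono: "x < y \<Longrightarrow> time x < time y"
  by (simp add: time_def divide_strict_right_mono arctan_less_iff)

lemma continuous_time: "continuous_on A time"
  unfolding time_def by (intro continuous_intros) auto

definition boxed :: "int \<Rightarrow> olink"
  where "boxed k = transport to_box (braided (path_points (family k 1)))"

lemma points_boxed: "crossing_letter k \<Longrightarrow> points (boxed k) = to_S3 ` to_box ` path_points (family k 1)"
proof -
  assume k: "crossing_letter k"
  obtain \<pi> and W :: "real \<Rightarrow> complex ^ 3" where W: "closed_braid \<pi> W" "strand_points W = path_points (family k 1)" using family_braid_points[OF k] .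
  have "points (boxed k) = (\<lambda>y. to_S3 (to_box (from_S3 y))) ` points (braided (path_points (family k 1)))"
    unfolding points_def boxed_def by (simp add: image_UN image_comp comp_def image_image)
  also have "points (braided (path_points (family k 1))) = to_S3 ` path_points (family k 1)"
    using points_braided[OF W(1)] W(2) by simp
  finally show ?thesis by (simp add: image_image)
qed

lemma link_family: "crossing_letter k \<Longrightarrow> link (braided (path_points (family k 1)))"
proof -
  assume k: "crossing_letter k"
  obtain \<pi> and W :: "real \<Rightarrow> complex ^ 3" where W: "closed_braid \<pi> W" "strand_points W = path_points (family k 1)"
    using family_braid_points[OF k] .
  then show ?thesis using link_braided[OF W(1)] by simp
qed

lemma boxed_isotopic: "isotopic (braided (path_points (family k 1))) (boxed k)"
  unfolding boxed_def using ambient_isotopic[OF to_box_ambient] braided_in_range by blast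

lemma link_boxed: "crossing_letter k \<Longrightarrow> link (boxed k)"
  using link_isotopic[OF link_family boxed_isotopic] .

lemma tangle_points:
  assumes k: "crossing_letter k"
  shows "points (boxed k) \<inter> to_S3 ` skein_box = to_S3 ` {tangle k \<delta> s | \<delta> s. \<delta> \<in> {- 1, 1} \<and> s \<in> {0..1}}"
proof -
  have "points (boxed k) \<inter> to_S3 ` skein_box = to_S3 ` (to_box ` path_points (family k 1) \<inter> skein_box)"
    unfolding points_boxed[OF k] using image_Int[OF inj_to_S3] by simp
  also have "to_box ` path_points (family k 1) \<inter> skein_box = {tangle k \<delta> s | \<delta> s. \<delta> \<in> {- 1, 1} \<and> s \<in> {0..1}}"
  proof (intro equalityI subsetI)
    fix x assume x: "x \<in> to_box ` path_points (family k 1) \<inter> skein_box"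
    then obtain y where y: "y \<in> path_points (family k 1)" "x = to_box y" by blast
    then obtain s i where s: "s \<in> {0..1}" "y = page (family k 1 s $ i) (2 * pi * s)"
      unfolding path_points_def by blast
    have xb: "to_box (page (family k 1 s $ i) (2 * pi * s)) \<in> skein_box" using x y(2) s(2) by simp
    obtain \<delta> where d: "\<bar>2 * pi * s - 3 * pi / 2\<bar> \<le> halfwidth" "crossing_label i \<delta>"
      using in_box_imp_sector[OF k s(1) xb] by blast
    have "x = tangle k \<delta> (progress s)" using to_box_sector(1)[OF k d] y(2) s(2) by simp
    then show "x \<in> {tangle k \<delta> s | \<delta> s. \<delta> \<in> {- 1, 1} \<and> s \<in> {0..1}}"
      using d(2) progress_bounds[of s] unfolding crossing_label_def by auto
  next
    fix x assume "x \<in> {tangle k \<delta> s | \<delta> s. \<delta> \<in> {- 1, 1} \<and> s \<in> {0..1}}"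
    then obtain \<delta> s where x: "x = tangle k \<delta> s" "\<delta> \<in> {-1, 1}" "s \<in> {0..1}" by blast
    obtain i where i: "crossing_label i \<delta>" using label_exists[OF x(2)] by blast
    have "x = to_box (page (family k 1 (time s) $ i) (2 * pi * time s))"
      using to_box_sector(1)[OF k time(1)[OF x(3)] i] time(2)[OF x(3)] x(1) by simp
    moreover have "page (family k 1 (time s) $ i) (2 * pi * time s) \<in> path_points (family k 1)"
      using time(3,4)[OF x(3)] unfolding path_points_def by force
    moreover have "x \<in> skein_box" using tangle_bounds[OF k x(2), of s] x(1,3) by (auto simp: in_skein_box abs_le_iff)
    ultimately show "x \<in> to_box ` path_points (family k 1) \<inter> skein_box" by blast
  qed
  finally show ?thesis .
qed

lemma tangle_runs_along:
  assumes k: "crossing_letter k" and d: "\<delta> \<in> {-1, 1}"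
  shows "runs_along (boxed k) (to_S3 \<circ> tangle k \<delta>)"
proof -
  obtain \<pi> W where W: "closed_braid \<pi> W" "\<And>s. s \<in> {0..1} \<Longrightarrow> W s = family k 1 s" "strand_points W = path_points (family k 1)"
    using family_braid[OF k] by metis
  obtain i where i: "crossing_label i \<delta>" using label_exists[OF d] by blast
  define c where "c s = page (W (time s) $ i) (2 * pi * time s)" for s
  have cW: "continuous_on UNIV W" using W by (simp add: closed_braid_def)
  have cc: "continuous_on {0..1} c"
    unfolding c_def page_def cis_conv_exp
    by (intro continuous_intros continuous_time continuous_on_compose2[OF cW]) auto
  have pos: "Re (W s $ i) > 0" for s using W(1) by (simp add: closed_braid_def)
  have inj: "inj_on c {0..1}"
  proof (rule inj_onI)
    fix x y :: real assume xy: "x \<in> {0..1}" "y \<in> {0..1}" "c x = c y"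
    then obtain j :: int where "2 * pi * time x = 2 * pi * time y + 2 * pi * of_int j"
      unfolding c_def page_eq_iff[OF pos pos] by blast
    then have "2 * pi * time x = 2 * pi * (time y + of_int j)" by (simp add: algebra_simps)
    then have j: "time x - time y = of_int j" by simp
    then have "\<bar>of_int j :: real\<bar> < 1" using time(3,4)[OF xy(1)] time(3,4)[OF xy(2)] by linarith
    then have "j = 0" by linarith
    then have "time x = time y" using j by simp
    then show "x = y" using time_mono[of x y] time_mono[of y x] by (metis less_irrefl linorder_neqE_linordered_idom)
  qed
  have "runs_along (braided (path_points (family k 1))) (to_S3 \<circ> c)"
    unfolding W(3)[symmetric] runs_along_braided_iff[OF W(1)]
  proof (intro conjI exI[of _ "\<lambda>s. W (time s) $ i"] exI[of _ time] ballI)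
    show "inj_on (to_S3 \<circ> c) {0..1}" using inj by (simp add: inj_on_def)
    show "continuous_on {0..1} (to_S3 \<circ> c)" using cc by (simp add: continuous_on_compose_to_S3_iff comp_def)
    show "strict_mono_on {0..1} time" using time_mono by (auto simp: strict_mono_on_def)
  qed (auto simp: pos c_def strand_points_def continuous_time)
  then show ?thesis
    unfolding boxed_def
  proof (rule runs_along_transport)
    fix s :: real assume s: "s \<in> {0..1}"
    have "time s \<in> {0..1}" using time(3,4)[OF s] by auto
    then have "to_box (c s) = tangle k \<delta> (progress (time s))"
      unfolding c_def W(2)[OF \<open>time s \<in> {0..1}\<close>] by (intro to_box_sector(1)[OF k time(1)[OF s] i])
    then show "(to_S3 \<circ> tangle k \<delta>) s = to_S3 (to_box (c s))" using time(2)[OF s] by simp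
  qed
qed

lemma inside_box_boxed: "crossing_letter k \<Longrightarrow> inside_box (boxed k) (tangle k)"
  unfolding inside_box_def by (intro conjI ballI tangle_points tangle_runs_along)

text \<open>Strictly inside the crossing the two strands are in the interior of the box. Outside they
  are at the beginning or at the end of the crossing, where the set of their positions is the
  same for all letters, and the third strand is the same for all letters throughout.\<close>

lemma outside_points:
  assumes k: "crossing_letter k" and k': "crossing_letter k'" and x: "x \<in> path_points (family k 1)"
    and out: "to_box x \<notin> interior skein_box"
  shows "x \<in> path_points (family k' 1)"
proof -
  obtain s i where s: "s \<in> {0..1}" "x = page (family k 1 s $ i) (2 * pi * s)"
    using x unfolding path_points_def by blast
  have fam: "family k' 1 s $ j = family k 1 s $ i"
    if "lpath k' start (progress s) $ j = lpath k start (progress s) $ i" "s \<le> 1/2 \<Longrightarrow> j = i" for j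
    using that by (auto simp: family_def loop_def)
  have "\<exists>j. family k' 1 s $ j = family k 1 s $ i"
  proof (cases "start $ i = 3")
    case True
    then show ?thesis using motion_3[OF k] motion_3[OF k'] by (intro exI[of _ i] fam) auto
  next
    case False
    then obtain \<delta> where d: "crossing_label i \<delta>" using label_cases by blast
    consider "progress s = 0" | "progress s = 1" | "0 < progress s" "progress s < 1"
      using progress_bounds[of s] by linarith
    then show ?thesis
    proof cases
      case 1
      have "lpath k' start 0 $ i = lpath k start 0 $ i"
        using lpath_0 standard_start crossing_letter_letter k k' by simp
      then show ?thesis using 1 by (intro exI[of _ i] fam) auto
    next
      case 2
      then have late: "\<not> s \<le> 1/2" using progress_early by fastforce
      have r: "range (\<lambda>j. lpath k' start 1 $ j) = range (\<lambda>j. lpath k start 1 $ j)"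
        using standard_positions[OF standard_lpath_1[OF crossing_letter_letter[OF k'] standard_start]]
          standard_positions[OF standard_lpath_1[OF crossing_letter_letter[OF k] standard_start]] by (rule trans[OF _ sym])
      have "lpath k start 1 $ i \<in> range (\<lambda>j. lpath k' start 1 $ j)" unfolding r by (rule rangeI)
      then obtain j where "lpath k start 1 $ i = lpath k' start 1 $ j" by (rule rangeE)
      then have "lpath k' start 1 $ j = lpath k start 1 $ i" by (rule sym)
      then show ?thesis using 2 late by (intro exI[of _ j] fam) auto
    next
      case 3
      have "tan (clamped s) \<noteq> tan halfwidth" "tan (clamped s) \<noteq> tan (- halfwidth)"
        using 3 by (auto simp: progress_def halfwidth)
      then have "clamped s \<noteq> halfwidth" "clamped s \<noteq> - halfwidth" by auto
      then have "\<bar>2 * pi * s - 3 * pi / 2\<bar> \<le> halfwidth"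
        by (auto simp: clamped_def max_def min_def abs_le_iff split: if_splits)
      from to_box_sector(1)[OF k this d] have "to_box x = tangle k \<delta> (progress s)" using s(2) by simp
      moreover have "\<delta> \<in> {-1, 1}" using d by (simp add: crossing_label_def)
      then have "tangle k \<delta> (progress s) \<in> interior skein_box"
        using tangle_bounds[OF k, of \<delta> "progress s"] 3 by (intro interior_skein_box) auto
      ultimately show ?thesis using out by simp
    qed
  qed
  then obtain j where "x = page (family k' 1 s $ j) (2 * pi * s)" using s(2) by metis
  then show ?thesis using s(1) unfolding path_points_def by blast
qed

lemma outside_runs_along:
  assumes k: "crossing_letter k" and k': "crossing_letter k'"
    and out: "\<And>s. s \<in> {0..1} \<Longrightarrow> p s \<notin> to_S3 ` interior skein_box" and r: "runs_along (boxed k) p"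
  shows "runs_along (boxed k') p"
proof -
  obtain \<pi> and W :: "real \<Rightarrow> complex ^ 3" where W: "closed_braid \<pi> W" "strand_points W = path_points (family k 1)"
    using family_braid_points[OF k] .
  obtain \<pi>' and W' :: "real \<Rightarrow> complex ^ 3" where W': "closed_braid \<pi>' W'" "strand_points W' = path_points (family k' 1)"
    using family_braid_points[OF k'] .
  have r': "runs_along (transport to_box (braided (strand_points W))) p" using r unfolding boxed_def W(2) .
  obtain c where c: "runs_along (braided (strand_points W)) (to_S3 \<circ> c)" "\<And>s. s \<in> {0..1} \<Longrightarrow> p s = to_S3 (to_box (c s))"
  proof (rule runs_along_transportD[OF r'])
    show "range \<gamma> \<subseteq> range to_S3" if "\<gamma> \<in> braided (strand_points W)" for \<gamma> by (rule braided_in_range[OF that])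
  qed blast
  then obtain P G where ic: "inj_on (to_S3 \<circ> c) {0..1}" "continuous_on {0..1} (to_S3 \<circ> c)"
    "continuous_on {0..1} G" "strict_mono_on {0..1} G"
    and PG: "\<And>s. s \<in> {0..1} \<Longrightarrow> Re (P s) > 0 \<and> page (P s) (2 * pi * G s) \<in> strand_points W \<and>
          (to_S3 \<circ> c) s = to_S3 (page (P s) (2 * pi * G s))"
    unfolding runs_along_braided_iff[OF W(1)] by blast
  have "page (P s) (2 * pi * G s) \<in> strand_points W'" if s: "s \<in> {0..1}" for s
  proof -
    have e: "c s = page (P s) (2 * pi * G s)" using PG[OF s] by simp
    have "to_box (c s) \<notin> interior skein_box" using out[OF s] unfolding c(2)[OF s] by blast
    moreover have "c s \<in> path_points (family k 1)" using PG[OF s] unfolding e W(2) by blast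
    ultimately have "c s \<in> path_points (family k' 1)" using outside_points[OF k k'] by blast
    then show ?thesis unfolding e W'(2) .
  qed
  then have "runs_along (braided (strand_points W')) (to_S3 \<circ> c)"
    unfolding runs_along_braided_iff[OF W'(1)] using ic PG by blast
  then show ?thesis unfolding boxed_def W'(2) using c(2) by (rule runs_along_transport)
qed

lemma skein_triple_boxed: "skein_triple (boxed 1) (boxed (-1)) (boxed 0)"
proof -
  have k: "crossing_letter 1" "crossing_letter (-1)" "crossing_letter 0" by (auto simp: crossing_letter_def)
  have t: "tangle 1 = crossing 1" "tangle (-1) = crossing (-1)" "tangle 0 = smoothing" by (simp_all add: tangle_def)
  show ?thesis
    unfolding skein_triple_def same_outside_box_def
    using link_boxed[OF k(1)] link_boxed[OF k(2)] link_boxed[OF k(3)]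
      inside_box_boxed[OF k(1)] inside_box_boxed[OF k(2)] inside_box_boxed[OF k(3)]
      outside_runs_along[OF k(1) k(2)] outside_runs_along[OF k(2) k(1)]
      outside_runs_along[OF k(1) k(3)] outside_runs_along[OF k(3) k(1)]
    unfolding t by blast
qed

lemma closure_boxed:
  assumes "k = 1 \<or> k = -1"
  shows "isotopic (braid_closure 3 (\<beta> @ [k])) (boxed k)"
proof -
  have k: "crossing_letter k" using assms by (auto simp: crossing_letter_def)
  have bw: "braid_word 3 (\<beta> @ [k])" using \<beta> assms by (auto simp: braid_word_def)
  have l: "letter k" by (rule crossing_letter_letter[OF k])
  have "homotopic_paths config (wpath \<beta> std +++ lpath k start) (wpath \<beta> std +++ wpath [k] start)"
  proof (rule homotopic_paths_join)
    show "homotopic_paths config (wpath \<beta> std) (wpath \<beta> std)"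
      using word standard_std by (simp add: homotopic_paths_refl)
    show "homotopic_paths config (lpath k start) (wpath [k] start)"
      by (rule homotopic_paths_sym[OF wpath_single[OF l standard_start]])
    show "pathfinish (wpath \<beta> std) = pathstart (lpath k start)"
      using l standard_start wpath_ends by (simp add: pathfinish_def pathstart_def)
  qed
  moreover have "homotopic_paths config (wpath (\<beta> @ [k]) std) (wpath \<beta> std +++ wpath [k] start)"
    using wpath_append[of \<beta> "[k]" std] word l standard_std by (simp add: start_def del: wpath.simps)
  ultimately have "homotopic_paths config (loop k) (wpath (\<beta> @ [k]) std)"
    using loop_homotopic[OF k] by (meson homotopic_paths_sym homotopic_paths_trans)
  from isotopic_path_points_braid_closure(1)[OF bw this] family_isotopic[OF k] boxed_isotopic[of k]
  show ?thesis by (meson isotopic_trans)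
qed

text \<open>The letter \<open>0\<close> contributes a constant path, which does not change the homotopy class.\<close>

lemma closure_boxed_0: "isotopic (braid_closure 3 \<beta>) (boxed 0)"
proof -
  have k: "crossing_letter 0" by (simp add: crossing_letter_def)
  have "lpath 0 start = linepath (pathfinish (wpath \<beta> std)) (pathfinish (wpath \<beta> std))"
    using wpath_ends by (simp add: fun_eq_iff vec_eq_iff linepath_def pathfinish_def algebra_simps)
  moreover have "homotopic_paths config (wpath \<beta> std +++ linepath (pathfinish (wpath \<beta> std)) (pathfinish (wpath \<beta> std))) (wpath \<beta> std)"
    using word standard_std by (intro homotopic_paths_rid) auto
  ultimately have "homotopic_paths config (loop 0) (wpath \<beta> std)"
    using loop_homotopic[OF k] by (metis homotopic_paths_trans)
  from isotopic_path_points_braid_closure(1)[OF \<beta> this] family_isotopic[OF k] boxed_isotopic[of 0]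
  show ?thesis by (meson isotopic_trans)
qed

end

theorem skein_relation_braids:
  assumes P: "is_skein_polynomial P" and \<beta>: "braid_word 3 \<beta>"
  shows "mono_vz (- 1) 0 * P (braid_closure 3 (\<beta> @ [1])) - mono_vz 1 0 * P (braid_closure 3 (\<beta> @ [- 1]))
     = mono_vz 0 1 * P (braid_closure 3 \<beta>)"
proof -
  interpret crossing_loops \<beta> by standard (rule \<beta>)
  have bw: "braid_word 3 (\<beta> @ [1])" "braid_word 3 (\<beta> @ [-1])" using \<beta> by (auto simp: braid_word_def)
  have inv: "P L = P L'" if "link L" "isotopic L L'" for L L'
    using P link_isotopic[OF that] that unfolding is_skein_polynomial_def by blast
  have "mono_vz (- 1) 0 * P (boxed 1) - mono_vz 1 0 * P (boxed (-1)) = mono_vz 0 1 * P (boxed 0)"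
    using P skein_triple_boxed unfolding is_skein_polynomial_def by blast
  then show ?thesis
    using inv[OF link_braid_closure[OF bw(1)] closure_boxed[of 1]] inv[OF link_braid_closure[OF bw(2)] closure_boxed[of "-1"]]
      inv[OF link_braid_closure[OF \<beta>] closure_boxed_0] by simp
qed


section \<open>The braid group on three strands, modulo its centre and conjugation\<close>

abbreviation bw :: "int list \<Rightarrow> bool" where "bw \<equiv> braid_word 3"

lemma bw_simps [simp]:
  "bw []" "bw (k # w) \<longleftrightarrow> k \<in> {1, 2, -1, -2} \<and> bw w" "bw (u @ v) \<longleftrightarrow> bw u \<and> bw v"
  by (auto simp: braid_word_def)

inductive braid_eq :: "int list \<Rightarrow> int list \<Rightarrow> bool" where
  refl: "braid_eq w w"
| sym: "braid_eq u v \<Longrightarrow> braid_eq v u"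
| trans: "braid_eq u v \<Longrightarrow> braid_eq v w \<Longrightarrow> braid_eq u w"
| cancel: "k \<in> {1, 2, -1, -2} \<Longrightarrow> braid_eq (u @ [k, - k] @ v) (u @ v)"
| braid: "braid_eq (u @ [1, 2, 1] @ v) (u @ [2, 1, 2] @ v)"

inductive conj_eq :: "int list \<Rightarrow> int list \<Rightarrow> bool" where
  equal: "braid_eq u v \<Longrightarrow> conj_eq u v"
| sym: "conj_eq u v \<Longrightarrow> conj_eq v u"
| trans: "conj_eq u v \<Longrightarrow> conj_eq v w \<Longrightarrow> conj_eq u w"
| cycle: "bw u \<Longrightarrow> bw v \<Longrightarrow> conj_eq (u @ v) (v @ u)"

lemmas [trans] = braid_eq.trans conj_eq.trans

lemma braid_eq_context: "braid_eq u v \<Longrightarrow> braid_eq (a @ u @ b) (a @ v @ b)"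
proof (induction rule: braid_eq.induct)
  case (cancel k u v)
  then show ?case using braid_eq.cancel[of k "a @ u" "v @ b"] by simp
next
  case (braid u v)
  show ?case using braid_eq.braid[of "a @ u" "v @ b"] by simp
qed (auto intro: braid_eq.intros)

lemma braid_eq_left: "braid_eq u v \<Longrightarrow> braid_eq (a @ u) (a @ v)"
  using braid_eq_context[of u v a "[]"] by simp

lemma braid_eq_right: "braid_eq u v \<Longrightarrow> braid_eq (u @ b) (v @ b)"
  using braid_eq_context[of u v "[]" b] by simp

lemma braid_eq_bw: "braid_eq u v \<Longrightarrow> bw u \<longleftrightarrow> bw v"
  by (induction rule: braid_eq.induct) auto

lemma conj_eq_bw: "conj_eq u v \<Longrightarrow> bw u \<longleftrightarrow> bw v"
  by (induction rule: conj_eq.induct) (auto simp: braid_eq_bw)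

lemma conj_eq_refl: "conj_eq u u"
  by (intro conj_eq.equal braid_eq.refl)

lemma bw_letters: "k \<in> {1, 2, -1, -2} \<Longrightarrow> letter k"
  by (auto simp: letter_def)

lemma isotopic_closure_sym: "isotopic (braid_closure 3 u) L \<Longrightarrow> isotopic L (braid_closure 3 u)"
  by (rule isotopic_sym_space) (auto simp: braid_closure_eq dest: braided_in_range)

lemma braid_eq_isotopic:
  "braid_eq u v \<Longrightarrow> bw u \<Longrightarrow> isotopic (braid_closure 3 u) (braid_closure 3 v)"
proof (induction rule: braid_eq.induct)
  case (refl w) show ?case by (rule isotopic_refl)
next
  case (sym u v) then show ?case using braid_eq_bw isotopic_closure_sym by blast
next
  case (trans u v w) then show ?case using braid_eq_bw isotopic_trans by blast
next
  case (cancel k u v)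
  then have w: "word u" "word v" "word [k, - k]" using braid_word_word by (auto simp: bw_letters)
  have "weq (u @ [k, - k] @ v) (u @ [] @ v)"
    using w by (intro weq_context weq_cancel) auto
  then show ?case using cancel by (intro weq_isotopic) auto
next
  case (braid u v)
  then have "word u" "word v" using braid_word_word by auto
  then have "weq (u @ [1, 2, 1] @ v) (u @ [2, 1, 2] @ v)"
    by (intro weq_context weq_braid) (auto simp: letter_def)
  then show ?case using braid by (intro weq_isotopic) auto
qed

lemma conj_eq_isotopic:
  "conj_eq u v \<Longrightarrow> bw u \<Longrightarrow> isotopic (braid_closure 3 u) (braid_closure 3 v)"
proof (induction rule: conj_eq.induct)
  case (equal u v) then show ?case by (rule braid_eq_isotopic)
next
  case (sym u v) then show ?case using conj_eq_bw isotopic_closure_sym by blast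
next
  case (trans u v w) then show ?case using conj_eq_bw isotopic_trans by blast
next
  case (cycle u v) then show ?case by (intro conjugate_isotopic)
qed

definition expo :: "int list \<Rightarrow> int"
  where "expo w = sum_list (map sgn w)"

lemma expo_simps [simp]: "expo [] = 0" "expo (k # w) = sgn k + expo w" "expo (u @ v) = expo u + expo v"
  by (simp_all add: expo_def)

lemma braid_eq_expo: "braid_eq u v \<Longrightarrow> expo u = expo v"
  by (induction rule: braid_eq.induct) auto

lemma conj_eq_expo: "conj_eq u v \<Longrightarrow> expo u = expo v"
  by (induction rule: conj_eq.induct) (auto simp: braid_eq_expo)

text \<open>The Garside element, its square, which generates the centre, and the inverse of the latter.\<close>

definition half :: "int list" where "half = [1, 2, 1]"
definition full :: "int list" where "full = [1, 2, 1, 2, 1, 2]"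
definition full_inv :: "int list" where "full_inv = [-2, -1, -2, -1, -2, -1]"

lemma bw_twists [simp]: "bw half" "bw full" "bw full_inv"
  by (simp_all add: half_def full_def full_inv_def)

lemma expo_twists [simp]: "expo half = 3" "expo full = 6"
  by (simp_all add: half_def full_def)

lemma half_half: "braid_eq (half @ half) full"
  using braid_eq.braid[of "[1, 2, 1]" "[]"] by (simp add: half_def full_def)

lemma half_1: "braid_eq (half @ [1]) ([2] @ half)"
proof -
  have "braid_eq ([1, 2, 1] @ [1]) ([2, 1, 2] @ [1])" using braid_eq.braid[of "[]" "[1]"] by simp
  then show ?thesis by (simp add: half_def)
qed

lemma half_2: "braid_eq (half @ [2]) ([1] @ half)"
proof -
  have "braid_eq ([1] @ [2, 1, 2]) ([1] @ [1, 2, 1])" using braid_eq.braid[of "[1]" "[]"] by (auto intro: braid_eq.sym)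
  then show ?thesis by (simp add: half_def)
qed

lemma full_inverse: "braid_eq (full_inv @ full) []" "braid_eq (full @ full_inv) []"
proof -
  note c = braid_eq.cancel
  have "braid_eq ([-2, -1, -2, -1, -2, -1] @ [1, 2, 1, 2, 1, 2]) ([-2, -1, -2, -1, -2] @ [2, 1, 2, 1, 2])"
    using c[of "-1" "[-2, -1, -2, -1, -2]" "[2, 1, 2, 1, 2]"] by simp
  also have "braid_eq \<dots> ([-2, -1, -2, -1] @ [1, 2, 1, 2])" using c[of "-2" "[-2, -1, -2, -1]" "[1, 2, 1, 2]"] by simp
  also have "braid_eq \<dots> ([-2, -1, -2] @ [2, 1, 2])" using c[of "-1" "[-2, -1, -2]" "[2, 1, 2]"] by simp
  also have "braid_eq \<dots> ([-2, -1] @ [1, 2])" using c[of "-2" "[-2, -1]" "[1, 2]"] by simp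
  also have "braid_eq \<dots> ([-2] @ [2])" using c[of "-1" "[-2]" "[2]"] by simp
  also have "braid_eq \<dots> []" using c[of "-2" "[]" "[]"] by simp
  finally show "braid_eq (full_inv @ full) []" by (simp add: full_def full_inv_def)
  have "braid_eq ([1, 2, 1, 2, 1, 2] @ [-2, -1, -2, -1, -2, -1]) ([1, 2, 1, 2, 1] @ [-1, -2, -1, -2, -1])"
    using c[of 2 "[1, 2, 1, 2, 1]" "[-1, -2, -1, -2, -1]"] by simp
  also have "braid_eq \<dots> ([1, 2, 1, 2] @ [-2, -1, -2, -1])" using c[of 1 "[1, 2, 1, 2]" "[-2, -1, -2, -1]"] by simp
  also have "braid_eq \<dots> ([1, 2, 1] @ [-1, -2, -1])" using c[of 2 "[1, 2, 1]" "[-1, -2, -1]"] by simp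
  also have "braid_eq \<dots> ([1, 2] @ [-2, -1])" using c[of 1 "[1, 2]" "[-2, -1]"] by simp
  also have "braid_eq \<dots> ([1] @ [-1])" using c[of 2 "[1]" "[-1]"] by simp
  also have "braid_eq \<dots> []" using c[of 1 "[]" "[]"] by simp
  finally show "braid_eq (full @ full_inv) []" by (simp add: full_def full_inv_def)
qed

text \<open>The half twist exchanges the two generators, so its square commutes with them.\<close>

lemma full_letter_pos:
  assumes "k = 1 \<or> k = 2"
  shows "braid_eq (full @ [k]) ([k] @ full)"
proof -
  define j :: int where "j = 3 - k"
  have h: "braid_eq (half @ [k]) ([j] @ half)" "braid_eq (half @ [j]) ([k] @ half)"
    using assms half_1 half_2 by (auto simp: j_def)
  have "braid_eq (full @ [k]) ((half @ half) @ [k])" by (intro braid_eq_right braid_eq.sym[OF half_half])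
  also have "braid_eq ((half @ half) @ [k]) (half @ [j] @ half)" using braid_eq_left[OF h(1), of half] by simp
  also have "braid_eq \<dots> ([k] @ half @ half)" using braid_eq_right[OF h(2), of half] by simp
  also have "braid_eq \<dots> ([k] @ full)" by (intro braid_eq_left half_half)
  finally show ?thesis .
qed

lemma full_letter:
  assumes "k \<in> {1, 2, -1, -2}"
  shows "braid_eq (full @ [k]) ([k] @ full)"
proof (cases "k > 0")
  case True then show ?thesis using assms full_letter_pos by auto
next
  case False
  then have k: "- k = 1 \<or> - k = 2" "k \<in> {1, 2, -1, -2}" "- k \<in> {1, 2, -1, -2}" using assms by auto
  have "braid_eq (full @ [k]) ([k, - k] @ full @ [k])"
    using braid_eq.cancel[OF k(2), of "[]" "full @ [k]"] by (auto intro: braid_eq.sym)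
  also have "braid_eq \<dots> ([k] @ (full @ [- k]) @ [k])"
    using braid_eq_context[OF braid_eq.sym[OF full_letter_pos[OF k(1)]], of "[k]" "[k]"] by simp
  also have "braid_eq \<dots> ([k] @ full)"
    using braid_eq.cancel[OF k(3), of "[k] @ full" "[]"] by simp
  finally show ?thesis .
qed

lemma full_central: "bw w \<Longrightarrow> braid_eq (full @ w) (w @ full)"
proof (induction w)
  case Nil show ?case by (simp add: braid_eq.refl)
next
  case (Cons k w)
  have "braid_eq (full @ k # w) ([k] @ full @ w)" using braid_eq_right[OF full_letter[of k], of w] Cons.prems by simp
  also have "braid_eq \<dots> ([k] @ w @ full)" using Cons by (intro braid_eq_left) simp
  finally show ?case by simp
qed

definition fulls :: "nat \<Rightarrow> int list"
  where "fulls n = concat (replicate n full)"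

lemma fulls_simps [simp]: "fulls 0 = []" "fulls (Suc n) = full @ fulls n"
  by (simp_all add: fulls_def)

lemma fulls_add: "fulls (m + n) = fulls m @ fulls n"
  by (induction m) auto

lemma bw_fulls [simp]: "bw (fulls n)"
  by (induction n) auto

lemma expo_fulls [simp]: "expo (fulls n) = 6 * int n"
  by (induction n) (auto simp: algebra_simps)

lemma fulls_central: "bw w \<Longrightarrow> braid_eq (fulls n @ w) (w @ fulls n)"
proof (induction n)
  case 0 show ?case by (simp add: braid_eq.refl)
next
  case (Suc n)
  have "braid_eq (full @ fulls n @ w) (full @ w @ fulls n)" using Suc by (intro braid_eq_left)
  also have "braid_eq \<dots> (w @ full @ fulls n)" using braid_eq_right[OF full_central[OF Suc.prems], of "fulls n"] by simp
  finally show ?case by simp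
qed

lemma conj_eq_full: "conj_eq u v \<Longrightarrow> bw u \<Longrightarrow> conj_eq (full @ u) (full @ v)"
proof (induction rule: conj_eq.induct)
  case (equal u v) then show ?case by (intro conj_eq.equal braid_eq_left)
next
  case (sym u v) then show ?case using conj_eq_bw conj_eq.sym by blast
next
  case (trans u v w) then show ?case using conj_eq_bw conj_eq.trans by blast
next
  case (cycle u v)
  have "conj_eq (full @ u @ v) (u @ full @ v)"
    using braid_eq_right[OF full_central[of u], of v] cycle by (intro conj_eq.equal) simp
  also have "conj_eq \<dots> (full @ v @ u)" using conj_eq.cycle[of u "full @ v"] cycle by simp
  finally show ?case .
qed

lemma conj_eq_full_cancel: "conj_eq (full @ u) (full @ v) \<Longrightarrow> bw u \<Longrightarrow> conj_eq u v"
proof -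
  have inv_central: "braid_eq (full_inv @ w) (w @ full_inv)" if "bw w" for w
  proof -
    have "braid_eq (full_inv @ w) ((full_inv @ w) @ full @ full_inv)"
      using braid_eq_left[OF braid_eq.sym[OF full_inverse(2)], of "full_inv @ w"] by simp
    also have "braid_eq \<dots> (full_inv @ (full @ w) @ full_inv)"
      using braid_eq_context[OF braid_eq.sym[OF full_central[OF that]], of full_inv full_inv] by simp
    also have "braid_eq \<dots> (w @ full_inv)"
      using braid_eq_right[OF full_inverse(1), of "w @ full_inv"] by simp
    finally show ?thesis .
  qed
  have inv_mult: "conj_eq (full_inv @ u) (full_inv @ v)" if "conj_eq u v" "bw u" for u v
    using that
  proof (induction rule: conj_eq.induct)
    case (equal u v) then show ?case by (intro conj_eq.equal braid_eq_left)
  next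
    case (sym u v) then show ?case using conj_eq_bw conj_eq.sym by blast
  next
    case (trans u v w) then show ?case using conj_eq_bw conj_eq.trans by blast
  next
    case (cycle u v)
    have "conj_eq (full_inv @ u @ v) (u @ full_inv @ v)"
      using braid_eq_right[OF inv_central[of u], of v] cycle by (intro conj_eq.equal) simp
    also have "conj_eq \<dots> (full_inv @ v @ u)" using conj_eq.cycle[of u "full_inv @ v"] cycle by simp
    finally show ?case .
  qed
  assume a: "conj_eq (full @ u) (full @ v)" "bw u"
  have "conj_eq u (full_inv @ full @ u)"
    using braid_eq_right[OF braid_eq.sym[OF full_inverse(1)], of u] by (intro conj_eq.equal) simp
  also have "conj_eq \<dots> (full_inv @ full @ v)" using inv_mult[OF a(1)] a(2) by simp
  also have "conj_eq \<dots> v" using braid_eq_right[OF full_inverse(1), of v] by (intro conj_eq.equal) simp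
  finally show ?thesis .
qed

lemma conj_eq_fulls: "conj_eq u v \<Longrightarrow> bw u \<Longrightarrow> conj_eq (fulls n @ u) (fulls n @ v)"
  by (induction n) (auto intro: conj_eq_full)

lemma conj_eq_fulls_cancel: "conj_eq (fulls n @ u) (fulls n @ v) \<Longrightarrow> bw u \<Longrightarrow> conj_eq u v"
  by (induction n) (auto dest: conj_eq_full_cancel)

text \<open>Equality and conjugacy in the quotient by the centre. Nonnegative powers of the full twist on both sides
  avoid its inverse.\<close>

definition peq :: "int list \<Rightarrow> int list \<Rightarrow> bool"
  where "peq u v \<longleftrightarrow> (\<exists>m n. braid_eq (fulls m @ u) (fulls n @ v))"

definition pconj :: "int list \<Rightarrow> int list \<Rightarrow> bool"
  where "pconj u v \<longleftrightarrow> (\<exists>m n. conj_eq (fulls m @ u) (fulls n @ v))"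

lemma peq_trans [trans]:
  assumes "peq u v" "peq v w"
  shows "peq u w"
proof -
  obtain m n m' n' where a: "braid_eq (fulls m @ u) (fulls n @ v)" "braid_eq (fulls m' @ v) (fulls n' @ w)"
    using assms unfolding peq_def by blast
  have "braid_eq (fulls (m' + m) @ u) (fulls m' @ fulls n @ v)"
    using braid_eq_left[OF a(1), of "fulls m'"] by (simp add: fulls_add)
  also have "fulls m' @ fulls n @ v = fulls n @ fulls m' @ v"
    using fulls_add[of m' n] fulls_add[of n m'] by (metis add.commute append_assoc)
  also have "braid_eq (fulls n @ fulls m' @ v) (fulls (n + n') @ w)"
    using braid_eq_left[OF a(2), of "fulls n"] by (simp add: fulls_add)
  finally show ?thesis unfolding peq_def by blast
qed

lemma pconj_trans [trans]:
  assumes "pconj u v" "pconj v w" "bw u"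
  shows "pconj u w"
proof -
  obtain m n m' n' where a: "conj_eq (fulls m @ u) (fulls n @ v)" "conj_eq (fulls m' @ v) (fulls n' @ w)"
    using assms unfolding pconj_def by blast
  have v: "bw v" using conj_eq_bw[OF a(1)] assms(3) by simp
  have "conj_eq (fulls (m' + m) @ u) (fulls m' @ fulls n @ v)"
    using conj_eq_fulls[OF a(1), of m'] assms(3) by (simp add: fulls_add)
  also have "fulls m' @ fulls n @ v = fulls n @ fulls m' @ v"
    using fulls_add[of m' n] fulls_add[of n m'] by (metis add.commute append_assoc)
  also have "conj_eq (fulls n @ fulls m' @ v) (fulls (n + n') @ w)"
    using conj_eq_fulls[OF a(2), of n] v by (simp add: fulls_add)
  finally show ?thesis unfolding pconj_def by blast
qed

lemma braid_eq_peq: "braid_eq u v \<Longrightarrow> peq u v"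
  unfolding peq_def by (intro exI[of _ 0]) simp

lemma peq_sym: "peq u v \<Longrightarrow> peq v u"
  unfolding peq_def using braid_eq.sym by blast

lemma peq_context:
  assumes "peq u v" "bw a"
  shows "peq (a @ u @ b) (a @ v @ b)"
proof -
  obtain m n where mn: "braid_eq (fulls m @ u) (fulls n @ v)" using assms unfolding peq_def by blast
  have "braid_eq (fulls m @ a @ u @ b) (a @ (fulls m @ u) @ b)"
    using braid_eq_right[OF fulls_central[OF assms(2)], of m "u @ b"] by simp
  also have "braid_eq \<dots> (a @ (fulls n @ v) @ b)" by (rule braid_eq_context[OF mn])
  also have "braid_eq \<dots> (fulls n @ a @ v @ b)"
    using braid_eq_right[OF braid_eq.sym[OF fulls_central[OF assms(2)]], of n "v @ b"] by simp
  finally show ?thesis unfolding peq_def by blast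
qed

lemma peq_left: "peq u v \<Longrightarrow> bw a \<Longrightarrow> peq (a @ u) (a @ v)"
  using peq_context[of u v a "[]"] by simp

lemma peq_right: "peq u v \<Longrightarrow> peq (u @ b) (v @ b)"
  using peq_context[of u v "[]" b] by simp

lemma peq_pconj: "peq u v \<Longrightarrow> pconj u v"
  unfolding peq_def pconj_def using conj_eq.equal by blast

lemma conj_eq_pconj: "conj_eq u v \<Longrightarrow> pconj u v"
  unfolding pconj_def by (intro exI[of _ 0]) simp

lemma full_peq: "peq full []"
  unfolding peq_def by (intro exI[of _ 0] exI[of _ 1]) (simp add: braid_eq.refl)

text \<open>Modulo the full twist, the group is generated by the half twist, of order two, and the
  product of the two generators, of order three.\<close>

definition third :: "nat \<Rightarrow> int list"
  where "third n = concat (replicate n [1, 2])"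

lemma third_simps [simp]: "third 0 = []" "third (Suc n) = [1, 2] @ third n"
  by (simp_all add: third_def)

lemma third_add: "third (m + n) = third m @ third n"
  by (induction m) auto

lemma bw_third [simp]: "bw (third n)"
  by (induction n) auto

lemma third_3: "third 3 = full"
  by (simp add: eval_nat_numeral full_def)

lemma third_mod: "peq (third n) (third (n mod 3))"
proof (induction n rule: less_induct)
  case (less n)
  show ?case
  proof (cases "n < 3")
    case True then show ?thesis by (simp add: braid_eq_peq braid_eq.refl)
  next
    case False
    then obtain m where m: "n = 3 + m" by (metis add.commute le_Suc_ex not_less)
    have "peq (third n) (third m)"
      using peq_right[OF full_peq, of "third m"] by (simp add: m third_add third_3)
    also have "peq (third m) (third (m mod 3))" using less m by simp
    finally show ?thesis by (simp add: m)
  qed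
qed

text \<open>Words in the free product of the cyclic groups of orders two and three. The exponent \<open>0\<close>
  is allowed; it marks two half twists that cancel.\<close>

fun modular :: "nat list \<Rightarrow> int list" where
  "modular [] = []"
| "modular (e # es) = third e @ half @ modular es"

lemma modular_append: "modular (es @ fs) = modular es @ modular fs"
  by (induction es) auto

lemma bw_modular [simp]: "bw (modular es)"
  by (induction es) auto

lemma letter_peq:
  "peq [1] (third 2 @ half)" "peq [-2] (third 1 @ half)" "peq [-1] (half @ third 1)" "peq [2] (half @ third 2)"
proof -
  have step: "peq [k] A" if "braid_eq (full @ [k]) A" for k A
  proof -
    have "peq [k] (full @ [k])" using peq_right[OF peq_sym[OF full_peq], of "[k]"] by simp
    also have "peq (full @ [k]) A" by (rule braid_eq_peq[OF that])
    finally show ?thesis .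
  qed
  show "peq [1] (third 2 @ half)"
    by (rule step) (simp add: full_def half_def eval_nat_numeral braid_eq.refl)
  show "peq [-2] (third 1 @ half)"
    by (rule step) (use braid_eq.cancel[of 2 "[1, 2, 1, 2, 1]" "[]"] in \<open>simp add: full_def half_def\<close>)
  show "peq [-1] (half @ third 1)"
  proof (rule step)
    have "braid_eq (full @ [-1]) (half @ half @ [-1])"
      using braid_eq_right[OF braid_eq.sym[OF half_half], of "[-1]"] by simp
    also have "braid_eq \<dots> (half @ third 1)"
      using braid_eq.cancel[of 1 "half @ [1, 2]" "[]"] by (simp add: half_def)
    finally show "braid_eq (full @ [-1]) (half @ third 1)" .
  qed
  show "peq [2] (half @ third 2)"
  proof (rule step)
    have "braid_eq (full @ [2]) (half @ half @ [2])"
      using braid_eq_right[OF braid_eq.sym[OF half_half], of "[2]"] by simp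
    then show "braid_eq (full @ [2]) (half @ third 2)" by (simp add: half_def eval_nat_numeral)
  qed
qed

lemma exists_modular_form:
  "bw w \<Longrightarrow> \<exists>es e. set es \<subseteq> {..<3} \<and> e < 3 \<and> peq w (modular es @ third e)"
proof (induction w rule: rev_induct)
  case Nil show ?case by (intro exI[of _ "[]"] exI[of _ 0]) (simp add: braid_eq_peq braid_eq.refl)
next
  case (snoc k w)
  then obtain es e where IH: "set es \<subseteq> {..<3}" "e < 3" "peq w (modular es @ third e)" by auto
  have app: "peq (w @ [k]) (modular es @ third e @ A)" if "peq [k] A" for A
  proof -
    have "peq (w @ [k]) ((modular es @ third e) @ [k])" by (rule peq_right[OF IH(3)])
    also have "peq \<dots> ((modular es @ third e) @ A)" by (rule peq_left[OF that]) simp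
    finally show ?thesis by simp
  qed
  have before: ?case if "peq [k] (third j @ half)" for j
  proof -
    have "peq (w @ [k]) (modular es @ third (e + j) @ half)" using app[OF that] by (simp add: third_add)
    also have "peq \<dots> (modular es @ third ((e + j) mod 3) @ half)" by (intro peq_context third_mod) simp
    finally have "peq (w @ [k]) (modular (es @ [(e + j) mod 3]) @ third 0)" by (simp add: modular_append)
    then show ?thesis using IH by (intro exI[of _ "es @ [(e + j) mod 3]"] exI[of _ 0]) auto
  qed
  have after: ?case if "peq [k] (half @ third j)" "j < 3" for j
  proof -
    have "peq (w @ [k]) (modular (es @ [e]) @ third j)" using app[OF that(1)] by (simp add: modular_append)
    then show ?thesis using IH that(2) by (intro exI[of _ "es @ [e]"] exI[of _ j]) auto
  qed
  have "k \<in> {1, 2, -1, -2}" using snoc.prems by simp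
  then show ?case using before[of 2] before[of 1] after[of 1] after[of 2] letter_peq by auto
qed

text \<open>The first three words represent the nontrivial conjugacy classes of elements of finite
  order in the modular group.\<close>

definition normal_form :: "int list \<Rightarrow> bool"
  where "normal_form r \<longleftrightarrow> r = third 1 \<or> r = third 2 \<or> r = half \<or> set r \<subseteq> {1, -2}"

text \<open>Cyclic reduction. After conjugation the last power of order three joins the first one; an
  exponent \<open>0\<close> is rotated to the end, where the two half twists next to it cancel and the word
  becomes shorter. If no exponent is \<open>0\<close>, the factors \<open>third 1 @ half\<close> and \<open>third 2 @ half\<close> are
  the letters \<open>-2\<close> and \<open>1\<close>.\<close>

lemma modular_normal_form:
  "set es \<subseteq> {..<3} \<Longrightarrow> e < 3 \<Longrightarrow> \<exists>r. normal_form r \<and> pconj (modular es @ third e) r"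
proof (induction "length es" arbitrary: es e rule: less_induct)
  case less
  show ?case
  proof (cases es)
    case Nil
    have "normal_form (third e)"
    proof -
      have "e = 0 \<or> e = 1 \<or> e = 2" using less.prems by auto
      then show ?thesis by (auto simp: normal_form_def)
    qed
    then show ?thesis using Nil by (intro exI[of _ "third e"]) (simp add: conj_eq_pconj conj_eq_refl)
  next
    case (Cons e1 es')
    let ?fs = "((e + e1) mod 3) # es'"
    have fs: "set ?fs \<subseteq> {..<3}" using less.prems Cons by auto
    have "pconj (modular es @ third e) (third e @ modular es)"
      by (intro conj_eq_pconj conj_eq.cycle) auto
    also have "pconj (third e @ modular es) (modular ?fs)"
      using peq_right[OF third_mod[of "e + e1"], of "half @ modular es'"] Cons
      by (intro peq_pconj) (simp add: third_add)
    finally have 1: "pconj (modular es @ third e) (modular ?fs)" by simp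
    have "\<exists>r. normal_form r \<and> pconj (modular ?fs) r"
    proof (cases "0 \<in> set ?fs")
      case False
      have *: "\<exists>r. set r \<subseteq> {1, -2} \<and> peq (modular gs) r" if "set gs \<subseteq> {..<3}" "0 \<notin> set gs" for gs
        using that
      proof (induction gs)
        case Nil show ?case by (intro exI[of _ "[]"]) (simp add: braid_eq_peq braid_eq.refl)
      next
        case (Cons g gs)
        then obtain r where r: "set r \<subseteq> {1, -2}" "peq (modular gs) r" by auto
        have "g = 1 \<or> g = 2" using Cons.prems by auto
        then have "\<exists>k\<in>{1, -2}. peq (third g @ half) [k]"
        proof
          assume "g = 1"
          then show ?thesis using peq_sym[OF letter_peq(2)] by blast
        next
          assume "g = 2"
          then show ?thesis using peq_sym[OF letter_peq(1)] by blast
        qed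
        then obtain k where k: "k \<in> {1, -2}" "peq (third g @ half) [k]" by blast
        have "peq (modular (g # gs)) ([k] @ modular gs)" using peq_right[OF k(2), of "modular gs"] by simp
        also have "peq \<dots> ([k] @ r)" using k(1) by (intro peq_left r) auto
        finally show ?case using k(1) r(1) by (intro exI[of _ "[k] @ r"]) auto
      qed
      then obtain r where "set r \<subseteq> {1, -2}" "peq (modular ?fs) r" using fs False by blast
      then show ?thesis by (intro exI[of _ r]) (auto simp: normal_form_def intro: peq_pconj)
    next
      case True
      then obtain a b where ab: "?fs = a @ 0 # b" by (meson split_list)
      have rot: "pconj (modular ?fs) (modular (b @ a) @ half)"
        using conj_eq.cycle[of "modular a @ half" "modular b"] unfolding ab
        by (intro conj_eq_pconj) (simp add: modular_append)
      show ?thesis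
      proof (cases "b @ a" rule: rev_cases)
        case Nil
        then show ?thesis using rot by (intro exI[of _ half]) (auto simp: normal_form_def)
      next
        case (snoc c h)
        have len: "length c < length es"
        proof -
          have "length ?fs = length a + length b + 1" using ab by simp
          moreover have "length a + length b = length c + 1" using arg_cong[OF snoc, of length] by simp
          ultimately show ?thesis using Cons by simp
        qed
        have ch: "set c \<subseteq> {..<3}" "h < 3"
        proof -
          have "set (b @ a) \<subseteq> {..<3}" using fs unfolding ab by auto
          then show "set c \<subseteq> {..<3}" "h < 3" unfolding snoc by auto
        qed
        have "peq (modular (b @ a) @ half) (modular c @ third h)"
        proof -
          have "peq ((modular c @ third h) @ half @ half) ((modular c @ third h) @ full)"
            by (intro peq_left braid_eq_peq half_half) simp
          also have "peq \<dots> ((modular c @ third h) @ [])" by (intro peq_left full_peq) simp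
          finally show ?thesis by (simp add: snoc modular_append)
        qed
        then have "pconj (modular ?fs) (modular c @ third h)" using rot pconj_trans peq_pconj by (meson bw_modular)
        moreover obtain r where "normal_form r" "pconj (modular c @ third h) r" using less.hyps[OF len ch] by blast
        ultimately show ?thesis using pconj_trans by (meson bw_modular)
      qed
    qed
    then obtain r where "normal_form r" "pconj (modular ?fs) r" by blast
    then show ?thesis using pconj_trans[OF 1] by (metis bw_modular bw_simps(3) bw_third)
  qed
qed

theorem exists_normal_form:
  assumes "bw w"
  obtains r m n where "normal_form r" "conj_eq (fulls m @ w) (fulls n @ r)"
proof -
  obtain es e where e: "set es \<subseteq> {..<3}" "e < 3" "peq w (modular es @ third e)"
    using exists_modular_form[OF assms] by blast
  obtain r where r: "normal_form r" "pconj (modular es @ third e) r"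
    using modular_normal_form[OF e(1,2)] by blast
  have "pconj w r" using pconj_trans[OF peq_pconj[OF e(3)] r(2) assms] .
  then show thesis using r(1) that unfolding pconj_def by blast
qed

text \<open>The full twist has exponent sum six, so the exponent sums determine the powers of the full
  twist that separate the words from their normal form.\<close>

lemma normal_form_determines:
  assumes w: "bw w" "bw w'" and e: "expo w = expo w'"
    and r: "conj_eq (fulls m @ w) (fulls n @ r)" "conj_eq (fulls m' @ w') (fulls n' @ r)"
  shows "conj_eq w w'"
proof -
  have "6 * int m + expo w = 6 * int n + expo r" "6 * int m' + expo w' = 6 * int n' + expo r"
    using conj_eq_expo[OF r(1)] conj_eq_expo[OF r(2)] by simp_all
  then have "int (m + n') = int (m' + n)" using e by simp
  then have mn: "m + n' = m' + n" by (simp only: of_nat_eq_iff)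
  have "conj_eq (fulls (m + n') @ w) (fulls (n' + n) @ r)"
    using conj_eq_fulls[OF r(1), of n'] w(1) by (simp add: add.commute[of m] fulls_add)
  also have "conj_eq (fulls (n' + n) @ r) (fulls (m' + n) @ w')"
    using conj_eq.sym[OF conj_eq_fulls[OF r(2), of n]] w(2) by (simp add: add.commute[of m'] add.commute[of n'] fulls_add)
  finally show ?thesis using conj_eq_fulls_cancel w(1) mn by metis
qed

section \<open>Properties of words that respect the skein relation\<close>

lemma letter_2_conjugate: "braid_eq ([1, 2] @ [1] @ [-2, -1]) [2]" "braid_eq ([1, 2] @ [-1] @ [-2, -1]) [-2]"
proof -
  have a: "braid_eq [1, 2, 1] [2, 1, 2]" using braid_eq.braid[of "[]" "[]"] by simp
  have c: "braid_eq ([1, 2] @ [-2, -1]) []"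
  proof -
    have "braid_eq ([1, 2] @ [-2, -1]) ([1] @ [-1])" using braid_eq.cancel[of 2 "[1]" "[-1]"] by simp
    also have "braid_eq \<dots> []" using braid_eq.cancel[of 1 "[]" "[]"] by simp
    finally show ?thesis .
  qed
  have "braid_eq ([1, 2] @ [1] @ [-2, -1]) ([2] @ [1, 2] @ [-2, -1])" using braid_eq_right[OF a, of "[-2, -1]"] by simp
  also have "braid_eq \<dots> [2]" using braid_eq_left[OF c, of "[2]"] by simp
  finally show "braid_eq ([1, 2] @ [1] @ [-2, -1]) [2]" .
  have "braid_eq ([1, 2] @ [-1] @ [-2, -1]) ([-2] @ [2, 1, 2] @ [-1, -2, -1])"
    using braid_eq.sym[OF braid_eq.cancel[of "-2" "[]" "[1, 2, -1, -2, -1]"]] by simp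
  also have "braid_eq \<dots> ([-2] @ [1, 2, 1] @ [-1, -2, -1])"
    by (intro braid_eq_context braid_eq.sym[OF a])
  also have "braid_eq \<dots> ([-2] @ [1, 2] @ [-2, -1])" using braid_eq.cancel[of 1 "[-2, 1, 2]" "[-2, -1]"] by simp
  also have "braid_eq \<dots> [-2]" using braid_eq_left[OF c, of "[-2]"] by simp
  finally show "braid_eq ([1, 2] @ [-1] @ [-2, -1]) [-2]" .
qed

lemma conjugate_letter_2:
  assumes "bw \<beta>"
  defines "\<beta>' \<equiv> [-2, -1] @ \<beta> @ [1, 2]"
  shows "conj_eq (\<beta> @ [2]) (\<beta>' @ [1])" "conj_eq (\<beta> @ [-2]) (\<beta>' @ [-1])" "conj_eq \<beta> \<beta>'"
proof -
  have c: "braid_eq ([1, 2] @ [-2, -1]) []"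
  proof -
    have "braid_eq ([1, 2] @ [-2, -1]) ([1] @ [-1])" using braid_eq.cancel[of 2 "[1]" "[-1]"] by simp
    also have "braid_eq \<dots> []" using braid_eq.cancel[of 1 "[]" "[]"] by simp
    finally show ?thesis .
  qed
  have step: "conj_eq (\<beta> @ A) (\<beta>' @ B)" if "braid_eq ([1, 2] @ B @ [-2, -1]) A" "bw B" for A B
  proof -
    have "conj_eq (\<beta> @ A) (\<beta> @ [1, 2] @ B @ [-2, -1])"
      by (intro conj_eq.equal braid_eq_left braid_eq.sym[OF that(1)])
    also have "conj_eq \<dots> (\<beta>' @ B)"
      using conj_eq.cycle[of "\<beta> @ [1, 2] @ B" "[-2, -1]"] assms(1) that(2) by (simp add: \<beta>'_def)
    finally show ?thesis .
  qed
  show "conj_eq (\<beta> @ [2]) (\<beta>' @ [1])" "conj_eq (\<beta> @ [-2]) (\<beta>' @ [-1])"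
    by (intro step letter_2_conjugate; simp)+
  show "conj_eq \<beta> \<beta>'" using step[of "[]" "[]"] c by simp
qed

text \<open>By induction on the length. Changing the sign of a letter is a skein move, whose third
  word is shorter; so the signs of the letters do not matter and all words may be taken to be
  positive. A double letter becomes, after a change of sign, a pair that cancels, which again
  leaves a shorter word. Every positive word with at least three letters can be given a double
  letter by the braid relation and conjugation.\<close>

theorem skein_word_induct [consumes 1]:
  fixes K :: "int list \<Rightarrow> bool"
  assumes w: "bw w"
    and conj: "\<And>u v. conj_eq u v \<Longrightarrow> bw u \<Longrightarrow> K u \<Longrightarrow> K v"
    and pos: "\<And>\<beta>. bw \<beta> \<Longrightarrow> K \<beta> \<Longrightarrow> K (\<beta> @ [-1]) \<Longrightarrow> K (\<beta> @ [1])"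
    and neg: "\<And>\<beta>. bw \<beta> \<Longrightarrow> K \<beta> \<Longrightarrow> K (\<beta> @ [1]) \<Longrightarrow> K (\<beta> @ [-1])"
    and base: "K []" "K [1]" "K [1, 2]"
  shows "K w"
  using w
proof (induction "length w" arbitrary: w rule: less_induct)
  case less
  have ceq: "K u \<longleftrightarrow> K v" if "conj_eq u v" "bw u" for u v
    using conj[OF that] conj[OF conj_eq.sym[OF that(1)]] conj_eq_bw[OF that(1)] that(2) by blast
  \<comment> \<open>a letter \<open>2\<close> at the end is conjugated into a letter \<open>1\<close> first\<close>
  have flip_end: "K (\<beta> @ [- k])" if b: "bw \<beta>" and k: "k \<in> {1, 2, -1, -2}" and K: "K \<beta>" "K (\<beta> @ [k])" for \<beta> k
  proof -
    note c = conjugate_letter_2[OF b]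
    let ?b = "[-2, -1] @ \<beta> @ [1, 2]"
    have bb: "bw ?b" using b by simp
    have K': "K ?b" using ceq[OF c(3) b] K(1) by simp
    have e: "K (\<beta> @ [2]) \<longleftrightarrow> K (?b @ [1])" "K (\<beta> @ [-2]) \<longleftrightarrow> K (?b @ [-1])"
      using ceq[OF c(1)] ceq[OF c(2)] b by simp_all
    consider "k = 1" | "k = -1" | "k = 2" | "k = -2" using k by auto
    then show ?thesis
    proof cases
      case 1 then show ?thesis using neg[OF b] K by simp
    next
      case 2 then show ?thesis using pos[OF b] K by simp
    next
      case 3 then show ?thesis using neg[OF bb K'] K(2) e by simp
    next
      case 4 then show ?thesis using pos[OF bb K'] K(2) e by simp
    qed
  qed
  have flip: "K (u @ [k] @ v) \<Longrightarrow> K (u @ [- k] @ v)"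
    if b: "bw (u @ [k] @ v)" and l: "length (u @ [k] @ v) = length w" for u k v
  proof -
    assume "K (u @ [k] @ v)"
    have kk: "k \<in> {1, 2, -1, -2}" "- k \<in> {1, 2, -1, -2}" and bv: "bw (v @ u)" using b by auto
    have "conj_eq (u @ [k] @ v) ((v @ u) @ [k])" using conj_eq.cycle[of "u @ [k]" v] b by simp
    then have 1: "K ((v @ u) @ [k])" using \<open>K (u @ [k] @ v)\<close> ceq b by blast
    have "K (v @ u)" using less.hyps[of "v @ u"] bv l by simp
    then have "K ((v @ u) @ [- k])" using flip_end[OF bv kk(1) _ 1] by blast
    moreover have "conj_eq ((v @ u) @ [- k]) (u @ [- k] @ v)"
      using conj_eq.cycle[of v "u @ [- k]"] b kk by simp
    moreover have "bw ((v @ u) @ [- k])" using bv kk by simp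
    ultimately show "K (u @ [- k] @ v)" using ceq by blast
  qed
  have double: "K (u @ [k, k] @ v)" if b: "bw (u @ [k, k] @ v)" and l: "length (u @ [k, k] @ v) = length w" for u k v
  proof -
    have kk: "- k \<in> {1, 2, -1, -2}" "k \<in> {1, 2, -1, -2}" using b by auto
    have "K (u @ v)" using less.hyps[of "u @ v"] b l by simp
    moreover have "conj_eq (u @ [k, - k] @ v) (u @ v)" using kk by (intro conj_eq.equal braid_eq.cancel)
    moreover have "bw (u @ [k, - k] @ v)" using b kk by simp
    ultimately have "K (u @ [k, - k] @ v)" using ceq by blast
    then show ?thesis using flip[of "u @ [k]" "- k" v] b l kk by simp
  qed
  have positive: "K v" if v: "set v \<subseteq> {1, 2}" "length v = length w" for v
  proof -
    have bv: "bw v" using v(1) by (auto simp: braid_word_def)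
    have two: "x = y \<or> y = z \<or> z = x" if "x \<in> {1, 2}" "y \<in> {1, 2}" "z \<in> {1, 2}" for x y z :: int using that by auto
    consider "v = []" | x where "v = [x]" | x y where "v = [x, y]" | x y z r where "v = x # y # z # r"
      by (metis list.exhaust)
    then show ?thesis
    proof cases
      case 1 then show ?thesis using base by simp
    next
      case (2 x)
      have "conj_eq [2] ([-2, -1] @ [1, 2] @ [1])" using conjugate_letter_2(1)[of "[]"] by simp
      also have "conj_eq \<dots> [1]"
      proof -
        have "braid_eq ([-2, -1] @ [1, 2] @ [1]) ([-2] @ [2] @ [1])" using braid_eq.cancel[of "-1" "[-2]" "[2, 1]"] by simp
        also have "braid_eq \<dots> [1]" using braid_eq.cancel[of "-2" "[]" "[1]"] by simp
        finally show ?thesis by (rule conj_eq.equal)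
      qed
      finally have "K [2]" using ceq base(2) by simp
      then show ?thesis using 2 v(1) base(2) by auto
    next
      case (3 x y)
      have "conj_eq ([1] @ [2]) ([2] @ [1])" by (intro conj_eq.cycle) auto
      then have "K [2, 1]" using ceq[of "[1, 2]" "[2, 1]"] base(3) by simp
      moreover have "K ([] @ [x, x] @ [])" if "x = y" using double[of "[]" x "[]"] bv 3 v(2) that by simp
      ultimately show ?thesis using 3 v(1) base(3) by auto
    next
      case (4 x y z r)
      have xyz: "x \<in> {1, 2}" "y \<in> {1, 2}" "z \<in> {1, 2}" using v(1) 4 by auto
      consider "x = y" | "y = z" | "x \<noteq> y" "y \<noteq> z" "z = x" using two[OF xyz] by blast
      then show ?thesis
      proof cases
        case 1 then show ?thesis using double[of "[]" x "z # r"] bv v(2) 4 by simp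
      next
        case 2 then show ?thesis using double[of "[x]" y r] bv v(2) 4 by simp
      next
        case 3
        have aba: "braid_eq [y, x, y] [x, y, x]"
        proof -
          have "braid_eq [1, 2, 1] [2, 1, 2]" using braid_eq.braid[of "[]" "[]"] by simp
          moreover have "(x = 1 \<and> y = 2) \<or> (x = 2 \<and> y = 1)" using xyz 3 by auto
          ultimately show ?thesis using braid_eq.sym by auto
        qed
        show ?thesis
        proof (cases r)
          case Nil
          have "conj_eq ([x] @ [y, x]) ([y, x] @ [x])" using bv 4 3 Nil by (intro conj_eq.cycle) auto
          moreover have "K ([y] @ [x, x] @ [])" using double[of "[y]" x "[]"] bv v(2) 4 3 Nil by simp
          moreover have "bw [x, y, x]" using bv 4 3 Nil by simp
          ultimately show ?thesis using ceq[of "[x, y, x]" "[y, x, x]"] 4 3 Nil by simp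
        next
          case (Cons t r')
          have t: "t \<in> {1, 2}" using v(1) 4 Cons by auto
          show ?thesis
          proof (cases "t = x")
            case True
            then show ?thesis using double[of "[x, y]" x r'] bv v(2) 4 3 Cons by simp
          next
            case False
            then have "t = y" using t xyz 3 by auto
            have "conj_eq ([x] @ [y, x, y] @ r') ([x] @ [x, y, x] @ r')"
              by (intro conj_eq.equal braid_eq_context aba)
            moreover have "K ([] @ [x, x] @ [y, x] @ r')" using double[of "[]" x "[y, x] @ r'"] bv v(2) 4 3 Cons \<open>t = y\<close> by simp
            moreover have "bw ([x] @ [y, x, y] @ r')" using bv 4 3 Cons \<open>t = y\<close> by simp
            ultimately show ?thesis using ceq[of "[x] @ [y, x, y] @ r'" "[x] @ [x, y, x] @ r'"] 4 3 Cons \<open>t = y\<close> by simp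
          qed
        qed
      qed
    qed
  qed
  have "K (u @ v)" if "bw v" "set u \<subseteq> {1, 2}" "length (u @ v) = length w" for u v
    using that
  proof (induction v arbitrary: u)
    case Nil then show ?case using positive[of u] by simp
  next
    case (Cons k v)
    have bu: "bw u" using Cons.prems(2) by (auto simp: braid_word_def)
    consider "k \<in> {1, 2}" | "- k \<in> {1, 2}" using Cons.prems(1) by auto
    then show ?case
    proof cases
      case 1 then show ?thesis using Cons.IH[of "u @ [k]"] Cons.prems by simp
    next
      case 2
      then have "K ((u @ [- k]) @ v)" using Cons.prems by (intro Cons.IH) auto
      then show ?thesis using flip[of u "- k" v] Cons.prems bu 2 by auto
    qed
  qed
  from this[of w "[]"] less.prems show ?case by simp
qed

section \<open>Evaluations of Laurent polynomials\<close>

text \<open>Evaluation at a pair of complex numbers, which for nonzero arguments is a ring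
  homomorphism.\<close>

definition ev :: "complex \<Rightarrow> complex \<Rightarrow> laurent \<Rightarrow> complex"
  where "ev v z Q = (\<Sum>k\<in>Poly_Mapping.keys Q. of_int (Poly_Mapping.lookup Q k) * (v powi fst k * z powi snd k))"

lemma ev_superset:
  assumes "finite A" "Poly_Mapping.keys Q \<subseteq> A"
  shows "ev v z Q = (\<Sum>k\<in>A. of_int (Poly_Mapping.lookup Q k) * (v powi fst k * z powi snd k))"
  unfolding ev_def using assms by (intro sum.mono_neutral_left) (auto simp: in_keys_iff)

lemma ev_diff: "ev v z (Q - R) = ev v z Q - ev v z R"
proof -
  let ?A = "Poly_Mapping.keys Q \<union> Poly_Mapping.keys R"
  have "ev v z (Q - R) = (\<Sum>k\<in>?A. of_int (Poly_Mapping.lookup (Q - R) k) * (v powi fst k * z powi snd k))"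
    by (intro ev_superset) (auto simp: keys_diff)
  also have "\<dots> = ev v z Q - ev v z R"
    by (simp add: ev_superset[of ?A Q] ev_superset[of ?A R] lookup_minus left_diff_distrib sum_subtractf)
  finally show ?thesis .
qed

lemma ev_0 [simp]: "ev v z 0 = 0"
  by (simp add: ev_def)

lemma ev_mono: "ev v z (mono_vz i j) = v powi i * z powi j"
  by (simp add: ev_def mono_vz_def)

lemma mono_mult: "mono_vz i j * mono_vz k l = mono_vz (i + k) (j + l)"
  by (simp add: mono_vz_def mult_single)

lemma mono_0_0: "mono_vz 0 0 = 1"
  by (simp add: mono_vz_def zero_prod_def[symmetric])

lemma ev_1 [simp]: "ev v z 1 = 1"
  using ev_mono[of v z 0 0] by (simp add: mono_0_0)

lemma ev_mono_mult:
  assumes "v \<noteq> 0" "z \<noteq> 0"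
  shows "ev v z (mono_vz i j * Q) = v powi i * z powi j * ev v z Q"
proof (rule frag_induction[where S = UNIV and c = Q and
      P = "\<lambda>Q. ev v z (mono_vz i j * Q) = v powi i * z powi j * ev v z Q"])
  fix x :: "int \<times> int"
  have "frag_of x = mono_vz (fst x) (snd x)" by (simp add: mono_vz_def)
  then show "ev v z (mono_vz i j * frag_of x) = v powi i * z powi j * ev v z (frag_of x)"
    using assms by (simp add: mono_mult ev_mono power_int_add)
next
  fix Q R :: laurent
  assume "ev v z (mono_vz i j * Q) = v powi i * z powi j * ev v z Q"
    "ev v z (mono_vz i j * R) = v powi i * z powi j * ev v z R"
  then show "ev v z (mono_vz i j * (Q - R)) = v powi i * z powi j * ev v z (Q - R)"
    by (simp add: right_diff_distrib ev_diff)
qed simp_all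

section \<open>A two-dimensional representation\<close>

type_synonym mat2 = "real \<times> real \<times> real \<times> real"

fun mat_mult :: "mat2 \<Rightarrow> mat2 \<Rightarrow> mat2" where
  "mat_mult (a, b, c, d) (a', b', c', d') = (a * a' + b * c', a * b' + b * d', c * a' + d * c', c * b' + d * d')"

fun mat_trace :: "mat2 \<Rightarrow> real" where
  "mat_trace (a, b, c, d) = a + d"

text \<open>Up to scaling a specialization of the Burau representation. Both generators have the
  eigenvalues \<open>2\<close> and \<open>1/2\<close>, and in the chosen basis the matrices of the letters \<open>1\<close> and \<open>-2\<close>
  have nonnegative entries.\<close>

definition mat_letter :: "int \<Rightarrow> mat2"
  where "mat_letter k =
    (if k = 1 then (2, 1, 0, 1/2) else if k = 2 then (1/2, 0, -1, 2)
     else if k = -1 then (1/2, -1, 0, 2) else (2, 0, 1, 1/2))"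

fun mat :: "int list \<Rightarrow> mat2" where
  "mat [] = (1, 0, 0, 1)"
| "mat (k # w) = mat_mult (mat_letter k) (mat w)"

lemma mat_mult_assoc: "mat_mult (mat_mult A B) C = mat_mult A (mat_mult B C)"
  by (cases A; cases B; cases C) (simp add: algebra_simps)

lemma mat_mult_1 [simp]: "mat_mult (1, 0, 0, 1) A = A" "mat_mult A (1, 0, 0, 1) = A"
  by (cases A; simp)+

lemma mat_append: "mat (u @ v) = mat_mult (mat u) (mat v)"
  by (induction u) (auto simp: mat_mult_assoc)

lemma mat_trace_commute: "mat_trace (mat_mult A B) = mat_trace (mat_mult B A)"
  by (cases A; cases B) (simp add: algebra_simps)

lemma mat_braid_eq: "braid_eq u v \<Longrightarrow> mat u = mat v"
proof (induction rule: braid_eq.induct)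
  case (cancel k u v)
  have "mat [k, - k] = (1, 0, 0, 1)" using cancel by (auto simp: mat_letter_def)
  then show ?case by (simp only: mat_append mat_mult_1)
next
  case (braid u v)
  have "mat [1, 2, 1] = mat [2, 1, 2]" by (simp add: mat_letter_def)
  then show ?case by (simp only: mat_append)
qed auto

definition tr :: "int list \<Rightarrow> real"
  where "tr w = mat_trace (mat w)"

lemma tr_conj_eq: "conj_eq u v \<Longrightarrow> tr u = tr v"
  by (induction rule: conj_eq.induct) (auto simp: tr_def mat_braid_eq mat_append mat_trace_commute)

lemma mat_full: "mat full = (-1, 0, 0, -1)"
  by (simp add: full_def mat_letter_def)

lemma tr_fulls: "\<bar>tr (fulls n @ w)\<bar> = \<bar>tr w\<bar>"
proof (induction n)
  case (Suc n)
  have "mat_trace (mat_mult (-1, 0, 0, -1) A) = - mat_trace A" for A by (cases A) simp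
  then have "tr (fulls (Suc n) @ w) = - tr (fulls n @ w)"
    by (simp add: tr_def mat_append mat_full mat_mult_assoc)
  then show ?case using Suc by simp
qed simp

text \<open>Multiplication by either letter doubles the first diagonal entry of a nonnegative matrix
  or makes it even larger.\<close>

lemma tr_ge_power:
  assumes "set r \<subseteq> {1, -2}"
  shows "2 ^ length r \<le> tr r"
proof -
  have "\<exists>a b c d. mat r = (a, b, c, d) \<and> a \<ge> 2 ^ length r \<and> b \<ge> 0 \<and> c \<ge> 0 \<and> d \<ge> 0"
    using assms
  proof (induction r)
    case (Cons k r)
    then obtain a b c d where r: "mat r = (a, b, c, d)" "a \<ge> 2 ^ length r" "b \<ge> 0" "c \<ge> 0" "d \<ge> 0" by auto
    have a: "a \<ge> 0" using r(2) zero_le_power[of "2::real" "length r"] by linarith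
    have "k = 1 \<or> k = -2" using Cons.prems by auto
    then have "mat (k # r) = (2 * a + c, 2 * b + d, c / 2, d / 2) \<or> mat (k # r) = (2 * a, 2 * b, a + c / 2, b + d / 2)"
      by (auto simp: r(1) mat_letter_def)
    moreover have "2 ^ length (k # r) \<le> 2 * a" using r(2) by simp
    ultimately show ?case using r(3-5) a by (elim disjE) (intro exI conjI, assumption, simp_all)+
  qed simp
  then show ?thesis by (auto simp: tr_def)
qed

text \<open>By the theorem of Cayley and Hamilton the sum of a generator and its inverse is \<open>5/2\<close>.\<close>

lemma tr_skein: "tr (\<beta> @ [1]) + tr (\<beta> @ [-1]) = 5/2 * tr \<beta>"
  unfolding tr_def mat_append by (cases "mat \<beta>") (simp add: mat_letter_def)

section \<open>The skein polynomial of closed 3-braids\<close>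

locale skein_polynomial =
  fixes P :: "olink \<Rightarrow> laurent"
  assumes P: "is_skein_polynomial P"
begin

definition f :: "int list \<Rightarrow> laurent"
  where "f w = P (braid_closure 3 w)"

lemma P_isotopic: "link L \<Longrightarrow> isotopic L L' \<Longrightarrow> P L = P L'"
  using P link_isotopic unfolding is_skein_polynomial_def by blast

lemma f_conj: "conj_eq u v \<Longrightarrow> bw u \<Longrightarrow> f u = f v"
  unfolding f_def using P_isotopic link_braid_closure conj_eq_isotopic by blast

lemma f_skein: "bw \<beta> \<Longrightarrow> mono_vz (- 1) 0 * f (\<beta> @ [1]) - mono_vz 1 0 * f (\<beta> @ [- 1]) = mono_vz 0 1 * f \<beta>"
  unfolding f_def by (rule skein_relation_braids[OF P])

lemma f_unlink: "isotopic (unlink n) (braid_closure 3 w) \<Longrightarrow> bw w \<Longrightarrow> f w = P (unlink n)"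
  unfolding f_def
proof -
  assume a: "isotopic (unlink n) (braid_closure 3 w)" "bw w"
  have "isotopic (braid_closure 3 w) (unlink n)"
    using isotopic_sym_space[OF a(1)] space_link_in_range unfolding unlink_space_link by blast
  then show "P (braid_closure 3 w) = P (unlink n)"
    using P_isotopic[OF link_braid_closure[OF a(2)]] by simp
qed

lemma f_unknot: "\<epsilon>1 \<in> {1, -1} \<Longrightarrow> \<epsilon>2 \<in> {1, -1} \<Longrightarrow> f [\<epsilon>1, 2 * \<epsilon>2] = 1"
  using f_unlink[OF unlink_1_braid] P by (auto simp: is_skein_polynomial_def)

text \<open>The two generators are conjugate.\<close>

lemma f_2: "f [2] = f [1]" "f [-2] = f [-1]" "conj_eq [-2] [-1]"
proof -
  have c: "conj_eq ([-2, -1] @ [1, 2] @ A) A" for A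
  proof -
    have "braid_eq ([-2, -1] @ [1, 2] @ A) ([-2] @ [2] @ A)" using braid_eq.cancel[of "-1" "[-2]" "[2] @ A"] by simp
    also have "braid_eq \<dots> A" using braid_eq.cancel[of "-2" "[]" A] by simp
    finally show ?thesis by (rule conj_eq.equal)
  qed
  show "f [2] = f [1]"
    using conj_eq.trans[OF conjugate_letter_2(1)[of "[]", simplified] c[of "[1]", simplified]] by (intro f_conj) auto
  show "conj_eq [-2] [-1]"
    using conj_eq.trans[OF conjugate_letter_2(2)[of "[]", simplified] c[of "[-1]", simplified]] .
  then show "f [-2] = f [-1]" by (intro f_conj) auto
qed

lemma mono_cancel: "mono_vz i j * Q = R \<Longrightarrow> Q = mono_vz (- i) (- j) * R"
proof -
  assume "mono_vz i j * Q = R"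
  then have "mono_vz (- i) (- j) * R = (mono_vz (- i) (- j) * mono_vz i j) * Q" by (simp only: mult.assoc)
  then show ?thesis by (simp add: mono_mult mono_0_0)
qed

text \<open>Both signs of the last letter of \<open>[2, 1]\<close> give the unknot, so that the skein relation
  yields the polynomial of the word \<open>[2]\<close>, which is conjugate to \<open>[1]\<close>; with \<open>[-2]\<close> in place of
  \<open>[2]\<close> it yields that of \<open>[-1]\<close>.\<close>

lemma f_1: "f [1] = mono_vz (-1) (-1) - mono_vz 1 (-1)" "f [-1] = f [1]"
proof -
  have two: "f [k, 1] = f [1, k]" "f [k, -1] = f [-1, k]" if "k = 2 \<or> k = -2" for k
    using f_conj[OF conj_eq.cycle[of "[k]" "[1]"]] f_conj[OF conj_eq.cycle[of "[k]" "[-1]"]] that by auto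
  have "mono_vz (-1) 0 * 1 - mono_vz 1 0 * 1 = mono_vz 0 1 * f [2]"
    using f_skein[of "[2]"] two[of 2] f_unknot[of 1 1] f_unknot[of "-1" 1] by simp
  then have 1: "f [1] = mono_vz 0 (-1) * (mono_vz (-1) 0 - mono_vz 1 0)"
    using mono_cancel[of 0 1 "f [2]"] f_2 by simp
  then show "f [1] = mono_vz (-1) (-1) - mono_vz 1 (-1)" by (simp add: right_diff_distrib mono_mult)
  have "mono_vz (-1) 0 * 1 - mono_vz 1 0 * 1 = mono_vz 0 1 * f [-2]"
    using f_skein[of "[-2]"] two[of "-2"] f_unknot[of 1 "-1"] f_unknot[of "-1" "-1"] by simp
  then show "f [-1] = f [1]" using mono_cancel[of 0 1 "f [-2]"] f_2 1 by simp
qed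

lemma f_Nil: "f [] = (mono_vz (-2) (-2) - mono_vz 0 (-2)) - (mono_vz 0 (-2) - mono_vz 2 (-2))"
proof -
  have "mono_vz 0 1 * f [] = mono_vz (-1) 0 * f [1] - mono_vz 1 0 * f [1]"
    using f_skein[of "[]"] f_1(2) by simp
  from mono_cancel[OF this] show ?thesis
    unfolding f_1(1) by (simp add: right_diff_distrib distrib_left mono_mult algebra_simps)
qed

subsection \<open>The exponent sum\<close>

text \<open>The form that the Morton-Franks-Williams inequality takes on three strands.\<close>

definition v_support :: "int \<Rightarrow> laurent \<Rightarrow> bool"
  where "v_support e Q \<longleftrightarrow> (\<forall>k\<in>Poly_Mapping.keys Q. fst k \<in> {e - 2, e, e + 2})"

lemma v_support_diff: "v_support e Q \<Longrightarrow> v_support e R \<Longrightarrow> v_support e (Q - R)"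
  using keys_diff[of Q R] by (auto simp: v_support_def)

lemma v_support_add: "v_support e Q \<Longrightarrow> v_support e R \<Longrightarrow> v_support e (Q + R)"
  using Poly_Mapping.keys_add[of Q R] by (auto simp: v_support_def)

lemma v_support_mult:
  assumes "v_support e Q"
  shows "v_support (e + i) (mono_vz i j * Q)"
  unfolding v_support_def
proof
  fix k assume "k \<in> Poly_Mapping.keys (mono_vz i j * Q)"
  then obtain b where "b \<in> Poly_Mapping.keys Q" "k = (i, j) + b"
    using keys_mult[of "mono_vz i j" Q] by (auto simp: mono_vz_def)
  then show "fst k \<in> {e + i - 2, e + i, e + i + 2}" using assms by (auto simp: v_support_def)
qed

lemma f_pos: "bw \<beta> \<Longrightarrow> f (\<beta> @ [1]) = mono_vz 2 0 * f (\<beta> @ [-1]) + mono_vz 1 1 * f \<beta>"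
proof -
  assume b: "bw \<beta>"
  have "mono_vz (- 1) 0 * f (\<beta> @ [1]) = mono_vz 1 0 * f (\<beta> @ [- 1]) + mono_vz 0 1 * f \<beta>"
    using f_skein[OF b] by (simp add: algebra_simps)
  from mono_cancel[OF this] show ?thesis by (simp add: distrib_left mono_mult flip: mult.assoc)
qed

lemma f_neg: "bw \<beta> \<Longrightarrow> f (\<beta> @ [-1]) = mono_vz (-2) 0 * f (\<beta> @ [1]) - mono_vz (-1) 1 * f \<beta>"
proof -
  assume b: "bw \<beta>"
  have "mono_vz 1 0 * f (\<beta> @ [-1]) = mono_vz (-1) 0 * f (\<beta> @ [1]) - mono_vz 0 1 * f \<beta>"
    using f_skein[OF b] by (simp add: algebra_simps)
  from mono_cancel[OF this] show ?thesis by (simp add: right_diff_distrib mono_mult flip: mult.assoc)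
qed

theorem f_v_support: "bw w \<Longrightarrow> v_support (expo w) (f w)"
proof (induction w rule: skein_word_induct)
  fix u v assume "conj_eq u v" "bw u" "v_support (expo u) (f u)"
  then show "v_support (expo v) (f v)" using f_conj conj_eq_expo by metis
next
  fix \<beta> assume b: "bw \<beta>" and K: "v_support (expo \<beta>) (f \<beta>)" "v_support (expo (\<beta> @ [-1])) (f (\<beta> @ [-1]))"
  have "v_support (expo \<beta> + 1) (mono_vz 2 0 * f (\<beta> @ [-1]))"
    using v_support_mult[OF K(2), of 2 0] by (simp add: add.commute)
  moreover have "v_support (expo \<beta> + 1) (mono_vz 1 1 * f \<beta>)" using v_support_mult[OF K(1)] .
  ultimately show "v_support (expo (\<beta> @ [1])) (f (\<beta> @ [1]))"
    unfolding f_pos[OF b] by (simp add: v_support_add)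
next
  fix \<beta> assume b: "bw \<beta>" and K: "v_support (expo \<beta>) (f \<beta>)" "v_support (expo (\<beta> @ [1])) (f (\<beta> @ [1]))"
  have "v_support (expo \<beta> - 1) (mono_vz (-2) 0 * f (\<beta> @ [1]))"
    using v_support_mult[OF K(2), of "-2" 0] by simp
  moreover have "v_support (expo \<beta> - 1) (mono_vz (-1) 1 * f \<beta>)" using v_support_mult[OF K(1), of "-1" 1] by simp
  ultimately show "v_support (expo (\<beta> @ [-1])) (f (\<beta> @ [-1]))"
    unfolding f_neg[OF b] by (simp add: v_support_diff)
next
  have m: "v_support e (mono_vz i j)" if "i \<in> {e - 2, e, e + 2}" for e i j
    using that by (auto simp: v_support_def mono_vz_def)
  show "v_support (expo []) (f [])" unfolding f_Nil by (intro v_support_diff m) auto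
  show "v_support (expo [1]) (f [1])" unfolding f_1(1) by (intro v_support_diff m) auto
  show "v_support (expo [1, 2]) (f [1, 2])" using f_unknot[of 1 1] m[of 0 2 0] by (simp add: mono_0_0)
qed

text \<open>At these values \<open>v^-1 - v = z\<close>, so that a constant solves the skein relation.\<close>

theorem f_ev_1: "bw w \<Longrightarrow> ev 2 (-3/2) (f w) = 1"
proof (induction w rule: skein_word_induct)
  fix u v assume "conj_eq u v" "bw u" "ev 2 (-3/2) (f u) = 1"
  then show "ev 2 (-3/2) (f v) = 1" using f_conj by metis
next
  have e: "1/2 * ev 2 (-3/2) (f (\<beta> @ [1])) - 2 * ev 2 (-3/2) (f (\<beta> @ [-1])) = -3/2 * ev 2 (-3/2) (f \<beta>)" if "bw \<beta>" for \<beta>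
    using arg_cong[OF f_skein[OF that], of "ev 2 (-3/2)"] by (simp add: ev_diff ev_mono_mult power_int_minus)
  fix \<beta> assume b: "bw \<beta>" and K: "ev 2 (-3/2) (f \<beta>) = 1"
  have lin: "a = 4 * b - 3 * c" "b = a / 4 + 3 / 4 * c" if "1/2 * a - 2 * b = - 3/2 * c" for a b c :: complex
  proof -
    have "a = 2 * (1/2 * a - 2 * b) + 4 * b" by simp
    also have "\<dots> = 4 * b - 3 * c" unfolding that by simp
    finally show "a = 4 * b - 3 * c" .
    then show "b = a / 4 + 3 / 4 * c" by (simp add: field_simps)
  qed
  show "ev 2 (-3/2) (f (\<beta> @ [1])) = 1" if "ev 2 (-3/2) (f (\<beta> @ [-1])) = 1"
    using lin(1)[OF e[OF b]] unfolding K that by simp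
  show "ev 2 (-3/2) (f (\<beta> @ [-1])) = 1" if "ev 2 (-3/2) (f (\<beta> @ [1])) = 1"
    using lin(2)[OF e[OF b]] unfolding K that by simp
next
  show "ev 2 (-3/2) (f []) = 1" unfolding f_Nil ev_diff ev_mono by (simp add: power_int_minus power_int_def power2_eq_square)
  show "ev 2 (-3/2) (f [1]) = 1" unfolding f_1(1) by (simp add: ev_diff ev_mono power_int_minus)
  show "ev 2 (-3/2) (f [1, 2]) = 1" using f_unknot[of 1 1] by simp
qed

lemma f_nonzero: "bw w \<Longrightarrow> f w \<noteq> 0"
  using f_ev_1[of w] by auto

subsection \<open>The trace\<close>

text \<open>At \<open>v = 1\<close>, \<open>z = 5/2 * \<i>\<close> the skein relation is solved by \<open>\<i>^e * tr w\<close> as well as by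
  \<open>\<i>^e * 2^e\<close> and \<open>\<i>^e * 2^(-e)\<close>, since \<open>2 + 1/2 = 5/2\<close>. This combination vanishes on the
  unlinks with two and three components, as their polynomials do at \<open>v = 1\<close>, and the factor
  \<open>4/13\<close> gives the unknot \<open>[1, 2]\<close> the value \<open>1\<close>.\<close>

definition trace_term :: "int list \<Rightarrow> complex"
  where "trace_term w = \<i> powi expo w * (4/13) * of_real (tr w - 2 powi expo w - 2 powi (- expo w))"

theorem f_trace: "bw w \<Longrightarrow> ev 1 (5/2 * \<i>) (f w) = trace_term w"
proof (induction w rule: skein_word_induct)
  fix u v assume "conj_eq u v" "bw u" "ev 1 (5/2 * \<i>) (f u) = trace_term u"
  then show "ev 1 (5/2 * \<i>) (f v) = trace_term v"
    using f_conj[of u v] conj_eq_expo[of u v] tr_conj_eq[of u v] by (simp add: trace_term_def)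
next
  have e: "ev 1 (5/2 * \<i>) (f (\<beta> @ [1])) - ev 1 (5/2 * \<i>) (f (\<beta> @ [-1])) = 5/2 * \<i> * ev 1 (5/2 * \<i>) (f \<beta>)" if "bw \<beta>" for \<beta>
    using arg_cong[OF f_skein[OF that], of "ev 1 (5/2 * \<i>)"] by (simp add: ev_diff ev_mono_mult)
  have t: "trace_term (\<beta> @ [1]) - trace_term (\<beta> @ [-1]) = 5/2 * \<i> * trace_term \<beta>" for \<beta>
  proof -
    define n where "n = expo \<beta>"
    define X where "X w = tr w - 2 powi expo w - 2 powi (- expo w)" for w
    have "X (\<beta> @ [1]) + X (\<beta> @ [-1]) = 5/2 * X \<beta>"
    proof -
      have p: "(2::real) powi (n + 1) = 2 * 2 powi n" "(2::real) powi (n - 1) = 2 powi n / 2"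
        "(2::real) powi (- n - 1) = 2 powi (- n) / 2" "(2::real) powi (1 - n) = 2 * 2 powi (- n)"
        using power_int_add[of "2::real" n 1] power_int_diff[of "2::real" n 1]
          power_int_diff[of "2::real" "- n" 1] power_int_add[of "2::real" 1 "- n"] by simp_all
      show ?thesis unfolding X_def using tr_skein[of \<beta>] p by (simp flip: n_def)
    qed
    moreover have "\<i> powi (n + 1) = \<i> * \<i> powi n" "\<i> powi (n - 1) = - \<i> * \<i> powi n"
      using power_int_add[of \<i> n 1] power_int_diff[of \<i> n 1] by simp_all
    ultimately have "trace_term (\<beta> @ [1]) - trace_term (\<beta> @ [-1]) = \<i> * \<i> powi n * (4/13) * of_real (X (\<beta> @ [1]) + X (\<beta> @ [-1]))"
      by (simp add: trace_term_def X_def n_def algebra_simps)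
    also have "\<dots> = 5/2 * \<i> * trace_term \<beta>"
      unfolding \<open>X (\<beta> @ [1]) + X (\<beta> @ [-1]) = 5/2 * X \<beta>\<close> by (simp add: trace_term_def X_def n_def)
    finally show ?thesis .
  qed
  fix \<beta> assume b: "bw \<beta>" and K: "ev 1 (5/2 * \<i>) (f \<beta>) = trace_term \<beta>"
  have d: "a = a'" if "a - b = s" "a' - b' = s" "b = b'" for a a' b b' s :: complex
    using that by (simp add: diff_eq_eq)
  have d': "b = b'" if "a - b = s" "a' - b' = s" "a = a'" for a a' b b' s :: complex
    using that by (metis diff_left_imp_eq)
  show "ev 1 (5/2 * \<i>) (f (\<beta> @ [1])) = trace_term (\<beta> @ [1])" if "ev 1 (5/2 * \<i>) (f (\<beta> @ [-1])) = trace_term (\<beta> @ [-1])"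
    using d[OF e[OF b, unfolded K] t that] .
  show "ev 1 (5/2 * \<i>) (f (\<beta> @ [-1])) = trace_term (\<beta> @ [-1])" if "ev 1 (5/2 * \<i>) (f (\<beta> @ [1])) = trace_term (\<beta> @ [1])"
    using d'[OF e[OF b, unfolded K] t that] .
next
  show "ev 1 (5/2 * \<i>) (f []) = trace_term []" unfolding f_Nil ev_diff ev_mono by (simp add: trace_term_def tr_def)
  show "ev 1 (5/2 * \<i>) (f [1]) = trace_term [1]"
    unfolding f_1(1) by (simp add: ev_diff ev_mono trace_term_def tr_def mat_letter_def power_int_minus)
  show "ev 1 (5/2 * \<i>) (f [1, 2]) = trace_term [1, 2]"
    using f_unknot[of 1 1] by (simp add: trace_term_def tr_def mat_letter_def power_int_minus)
qed

lemma f_determines_trace: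
  assumes "bw w" "bw w'" "f w = f w'" "expo w = expo w'"
  shows "tr w = tr w'"
proof -
  have "trace_term w = trace_term w'" using f_trace assms by metis
  then have "\<i> powi expo w' * (4/13) * of_real (tr w - 2 powi expo w' - 2 powi (- expo w'))
     = \<i> powi expo w' * (4/13) * of_real (tr w' - 2 powi expo w' - 2 powi (- expo w'))"
    by (simp only: trace_term_def assms(4))
  then have "of_real (tr w - 2 powi expo w' - 2 powi (- expo w')) = (of_real (tr w' - 2 powi expo w' - 2 powi (- expo w')) :: complex)"
    by (simp only: mult_cancel_left) simp
  then show ?thesis by (simp only: of_real_eq_iff)
qed

lemma trace_bound:
  assumes "bw w"
  shows "\<bar>tr w\<bar> \<le> 13/4 * cmod (ev 1 (5/2 * \<i>) (f w)) + 2 powi \<bar>expo w\<bar> + 2 powi \<bar>expo w\<bar>"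
proof -
  have "cmod (ev 1 (5/2 * \<i>) (f w)) = 4/13 * \<bar>tr w - 2 powi expo w - 2 powi (- expo w)\<bar>"
    unfolding f_trace[OF assms] trace_term_def norm_mult norm_of_real by (simp add: norm_power_int)
  moreover have "(2::real) powi expo w \<le> 2 powi \<bar>expo w\<bar>" "(2::real) powi (- expo w) \<le> 2 powi \<bar>expo w\<bar>"
    by (intro power_int_increasing; simp)+
  moreover have "(2::real) powi expo w > 0" "(2::real) powi (- expo w) > 0" by simp_all
  moreover have "\<bar>t\<bar> \<le> 13/4 * c + M + M"
    if "c = 4/13 * \<bar>t - x - y\<bar>" "x \<le> M" "y \<le> M" "0 < x" "0 < y" for c t x y M :: real
    using that abs_triangle_ineq[of "t - x - y" "x + y"] by simp
  ultimately show ?thesis by blast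
qed

subsection \<open>Finitely many closed 3-braids with the same polynomial\<close>

text \<open>The exponent sum and the normal form of a word that represents \<open>L\<close>; by
  \<open>normal_form_determines\<close> they determine \<open>L\<close> up to isotopy.\<close>

definition datum :: "olink \<Rightarrow> int \<times> int list \<Rightarrow> bool"
  where "datum L d \<longleftrightarrow> (\<exists>w m n. bw w \<and> isotopic (braid_closure 3 w) L \<and> expo w = fst d \<and>
     conj_eq (fulls m @ w) (fulls n @ snd d))"

lemma datum_isotopic:
  assumes "datum L d" "datum L' d"
  shows "isotopic L L'"
proof -
  obtain w m n where w: "bw w" "isotopic (braid_closure 3 w) L" "expo w = fst d" "conj_eq (fulls m @ w) (fulls n @ snd d)"
    using assms(1) unfolding datum_def by blast
  obtain w' m' n' where w': "bw w'" "isotopic (braid_closure 3 w') L'" "expo w' = fst d" "conj_eq (fulls m' @ w') (fulls n' @ snd d)"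
    using assms(2) unfolding datum_def by blast
  have "conj_eq w w'" using normal_form_determines[OF w(1) w'(1) _ w(4) w'(4)] w(3) w'(3) by simp
  then have "isotopic (braid_closure 3 w) (braid_closure 3 w')" using conj_eq_isotopic w(1) by blast
  then show ?thesis using isotopic_closure_sym[OF w(2)] w'(2) isotopic_trans by blast
qed

lemma three_braid_word:
  assumes "three_braid_link L"
  obtains w where "bw w" "isotopic (braid_closure 3 w) L" "P L = f w"
  using assms P_isotopic link_braid_closure unfolding three_braid_link_def f_def by metis

lemma exists_datum:
  assumes L: "three_braid_link L" and k: "k \<in> Poly_Mapping.keys (P L)"
  obtains e r where "datum L (e, r)" "e \<in> {fst k - 2, fst k, fst k + 2}" "normal_form r"
    "\<bar>tr r\<bar> \<le> 13/4 * cmod (ev 1 (5/2 * \<i>) (P L)) + 2 powi (\<bar>fst k\<bar> + 2) + 2 powi (\<bar>fst k\<bar> + 2)"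
proof -
  obtain w where w: "bw w" "isotopic (braid_closure 3 w) L" "P L = f w" using three_braid_word[OF L] .
  obtain r m n where r: "normal_form r" "conj_eq (fulls m @ w) (fulls n @ r)" using exists_normal_form[OF w(1)] .
  have "fst k \<in> {expo w - 2, expo w, expo w + 2}"
    using f_v_support[OF w(1)] k unfolding w(3) v_support_def by blast
  then have e: "expo w \<in> {fst k - 2, fst k, fst k + 2}" by auto
  have "\<bar>tr r\<bar> = \<bar>tr w\<bar>" using tr_conj_eq[OF r(2)] tr_fulls by metis
  moreover have "(2::real) powi \<bar>expo w\<bar> \<le> 2 powi (\<bar>fst k\<bar> + 2)" using e by (intro power_int_increasing) auto
  ultimately have "\<bar>tr r\<bar> \<le> 13/4 * cmod (ev 1 (5/2 * \<i>) (P L)) + 2 powi (\<bar>fst k\<bar> + 2) + 2 powi (\<bar>fst k\<bar> + 2)"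
    using trace_bound[OF w(1)] unfolding w(3) by linarith
  moreover have "datum L (expo w, r)" using w r unfolding datum_def by auto
  ultimately show thesis using that e r(1) by blast
qed

lemma finite_normal_forms: "finite {r. normal_form r \<and> \<bar>tr r\<bar> \<le> B}"
proof -
  obtain N :: nat where N: "B < 2 ^ N" using real_arch_pow[of 2 B] by auto
  have "{r. normal_form r \<and> \<bar>tr r\<bar> \<le> B} \<subseteq> {third 1, third 2, half} \<union> {r. set r \<subseteq> {1, -2} \<and> length r \<le> N}"
  proof
    fix r assume r: "r \<in> {r. normal_form r \<and> \<bar>tr r\<bar> \<le> B}"
    show "r \<in> {third 1, third 2, half} \<union> {r. set r \<subseteq> {1, -2} \<and> length r \<le> N}"
    proof (cases "set r \<subseteq> {1, -2}")
      case True
      then have "(2::real) ^ length r \<le> B" using order.trans[OF tr_ge_power[OF True] abs_ge_self] r by (auto intro: order.trans)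
      then have "(2::real) ^ length r < 2 ^ N" using N by linarith
      then have "length r < N" by (rule power_less_imp_less_exp[rotated]) simp
      then show ?thesis using True by simp
    qed (use r in \<open>auto simp: normal_form_def\<close>)
  qed
  moreover have "finite {r :: int list. set r \<subseteq> {1, -2} \<and> length r \<le> N}"
    by (intro finite_lists_length_le) simp
  ultimately show ?thesis using finite_subset by blast
qed

lemma link_isotopy_class:
  assumes "link L" "link L'" "isotopic L L'"
  shows "link_isotopy `` {L} = link_isotopy `` {L'}"
proof -
  have "isotopic L' L" by (rule isotopic_sym[OF assms(3)]) (rule link_curves_S3[OF assms(1)])
  then show ?thesis using assms isotopic_trans unfolding link_isotopy_def by blast
qed

text \<open>One exponent that occurs in \<open>Q\<close> leaves three possibilities for the exponent sum, and the
  value of \<open>Q\<close> bounds the trace of the normal form; so the links with polynomial \<open>Q\<close> have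
  finitely many data.\<close>

theorem finitely_many: "finite ({L. three_braid_link L \<and> P L = Q} // link_isotopy)"
proof (cases "{L. three_braid_link L \<and> P L = Q} = {}")
  case True
  then show ?thesis by (simp only: quotient_empty finite.emptyI)
next
  case False
  let ?A = "{L. three_braid_link L \<and> P L = Q}"
  obtain L0 where "three_braid_link L0" "P L0 = Q" using False by blast
  then have "Q \<noteq> 0" using three_braid_word[of L0] f_nonzero by metis
  then obtain k where k: "k \<in> Poly_Mapping.keys Q" by (metis keys_eq_empty all_not_in_conv)
  define B where "B = 13/4 * cmod (ev 1 (5/2 * \<i>) Q) + 2 powi (\<bar>fst k\<bar> + 2) + 2 powi (\<bar>fst k\<bar> + 2)"
  define I where "I = {fst k - 2, fst k, fst k + 2} \<times> {r. normal_form r \<and> \<bar>tr r\<bar> \<le> B}"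
  have I: "finite I" unfolding I_def using finite_normal_forms by auto
  have ex: "\<exists>d\<in>I. datum L d" if "L \<in> ?A" for L
  proof -
    have L: "three_braid_link L" "k \<in> Poly_Mapping.keys (P L)" "P L = Q" using that k by auto
    obtain e r where er: "datum L (e, r)" "e \<in> {fst k - 2, fst k, fst k + 2}" "normal_form r"
      "\<bar>tr r\<bar> \<le> 13/4 * cmod (ev 1 (5/2 * \<i>) (P L)) + 2 powi (\<bar>fst k\<bar> + 2) + 2 powi (\<bar>fst k\<bar> + 2)"
      using exists_datum[OF L(1,2)] .
    show ?thesis
    proof (rule bexI[of _ "(e, r)"])
      show "(e, r) \<in> I" unfolding I_def B_def mem_Times_iff fst_conv snd_conv mem_Collect_eq
        using er(2-4) unfolding L(3) by (rule conjI[OF _ conjI])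
    qed (rule er(1))
  qed
  define g where "g L = (SOME d. d \<in> I \<and> datum L d)" for L
  have g: "g L \<in> I" "datum L (g L)" if "L \<in> ?A" for L
    using someI_ex[of "\<lambda>d. d \<in> I \<and> datum L d"] ex[OF that] unfolding g_def by blast+
  define c where "c d = link_isotopy `` {SOME L. L \<in> ?A \<and> g L = d}" for d
  have "?A // link_isotopy \<subseteq> c ` I"
  proof
    fix X assume "X \<in> ?A // link_isotopy"
    then obtain L where L: "L \<in> ?A" "X = link_isotopy `` {L}" by (auto simp: quotient_def)
    define L' where "L' = (SOME L'. L' \<in> ?A \<and> g L' = g L)"
    have L': "L' \<in> ?A \<and> g L' = g L" unfolding L'_def by (rule someI[of _ L]) (use L in simp)
    have "isotopic L L'" using datum_isotopic[OF g(2)[OF L(1)]] g(2)[of L'] L' by simp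
    then have "link_isotopy `` {L} = link_isotopy `` {L'}"
      using L L' by (intro link_isotopy_class) (auto simp: three_braid_link_def)
    then have "X = c (g L)" using L by (simp add: c_def L'_def)
    then show "X \<in> c ` I" using g(1)[OF L(1)] by blast
  qed
  then show ?thesis using I finite_surj by blast
qed

subsection \<open>Closed 3-braids with the polynomial of an unlink\<close>

text \<open>Words with the same polynomial and exponent sum have the same trace. If this trace and the
  exponent sum modulo six admit only one normal form up to conjugation, the words are
  conjugate.\<close>

lemma same_word_unlink:
  assumes w: "bw w" "bw u" and e: "expo w = expo u" and f: "f w = f u"
    and nf: "\<And>r. normal_form r \<Longrightarrow> \<bar>tr r\<bar> = \<bar>tr u\<bar> \<Longrightarrow> 6 dvd (expo r - expo u) \<Longrightarrow> conj_eq r r0"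
    and u: "isotopic (unlink n) (braid_closure 3 u)" and L: "isotopic (braid_closure 3 w) L"
  shows "isotopic (unlink n) L"
proof -
  have red: "\<exists>m n. conj_eq (fulls m @ w') (fulls n @ r0)" if w': "bw w'" "expo w' = expo u" "tr w' = tr u" for w'
  proof -
    obtain r m n where r: "normal_form r" "conj_eq (fulls m @ w') (fulls n @ r)" using exists_normal_form[OF w'(1)] .
    have "\<bar>tr r\<bar> = \<bar>tr u\<bar>" using tr_conj_eq[OF r(2)] tr_fulls w'(3) by metis
    moreover have "expo r - expo u = 6 * (int m - int n)" using conj_eq_expo[OF r(2)] w'(2) by simp
    then have "6 dvd (expo r - expo u)" by simp
    ultimately have "conj_eq r r0" using nf r(1) by blast
    moreover have "bw r" using conj_eq_bw[OF r(2)] w'(1) by simp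
    ultimately have "conj_eq (fulls n @ r) (fulls n @ r0)" by (intro conj_eq_fulls)
    then show ?thesis using conj_eq.trans[OF r(2)] by blast
  qed
  have t: "tr w = tr u" using f_determines_trace[OF w f e] .
  obtain m n m' n' where "conj_eq (fulls m @ w) (fulls n @ r0)" "conj_eq (fulls m' @ u) (fulls n' @ r0)"
    using red[OF w(1) e t] red[OF w(2) HOL.refl HOL.refl] by blast
  then have "conj_eq u w" using normal_form_determines[OF w e] conj_eq.sym by blast
  then have "isotopic (braid_closure 3 u) (braid_closure 3 w)" using conj_eq_isotopic w(2) by blast
  then show ?thesis using u L isotopic_trans by blast
qed

lemma small_normal_form:
  assumes "normal_form r" "\<bar>tr r\<bar> < 8"
  shows "r = third 1 \<or> r = third 2 \<or> r = half \<or> r = [] \<or> r = [1] \<or> r = [-2] \<or>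
     r = [1, 1] \<or> r = [1, -2] \<or> r = [-2, 1] \<or> r = [-2, -2]"
proof (cases "set r \<subseteq> {1, -2}")
  case True
  have "(2::real) ^ length r < 2 ^ 3" using tr_ge_power[OF True] assms(2) by simp
  then have "length r < 3" by (rule power_less_imp_less_exp[rotated]) simp
  then consider "r = []" | x where "r = [x]" | x y where "r = [x, y]"
    by (metis (no_types, opaque_lifting) Suc_less_eq length_Cons less_nat_zero_code list.exhaust numeral_3_eq_3)
  then show ?thesis using True by cases auto
qed (use assms in \<open>auto simp: normal_form_def\<close>)

lemma tr_values:
  "tr [] = 2" "tr [1] = 5/2" "tr [-2] = 5/2" "tr [-1] = 5/2" "tr [1, 2] = 1" "tr [-1, -2] = 1" "tr [1, -2] = 21/4" "tr [-2, 1] = 21/4"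
  "tr [1, 1] = 17/4" "tr [-2, -2] = 17/4"
  by (simp_all add: tr_def mat_letter_def)

lemma expo_third: "expo (third 1) = 2" "expo (third 2) = 4"
  by (simp_all add: eval_nat_numeral)

text \<open>The extreme exponents of \<open>v\<close> in the polynomial of the unlink leave the exponent sum \<open>0\<close>
  for three components, \<open>1\<close> and \<open>-1\<close> for two, and \<open>2\<close>, \<open>0\<close>, \<open>-2\<close> for one. In each case there is
  a word with this exponent sum whose closure is the unlink, and the trace and the exponent sum
  modulo six single out its normal form.\<close>

theorem unlink_polynomial_imp_unlink:
  assumes L: "three_braid_link L" and n: "n \<in> {1, 2, 3}" and PL: "P L = P (unlink n)"
  shows "is_unlink L"
proof -
  obtain w where w: "bw w" "isotopic (braid_closure 3 w) L" "P L = f w" using three_braid_word[OF L] .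
  have u3: "isotopic (unlink 3) (braid_closure 3 [])" using isotopic_closure_sym[OF unlink_3_braid] .
  have u2: "isotopic (unlink 2) (braid_closure 3 [1])" "isotopic (unlink 2) (braid_closure 3 [-1])"
    by (intro unlink_2_braid; simp)+
  have u1: "isotopic (unlink 1) (braid_closure 3 [1, 2])" "isotopic (unlink 1) (braid_closure 3 [1, -2])"
     "isotopic (unlink 1) (braid_closure 3 [-1, -2])"
    using unlink_1_braid[of 1 1] unlink_1_braid[of 1 "-1"] unlink_1_braid[of "-1" "-1"] by simp_all
  have sup: "fst k \<in> {expo w - 2, expo w, expo w + 2}" if "Poly_Mapping.lookup (f w) k \<noteq> 0" for k
    using f_v_support[OF w(1)] that unfolding v_support_def by (simp add: in_keys_iff)
  have lk: "Poly_Mapping.lookup (mono_vz i j) k = (if k = (i, j) then 1 else 0)" for i j k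
    by (auto simp: mono_vz_def lookup_single when_def)
  have "isotopic (unlink n) L"
  proof -
    consider "n = 3" | "n = 2" | "n = 1" using n by auto
    then show ?thesis
    proof cases
      case 1
      have fw: "f w = f []" using f_unlink[OF u3] w(3) PL 1 by simp
      have "Poly_Mapping.lookup (f w) (-2, -2) \<noteq> 0" "Poly_Mapping.lookup (f w) (2, -2) \<noteq> 0"
        unfolding fw f_Nil lookup_minus lk by simp_all
      then have "expo w = 0" using sup[of "(-2, -2)"] sup[of "(2, -2)"] by auto
      then show ?thesis
        unfolding 1
      proof (intro same_word_unlink[OF w(1) _ _ fw _ u3 w(2), of "[]"])
        fix r assume r: "normal_form r" "\<bar>tr r\<bar> = \<bar>tr []\<bar>" "6 dvd (expo r - expo [])"
        then show "conj_eq r []"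
          using small_normal_form[OF r(1)] by (auto simp: tr_values expo_third conj_eq_refl)
      qed auto
    next
      case 2
      have fw: "f w = f [1]" "f w = f [-1]" using f_unlink[OF u2(1)] f_1(2) w(3) PL 2 by simp_all
      have "Poly_Mapping.lookup (f w) (-1, -1) \<noteq> 0" "Poly_Mapping.lookup (f w) (1, -1) \<noteq> 0"
        unfolding fw(1) f_1(1) lookup_minus lk by simp_all
      then have "-1 \<in> {expo w - 2, expo w, expo w + 2}" "1 \<in> {expo w - 2, expo w, expo w + 2}"
        using sup[of "(-1, -1)"] sup[of "(1, -1)"] by simp_all
      then have "expo w = 1 \<or> expo w = -1" unfolding insert_iff empty_iff by presburger
      then show ?thesis
        unfolding 2
      proof
        assume "expo w = 1"
        then show "isotopic (unlink 2) L"
        proof (intro same_word_unlink[OF w(1) _ _ fw(1) _ u2(1) w(2), of "[1]"])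
          fix r assume r: "normal_form r" "\<bar>tr r\<bar> = \<bar>tr [1]\<bar>" "6 dvd (expo r - expo [1])"
          then show "conj_eq r [1]"
            using small_normal_form[OF r(1)] by (auto simp: tr_values expo_third conj_eq_refl)
        qed auto
      next
        assume "expo w = -1"
        then show "isotopic (unlink 2) L"
        proof (intro same_word_unlink[OF w(1) _ _ fw(2) _ u2(2) w(2), of "[-2]"])
          fix r assume r: "normal_form r" "\<bar>tr r\<bar> = \<bar>tr [-1]\<bar>" "6 dvd (expo r - expo [-1])"
          then show "conj_eq r [-2]"
            using small_normal_form[OF r(1)] by (auto simp: tr_values expo_third conj_eq_refl)
        qed auto
      qed
    next
      case 3
      have fu: "f [1, 2] = 1" "f [1, -2] = 1" "f [-1, -2] = 1"
        using f_unknot[of 1 1] f_unknot[of 1 "-1"] f_unknot[of "-1" "-1"] by simp_all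
      have fw: "f w = 1" using f_unlink[OF u1(1)] w(3) PL 3 fu by simp
      have "expo w = 2 \<or> expo w = 0 \<or> expo w = -2"
        using sup[of "(0, 0)"] unfolding fw mono_0_0[symmetric] by (auto simp: lk)
      then show ?thesis
        unfolding 3
      proof (elim disjE)
        assume "expo w = 2"
        then show "isotopic (unlink 1) L"
        proof (intro same_word_unlink[OF w(1) _ _ _ _ u1(1) w(2), of "third 1"])
          fix r assume r: "normal_form r" "\<bar>tr r\<bar> = \<bar>tr [1, 2]\<bar>" "6 dvd (expo r - expo [1, 2])"
          then show "conj_eq r (third 1)"
            using small_normal_form[OF r(1)] by (auto simp: tr_values expo_third conj_eq_refl)
        qed (auto simp: fw fu)
      next
        assume "expo w = 0"
        then show "isotopic (unlink 1) L"
        proof (intro same_word_unlink[OF w(1) _ _ _ _ u1(2) w(2), of "[1, -2]"])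
          fix r assume r: "normal_form r" "\<bar>tr r\<bar> = \<bar>tr [1, -2]\<bar>" "6 dvd (expo r - expo [1, -2])"
          have "conj_eq ([-2] @ [1]) ([1] @ [-2])" by (intro conj_eq.cycle) auto
          then show "conj_eq r [1, -2]"
            using small_normal_form[OF r(1)] r by (auto simp: tr_values expo_third conj_eq_refl)
        qed (auto simp: fw fu)
      next
        assume "expo w = -2"
        then show "isotopic (unlink 1) L"
        proof (intro same_word_unlink[OF w(1) _ _ _ _ u1(3) w(2), of "third 2"])
          fix r assume r: "normal_form r" "\<bar>tr r\<bar> = \<bar>tr [-1, -2]\<bar>" "6 dvd (expo r - expo [-1, -2])"
          then show "conj_eq r (third 2)"
            using small_normal_form[OF r(1)] by (auto simp: tr_values expo_third conj_eq_refl)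
        qed (auto simp: fw fu)
      qed
    qed
  qed
  moreover have "n \<ge> 1" using n by auto
  ultimately show ?thesis unfolding is_unlink_def by blast
qed

end

theorem corollary1:
  fixes P :: "olink \<Rightarrow> laurent"
  assumes "is_skein_polynomial P"
  shows "(\<forall>L. \<forall>n\<in>{1, 2, 3}. three_braid_link L \<and> P L = P (unlink n) \<longrightarrow> is_unlink L) \<and>
    (\<forall>Q :: laurent. finite ({L. three_braid_link L \<and> P L = Q} // link_isotopy))"
proof -
  interpret skein_polynomial P by standard (rule assms)
  show ?thesis using unlink_polynomial_imp_unlink finitely_many by blast
qed

end
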